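(* Let $\Theta$ be a compact subset of $\Theta(2)$, let $\theta_0\in\Theta$, and let $X$ be the stationary solution to the non-linear AR($\infty$) equation $$X_t=\xi_t+f_{\theta_0}(X_{t-1},X_{t-2},\ldots),\quad t\in\mathbb Z,\qquad f_\theta(x_1,x_2,\ldots)=A_0(\theta)+\sum_{i=1}^\infty A_i(\theta,x_i).$$ Assume that for all $\theta\in\Theta$, $f_\theta^t=f_{\theta_0}^t$ a.s. implies $\theta=\theta_0$, and that for $j\ge1$ $$\sup_{\theta\in\Theta}\mathrm{Lip}_x\,A_j(\theta,x)=O(j^{-\ell})\quad\text{for some }\ell>3/2.$$ Then the QMLE $\widehat\theta_n$ is strongly consistent: $\widehat\theta_n\to\theta_0$ a.s. Moreover, if $\theta_0\in\overset{\circ}{\Theta}$ with $\overset{\circ}{\Theta}\subset\Theta(4)$, then $\widehat\theta_n$ is also asymptotically normal, i.e. $$\sqrt n(\widehat\theta_n-\theta_0)\xrightarrow[n\to\infty]{\mathcal D}\mathcal N_d\big(0,F(\theta_0)^{-1}G(\theta_0)F(\theta_0)^{-1}\big),$$ as soon as the functions $\theta\mapsto A_0(\theta)$, $\theta\mapsto A_j(\theta,x)$ are twice continuously differentiable on $\Theta$ for all $x\in\mathbb R^m$, the family $(\partial f_{\theta_0}^t/\partial\theta_i)_{1\le i\le d}$ is a.e. linearly independent, and for all $k,k'\in\{1,\ldots,d\}$ $$\sup_{\theta\in\Theta}\mathrm{Lip}_x\frac{\partial A_j(\theta,x)}{\partial\theta_k}=O(j^{-\ell'})\ \text{for some }\ell'>3/2,\qquad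 \sum_{j=1}^\infty\sup_{\theta\in\Theta}\mathrm{Lip}_x\frac{\partial^2A_j(\theta,x)}{\partial\theta_k\partial\theta_{k'}}<\infty .$$
   Context: $\|\cdot\|$ is the Euclidean norm; $\overset{\circ}{\Theta}$ is the interior of $\Theta$; $\mathrm{Lip}_x\,g(x)$ is the Lipschitz constant of $x\mapsto g(x)$. $(\xi_t)_{t\in\mathbb Z}$ are i.i.d. random vectors in $\mathbb R^m$ with $E[\xi_0^{(k)}\xi_0^{(k')}]=0$ for $k\ne k'$ and $E[(\xi_0^{(k)})^2]=\mathrm{Var}(\xi_0^{(k)})=1$ (so each component has mean zero). For $\theta\in\mathbb R^d$, $A_0(\theta)\in\mathbb R^m$ and $A_i(\theta,\cdot):\mathbb R^m\to\mathbb R^m$ ($i\ge1$) is Lipschitz. Standing assumptions: for all sequences $x$ with finitely many non-zero terms, $f_\theta(x)$ is well defined and $\theta\mapsto f_\theta(x)$ is continuous on $\Theta$ (in particular $\sup_{\theta\in\Theta}\|f_\theta(0)\|<\infty$). $$\Theta(r)=\Big\{\theta\in\mathbb R^d:\ \sum_{j=1}^\infty\mathrm{Lip}_xA_j(\theta,x)<1\Big\},$$ defined under the assumption $E\|\xi_0\|^r<\infty$ (the set itself does not depend on $r$ or on the law of $\xi_0$); in particular $E\|\xi_0\|^4<\infty$ is assumed whenever $\Theta(4)$ is used. The stationary solution $X$ is the causal ($X_t$ independent of $(\xi_i)_{i>t}$), stationary ergodic solution with $E\|X_0\|^r<\infty$ ($r=2$ for the first part, $r=4$ for the second). $f_\theta^t=f_\theta(X_{t-1},X_{t-2},\ldots)$,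 $\partial f_\theta^t/\partial\theta=(\partial f_\theta/\partial\theta)(X_{t-1},\ldots)$, and $q_t(\theta)=\|X_t-f_\theta^t\|^2$. QMLE (here the least squares estimator): fix a sequence $u$ in $\mathbb R^m$ with finitely many non-zero terms, let $\widehat f_\theta^t=f_\theta(X_{t-1},\ldots,X_1,u)$, $\widehat L_n(\theta)=-\frac12\sum_{t=1}^n\|X_t-\widehat f_\theta^t\|^2$ and $\widehat\theta_n=\operatorname{Argmax}_{\theta\in\Theta}\widehat L_n(\theta)$. The $d\times d$ matrices are $F(\theta_0)_{ij}=E[\partial^2q_0(\theta_0)/\partial\theta_i\partial\theta_j]$ and $G(\theta_0)_{ij}=E[(\partial q_0(\theta_0)/\partial\theta_i)(\partial q_0(\theta_0)/\partial\theta_j)]$.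
   Formalization: In the second part, θ ↦ f_θ(0) = A_0(θ)+Σ A_j(θ,0) is also assumed twice continuously differentiable on the interior of Θ (else F(θ_0) may be undefined), and the estimators are assumed measurable. *)

theory Defs
  imports "HOL-Probability.Probability"
begin

section \<open>Analytic notions\<close>

text \<open>The Lipschitz constant takes values in \<^typ>\<open>ennreal\<close>, so that it is \<^term>\<open>\<infinity>\<close>
  for a function that is not Lipschitz, and suprema and series of Lipschitz constants always
  have their true value. (The pairs with \<open>x = y\<close> contribute \<open>0 / 0 = 0\<close>.)\<close>

definition Lip :: "('a::metric_space \<Rightarrow> 'b::metric_space) \<Rightarrow> ennreal" where
  "Lip g = (SUP x. SUP y. ennreal (dist (g x) (g y) / dist x y))"

text \<open>\<open>u j = O(j powr - l)\<close> for a sequence indexed by \<open>j \<ge> 1\<close>; all its terms have to be finite.\<close>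

definition power_decay :: "(nat \<Rightarrow> ennreal) \<Rightarrow> real \<Rightarrow> bool" where
  "power_decay u l \<longleftrightarrow>
     (\<forall>j\<ge>1. u j < \<infinity>) \<and> (\<lambda>j. enn2real (u j)) \<in> O(\<lambda>j. real j powr (- l))"

definition pderivative :: "'d::finite \<Rightarrow> (real^'d \<Rightarrow> 'b::real_normed_vector) \<Rightarrow> real^'d \<Rightarrow> 'b" where
  "pderivative k g \<theta> = vector_derivative (\<lambda>h. g (\<theta> + h *\<^sub>R axis k 1)) (at 0)"

text \<open>Twice continuous differentiability on an arbitrary set \<open>S\<close> means twice continuous
  differentiability on some open neighbourhood of \<open>S\<close>, so that the partial derivatives up to
  order two are determined at every point of \<open>S\<close>, including its boundary.\<close>

definition C2_on :: "(real^'d::finite) set \<Rightarrow> (real^'d \<Rightarrow> 'b::real_normed_vector) \<Rightarrow> bool" where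
  "C2_on S g \<longleftrightarrow> (\<exists>U. open U \<and> S \<subseteq> U \<and> g differentiable_on U \<and>
     (\<forall>k. pderivative k g differentiable_on U) \<and>
     (\<forall>k k'. continuous_on U (pderivative k (pderivative k' g))))"


section \<open>Convergence in law and normal laws on Euclidean space\<close>

definition weak_conv_vec :: "(nat \<Rightarrow> (real^'d::finite) measure) \<Rightarrow> (real^'d) measure \<Rightarrow> bool" where
  "weak_conv_vec \<mu> \<nu> \<longleftrightarrow>
     (\<forall>g :: real^'d \<Rightarrow> real. continuous_on UNIV g \<and> bounded (range g) \<longrightarrow>
        (\<lambda>n. \<integral>x. g x \<partial>\<mu> n) \<longlonglongrightarrow> (\<integral>x. g x \<partial>\<nu>))"

definition std_normal_vec :: "(real^'d::finite) measure" where
  "std_normal_vec = density lborel (\<lambda>x. ennreal (\<Prod>i\<in>UNIV. std_normal_density (x $ i)))"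

text \<open>\<open>\<nu>\<close> is the normal law with mean \<open>\<mu>\<close> and covariance matrix \<open>\<Sigma>\<close>: the law of \<open>\<mu> + B Z\<close>
  with \<open>Z\<close> a standard normal vector and \<open>B\<close> any matrix with \<open>B B\<^sup>T = \<Sigma>\<close>.
  In particular \<open>\<Sigma>\<close> has to be positive semidefinite.\<close>

definition normal_law :: "real^'d::finite \<Rightarrow> real^'d^'d \<Rightarrow> (real^'d) measure \<Rightarrow> bool" where
  "normal_law \<mu> \<Sigma> \<nu> \<longleftrightarrow>
     (\<exists>B :: real^'d^'d. B ** transpose B = \<Sigma> \<and>
        \<nu> = distr std_normal_vec borel (\<lambda>z. \<mu> + B *v z))"


section \<open>The non-linear autoregressive model of infinite order\<close>

text \<open>Sequences \<open>x\<^sub>1, x\<^sub>2, \<dots>\<close> and families \<open>A\<^sub>1, A\<^sub>2, \<dots>\<close> are functions on \<^typ>\<open>nat\<close>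
  of which the value at \<open>0\<close> is never used.\<close>

definition finitely_supported :: "(nat \<Rightarrow> 'b::zero) \<Rightarrow> bool" where
  "finitely_supported x \<longleftrightarrow> finite {j. j \<ge> 1 \<and> x j \<noteq> 0}"

definition ar_fun ::
  "('p \<Rightarrow> real^'m) \<Rightarrow> (nat \<Rightarrow> 'p \<Rightarrow> real^'m \<Rightarrow> real^'m::finite) \<Rightarrow> 'p \<Rightarrow> (nat \<Rightarrow> real^'m) \<Rightarrow> real^'m"
  where "ar_fun A0 A \<theta> x = A0 \<theta> + (\<Sum>j. A (Suc j) \<theta> (x (Suc j)))"

definition ar_standing ::
  "(real^'d) set \<Rightarrow> (real^'d::finite \<Rightarrow> real^'m) \<Rightarrow> (nat \<Rightarrow> real^'d \<Rightarrow> real^'m \<Rightarrow> real^'m::finite) \<Rightarrow> bool"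
  where "ar_standing \<Theta> A0 A \<longleftrightarrow>
     (\<forall>\<theta>. \<forall>j\<ge>1. \<exists>L. L-lipschitz_on UNIV (A j \<theta>)) \<and>
     (\<forall>x. finitely_supported x \<longrightarrow>
        (\<forall>\<theta>\<in>\<Theta>. summable (\<lambda>j. A (Suc j) \<theta> (x (Suc j)))) \<and>
        continuous_on \<Theta> (\<lambda>\<theta>. ar_fun A0 A \<theta> x))"

text \<open>This is the set \<open>\<Theta>(r)\<close>, for every \<open>r\<close>; the moment condition of order \<open>r\<close> on the
  noise under which it is considered is stated separately.\<close>

definition stability_region :: "(nat \<Rightarrow> 'p \<Rightarrow> real^'m \<Rightarrow> real^'m::finite) \<Rightarrow> 'p set" where
  "stability_region A = {\<theta>. (\<Sum>j. Lip (A (Suc j) \<theta>)) < 1}"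

definition iid_noise :: "'a measure \<Rightarrow> (int \<Rightarrow> 'a \<Rightarrow> real^'m::finite) \<Rightarrow> bool" where
  "iid_noise M \<xi> \<longleftrightarrow>
     prob_space.indep_vars M (\<lambda>_. borel) \<xi> UNIV \<and>
     (\<forall>t. distr M borel (\<xi> t) = distr M borel (\<xi> 0)) \<and>
     (\<forall>k k'. k \<noteq> k' \<longrightarrow> (\<integral>\<omega>. \<xi> 0 \<omega> $ k * \<xi> 0 \<omega> $ k' \<partial>M) = 0) \<and>
     (\<forall>k. (\<integral>\<omega>. (\<xi> 0 \<omega> $ k)\<^sup>2 \<partial>M) = 1 \<and> prob_space.variance M (\<lambda>\<omega>. \<xi> 0 \<omega> $ k) = 1)"

definition strictly_stationary :: "'a measure \<Rightarrow> (int \<Rightarrow> 'a \<Rightarrow> real^'m::finite) \<Rightarrow> bool" where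
  "strictly_stationary M X \<longleftrightarrow>
     (\<forall>h. distr M (PiM UNIV (\<lambda>_. borel)) (\<lambda>\<omega> t. X (t + h) \<omega>) =
          distr M (PiM UNIV (\<lambda>_. borel)) (\<lambda>\<omega> t. X t \<omega>))"

definition ergodic_process :: "'a measure \<Rightarrow> (int \<Rightarrow> 'a \<Rightarrow> real^'m::finite) \<Rightarrow> bool" where
  "ergodic_process M X \<longleftrightarrow>
     (\<forall>B \<in> sets (PiM (UNIV :: int set) (\<lambda>_. borel :: (real^'m) measure)).
        (\<lambda>x t. x (t + 1)) -` B = B \<longrightarrow>
        measure M {\<omega> \<in> space M. (\<lambda>t. X t \<omega>) \<in> B} \<in> {0, 1})"

text \<open>Independence of the \<open>\<sigma>\<close>-algebras generated by \<open>X t\<close> and by the family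
  \<open>(\<xi> i)\<close>, \<open>i > t\<close> (\<open>indep_var\<close> only covers random variables of equal type).\<close>

definition causal :: "'a measure \<Rightarrow> (int \<Rightarrow> 'a \<Rightarrow> real^'m::finite) \<Rightarrow> (int \<Rightarrow> 'a \<Rightarrow> real^'m) \<Rightarrow> bool" where
  "causal M \<xi> X \<longleftrightarrow>
     (\<forall>t. prob_space.indep_set M
        {X t -` B \<inter> space M | B. B \<in> sets borel}
        {(\<lambda>\<omega>. \<lambda>i\<in>{t<..}. \<xi> i \<omega>) -` B \<inter> space M | B. B \<in> sets (PiM {t<..} (\<lambda>_. borel))})"

definition past :: "(int \<Rightarrow> 'a \<Rightarrow> 'b) \<Rightarrow> int \<Rightarrow> 'a \<Rightarrow> nat \<Rightarrow> 'b" where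
  "past X t \<omega> = (\<lambda>j. X (t - int j) \<omega>)"

definition stationary_solution ::
  "'a measure \<Rightarrow> nat \<Rightarrow> (int \<Rightarrow> 'a \<Rightarrow> real^'m) \<Rightarrow> ('p \<Rightarrow> real^'m) \<Rightarrow>
   (nat \<Rightarrow> 'p \<Rightarrow> real^'m \<Rightarrow> real^'m::finite) \<Rightarrow> 'p \<Rightarrow> (int \<Rightarrow> 'a \<Rightarrow> real^'m) \<Rightarrow> bool"
  where "stationary_solution M r \<xi> A0 A \<theta> X \<longleftrightarrow>
     (\<forall>t. X t \<in> borel_measurable M) \<and>
     (\<forall>t. AE \<omega> in M. X t \<omega> = \<xi> t \<omega> + ar_fun A0 A \<theta> (past X t \<omega>)) \<and>
     causal M \<xi> X \<and> strictly_stationary M X \<and> ergodic_process M X \<and>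
     integrable M (\<lambda>\<omega>. norm (X 0 \<omega>) ^ r)"


section \<open>The quasi-maximum likelihood estimator\<close>

text \<open>The sequence \<open>X\<^bsub>t-1\<^esub>, \<dots>, X\<^sub>1, u\<^sub>1, u\<^sub>2, \<dots>\<close>, for \<open>t \<ge> 1\<close>.\<close>

definition truncated_past :: "(int \<Rightarrow> 'a \<Rightarrow> 'b) \<Rightarrow> (nat \<Rightarrow> 'b) \<Rightarrow> nat \<Rightarrow> 'a \<Rightarrow> nat \<Rightarrow> 'b" where
  "truncated_past X u t \<omega> = (\<lambda>j. if j < t then X (int t - int j) \<omega> else u (j - (t - 1)))"

definition quasi_loglik ::
  "('p \<Rightarrow> real^'m) \<Rightarrow> (nat \<Rightarrow> 'p \<Rightarrow> real^'m \<Rightarrow> real^'m::finite) \<Rightarrow>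
   (int \<Rightarrow> 'a \<Rightarrow> real^'m) \<Rightarrow> (nat \<Rightarrow> real^'m) \<Rightarrow> nat \<Rightarrow> 'a \<Rightarrow> 'p \<Rightarrow> real"
  where "quasi_loglik A0 A X u n \<omega> \<theta> =
     - (1/2) * (\<Sum>t=1..n. (norm (X (int t) \<omega> - ar_fun A0 A \<theta> (truncated_past X u t \<omega>)))\<^sup>2)"

text \<open>Any choice of maximisers is admitted, since the maximiser need not be unique.\<close>

definition is_qmle ::
  "'a measure \<Rightarrow> 'p set \<Rightarrow> ('p \<Rightarrow> real^'m) \<Rightarrow> (nat \<Rightarrow> 'p \<Rightarrow> real^'m \<Rightarrow> real^'m::finite) \<Rightarrow>
   (int \<Rightarrow> 'a \<Rightarrow> real^'m) \<Rightarrow> (nat \<Rightarrow> real^'m) \<Rightarrow> (nat \<Rightarrow> 'a \<Rightarrow> 'p) \<Rightarrow> bool"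
  where "is_qmle M \<Theta> A0 A X u \<theta>hat \<longleftrightarrow>
     (\<forall>n\<ge>1. \<forall>\<omega>\<in>space M.
        is_arg_max (quasi_loglik A0 A X u n \<omega>) (\<lambda>\<theta>. \<theta> \<in> \<Theta>) (\<theta>hat n \<omega>))"

definition q_fun ::
  "('p \<Rightarrow> real^'m) \<Rightarrow> (nat \<Rightarrow> 'p \<Rightarrow> real^'m \<Rightarrow> real^'m::finite) \<Rightarrow>
   (int \<Rightarrow> 'a \<Rightarrow> real^'m) \<Rightarrow> int \<Rightarrow> 'a \<Rightarrow> 'p \<Rightarrow> real"
  where "q_fun A0 A X t \<omega> \<theta> = (norm (X t \<omega> - ar_fun A0 A \<theta> (past X t \<omega>)))\<^sup>2"

text \<open>The derivatives of \<open>q\<^sub>0\<close> exist only almost surely and take arbitrary values elsewhere. Their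
  expectations are therefore taken over the completion of the probability space, so that they
  do not depend on (and cannot be made non-measurable by) the values on a null set.\<close>

definition F_matrix ::
  "'a measure \<Rightarrow> (real^'d::finite \<Rightarrow> real^'m) \<Rightarrow> (nat \<Rightarrow> real^'d \<Rightarrow> real^'m \<Rightarrow> real^'m::finite) \<Rightarrow>
   (int \<Rightarrow> 'a \<Rightarrow> real^'m) \<Rightarrow> real^'d \<Rightarrow> real^'d^'d"
  where "F_matrix M A0 A X \<theta> =
     (\<chi> i j. \<integral>\<omega>. pderivative i (pderivative j (q_fun A0 A X 0 \<omega>)) \<theta> \<partial>completion M)"

definition G_matrix ::
  "'a measure \<Rightarrow> (real^'d::finite \<Rightarrow> real^'m) \<Rightarrow> (nat \<Rightarrow> real^'d \<Rightarrow> real^'m \<Rightarrow> real^'m::finite) \<Rightarrow>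
   (int \<Rightarrow> 'a \<Rightarrow> real^'m) \<Rightarrow> real^'d \<Rightarrow> real^'d^'d"
  where "G_matrix M A0 A X \<theta> =
     (\<chi> i j. \<integral>\<omega>. pderivative i (q_fun A0 A X 0 \<omega>) \<theta> * pderivative j (q_fun A0 A X 0 \<omega>) \<theta>
        \<partial>completion M)"

text \<open>The conclusion asserts that the limiting covariance is well defined (the expectations in
  \<open>F\<close> and \<open>G\<close> exist and \<open>F\<close> is invertible), because the Bochner integral and
  \<^const>\<open>matrix_inv\<close> are total.\<close>

definition asymptotically_normal ::
  "'a measure \<Rightarrow> (real^'d::finite \<Rightarrow> real^'m) \<Rightarrow> (nat \<Rightarrow> real^'d \<Rightarrow> real^'m \<Rightarrow> real^'m::finite) \<Rightarrow>
   (int \<Rightarrow> 'a \<Rightarrow> real^'m) \<Rightarrow> real^'d \<Rightarrow> (nat \<Rightarrow> 'a \<Rightarrow> real^'d) \<Rightarrow> bool"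
  where "asymptotically_normal M A0 A X \<theta>0 \<theta>hat \<longleftrightarrow>
     (let F = F_matrix M A0 A X \<theta>0; G = G_matrix M A0 A X \<theta>0; q = q_fun A0 A X 0 in
      (\<forall>i j. integrable (completion M) (\<lambda>\<omega>. pderivative i (pderivative j (q \<omega>)) \<theta>0)) \<and>
      (\<forall>i j. integrable (completion M) (\<lambda>\<omega>. pderivative i (q \<omega>) \<theta>0 * pderivative j (q \<omega>) \<theta>0)) \<and>
      invertible F \<and>
      (\<exists>\<nu>. normal_law 0 (matrix_inv F ** G ** matrix_inv F) \<nu> \<and>
         weak_conv_vec
           (\<lambda>n. distr M borel (\<lambda>\<omega>. sqrt (real n) *\<^sub>R (\<theta>hat n \<omega> - \<theta>0))) \<nu>))"

end

theory Submission
  imports Defs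
begin

text \<open>Consistency: the residuals \<open>X\<^sub>t - f\<^sub>\<theta>\<^sup>t\<close> are Lipschitz functions of the past with summable weights, so the
  ergodic theorem holds uniformly in \<open>\<theta>\<close>, and by the decay of the weights replacing the past before time \<open>1\<close> by \<open>u\<close> changes
  the averages negligibly. The limit contrast \<open>E q\<^sub>0(\<theta>) = m + E \<parallel>f\<^sub>\<theta>\<^sup>0 - f\<^bsub>\<theta>0\<^esub>\<^sup>0\<parallel>\<^sup>2\<close> has
  \<open>\<theta>0\<close> as its only minimiser, because the innovation \<open>\<xi>\<^sub>0\<close> is independent of the past.

  Normality: expand the score around \<open>\<theta>0\<close>. Near \<open>\<theta>0\<close> the averaged Hessians are eventually close to a multiple of the
  Gram matrix \<open>H\<close> of the gradients; \<open>H\<close> is positive definite by linear independence, \<open>F = 2 H\<close> and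
  \<open>G = 4 H\<close>. The scaled score is a normalised sum of stationary ergodic martingale differences
  \<open>\<langle>\<xi>\<^sub>t, \<partial>f\<^sub>t\<rangle>\<close>, and the error of the truncated past in its
  \<open>t\<close>-th term is of mean \<open>O(t\<^bsup>1 - \<ell>\<^esup>)\<close>, which sums to \<open>o(\<surd>n)\<close> since \<open>\<ell> > 3/2\<close>.
  A tight sequence converges weakly as soon as its characteristic functions converge, because trigonometric sums
  are dense on compact sets.\<close>

section \<open>The pointwise ergodic theorem\<close>

text \<open>All quantities are functions on the space of one-sided paths: residual, gradients and
  innovation are evaluated at \<open>past X t\<close>, whose law \<open>path_law\<close> does not
  depend on t. The obstacle that shapes most estimates is that the estimator sees
  \<open>truncated_past\<close>, which is not stationary. Every function in play is therefore
  required to be Lipschitz lag by lag, with weights uniform over the parameter set, and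
  \<open>tail_weight\<close> bounds the price of truncation. For averages it suffices that the tails
  vanish; for the score they must beat the square root of n, and square summability of the tails
  achieves that. So residuals and gradients carry weights of their own, apart from the second
  derivatives, whose weights are merely summable. The central limit theorem is McLeish's: exp(ix) is
  close to (1 + ix) exp(-x^2/2), the product of the factors 1 + ix has expectation 1 by the
  martingale property, and the sum of squares converges by the ergodic theorem. Since the mean value
  theorem is applied to each score component separately, the Hessian is controlled uniformly near
  \<theta>0 and not just at one point.\<close>

fun birkhoff_max :: "('a \<Rightarrow> real) \<Rightarrow> ('a \<Rightarrow> 'a) \<Rightarrow> nat \<Rightarrow> 'a \<Rightarrow> real" where
  "birkhoff_max g T 0 x = g x"
| "birkhoff_max g T (Suc n) x = g x + max 0 (birkhoff_max g T n (T x))"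

text \<open>With the recursion unfolded, \<open>birkhoff_max g T n x\<close> is the largest of the
  orbit sums with 1 to n + 1 terms, hence it grows with n. Recursing through \<open>T x\<close>
  gives the relation between the values at \<open>x\<close> and at \<open>T x\<close> by definition,
  and the maximal argument needs exactly this relation.\<close>

lemma birkhoff_max_mono: "birkhoff_max g T n x \<le> birkhoff_max g T (Suc n) x"
proof (induction n arbitrary: x)
  case (Suc n)
  have "max 0 (birkhoff_max g T n (T x)) \<le> max 0 (birkhoff_max g T (Suc n) (T x))"
    using Suc[of "T x"] by (auto simp: max_def)
  then show ?case by (simp del: birkhoff_max.simps add: birkhoff_max.simps(2))
qed simp

lemma birkhoff_max_incseq: "incseq (\<lambda>n. birkhoff_max g T n x)"
  by (rule incseq_SucI) (rule birkhoff_max_mono)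

lemma birkhoff_sum_le_max: "(\<Sum>k<Suc n. g ((T ^^ k) x)) \<le> birkhoff_max g T n x"
proof (induction n arbitrary: x)
  case (Suc n)
  have "(\<Sum>k<Suc (Suc n). g ((T ^^ k) x)) = g x + (\<Sum>k<Suc n. g ((T ^^ k) (T x)))"
    by (subst sum.lessThan_Suc_shift) (simp add: funpow_swap1)
  also have "\<dots> \<le> birkhoff_max g T (Suc n) x"
    using Suc[of "T x"] by simp
  finally show ?case .
qed simp

locale ergodic_transformation = prob_space N for N :: "'b measure" +
  fixes T :: "'b \<Rightarrow> 'b"
  assumes T_measurable [measurable]: "T \<in> measurable N N"
    and T_preserves: "distr N N T = N"
    and ergodic: "\<And>B. B \<in> sets N \<Longrightarrow> T -` B \<inter> space N = B \<Longrightarrow> measure N B \<in> {0, 1}"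
begin

lemma integrable_T:
  fixes g :: "'b \<Rightarrow> real"
  assumes "integrable N g" shows "integrable N (\<lambda>x. g (T x))"
  by (rule integrable_distr[OF T_measurable]) (simp add: T_preserves assms)

lemma integral_T:
  fixes g :: "'b \<Rightarrow> real"
  assumes "g \<in> borel_measurable N" shows "(\<integral>x. g (T x) \<partial>N) = (\<integral>x. g x \<partial>N)"
  using integral_distr[OF T_measurable assms] by (simp add: T_preserves)

text \<open>Garsia's maximal argument by contradiction: if the maxima were unbounded almost surely,
  the maximum at x minus the one at T x would converge to g x, while its integral is nonnegative by
  invariance of the measure. The integral of g would then be nonnegative.\<close>

lemma birkhoff_sums_bounded_above:
  fixes g :: "'b \<Rightarrow> real"
  assumes g: "integrable N g" and neg: "(\<integral>x. g x \<partial>N) < 0"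
  shows "AE x in N. \<exists>c. \<forall>n. (\<Sum>k<n. g ((T ^^ k) x)) \<le> c"
proof -
  have [measurable]: "g \<in> borel_measurable N" using g by auto
  let ?R = "birkhoff_max g T"
  have int: "integrable N (?R n)" for n
  proof (induction n)
    case (Suc n)
    show ?case unfolding birkhoff_max.simps
      using integrable_T[OF Suc] g by (intro Bochner_Integration.integrable_add integrable_max) auto
  qed (simp add: g)
  have meas [measurable]: "?R n \<in> borel_measurable N" for n
    using int by auto
  \<comment> \<open>From T x to x the maxima change only by g x and the cut at 0, so unboundedness
    is a strictly invariant event, as \<open>ergodic\<close> requires.\<close>
  define A where "A = {x \<in> space N. \<forall>c::nat. \<exists>n. ?R n x > real c}"
  have A [measurable]: "A \<in> sets N" unfolding A_def by measurable
  have inv: "T x \<in> A \<longleftrightarrow> x \<in> A" if x: "x \<in> space N" for x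
  proof
    assume a: "T x \<in> A"
    have "\<exists>n. ?R n x > real c" for c :: nat
    proof -
      obtain c' :: nat where c': "real c' > real c - g x" using reals_Archimedean2 by blast
      from a obtain n where "?R n (T x) > real c'" unfolding A_def by blast
      then have "?R (Suc n) x > real c" using c' by simp
      then show ?thesis by blast
    qed
    then show "x \<in> A" using x by (simp add: A_def)
  next
    assume a: "x \<in> A"
    have "\<exists>n. ?R n (T x) > real c" for c :: nat
    proof -
      obtain c' :: nat where c': "real c' > real c + \<bar>g x\<bar>" using reals_Archimedean2 by blast
      from a obtain n where "?R n x > real c'" unfolding A_def by blast
      then have "?R (Suc n) x > real c'" using birkhoff_max_mono[of g T n x] by linarith
      then have "?R n (T x) > real c" using c' by (simp add: max_def split: if_splits)
      then show ?thesis by blast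
    qed
    then show "T x \<in> A" using x measurable_space[OF T_measurable] by (simp add: A_def)
  qed
  have "T -` A \<inter> space N = A"
    using inv by (auto simp: A_def)
  then have A01: "measure N A \<in> {0, 1}" using ergodic[OF A] by blast
  have "measure N A \<noteq> 1"
  proof
    assume "measure N A = 1"
    then have AEA: "AE x in N. x \<in> A"
      using prob_eq_1[OF A] by simp
    \<comment> \<open>On \<open>A\<close> the maximum at T x is eventually positive; then the cut at
      0 is inactive and the integrand equals g x exactly. For all n the integrand is dominated,
      because the maximum at T x is at least g (T x).\<close>
    have lim: "(\<lambda>n. (\<integral>x. ?R (Suc n) x - ?R n (T x) \<partial>N)) \<longlonglongrightarrow> (\<integral>x. g x \<partial>N)"
    proof (rule integral_dominated_convergence[where w = "\<lambda>x. \<bar>g x\<bar> + \<bar>g (T x)\<bar>"])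
      show "integrable N (\<lambda>x. \<bar>g x\<bar> + \<bar>g (T x)\<bar>)"
        using g integrable_T[OF g] by auto
      show "AE x in N. (\<lambda>n. ?R (Suc n) x - ?R n (T x)) \<longlonglongrightarrow> g x"
        using AEA
      proof eventually_elim
        case (elim x)
        then have "T x \<in> A" using inv[of x] by (auto simp: A_def)
        then obtain n0 where "?R n0 (T x) > real 0" unfolding A_def by blast
        then have "?R n (T x) > 0" if "n \<ge> n0" for n
          using incseqD[OF birkhoff_max_incseq that, of g T "T x"] by simp
        then have "\<forall>\<^sub>F n in sequentially. ?R (Suc n) x - ?R n (T x) = g x"
          unfolding eventually_sequentially by (intro exI[of _ n0]) (auto simp: max_def dest: less_imp_le)
        then show ?case by (rule tendsto_eventually)
      qed
      show "AE x in N. norm (?R (Suc n) x - ?R n (T x)) \<le> \<bar>g x\<bar> + \<bar>g (T x)\<bar>" for n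
      proof (rule AE_I2)
        fix x
        have "?R n (T x) \<ge> g (T x)"
          using incseqD[OF birkhoff_max_incseq, of 0 n g T "T x"] by simp
        then show "norm (?R (Suc n) x - ?R n (T x)) \<le> \<bar>g x\<bar> + \<bar>g (T x)\<bar>"
          by (simp add: max_def abs_if)
      qed
    qed simp_all
    \<comment> \<open>Invariance replaces T x by x under the integral; what remains is the integral
      of an increment of an increasing sequence.\<close>
    have "(\<integral>x. ?R (Suc n) x - ?R n (T x) \<partial>N) \<ge> 0" for n
    proof -
      have "(\<integral>x. ?R (Suc n) x - ?R n (T x) \<partial>N) = (\<integral>x. ?R (Suc n) x \<partial>N) - (\<integral>x. ?R n x \<partial>N)"
        using int[of "Suc n"] integrable_T[OF int[of n]] integral_T[OF meas[of n]]
        by (simp del: birkhoff_max.simps)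
      moreover have "(\<integral>x. ?R n x \<partial>N) \<le> (\<integral>x. ?R (Suc n) x \<partial>N)"
        by (intro integral_mono int birkhoff_max_mono)
      ultimately show ?thesis by simp
    qed
    then have "(\<integral>x. g x \<partial>N) \<ge> 0" using lim by (intro LIMSEQ_le_const) auto
    then show False using neg by simp
  qed
  then have "measure N A = 0" using A01 by simp
  then have "AE x in N. x \<notin> A"
    using A by (simp add: AE_iff_measurable[where N = A] emeasure_eq_measure sets.sets_into_space Int_absorb1 A_def)
  with AE_space show ?thesis
  proof eventually_elim
    case (elim x)
    then obtain c :: nat where c: "\<And>n. ?R n x \<le> real c"
      by (auto simp: A_def not_less)
    have "(\<Sum>k<n. g ((T ^^ k) x)) \<le> real c" for n
    proof (cases n)
      case (Suc m)
      then show ?thesis using order_trans[OF birkhoff_sum_le_max c] by (simp only:)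
    qed simp
    then show ?case by blast
  qed
qed

text \<open>Subtracting slightly more than the mean makes the integral negative, so the shifted sums
  are bounded above and their bound disappears after division by n. The countably many excesses 1 /
  (i + 1) allow a single exceptional null set.\<close>

lemma birkhoff_limsup:
  fixes g :: "'b \<Rightarrow> real"
  assumes g: "integrable N g"
  shows "AE x in N. \<forall>e>0. \<forall>\<^sub>F n in sequentially. (\<Sum>k<n. g ((T ^^ k) x)) / real n \<le> (\<integral>x. g x \<partial>N) + e"
proof -
  let ?m = "\<integral>x. g x \<partial>N"
  have "AE x in N. \<forall>i::nat. \<exists>c. \<forall>n. (\<Sum>k<n. g ((T ^^ k) x) - (?m + 1 / real (Suc i))) \<le> c"
    unfolding AE_all_countable
  proof
    fix i :: nat
    show "AE x in N. \<exists>c. \<forall>n. (\<Sum>k<n. g ((T ^^ k) x) - (?m + 1 / real (Suc i))) \<le> c"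
      by (rule birkhoff_sums_bounded_above) (use g in \<open>simp_all add: prob_space\<close>)
  qed
  then show ?thesis
  proof eventually_elim
    case (elim x)
    show ?case
    proof (intro allI impI)
      fix e :: real assume e: "e > 0"
      obtain i :: nat where i: "1 / real (Suc i) < e / 2"
        using reals_Archimedean[of "e / 2"] e by (auto simp: inverse_eq_divide)
      from elim obtain c where c: "\<And>n. (\<Sum>k<n. g ((T ^^ k) x) - (?m + 1 / real (Suc i))) \<le> c" by blast
      have "(\<lambda>n. c / real n) \<longlonglongrightarrow> 0" by real_asymp
      then have "\<forall>\<^sub>F n in sequentially. c / real n < e / 2"
        by (rule order_tendstoD) (use e in simp)
      with eventually_gt_at_top[of 0] show "\<forall>\<^sub>F n in sequentially. (\<Sum>k<n. g ((T ^^ k) x)) / real n \<le> ?m + e"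
      proof eventually_elim
        case (elim n)
        have "(\<Sum>k<n. g ((T ^^ k) x)) \<le> c + real n * (?m + 1 / real (Suc i))"
          using c[of n] by (simp add: sum_subtractf)
        then have "(\<Sum>k<n. g ((T ^^ k) x)) / real n \<le> (c + real n * (?m + 1 / real (Suc i))) / real n"
          by (rule divide_right_mono) simp
        also have "\<dots> = c / real n + (?m + 1 / real (Suc i))"
          using elim(1) by (subst add_divide_distrib) simp
        finally have "(\<Sum>k<n. g ((T ^^ k) x)) / real n \<le> c / real n + (?m + 1 / real (Suc i))" .
        then show ?case using elim(2) i by linarith
      qed
    qed
  qed
qed

text \<open>The lower bound is the upper bound for - g.\<close>

theorem birkhoff:
  fixes g :: "'b \<Rightarrow> real"
  assumes g: "integrable N g"
  shows "AE x in N. (\<lambda>n. (\<Sum>k<n. g ((T ^^ k) x)) / real n) \<longlonglongrightarrow> (\<integral>x. g x \<partial>N)"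
proof -
  have "integrable N (\<lambda>x. - g x)" using g by simp
  from birkhoff_limsup[OF this] birkhoff_limsup[OF g] show ?thesis
  proof eventually_elim
    case (elim x)
    show ?case
    proof (rule LIMSEQ_I)
      fix r :: real assume r: "r > 0"
      then have r2: "r / 2 > 0" by simp
      from elim(1)[rule_format, OF r2] elim(2)[rule_format, OF r2]
      have "\<forall>\<^sub>F n in sequentially. norm ((\<Sum>k<n. g ((T ^^ k) x)) / real n - (\<integral>x. g x \<partial>N)) < r"
      proof eventually_elim
        case (elim n)
        have "(\<Sum>k<n. - g ((T ^^ k) x)) / real n = - ((\<Sum>k<n. g ((T ^^ k) x)) / real n)"
          by (simp add: sum_negf)
        with elim r show ?case unfolding real_norm_def abs_less_iff integral_minus by linarith
      qed
      then show "\<exists>no. \<forall>n\<ge>no. norm ((\<Sum>k<n. g ((T ^^ k) x)) / real n - (\<integral>x. g x \<partial>N)) < r"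
        by (simp add: eventually_sequentially)
    qed
  qed
qed

end

subsection \<open>Stationary ergodic processes\<close>

abbreviation seq_space :: "(nat \<Rightarrow> (real^'m::finite)) measure" where
  "seq_space \<equiv> PiM UNIV (\<lambda>_. borel)"

locale stationary_process = prob_space M for M :: "'a measure" +
  fixes X :: "int \<Rightarrow> 'a \<Rightarrow> real^'m::finite"
  assumes X_measurable [measurable]: "\<And>t. X t \<in> borel_measurable M"
    and stationary: "strictly_stationary M X"
    and ergodic: "ergodic_process M X"
begin

text \<open>Coordinate j of a path is the value j steps before the present. By stationarity one
  measure serves every time t, so moments, integrability and almost sure properties are settled once
  on path space.\<close>

definition path_law :: "(nat \<Rightarrow> real^'m) measure" where
  "path_law = distr M seq_space (past X 0)"

lemma past_measurable [measurable]: "past X t \<in> measurable M seq_space"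
  unfolding past_def by (rule measurable_PiM_single') auto

lemma path_measurable: "(\<lambda>\<omega> t. X (t + h) \<omega>) \<in> measurable M (PiM UNIV (\<lambda>_. borel))"
  by (rule measurable_PiM_single') auto

lemma sets_path_law [measurable_cong]: "sets path_law = sets seq_space"
  by (simp add: path_law_def)

lemma prob_space_path_law: "prob_space path_law"
  unfolding path_law_def by (rule prob_space_distr) simp

lemma distr_past: "distr M seq_space (past X t) = path_law"
proof -
  let ?r = "\<lambda>x::int \<Rightarrow> real^'m. \<lambda>j::nat. x (- int j)"
  let ?P = "PiM (UNIV::int set) (\<lambda>_. borel) :: (int \<Rightarrow> real^'m) measure"
  have r: "?r \<in> measurable ?P seq_space"
    by (rule measurable_PiM_single') (auto intro!: measurable_component_singleton)
  have "distr M seq_space (past X h) = distr (distr M ?P (\<lambda>\<omega> t. X (t + h) \<omega>)) seq_space ?r" for h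
    by (subst distr_distr[OF r path_measurable]) (simp add: past_def [abs_def] comp_def)
  moreover have "distr M ?P (\<lambda>\<omega> t. X (t + h) \<omega>) = distr M ?P (\<lambda>\<omega> t. X (t + 0) \<omega>)" for h
    using stationary unfolding strictly_stationary_def by simp
  ultimately show ?thesis unfolding path_law_def by metis
qed

lemma AE_past: "AE p in path_law. P p \<Longrightarrow> AE \<omega> in M. P (past X t \<omega>)"
  by (metis AE_distrD distr_past past_measurable)

lemma AE_all_past: "AE p in path_law. P p \<Longrightarrow> AE \<omega> in M. \<forall>t. P (past X t \<omega>)"
  unfolding AE_all_countable by (blast intro: AE_past)

lemma integral_past:
  fixes g :: "(nat \<Rightarrow> real^'m) \<Rightarrow> 'b::{banach, second_countable_topology}"
  assumes "g \<in> borel_measurable seq_space"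
  shows "(\<integral>\<omega>. g (past X t \<omega>) \<partial>M) = (\<integral>p. g p \<partial>path_law)"
  using integral_distr[OF past_measurable assms] by (simp add: distr_past)

lemma integrable_past_iff:
  fixes g :: "(nat \<Rightarrow> real^'m) \<Rightarrow> 'b::{banach, second_countable_topology}"
  assumes "g \<in> borel_measurable seq_space"
  shows "integrable M (\<lambda>\<omega>. g (past X t \<omega>)) \<longleftrightarrow> integrable path_law g"
  using integrable_distr_eq[OF past_measurable assms] by (simp add: distr_past)

lemma integrable_past:
  fixes g :: "(nat \<Rightarrow> real^'m) \<Rightarrow> 'b::{banach, second_countable_topology}"
  shows "integrable path_law g \<Longrightarrow> integrable M (\<lambda>\<omega>. g (past X t \<omega>))"
  using integrable_distr[OF past_measurable, of t g] by (simp add: distr_past)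

text \<open>The transformation is the shift on two-sided paths, where it preserves the law; h is
  carried over to that space by reading off the past at one fixed time.\<close>

theorem ergodic_average:
  assumes h: "integrable path_law h"
  shows "AE \<omega> in M. (\<lambda>n. (\<Sum>t=1..n. h (past X (int t) \<omega>)) / real n) \<longlonglongrightarrow> (\<integral>p. h p \<partial>path_law)"
proof -
  let ?P = "PiM (UNIV::int set) (\<lambda>_. borel) :: (int \<Rightarrow> real^'m) measure"
  let ?X = "\<lambda>\<omega> t. X t \<omega>"
  let ?T = "\<lambda>x::int \<Rightarrow> real^'m. \<lambda>t. x (t + 1)"
  define N where "N = distr M ?P ?X"
  have X: "?X \<in> measurable M ?P" using path_measurable[of 0] by simp
  have T: "?T \<in> measurable ?P ?P"
    by (rule measurable_PiM_single') (auto intro!: measurable_component_singleton)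
  have sN [measurable_cong]: "sets N = sets ?P" by (simp add: N_def)
  have spN: "space N = UNIV" by (simp add: N_def space_PiM)
  interpret N: prob_space N unfolding N_def by (rule prob_space_distr[OF X])
  interpret N: ergodic_transformation N ?T
  proof
    show "?T \<in> measurable N N" using T by simp
    have "distr N N ?T = distr N ?P ?T" by (rule distr_cong) (simp_all add: sN)
    also have "\<dots> = distr M ?P (\<lambda>\<omega> t. X (t + 1) \<omega>)"
      unfolding N_def by (subst distr_distr[OF T X]) (simp add: comp_def)
    also have "\<dots> = N" using stationary unfolding strictly_stationary_def N_def by simp
    finally show "distr N N ?T = N" .
    fix B assume B: "B \<in> sets N" "?T -` B \<inter> space N = B"
    have "measure N B = measure M (?X -` B \<inter> space M)"
      unfolding N_def using B(1) by (intro measure_distr[OF X]) (simp add: sN)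
    also have "?X -` B \<inter> space M = {\<omega> \<in> space M. ?X \<omega> \<in> B}" by auto
    finally show "measure N B \<in> {0, 1}"
      using B ergodic[unfolded ergodic_process_def, rule_format, of B] by (simp only: spN sN Int_UNIV_right)
  qed
  \<comment> \<open>The past is read at time 1 and not at time 0, so that the orbit sum over k < n
    becomes the sum over t = 1..n.\<close>
  let ?r = "\<lambda>x::int \<Rightarrow> real^'m. \<lambda>j::nat. x (1 - int j)"
  have r: "?r \<in> measurable ?P seq_space"
    by (rule measurable_PiM_single') (auto intro!: measurable_component_singleton)
  have hm [measurable]: "h \<in> borel_measurable seq_space" using borel_measurable_integrable[OF h] unfolding measurable_cong_sets[OF sets_path_law refl] .
  have hr: "(\<lambda>x. h (?r x)) \<in> borel_measurable ?P"
    using measurable_compose[OF r hm] .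
  have "integrable N (\<lambda>x. h (?r x))"
    unfolding N_def integrable_distr_eq[OF X hr] using integrable_past[OF h, of 1] by (simp only: past_def of_nat_0 int_ops)
  from N.birkhoff[OF this]
  have "AE x in N. (\<lambda>n. (\<Sum>k<n. h (?r ((?T ^^ k) x))) / real n) \<longlonglongrightarrow> (\<integral>x. h (?r x) \<partial>N)" .
  then have 1: "AE \<omega> in M. (\<lambda>n. (\<Sum>k<n. h (?r ((?T ^^ k) (?X \<omega>)))) / real n) \<longlonglongrightarrow> (\<integral>x. h (?r x) \<partial>N)"
    unfolding N_def by (rule AE_distrD[OF X])
  have 2: "(\<integral>x. h (?r x) \<partial>N) = (\<integral>p. h p \<partial>path_law)"
    unfolding N_def integral_distr[OF X hr] using integral_past[OF hm, of 1] by (simp only: past_def)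
  have Tk: "(?T ^^ k) x = (\<lambda>t. x (t + int k))" for k x
    by (induction k arbitrary: x) (simp_all add: add_ac)
  have 3: "(\<Sum>k<n. h (?r ((?T ^^ k) (?X \<omega>)))) = (\<Sum>t=1..n. h (past X (int t) \<omega>))" for n \<omega>
  proof -
    have "(\<Sum>k<n. h (?r ((?T ^^ k) (?X \<omega>)))) = (\<Sum>k<n. h (past X (int (Suc k)) \<omega>))"
      unfolding Tk past_def by (intro sum.cong arg_cong[where f = h] ext arg_cong2[where f = X]) auto
    also have "\<dots> = (\<Sum>t=1..n. h (past X (int t) \<omega>))"
      by (rule sum.reindex_bij_witness[of _ "\<lambda>t. t - 1" Suc]) auto
    finally show ?thesis .
  qed
  show ?thesis using 1 unfolding 2 3 .
qed

end

section \<open>Weighted series of square integrable functions\<close>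

text \<open>Cauchy-Schwarz after splitting each term into sqrt (b j) and sqrt (b j) * y j.
  Convergence of the left-hand series comes from y <= 1 + y^2.\<close>

lemma weighted_Cauchy_Schwarz_suminf:
  fixes b y :: "nat \<Rightarrow> real"
  assumes b: "\<And>j. b j \<ge> 0" "summable b" and y: "\<And>j. y j \<ge> 0" "summable (\<lambda>j. b j * (y j)\<^sup>2)"
  shows "summable (\<lambda>j. b j * y j)" "(\<Sum>j. b j * y j)\<^sup>2 \<le> (\<Sum>j. b j) * (\<Sum>j. b j * (y j)\<^sup>2)"
proof -
  show s: "summable (\<lambda>j. b j * y j)"
  proof (rule summable_comparison_test')
    show "summable (\<lambda>j. b j + b j * (y j)\<^sup>2)" by (intro summable_add b y)
    fix j :: nat
    have "y j \<le> 1 + (y j)\<^sup>2" using zero_le_power2[of "y j - 1"] y(1)[of j] by (simp add: power2_diff)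
    from mult_left_mono[OF this b(1)[of j]] show "norm (b j * y j) \<le> b j + b j * (y j)\<^sup>2"
      using b(1)[of j] y(1)[of j] by (simp add: distrib_left)
  qed
  have "(\<Sum>j<n. b j * y j)\<^sup>2 \<le> (\<Sum>j. b j) * (\<Sum>j. b j * (y j)\<^sup>2)" for n
  proof -
    have "(\<Sum>j<n. b j * y j) = (\<Sum>j<n. sqrt (b j) * (sqrt (b j) * y j))"
      by (intro sum.cong refl) (simp add: b mult.assoc[symmetric])
    also have "\<dots>\<^sup>2 \<le> (\<Sum>j<n. (sqrt (b j))\<^sup>2) * (\<Sum>j<n. (sqrt (b j) * y j)\<^sup>2)"
      by (rule Cauchy_Schwarz_ineq_sum)
    also have "\<dots> = (\<Sum>j<n. b j) * (\<Sum>j<n. b j * (y j)\<^sup>2)"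
      by (simp add: b power_mult_distrib)
    also have "\<dots> \<le> (\<Sum>j. b j) * (\<Sum>j. b j * (y j)\<^sup>2)"
      by (intro mult_mono sum_le_suminf sum_nonneg suminf_nonneg mult_nonneg_nonneg b y) auto
    finally show ?thesis .
  qed
  then show "(\<Sum>j. b j * y j)\<^sup>2 \<le> (\<Sum>j. b j) * (\<Sum>j. b j * (y j)\<^sup>2)"
    by (intro LIMSEQ_le_const2[OF tendsto_power[OF summable_LIMSEQ[OF s]]]) auto
qed

text \<open>Monotone convergence for series with values in \<open>ennreal\<close>: a finite expected
  sum is finite almost everywhere, and there it agrees with the real \<open>suminf\<close>.\<close>

lemma AE_summable_of_integrals:
  fixes f :: "nat \<Rightarrow> 'a \<Rightarrow> real"
  assumes [measurable]: "\<And>j. f j \<in> borel_measurable M" and nn: "\<And>j x. f j x \<ge> 0"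
    and int: "\<And>j. (\<integral>\<^sup>+x. ennreal (f j x) \<partial>M) \<le> ennreal (c j)" and c: "\<And>j. c j \<ge> 0" "summable c"
  shows "AE x in M. summable (\<lambda>j. f j x)" "(\<integral>\<^sup>+x. ennreal (\<Sum>j. f j x) \<partial>M) \<le> ennreal (\<Sum>j. c j)"
proof -
  have "(\<integral>\<^sup>+x. (\<Sum>j. ennreal (f j x)) \<partial>M) = (\<Sum>j. \<integral>\<^sup>+x. ennreal (f j x) \<partial>M)"
    by (intro nn_integral_suminf) simp
  also have "\<dots> \<le> (\<Sum>j. ennreal (c j))" by (intro suminf_le int) auto
  also have "\<dots> = ennreal (\<Sum>j. c j)" by (intro suminf_ennreal2 c)
  finally have le: "(\<integral>\<^sup>+x. (\<Sum>j. ennreal (f j x)) \<partial>M) \<le> ennreal (\<Sum>j. c j)" .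
  then have "(\<integral>\<^sup>+x. (\<Sum>j. ennreal (f j x)) \<partial>M) \<noteq> \<infinity>"
    using ennreal_less_top[of "\<Sum>j. c j"] by (auto simp: top_unique)
  then have "AE x in M. (\<Sum>j. ennreal (f j x)) \<noteq> \<infinity>"
    by (intro nn_integral_PInf_AE) measurable
  then show AE: "AE x in M. summable (\<lambda>j. f j x)"
    by eventually_elim (rule summable_suminf_not_top, use nn in auto)
  have "(\<integral>\<^sup>+x. ennreal (\<Sum>j. f j x) \<partial>M) = (\<integral>\<^sup>+x. (\<Sum>j. ennreal (f j x)) \<partial>M)"
    using AE by (intro nn_integral_cong_AE) (auto elim!: eventually_mono simp: suminf_ennreal2 nn)
  then show "(\<integral>\<^sup>+x. ennreal (\<Sum>j. f j x) \<partial>M) \<le> ennreal (\<Sum>j. c j)" using le by simp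
qed

text \<open>Weighted Cauchy-Schwarz under the integral. The total weight enters the bound squared;
  this is what later converts square summable tails of the weights into a rate for the
  score.\<close>

lemma weighted_series_square_integrable:
  fixes y :: "nat \<Rightarrow> 'a \<Rightarrow> real" and b :: "nat \<Rightarrow> real"
  assumes [measurable]: "\<And>j. y j \<in> borel_measurable M" and nn: "\<And>j x. y j x \<ge> 0"
    and int: "\<And>j. integrable M (\<lambda>x. (y j x)\<^sup>2)" and C: "\<And>j. (\<integral>x. (y j x)\<^sup>2 \<partial>M) \<le> C"
    and b: "\<And>j. b j \<ge> 0" "summable b"
  shows "AE x in M. summable (\<lambda>j. b j * y j x)"
    "integrable M (\<lambda>x. (\<Sum>j. b j * y j x)\<^sup>2)"
    "(\<integral>x. (\<Sum>j. b j * y j x)\<^sup>2 \<partial>M) \<le> (\<Sum>j. b j)\<^sup>2 * C"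
proof -
  let ?B = "\<Sum>j. b j"
  have C0: "C \<ge> 0" by (rule order_trans[OF _ C[of 0]]) simp
  have B0: "?B \<ge> 0" by (intro suminf_nonneg b)
  have i: "(\<integral>\<^sup>+x. ennreal (b j * (y j x)\<^sup>2) \<partial>M) \<le> ennreal (b j * C)" for j
  proof -
    have "(\<integral>\<^sup>+x. ennreal (b j * (y j x)\<^sup>2) \<partial>M) = ennreal (\<integral>x. b j * (y j x)\<^sup>2 \<partial>M)"
      by (intro nn_integral_eq_integral) (use int b in auto)
    also have "\<dots> \<le> ennreal (b j * C)"
      using C[of j] b(1)[of j] by (intro ennreal_leI) (simp add: mult_left_mono)
    finally show ?thesis .
  qed
  have sm: "summable (\<lambda>j. b j * C)" using b(2) by (rule summable_mult2)
  have AE2: "AE x in M. summable (\<lambda>j. b j * (y j x)\<^sup>2)"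
    and le: "(\<integral>\<^sup>+x. ennreal (\<Sum>j. b j * (y j x)\<^sup>2) \<partial>M) \<le> ennreal (\<Sum>j. b j * C)"
    by (rule AE_summable_of_integrals[OF _ _ i]; use b C0 sm in simp)+
  show "AE x in M. summable (\<lambda>j. b j * y j x)"
    using AE2 by eventually_elim (rule weighted_Cauchy_Schwarz_suminf(1)[OF b nn])
  have "(\<integral>\<^sup>+x. ennreal ((\<Sum>j. b j * y j x)\<^sup>2) \<partial>M) \<le> (\<integral>\<^sup>+x. ennreal ?B * ennreal (\<Sum>j. b j * (y j x)\<^sup>2) \<partial>M)"
  proof (intro nn_integral_mono_AE)
    show "AE x in M. ennreal ((\<Sum>j. b j * y j x)\<^sup>2) \<le> ennreal ?B * ennreal (\<Sum>j. b j * (y j x)\<^sup>2)"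
      using AE2
    proof eventually_elim
      case (elim x)
      then show ?case
        using weighted_Cauchy_Schwarz_suminf(2)[OF b nn elim] suminf_nonneg[OF elim] b nn B0
        by (simp add: ennreal_mult[symmetric] ennreal_leI)
    qed
  qed
  also have "\<dots> = ennreal ?B * (\<integral>\<^sup>+x. ennreal (\<Sum>j. b j * (y j x)\<^sup>2) \<partial>M)"
    by (intro nn_integral_cmult) measurable
  also have "\<dots> \<le> ennreal ?B * ennreal (\<Sum>j. b j * C)" by (intro mult_left_mono le) simp
  also have "\<dots> = ennreal (?B\<^sup>2 * C)"
    using B0 C0 by (simp add: ennreal_mult[symmetric] suminf_mult2[OF b(2), symmetric] power2_eq_square mult.assoc)
  finally have fin: "(\<integral>\<^sup>+x. ennreal ((\<Sum>j. b j * y j x)\<^sup>2) \<partial>M) \<le> ennreal (?B\<^sup>2 * C)" .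
  show int2: "integrable M (\<lambda>x. (\<Sum>j. b j * y j x)\<^sup>2)"
    using fin by (intro integrableI_nonneg) (auto intro: le_less_trans)
  show "(\<integral>x. (\<Sum>j. b j * y j x)\<^sup>2 \<partial>M) \<le> ?B\<^sup>2 * C"
    using fin C0 by (subst (asm) nn_integral_eq_integral[OF int2]) auto
qed

section \<open>Uniform ergodic averages\<close>

context stationary_process
begin

text \<open>The oscillation of \<phi> over a ball around \<theta>1 is itself an integrable function
  of the path, and its mean tends to 0 with the radius by dominated convergence. The ergodic theorem
  for the oscillation at one small radius, together with the one for
  \<open>\<phi> \<theta>1\<close>, controls all parameters in the ball simultaneously, hence also
  random ones.\<close>

lemma uniform_ergodic_average:
  fixes \<phi> :: "'p::{metric_space, second_countable_topology} \<Rightarrow> (nat \<Rightarrow> real^'m) \<Rightarrow> real"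
  assumes meas [measurable]: "\<And>\<theta>. \<theta> \<in> K \<Longrightarrow> \<phi> \<theta> \<in> borel_measurable seq_space"
    and env: "integrable path_law env"
    and good: "AE p in path_law. continuous_on K (\<lambda>\<theta>. \<phi> \<theta> p) \<and> (\<forall>\<theta>\<in>K. \<bar>\<phi> \<theta> p\<bar> \<le> env p)"
    and \<theta>1: "\<theta>1 \<in> K" and \<epsilon>: "\<epsilon> > 0"
  obtains \<rho> where "\<rho> > 0" "AE \<omega> in M. \<forall>\<^sub>F n in sequentially. \<forall>\<theta>\<in>K \<inter> ball \<theta>1 \<rho>.
    \<bar>(\<Sum>t=1..n. \<phi> \<theta> (past X (int t) \<omega>)) / real n - (\<integral>p. \<phi> \<theta>1 p \<partial>path_law)\<bar> \<le> \<epsilon>"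
proof -
  \<comment> \<open>A supremum over a countable set is measurable; continuity in the parameter
    extends the bound from \<open>D\<close> to all of \<open>K\<close>.\<close>
  obtain D where D: "countable D" "D \<subseteq> K" "K \<subseteq> closure D" by (rule separable)
  define S where "S r p = (SUP \<theta>\<in>D \<inter> ball \<theta>1 r. ennreal \<bar>\<phi> \<theta> p - \<phi> \<theta>1 p\<bar>)" for r p
  let ?mod = "\<lambda>r p. enn2real (S r p)"
  let ?G = "\<lambda>p. continuous_on K (\<lambda>\<theta>. \<phi> \<theta> p) \<and> (\<forall>\<theta>\<in>K. \<bar>\<phi> \<theta> p\<bar> \<le> env p)"
  note mpl = measurable_cong_sets[OF sets_path_law refl]
  have m [measurable]: "?mod r \<in> borel_measurable seq_space" for r
    unfolding S_def using D by (intro borel_measurable_enn2real borel_measurable_SUP) (auto intro!: \<theta>1 measurable_compose[OF _ measurable_ennreal] borel_measurable_abs borel_measurable_diff meas)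
  have S_le: "S r p \<le> ennreal (2 * env p)" if "?G p" for r p
    unfolding S_def
  proof (rule SUP_least)
    fix \<theta> assume "\<theta> \<in> D \<inter> ball \<theta>1 r"
    then have "\<theta> \<in> K" using D by auto
    then have "\<bar>\<phi> \<theta> p\<bar> \<le> env p" "\<bar>\<phi> \<theta>1 p\<bar> \<le> env p" using that \<theta>1 by auto
    then show "ennreal \<bar>\<phi> \<theta> p - \<phi> \<theta>1 p\<bar> \<le> ennreal (2 * env p)" by (intro ennreal_leI) linarith
  qed
  have Sfin: "ennreal (?mod r p) = S r p" if "?G p" for r p
    using S_le[OF that, of r] by (metis ennreal_enn2real ennreal_less_top le_less_trans)
  have mod_ge: "\<bar>\<phi> \<theta> p - \<phi> \<theta>1 p\<bar> \<le> ?mod r p" if G: "?G p" and \<theta>: "\<theta> \<in> K \<inter> ball \<theta>1 r" for \<theta> r p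
  proof -
    have DD: "\<bar>\<phi> d p - \<phi> \<theta>1 p\<bar> \<le> ?mod r p" if "d \<in> D" "d \<in> ball \<theta>1 r" for d
    proof -
      have "ennreal \<bar>\<phi> d p - \<phi> \<theta>1 p\<bar> \<le> S r p" unfolding S_def using that by (intro SUP_upper) auto
      then show ?thesis using Sfin[OF G, of r] by (metis ennreal_le_iff enn2real_nonneg)
    qed
    have "\<theta> \<in> closure D" using \<theta> D by blast
    then obtain s where s: "\<And>n. s n \<in> D" "s \<longlonglongrightarrow> \<theta>"
      unfolding closure_sequential by blast
    have "(\<lambda>n. \<phi> (s n) p) \<longlonglongrightarrow> \<phi> \<theta> p"
      using G \<theta> s D(2) unfolding continuous_on_sequentially comp_def by blast
    then have l: "(\<lambda>n. \<bar>\<phi> (s n) p - \<phi> \<theta>1 p\<bar>) \<longlonglongrightarrow> \<bar>\<phi> \<theta> p - \<phi> \<theta>1 p\<bar>"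
      by (intro tendsto_intros)
    have "\<forall>\<^sub>F n in sequentially. s n \<in> ball \<theta>1 r"
      using s(2) \<theta> by (intro topological_tendstoD) auto
    then have "\<forall>\<^sub>F n in sequentially. \<bar>\<phi> (s n) p - \<phi> \<theta>1 p\<bar> \<le> ?mod r p"
      by eventually_elim (use DD s in auto)
    with l show ?thesis by (intro tendsto_upperbound[OF l]) auto
  qed
  have small: "\<exists>r0>0. \<forall>r\<le>r0. ?mod r p \<le> e" if G: "?G p" and e: "e > 0" for p and e :: real
  proof -
    from G \<theta>1 e obtain r0 where r0: "r0 > 0" "\<And>\<theta>. \<theta> \<in> K \<Longrightarrow> dist \<theta> \<theta>1 < r0 \<Longrightarrow> dist (\<phi> \<theta> p) (\<phi> \<theta>1 p) < e"
      unfolding continuous_on_iff by meson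
    have "?mod r p \<le> e" if "r \<le> r0" for r
    proof -
      have "S r p \<le> ennreal e"
        unfolding S_def
      proof (rule SUP_least)
        fix \<theta> assume "\<theta> \<in> D \<inter> ball \<theta>1 r"
        then have "\<theta> \<in> K" "dist \<theta> \<theta>1 < r0" using D that by (auto simp: dist_commute)
        from r0(2)[OF this] show "ennreal \<bar>\<phi> \<theta> p - \<phi> \<theta>1 p\<bar> \<le> ennreal e"
          by (intro ennreal_leI) (simp add: dist_real_def)
      qed
      then show ?thesis using e by (intro enn2real_leI) auto
    qed
    then show ?thesis using r0(1) by blast
  qed
  have bnd: "AE p in path_law. norm (?mod r p) \<le> 2 * env p" for r
    using good
  proof eventually_elim
    case (elim p)
    have "0 \<le> env p" using elim \<theta>1 by force
    then show ?case using S_le[OF elim, of r] by (simp add: enn2real_leI)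
  qed
  have int_mod: "integrable path_law (?mod r)" for r
  proof (rule Bochner_Integration.integrable_bound)
    show "integrable path_law (\<lambda>p. 2 * env p)" using env by simp
    show "?mod r \<in> borel_measurable path_law" unfolding mpl by (rule m)
    show "AE p in path_law. norm (?mod r p) \<le> norm (2 * env p)"
      using bnd[of r] by eventually_elim (simp add: abs_le_iff)
  qed
  have "(\<lambda>k. \<integral>p. ?mod (1 / real (Suc k)) p \<partial>path_law) \<longlonglongrightarrow> (\<integral>p. 0 \<partial>path_law)"
  proof (rule integral_dominated_convergence[where w = "\<lambda>p. 2 * env p"])
    show "AE p in path_law. (\<lambda>k. ?mod (1 / real (Suc k)) p) \<longlonglongrightarrow> 0"
      using good
    proof eventually_elim
      case (elim p)
      show ?case
      proof (rule LIMSEQ_I)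
        fix e :: real assume "e > 0"
        then have "e / 2 > 0" by simp
        from small[OF elim this] obtain r0 where r0: "r0 > 0" "\<And>r. r \<le> r0 \<Longrightarrow> ?mod r p \<le> e / 2" by blast
        have "\<forall>\<^sub>F k in sequentially. 1 / real (Suc k) < r0"
          by (rule order_tendstoD(2)[OF LIMSEQ_Suc[OF lim_1_over_n]]) (rule r0)
        then show "\<exists>no. \<forall>n\<ge>no. norm (?mod (1 / real (Suc n)) p - 0) < e"
          unfolding eventually_sequentially
        proof (elim exE, intro exI allI impI)
          fix no n :: nat
          assume "\<forall>k\<ge>no. 1 / real (Suc k) < r0" "n \<ge> no"
          then have "?mod (1 / real (Suc n)) p \<le> e / 2" by (intro r0(2) less_imp_le) blast
          then show "norm (?mod (1 / real (Suc n)) p - 0) < e" using \<open>e > 0\<close> by simp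
        qed
      qed
    qed
  next
    show "integrable path_law (\<lambda>p. 2 * env p)" using env by simp
    show "AE p in path_law. norm (?mod (1 / real (Suc k)) p) \<le> 2 * env p" for k by (rule bnd)
  qed (simp_all add: mpl m)
  then have "\<forall>\<^sub>F k in sequentially. (\<integral>p. ?mod (1 / real (Suc k)) p \<partial>path_law) < \<epsilon> / 2"
    by (intro order_tendstoD(2)) (use \<epsilon> in auto)
  \<comment> \<open>This fixes the radius. One half of \<epsilon> pays for the averaged oscillation,
    the other half for the average at \<theta>1.\<close>
  then obtain k where k: "(\<integral>p. ?mod (1 / real (Suc k)) p \<partial>path_law) < \<epsilon> / 2"
    by (auto simp: eventually_sequentially)
  let ?r = "1 / real (Suc k)"
  have int1: "integrable path_law (\<phi> \<theta>1)"
  proof (rule Bochner_Integration.integrable_bound[OF env])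
    show "\<phi> \<theta>1 \<in> borel_measurable path_law" unfolding mpl by (rule meas[OF \<theta>1])
    show "AE p in path_law. norm (\<phi> \<theta>1 p) \<le> norm (env p)"
      using good by eventually_elim (use \<theta>1 in force)
  qed
  show ?thesis
  proof (rule that)
    show "?r > 0" by simp
    show "AE \<omega> in M. \<forall>\<^sub>F n in sequentially. \<forall>\<theta>\<in>K \<inter> ball \<theta>1 ?r.
      \<bar>(\<Sum>t=1..n. \<phi> \<theta> (past X (int t) \<omega>)) / real n - (\<integral>p. \<phi> \<theta>1 p \<partial>path_law)\<bar> \<le> \<epsilon>"
      using AE_all_past[OF good] ergodic_average[OF int_mod[of ?r]] ergodic_average[OF int1]
    proof eventually_elim
      case (elim \<omega>)
      let ?p = "\<lambda>t. past X (int t) \<omega>"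
      let ?I = "\<integral>p. \<phi> \<theta>1 p \<partial>path_law"
      have "\<forall>\<^sub>F n in sequentially. (\<Sum>t=1..n. ?mod ?r (?p t)) / real n < \<epsilon> / 2"
        by (rule order_tendstoD(2)[OF elim(2) k])
      moreover have "\<forall>\<^sub>F n in sequentially. dist ((\<Sum>t=1..n. \<phi> \<theta>1 (?p t)) / real n) ?I < \<epsilon> / 2"
        by (rule tendstoD[OF elim(3)]) (use \<epsilon> in simp)
      ultimately show ?case
      proof eventually_elim
        case (elim n)
        show ?case
        proof
          fix \<theta> assume \<theta>: "\<theta> \<in> K \<inter> ball \<theta>1 ?r"
          have "\<bar>(\<Sum>t=1..n. \<phi> \<theta> (?p t)) / real n - (\<Sum>t=1..n. \<phi> \<theta>1 (?p t)) / real n\<bar>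
              = \<bar>\<Sum>t=1..n. \<phi> \<theta> (?p t) - \<phi> \<theta>1 (?p t)\<bar> / real n"
            by (simp add: sum_subtractf diff_divide_distrib[symmetric])
          also have "\<dots> \<le> (\<Sum>t=1..n. \<bar>\<phi> \<theta> (?p t) - \<phi> \<theta>1 (?p t)\<bar>) / real n"
            by (intro divide_right_mono sum_abs) simp
          also have "\<dots> \<le> (\<Sum>t=1..n. ?mod ?r (?p t)) / real n"
            using \<open>\<forall>t. ?G (past X t \<omega>)\<close> \<theta> by (intro divide_right_mono sum_mono mod_ge) auto
          finally show "\<bar>(\<Sum>t=1..n. \<phi> \<theta> (?p t)) / real n - ?I\<bar> \<le> \<epsilon>"
            using elim unfolding dist_real_def by linarith
        qed
      qed
    qed
  qed
qed

text \<open>If the coordinates from N on are replaced by values of norm at most U, a function with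
  Lipschitz weights b changes by no more than this quantity.\<close>

definition tail_weight :: "(nat \<Rightarrow> real) \<Rightarrow> real \<Rightarrow> nat \<Rightarrow> (nat \<Rightarrow> real^'m) \<Rightarrow> real" where
  "tail_weight b U N p = (\<Sum>j. (if N \<le> Suc j then b (Suc j) else 0) * (norm (p (Suc j)) + U))"

lemma tail_weight_measurable [measurable]: "tail_weight b U N \<in> borel_measurable seq_space"
  unfolding tail_weight_def by measurable

end

lemma suminf_tail_tendsto_0:
  fixes a :: "nat \<Rightarrow> real"
  assumes "summable a"
  shows "(\<lambda>N. \<Sum>j. if N \<le> Suc j then a j else 0) \<longlonglongrightarrow> 0"
proof -
  have "(\<Sum>j. if N \<le> Suc j then a j else 0) = suminf a - (\<Sum>j<N - 1. a j)" for N
  proof -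
    have "(\<lambda>j. if j \<in> {..<N - 1} then a j else 0) sums (\<Sum>j<N - 1. a j)"
      by (rule sums_If_finite_set) simp
    from sums_diff[OF summable_sums[OF assms] this]
    have "(\<lambda>j. a j - (if j \<in> {..<N - 1} then a j else 0)) sums (suminf a - (\<Sum>j<N - 1. a j))" .
    also have "(\<lambda>j. a j - (if j \<in> {..<N - 1} then a j else 0)) = (\<lambda>j. if N \<le> Suc j then a j else 0)"
      by (intro ext) auto
    finally show ?thesis by (rule sums_unique[symmetric])
  qed
  moreover have "(\<lambda>N. suminf a - (\<Sum>j<N - 1. a j)) \<longlonglongrightarrow> 0"
  proof (rule LIMSEQ_imp_Suc)
    have "(\<lambda>N. suminf a - (\<Sum>j<N. a j)) \<longlonglongrightarrow> suminf a - suminf a"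
      by (intro tendsto_intros summable_LIMSEQ assms)
    then show "(\<lambda>N. suminf a - (\<Sum>j<Suc N - 1. a j)) \<longlonglongrightarrow> 0" by simp
  qed
  ultimately show ?thesis by simp
qed

lemma integrable_mult_of_squares:
  fixes f g :: "'a \<Rightarrow> real"
  assumes [measurable]: "f \<in> borel_measurable M" "g \<in> borel_measurable M"
    and "integrable M (\<lambda>x. (f x)\<^sup>2)" "integrable M (\<lambda>x. (g x)\<^sup>2)"
  shows "integrable M (\<lambda>x. f x * g x)"
proof (rule Bochner_Integration.integrable_bound)
  show "integrable M (\<lambda>x. (f x)\<^sup>2 + (g x)\<^sup>2)" using assms by simp
  show "AE x in M. norm (f x * g x) \<le> norm ((f x)\<^sup>2 + (g x)\<^sup>2)"
  proof (rule AE_I2)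
    fix x
    have "2 * \<bar>f x * g x\<bar> \<le> (f x)\<^sup>2 + (g x)\<^sup>2"
      using sum_squares_bound[of "\<bar>f x\<bar>" "\<bar>g x\<bar>"] by (simp add: abs_mult)
    then show "norm (f x * g x) \<le> norm ((f x)\<^sup>2 + (g x)\<^sup>2)" by simp
  qed
qed measurable

text \<open>The paths on which the lag series with weights b converge. They have full measure under
  a second moment, and all pathwise estimates are made on them.\<close>

definition (in stationary_process) path_dom :: "(nat \<Rightarrow> real) \<Rightarrow> (nat \<Rightarrow> real^'m) set" where
  "path_dom b = {p. summable (\<lambda>j. b (Suc j) * norm (p (Suc j)))}"

locale square_integrable_process = stationary_process M X for M :: "'a measure" and X :: "int \<Rightarrow> 'a \<Rightarrow> real^'m::finite" +
  assumes X_square_integrable: "integrable M (\<lambda>\<omega>. (norm (X 0 \<omega>))\<^sup>2)"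
begin

sublocale path_law: prob_space path_law by (rule prob_space_path_law)

lemma measurable_path_law [simp]: "measurable path_law N = measurable seq_space N"
  by (rule measurable_cong_sets[OF sets_path_law refl])

lemma integrable_path_component: "integrable path_law (\<lambda>p. (norm (p j))\<^sup>2)"
  and integral_path_component: "(\<integral>p. (norm (p j))\<^sup>2 \<partial>path_law) = (\<integral>\<omega>. (norm (X 0 \<omega>))\<^sup>2 \<partial>M)"
proof -
  have m: "(\<lambda>p. (norm (p i))\<^sup>2) \<in> borel_measurable seq_space" for i :: nat by measurable
  have *: "past X (int j) \<omega> j = X 0 \<omega>" for \<omega> by (simp add: past_def)
  show "integrable path_law (\<lambda>p. (norm (p j))\<^sup>2)"
    using integrable_past_iff[OF m[of j], of "int j"] X_square_integrable by (simp add: *)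
  show "(\<integral>p. (norm (p j))\<^sup>2 \<partial>path_law) = (\<integral>\<omega>. (norm (X 0 \<omega>))\<^sup>2 \<partial>M)"
    using integral_past[OF m[of j], of "int j"] by (simp add: *)
qed

definition moment_bound :: "real \<Rightarrow> real" where
  "moment_bound U = 2 * (\<integral>\<omega>. (norm (X 0 \<omega>))\<^sup>2 \<partial>M) + 2 * U\<^sup>2"

lemma shifted_component_square:
  "integrable path_law (\<lambda>p. (norm (p j) + U)\<^sup>2)"
  "(\<integral>p. (norm (p j) + U)\<^sup>2 \<partial>path_law) \<le> moment_bound U"
proof -
  have le: "(norm (p j) + U)\<^sup>2 \<le> 2 * (norm (p j))\<^sup>2 + 2 * U\<^sup>2" for p :: "nat \<Rightarrow> real^'m"
    using sum_squares_bound[of "norm (p j)" U] by (simp add: power2_sum)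
  have i: "integrable path_law (\<lambda>p. 2 * (norm (p j))\<^sup>2 + 2 * U\<^sup>2)"
    using integrable_path_component by simp
  show 1: "integrable path_law (\<lambda>p. (norm (p j) + U)\<^sup>2)"
    by (rule Bochner_Integration.integrable_bound[OF i]) (auto intro!: AE_I2 order_trans[OF le])
  have "(\<integral>p. (norm (p j) + U)\<^sup>2 \<partial>path_law) \<le> (\<integral>p. 2 * (norm (p j))\<^sup>2 + 2 * U\<^sup>2 \<partial>path_law)"
    by (rule integral_mono[OF 1 i]) (rule le)
  also have "\<dots> = moment_bound U"
    using integrable_path_component by (simp add: moment_bound_def integral_path_component path_law.prob_space)
  finally show "(\<integral>p. (norm (p j) + U)\<^sup>2 \<partial>path_law) \<le> moment_bound U" .
qed

context
  fixes b :: "nat \<Rightarrow> real" and U :: real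
  assumes b_nonneg: "\<And>j. b j \<ge> 0" and b_summable: "summable (\<lambda>j. b (Suc j))" and U: "U \<ge> 0"
begin

lemma summable_tail: "summable (\<lambda>j. if N \<le> Suc j then b (Suc j) else 0)"
  by (rule summable_comparison_test'[OF b_summable, of 0]) (simp add: b_nonneg)

lemma tail_weight_L2:
  "integrable path_law (\<lambda>p. (tail_weight b U N p)\<^sup>2)"
  "(\<integral>p. (tail_weight b U N p)\<^sup>2 \<partial>path_law) \<le> (\<Sum>j. if N \<le> Suc j then b (Suc j) else 0)\<^sup>2 * moment_bound U"
  unfolding tail_weight_def
  by (rule weighted_series_square_integrable[of "\<lambda>j p. norm (p (Suc j)) + U", OF _ _ shifted_component_square];
      use U b_nonneg summable_tail in simp)+

lemma AE_path_dom: "AE p in path_law. p \<in> path_dom b"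
proof -
  have "AE p in path_law. summable (\<lambda>j. b (Suc j) * (norm (p (Suc j)) + 0))"
    by (rule weighted_series_square_integrable(1)[of "\<lambda>j p. norm (p (Suc j)) + 0", OF _ _ shifted_component_square];
      use b_nonneg b_summable in simp)
  then show ?thesis by (simp add: path_dom_def)
qed

lemma summable_tail_weight:
  assumes "p \<in> path_dom b"
  shows "summable (\<lambda>j. (if N \<le> Suc j then b (Suc j) else 0) * (norm (p (Suc j)) + U))"
proof (rule summable_comparison_test')
  show "summable (\<lambda>j. b (Suc j) * norm (p (Suc j)) + b (Suc j) * U)"
    using assms unfolding path_dom_def by (intro summable_add summable_mult2 b_summable) simp
qed (use U b_nonneg in \<open>simp add: distrib_left\<close>)

lemma tail_weight_nonneg: "p \<in> path_dom b \<Longrightarrow> tail_weight b U N p \<ge> 0"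
  unfolding tail_weight_def by (intro suminf_nonneg summable_tail_weight) (use U b_nonneg in auto)

lemma tail_weight_antimono:
  "p \<in> path_dom b \<Longrightarrow> N \<le> N' \<Longrightarrow> tail_weight b U N' p \<le> tail_weight b U N p"
  unfolding tail_weight_def by (intro suminf_le summable_tail_weight) (use U b_nonneg in auto)

lemma tail_weight_tendsto_0:
  assumes "p \<in> path_dom b"
  shows "(\<lambda>N. tail_weight b U N p) \<longlonglongrightarrow> 0"
proof -
  have "(\<lambda>N. \<Sum>j. if N \<le> Suc j then b (Suc j) * (norm (p (Suc j)) + U) else 0) \<longlonglongrightarrow> 0"
    by (rule suminf_tail_tendsto_0) (use summable_tail_weight[OF assms, of 0] in simp)
  then show ?thesis unfolding tail_weight_def by (simp add: if_distrib[of "\<lambda>z. z * _"] cong: if_cong)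
qed

text \<open>The index of the tail moves with t, so the ergodic theorem does not apply directly. It
  does for each fixed level N, with a limit that vanishes as N grows; by monotonicity one level
  dominates all later t.\<close>

lemma average_tail_weight_tendsto_0:
  assumes [measurable]: "e \<in> borel_measurable seq_space" and e: "\<And>p. e p \<ge> 0"
    and e2: "integrable path_law (\<lambda>p. (e p)\<^sup>2)"
  shows "AE \<omega> in M. (\<lambda>n. (\<Sum>t=1..n. e (past X (int t) \<omega>) * tail_weight b U t (past X (int t) \<omega>)) / real n) \<longlonglongrightarrow> 0"
proof -
  let ?h = "\<lambda>N p. e p * tail_weight b U N p"
  have int: "integrable path_law (?h N)" for N
    by (intro integrable_mult_of_squares tail_weight_L2 e2) simp_all
  have "(\<lambda>N. \<integral>p. ?h N p \<partial>path_law) \<longlonglongrightarrow> (\<integral>p. 0 \<partial>path_law)"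
  proof (rule integral_dominated_convergence[where w = "?h 0"])
    show "AE p in path_law. (\<lambda>N. ?h N p) \<longlonglongrightarrow> 0"
      using AE_path_dom by eventually_elim (auto intro!: tendsto_mult_right_zero tail_weight_tendsto_0)
    show "AE p in path_law. norm (?h N p) \<le> ?h 0 p" for N
      using AE_path_dom by eventually_elim (auto simp: e tail_weight_nonneg abs_mult intro!: mult_left_mono tail_weight_antimono)
  qed (simp_all add: int)
  then have lim: "(\<lambda>N. \<integral>p. ?h N p \<partial>path_law) \<longlonglongrightarrow> 0" by simp
  have "AE \<omega> in M. \<forall>N. (\<lambda>n. (\<Sum>t=1..n. ?h N (past X (int t) \<omega>)) / real n) \<longlonglongrightarrow> (\<integral>p. ?h N p \<partial>path_law)"
    unfolding AE_all_countable by (intro allI ergodic_average int)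
  with AE_all_past[OF AE_path_dom] show ?thesis
  proof eventually_elim
    case (elim \<omega>)
    let ?p = "\<lambda>t. past X (int t) \<omega>"
    have nn: "0 \<le> ?h N (?p t)" for N t using elim(1) by (simp add: e tail_weight_nonneg)
    show ?case
    proof (rule LIMSEQ_I)
      fix r :: real assume r: "r > 0"
      then have "\<forall>\<^sub>F N in sequentially. (\<integral>p. ?h N p \<partial>path_law) < r / 2"
        by (intro order_tendstoD(2)[OF lim]) simp
      then obtain N where N: "(\<integral>p. ?h N p \<partial>path_law) < r / 2" by (auto simp: eventually_sequentially)
      define C where "C = (\<Sum>t=1..N. ?h t (?p t))"
      have "(\<lambda>n. C / real n) \<longlonglongrightarrow> 0" by real_asymp
      then have "\<forall>\<^sub>F n in sequentially. C / real n < r / 2" by (rule order_tendstoD) (use r in simp)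
      moreover have "\<forall>\<^sub>F n in sequentially. (\<Sum>t=1..n. ?h N (?p t)) / real n < r / 2"
        using elim(2) N by (intro order_tendstoD(2)) auto
      ultimately have "\<forall>\<^sub>F n in sequentially. norm ((\<Sum>t=1..n. ?h t (?p t)) / real n - 0) < r"
      proof eventually_elim
        case (elim n)
        \<comment> \<open>The terms with t <= N are paid for in full by the constant
          \<open>C\<close>, the remaining ones are dominated by the tail at level N.\<close>
        have "(\<Sum>t=1..n. ?h t (?p t)) \<le> (\<Sum>t=1..n. (if t \<in> {1..N} then ?h t (?p t) else 0) + ?h N (?p t))"
          using \<open>\<forall>t. past X t \<omega> \<in> path_dom b\<close> nn
          by (intro sum_mono) (auto intro!: mult_left_mono tail_weight_antimono e)
        also have "\<dots> = (\<Sum>t\<in>{1..n} \<inter> {1..N}. ?h t (?p t)) + (\<Sum>t=1..n. ?h N (?p t))"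
          by (simp only: sum.distrib sum.inter_restrict[symmetric] finite_atLeastAtMost)
        also have "\<dots> \<le> C + (\<Sum>t=1..n. ?h N (?p t))"
          unfolding C_def by (intro add_right_mono sum_mono2) (use nn in auto)
        finally have "(\<Sum>t=1..n. ?h t (?p t)) / real n \<le> C / real n + (\<Sum>t=1..n. ?h N (?p t)) / real n"
          unfolding add_divide_distrib[symmetric] by (rule divide_right_mono) simp
        moreover have "0 \<le> (\<Sum>t=1..n. ?h t (?p t)) / real n" by (intro divide_nonneg_nonneg sum_nonneg nn) simp
        ultimately show ?case
          using elim unfolding real_norm_def diff_zero by (subst abs_of_nonneg) linarith+
      qed
      then show "\<exists>no. \<forall>n\<ge>no. norm ((\<Sum>t=1..n. ?h t (?p t)) / real n - 0) < r"
        by (simp add: eventually_sequentially)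
    qed
  qed
qed

end

end

section \<open>A central limit theorem for martingale differences\<close>

lemma exp_minus_bounds:
  fixes y :: real assumes "0 \<le> y"
  shows "\<bar>exp (- y) - (1 - y)\<bar> \<le> y\<^sup>2"
proof -
  have 1: "1 - y \<le> exp (- y)" using exp_ge_add_one_self[of "- y"] by simp
  have "exp (- y) \<le> 1 / (1 + y)"
    using exp_ge_add_one_self[of y] assms by (simp add: exp_minus field_simps)
  also have "\<dots> \<le> 1 - y + y\<^sup>2"
  proof -
    have "(1 - y + y\<^sup>2) * (1 + y) = 1 + y ^ 3"
      by (simp add: algebra_simps power2_eq_square power3_eq_cube)
    then have "1 \<le> (1 - y + y\<^sup>2) * (1 + y)" using assms by simp
    then show ?thesis using assms by (simp add: pos_divide_le_eq)
  qed
  finally show ?thesis using 1 by simp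
qed

text \<open>The elementary estimate behind McLeish's method. The modulus is at most 1 because 1 +
  x^2 <= exp (x^2), and the quadratic terms of both expansions agree, which leaves a cubic
  error.\<close>

lemma iexp_product_approx:
  "cmod (iexp x - (1 + \<i> * of_real x) * of_real (exp (- x\<^sup>2 / 2))) \<le> 2 * \<bar>x\<bar> ^ 3"
  and iexp_factor_le_1: "cmod ((1 + \<i> * of_real x) * of_real (exp (- x\<^sup>2 / 2))) \<le> 1"
proof -
  let ?r = "exp (- x\<^sup>2 / 2) - (1 - x\<^sup>2 / 2)"
  have n1: "cmod (1 + \<i> * of_real x) = sqrt (1 + x\<^sup>2)" by (simp add: cmod_def)
  have "1 + x\<^sup>2 \<le> exp (x\<^sup>2)" by (rule exp_ge_add_one_self)
  also have "exp (x\<^sup>2) = (exp (x\<^sup>2 / 2))\<^sup>2" by (simp add: exp_double[symmetric])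
  finally have "sqrt (1 + x\<^sup>2) \<le> exp (x\<^sup>2 / 2)" by (intro real_le_lsqrt) auto
  then have "sqrt (1 + x\<^sup>2) * exp (- x\<^sup>2 / 2) \<le> exp (x\<^sup>2 / 2) * exp (- x\<^sup>2 / 2)"
    by (rule mult_right_mono) simp
  also have "\<dots> = 1" by (simp add: exp_add[symmetric])
  finally show le1: "cmod ((1 + \<i> * of_real x) * of_real (exp (- x\<^sup>2 / 2))) \<le> 1"
    by (simp only: norm_mult n1 norm_of_real abs_exp_cancel)
  show "cmod (iexp x - (1 + \<i> * of_real x) * of_real (exp (- x\<^sup>2 / 2))) \<le> 2 * \<bar>x\<bar> ^ 3"
  \<comment> \<open>Taylor expansion is used only for small x; otherwise both numbers lie in the
    closed unit disc and their distance 2 is below the cubic bound.\<close>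
  proof (cases "\<bar>x\<bar> \<le> 1")
    case True
    have A: "cmod (iexp x - (\<Sum>k\<le>2. (\<i> * of_real x) ^ k / fact k)) \<le> \<bar>x\<bar> ^ 3 / 6"
      using iexp_approx1[of x 2] by (simp add: fact_numeral numeral_3_eq_3)
    have "(\<Sum>k\<le>2. (\<i> * of_real x) ^ k / fact k) = 1 + \<i> * of_real x - of_real (x\<^sup>2 / 2)"
      by (simp add: numeral_2_eq_2 complex_eq_iff power2_eq_square)
    then have "iexp x - (1 + \<i> * of_real x) * of_real (exp (- x\<^sup>2 / 2)) =
      (iexp x - (\<Sum>k\<le>2. (\<i> * of_real x) ^ k / fact k)) + (\<i> * of_real (x ^ 3 / 2) - (1 + \<i> * of_real x) * of_real ?r)"
      by (simp only:) (simp add: field_simps power2_eq_square power3_eq_cube)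
    also have "cmod \<dots> \<le> \<bar>x\<bar> ^ 3 / 6 + (cmod (\<i> * of_real (x ^ 3 / 2)) + cmod ((1 + \<i> * of_real x) * of_real ?r))"
      by (intro norm_triangle_le add_mono A norm_triangle_le_diff order_refl)
    also have "cmod (\<i> * of_real (x ^ 3 / 2)) = \<bar>x\<bar> ^ 3 / 2"
      by (simp add: norm_mult norm_power)
    also have "cmod ((1 + \<i> * of_real x) * of_real ?r) \<le> 2 * (\<bar>x\<bar> ^ 3 / 4)"
    proof -
      have "cmod (1 + \<i> * of_real x) \<le> 1 + \<bar>x\<bar>"
        by (rule order_trans[OF norm_triangle_ineq]) (simp add: norm_mult)
      then have a: "cmod (1 + \<i> * of_real x) \<le> 2" using True by simp
      have "\<bar>?r\<bar> \<le> (x\<^sup>2 / 2)\<^sup>2" using exp_minus_bounds[of "x\<^sup>2 / 2"] by simp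
      also have "\<dots> = \<bar>x\<bar> ^ 3 * \<bar>x\<bar> / 4" by (simp add: power_divide power2_eq_square power3_eq_cube)
      also have "\<dots> \<le> \<bar>x\<bar> ^ 3 / 4" using mult_left_mono[OF True, of "\<bar>x\<bar> ^ 3"] by simp
      finally have b: "\<bar>?r\<bar> \<le> \<bar>x\<bar> ^ 3 / 4" .
      show ?thesis unfolding norm_mult norm_of_real by (intro mult_mono a b) auto
    qed
    also have "\<bar>x\<bar> ^ 3 / 6 + (\<bar>x\<bar> ^ 3 / 2 + 2 * (\<bar>x\<bar> ^ 3 / 4)) \<le> 2 * \<bar>x\<bar> ^ 3"
      using zero_le_power[of "\<bar>x\<bar>" 3] by simp
    finally show ?thesis by simp
  next
    case False
    have "cmod (iexp x - (1 + \<i> * of_real x) * of_real (exp (- x\<^sup>2 / 2))) \<le> 1 + 1"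
      by (intro order_trans[OF norm_triangle_ineq4] add_mono le1) simp
    also have "\<dots> \<le> 2 * \<bar>x\<bar> ^ 3" using one_le_power[of "\<bar>x\<bar>" 3] False by simp
    finally show ?thesis .
  qed
qed

text \<open>Read off from the nonnegativity of the variance of the absolute value.\<close>

lemma (in prob_space) expectation_abs_le_sqrt:
  fixes Y :: "'a \<Rightarrow> real"
  assumes [measurable]: "Y \<in> borel_measurable M" and Y2: "integrable M (\<lambda>x. (Y x)\<^sup>2)"
  shows "integrable M Y" "expectation (\<lambda>x. \<bar>Y x\<bar>) \<le> sqrt (expectation (\<lambda>x. (Y x)\<^sup>2))"
proof -
  show i: "integrable M Y" by (rule square_integrable_imp_integrable[OF _ Y2]) simp
  have "0 \<le> variance (\<lambda>x. \<bar>Y x\<bar>)" by (rule variance_positive)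
  also have "\<dots> = expectation (\<lambda>x. \<bar>Y x\<bar>\<^sup>2) - (expectation (\<lambda>x. \<bar>Y x\<bar>))\<^sup>2"
    using i Y2 by (intro variance_eq) auto
  finally show "expectation (\<lambda>x. \<bar>Y x\<bar>) \<le> sqrt (expectation (\<lambda>x. (Y x)\<^sup>2))"
    by (intro real_le_rsqrt) simp
qed

lemma square_le_of_abs_le: "\<bar>x\<bar> \<le> B \<Longrightarrow> x\<^sup>2 \<le> B\<^sup>2" for x B :: real
  by (metis abs_ge_zero power2_abs power_mono)

lemma iexp_Lipschitz: "cmod (iexp x - iexp y) \<le> \<bar>x - y\<bar>"
proof -
  have "iexp x - iexp y = iexp y * (iexp (x - y) - 1)"
    by (simp add: right_diff_distrib exp_add[symmetric] algebra_simps)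
  also have "cmod \<dots> = cmod (iexp (x - y) - 1)" by (simp add: norm_mult)
  also have "\<dots> \<le> \<bar>x - y\<bar>" using iexp_approx1[of "x - y" 0] by simp
  finally show ?thesis .
qed

section \<open>Martingale differences as functions on path space, and McLeish's central limit
  theorem for them\<close>

context square_integrable_process
begin

text \<open>Vanishing conditional expectation given the strict past, encoded as orthogonality to
  every square integrable function of the shifted path.\<close>

definition martingale_difference :: "((nat \<Rightarrow> real^'m) \<Rightarrow> real) \<Rightarrow> bool" where
  "martingale_difference d \<longleftrightarrow> d \<in> borel_measurable seq_space \<and> integrable path_law (\<lambda>p. (d p)\<^sup>2) \<and>
     (\<forall>w \<in> borel_measurable seq_space. integrable path_law (\<lambda>p. (w p)\<^sup>2) \<longrightarrow>
        (\<integral>p. d p * w (\<lambda>j. p (Suc j)) \<partial>path_law) = 0)"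

lemma shift_measurable [measurable]: "(\<lambda>p j. p (j + k)) \<in> measurable seq_space seq_space"
  by (rule measurable_PiM_single') (auto intro!: measurable_component_singleton)

lemma Suc_shift_measurable [measurable]: "(\<lambda>p j. p (Suc j)) \<in> measurable seq_space seq_space"
  by (rule measurable_PiM_single') (auto intro!: measurable_component_singleton)

lemma past_shift: "past X t \<omega> (j + k) = past X (t - int k) \<omega> j"
  by (simp add: past_def algebra_simps)

lemma martingale_differenceD:
  assumes d: "martingale_difference d"
  shows "d \<in> borel_measurable seq_space" "integrable path_law (\<lambda>p. (d p)\<^sup>2)"
    and "\<And>w. w \<in> borel_measurable seq_space \<Longrightarrow> integrable path_law (\<lambda>p. (w p)\<^sup>2) \<Longrightarrow>
      (\<integral>\<omega>. d (past X t \<omega>) * w (past X (t - 1) \<omega>) \<partial>M) = 0"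
    and "\<And>w. w \<in> borel_measurable seq_space \<Longrightarrow> integrable path_law (\<lambda>p. (w p)\<^sup>2) \<Longrightarrow>
      integrable M (\<lambda>\<omega>. d (past X t \<omega>) * w (past X (t - 1) \<omega>))"
proof -
  show dm [measurable]: "d \<in> borel_measurable seq_space" and d2: "integrable path_law (\<lambda>p. (d p)\<^sup>2)"
    using d by (auto simp: martingale_difference_def)
  fix w :: "(nat \<Rightarrow> real^'m) \<Rightarrow> real"
  assume [measurable]: "w \<in> borel_measurable seq_space" and w2: "integrable path_law (\<lambda>p. (w p)\<^sup>2)"
  have "(\<integral>\<omega>. d (past X t \<omega>) * w (past X (t - 1) \<omega>) \<partial>M) = (\<integral>\<omega>. (\<lambda>p. d p * w (\<lambda>j. p (j + 1))) (past X t \<omega>) \<partial>M)"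
    using past_shift[of t _ _ 1] by simp
  also have "\<dots> = (\<integral>p. d p * w (\<lambda>j. p (j + 1)) \<partial>path_law)" by (rule integral_past) measurable
  also have "\<dots> = 0" using d w2 by (simp add: martingale_difference_def)
  finally show "(\<integral>\<omega>. d (past X t \<omega>) * w (past X (t - 1) \<omega>) \<partial>M) = 0" .
  show "integrable M (\<lambda>\<omega>. d (past X t \<omega>) * w (past X (t - 1) \<omega>))"
    by (intro integrable_mult_of_squares integrable_past[OF d2] integrable_past[OF w2])
      (auto intro: measurable_compose[OF past_measurable])
qed

lemma martingale_difference_diff:
  assumes "martingale_difference d" "martingale_difference d'"
  shows "martingale_difference (\<lambda>p. d p - d' p)"
  unfolding martingale_difference_def
proof (intro conjI ballI impI)
  note [measurable] = martingale_differenceD(1)[OF assms(1)] martingale_differenceD(1)[OF assms(2)]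
  note sq = martingale_differenceD(2)[OF assms(1)] martingale_differenceD(2)[OF assms(2)]
  show "(\<lambda>p. d p - d' p) \<in> borel_measurable seq_space" by measurable
  have "integrable path_law (\<lambda>p. d p * d' p)"
    by (intro integrable_mult_of_squares sq) simp_all
  then show "integrable path_law (\<lambda>p. (d p - d' p)\<^sup>2)"
    using sq by (simp add: power2_diff mult.assoc)
  fix w :: "(nat \<Rightarrow> real^'m) \<Rightarrow> real"
  assume [measurable]: "w \<in> borel_measurable seq_space" and w2: "integrable path_law (\<lambda>p. (w p)\<^sup>2)"
  let ?w = "\<lambda>p. w (\<lambda>j. p (Suc j))"
  have wm: "(\<lambda>p. (w p)\<^sup>2) \<in> borel_measurable seq_space" "(\<lambda>p. (?w p)\<^sup>2) \<in> borel_measurable seq_space" by measurable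
  have "integrable path_law (\<lambda>p. (?w p)\<^sup>2)"
    using integrable_past[OF w2, of 0] integrable_past_iff[OF wm(2), of 1] past_shift[of 1 _ _ 1] by simp
  then have "integrable path_law (\<lambda>p. d p * ?w p)" "integrable path_law (\<lambda>p. d' p * ?w p)"
    by (intro integrable_mult_of_squares sq; simp)+
  moreover have "(\<integral>p. d p * ?w p \<partial>path_law) = 0" "(\<integral>p. d' p * ?w p \<partial>path_law) = 0"
    using assms w2 by (auto simp: martingale_difference_def)
  ultimately show "(\<integral>p. (d p - d' p) * ?w p \<partial>path_law) = 0"
    by (simp add: left_diff_distrib)
qed

text \<open>All values up to time n are contained in the past at time n, so a partial sum may serve
  as test function against the increment at time n + 1.\<close>

lemma partial_sum_as_function_of_past:
  "(\<Sum>t=1..n. d (past X (int t) \<omega>)) = (\<Sum>t=1..n. d (\<lambda>j. past X (int n) \<omega> (j + (n - t))))"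
  by (intro sum.cong refl arg_cong[where f = d] ext) (simp add: past_def of_nat_diff)

text \<open>Pythagoras: each new increment is orthogonal to the sum before it. The exact factor n
  makes later error bounds uniform in n after normalisation.\<close>

lemma martingale_sum_square:
  assumes d: "martingale_difference d"
  shows "integrable M (\<lambda>\<omega>. (\<Sum>t=1..n. d (past X (int t) \<omega>))\<^sup>2)"
    "(\<integral>\<omega>. (\<Sum>t=1..n. d (past X (int t) \<omega>))\<^sup>2 \<partial>M) = real n * (\<integral>p. (d p)\<^sup>2 \<partial>path_law)"
proof (induction n)
  case (Suc n)
  note dm [measurable] = martingale_differenceD(1)[OF d]
  define W where "W p = (\<Sum>t=1..n. d (\<lambda>j. p (j + (n - t))))" for p
  have [measurable]: "W \<in> borel_measurable seq_space" unfolding W_def by measurable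
  have W: "(\<Sum>t=1..n. d (past X (int t) \<omega>)) = W (past X (int n) \<omega>)" for \<omega>
    unfolding W_def by (rule partial_sum_as_function_of_past)
  have W2: "integrable path_law (\<lambda>p. (W p)\<^sup>2)"
    using Suc(1) integrable_past_iff[of "\<lambda>p. (W p)\<^sup>2" "int n"] by (simp only: W) simp
  have d2: "integrable path_law (\<lambda>p. (d p)\<^sup>2)" by (rule martingale_differenceD[OF d])
  have d2': "(\<integral>\<omega>. (d (past X (int (Suc n)) \<omega>))\<^sup>2 \<partial>M) = (\<integral>p. (d p)\<^sup>2 \<partial>path_law)"
    by (rule integral_past[of "\<lambda>p. (d p)\<^sup>2"]) measurable
  have o: "integrable M (\<lambda>\<omega>. d (past X (int (Suc n)) \<omega>) * W (past X (int n) \<omega>))"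
    "(\<integral>\<omega>. d (past X (int (Suc n)) \<omega>) * W (past X (int n) \<omega>) \<partial>M) = 0"
    using martingale_differenceD(3,4)[OF d _ W2, of "int (Suc n)"] by simp_all
  have eq: "(\<Sum>t=1..Suc n. d (past X (int t) \<omega>))\<^sup>2 = (W (past X (int n) \<omega>))\<^sup>2 +
    ((d (past X (int (Suc n)) \<omega>))\<^sup>2 + 2 * (d (past X (int (Suc n)) \<omega>) * W (past X (int n) \<omega>)))" for \<omega>
    unfolding W[symmetric] by (simp add: power2_sum)
  note i = integrable_past[OF W2, of "int n"] integrable_past[OF d2, of "int (Suc n)"] o(1)
  show "integrable M (\<lambda>\<omega>. (\<Sum>t=1..Suc n. d (past X (int t) \<omega>))\<^sup>2)"
    unfolding eq using i by (intro Bochner_Integration.integrable_add integrable_mult_right) auto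
  have "(\<integral>\<omega>. (\<Sum>t=1..Suc n. d (past X (int t) \<omega>))\<^sup>2 \<partial>M) = (\<integral>\<omega>. (W (past X (int n) \<omega>))\<^sup>2 \<partial>M) +
    ((\<integral>\<omega>. (d (past X (int (Suc n)) \<omega>))\<^sup>2 \<partial>M) + 2 * (\<integral>\<omega>. d (past X (int (Suc n)) \<omega>) * W (past X (int n) \<omega>) \<partial>M))"
    unfolding eq using i by (simp del: of_nat_Suc)
  also have "(\<integral>\<omega>. (W (past X (int n) \<omega>))\<^sup>2 \<partial>M) = real n * (\<integral>p. (d p)\<^sup>2 \<partial>path_law)"
    using Suc(2) by (simp only: W)
  finally show "(\<integral>\<omega>. (\<Sum>t=1..Suc n. d (past X (int t) \<omega>))\<^sup>2 \<partial>M) = real (Suc n) * (\<integral>p. (d p)\<^sup>2 \<partial>path_law)"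
    unfolding d2' o(2) by (simp add: distrib_right)
qed simp_all

text \<open>Boundedness of d makes the product up to n bounded, so its real and imaginary parts are
  admissible test functions, and the term that is linear in the next increment integrates to
  0.\<close>

lemma martingale_product_expectation:
  assumes d: "martingale_difference d" and bnd: "\<And>p. \<bar>d p\<bar> \<le> B"
  shows "(\<integral>\<omega>. (\<Prod>t=1..n. 1 + \<i> * of_real (s * d (past X (int t) \<omega>))) \<partial>M) = 1"
proof (induction n)
  case (Suc n)
  note dm [measurable] = martingale_differenceD(1)[OF d]
  define W where "W p = (\<Prod>t=1..n. 1 + \<i> * of_real (s * d (\<lambda>j. p (j + (n - t)))))" for p
  have [measurable]: "W \<in> borel_measurable seq_space" unfolding W_def by measurable
  have W: "(\<Prod>t=1..n. 1 + \<i> * of_real (s * d (past X (int t) \<omega>))) = W (past X (int n) \<omega>)" for \<omega>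
    unfolding W_def
    by (intro prod.cong refl arg_cong[where f = "\<lambda>z. 1 + \<i> * of_real (s * d z)"] ext)
       (simp add: past_def of_nat_diff)
  have Wb: "cmod (W p) \<le> (1 + \<bar>s\<bar> * B) ^ n" for p
  proof -
    have "cmod (W p) \<le> (\<Prod>t=1..n. 1 + \<bar>s\<bar> * B)"
      unfolding W_def prod_norm[symmetric]
    proof (intro prod_mono conjI norm_ge_zero)
      fix t
      have "cmod (1 + \<i> * of_real (s * d (\<lambda>j. p (j + (n - t))))) \<le> 1 + \<bar>s * d (\<lambda>j. p (j + (n - t)))\<bar>"
        by (rule order_trans[OF norm_triangle_ineq]) (simp add: norm_mult)
      also have "\<dots> \<le> 1 + \<bar>s\<bar> * B" unfolding abs_mult by (intro add_mono mult_left_mono bnd) auto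
      finally show "cmod (1 + \<i> * of_real (s * d (\<lambda>j. p (j + (n - t))))) \<le> 1 + \<bar>s\<bar> * B" .
    qed
    then show ?thesis by simp
  qed
  have Re2: "integrable path_law (\<lambda>p. (Re (W p))\<^sup>2)"
    by (rule path_law.integrable_const_bound[where B = "((1 + \<bar>s\<bar> * B) ^ n)\<^sup>2"])
       (auto intro!: AE_I2 square_le_of_abs_le order_trans[OF abs_Re_le_cmod Wb])
  have Im2: "integrable path_law (\<lambda>p. (Im (W p))\<^sup>2)"
    by (rule path_law.integrable_const_bound[where B = "((1 + \<bar>s\<bar> * B) ^ n)\<^sup>2"])
       (auto intro!: AE_I2 square_le_of_abs_le order_trans[OF abs_Im_le_cmod Wb])
  let ?D = "\<lambda>\<omega>. d (past X (int (Suc n)) \<omega>)" and ?V = "\<lambda>\<omega>. W (past X (int n) \<omega>)"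
  have o: "integrable M (\<lambda>\<omega>. ?D \<omega> * Re (?V \<omega>))" "(\<integral>\<omega>. ?D \<omega> * Re (?V \<omega>) \<partial>M) = 0"
    "integrable M (\<lambda>\<omega>. ?D \<omega> * Im (?V \<omega>))" "(\<integral>\<omega>. ?D \<omega> * Im (?V \<omega>) \<partial>M) = 0"
    using martingale_differenceD(3,4)[OF d _ Re2, of "int (Suc n)"]
      martingale_differenceD(3,4)[OF d _ Im2, of "int (Suc n)"] by simp_all
  have iD: "integrable M (\<lambda>\<omega>. complex_of_real (?D \<omega> * Re (?V \<omega>)))" "integrable M (\<lambda>\<omega>. complex_of_real (?D \<omega> * Im (?V \<omega>)))"
    using o(1,3) by (auto simp only: complex_of_real_integrable_eq)
  have iV: "integrable M ?V"
    by (rule integrable_const_bound[where B = "(1 + \<bar>s\<bar> * B) ^ n"])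
      (auto intro!: AE_I2 Wb intro: measurable_compose[OF past_measurable])
  have "(\<Prod>t=1..Suc n. 1 + \<i> * of_real (s * d (past X (int t) \<omega>))) = ?V \<omega> +
     (\<i> * of_real s) * (of_real (?D \<omega> * Re (?V \<omega>)) + \<i> * of_real (?D \<omega> * Im (?V \<omega>)))" for \<omega>
  proof -
    have "(\<Prod>t=1..Suc n. 1 + \<i> * of_real (s * d (past X (int t) \<omega>))) = ?V \<omega> * (1 + \<i> * of_real (s * ?D \<omega>))"
      unfolding W[symmetric] by simp
    also have "\<dots> = ?V \<omega> + (\<i> * of_real s) * (of_real (?D \<omega> * Re (?V \<omega>)) + \<i> * of_real (?D \<omega> * Im (?V \<omega>)))"
      by (simp add: complex_eq_iff algebra_simps)
    finally show ?thesis .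
  qed
  then have "(\<integral>\<omega>. (\<Prod>t=1..Suc n. 1 + \<i> * of_real (s * d (past X (int t) \<omega>))) \<partial>M) =
      (\<integral>\<omega>. ?V \<omega> \<partial>M) + (\<i> * of_real s) * (of_real (\<integral>\<omega>. ?D \<omega> * Re (?V \<omega>) \<partial>M) + \<i> * of_real (\<integral>\<omega>. ?D \<omega> * Im (?V \<omega>) \<partial>M))"
    using iV iD by (simp del: of_nat_Suc of_real_mult)
  also have "\<dots> = 1" using Suc unfolding W o(2,4) by simp
  finally show ?case .
qed (simp add: prob_space)

text \<open>The exponential of the normalised sum is, up to O(1 / sqrt n), the product
  \<open>T\<close> of the factors 1 + ix times exp (- Q / 2), where \<open>Q\<close> is the sum of
  squares. \<open>T\<close> has expectation 1 and \<open>Q\<close> has a deterministic limit by the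
  ergodic theorem.\<close>

lemma bounded_martingale_clt:
  assumes d: "martingale_difference d" and bnd: "\<And>p. \<bar>d p\<bar> \<le> B"
  shows "(\<lambda>n. \<integral>\<omega>. iexp (s * ((\<Sum>t=1..n. d (past X (int t) \<omega>)) / sqrt (real n))) \<partial>M)
    \<longlonglongrightarrow> of_real (exp (- (s\<^sup>2 * (\<integral>p. (d p)\<^sup>2 \<partial>path_law)) / 2))"
proof -
  note dm [measurable] = martingale_differenceD(1)[OF d] measurable_compose[OF past_measurable martingale_differenceD(1)[OF d]]
  note d2 = martingale_differenceD(2)[OF d]
  define v where "v = (\<integral>p. (d p)\<^sup>2 \<partial>path_law)"
  define x where "x n t \<omega> = s * d (past X (int t) \<omega>) / sqrt (real n)" for n t \<omega>
  define T where "T n \<omega> = (\<Prod>t=1..n. 1 + \<i> * of_real (x n t \<omega>))" for n \<omega>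
  define Q where "Q n \<omega> = (\<Sum>t=1..n. (x n t \<omega>)\<^sup>2)" for n \<omega>
  have [measurable]: "x n t \<in> borel_measurable M" for n t unfolding x_def by measurable
  have [measurable]: "T n \<in> borel_measurable M" "Q n \<in> borel_measurable M" for n
    unfolding T_def Q_def by measurable
  have B: "B \<ge> 0" using bnd[of undefined] by linarith
  have Q: "Q n \<omega> = s\<^sup>2 * ((\<Sum>t=1..n. (d (past X (int t) \<omega>))\<^sup>2) / real n)" for n \<omega>
    by (simp add: Q_def x_def power_divide power_mult_distrib sum_distrib_left sum_divide_distrib)
  have Qb: "Q n \<omega> \<le> s\<^sup>2 * B\<^sup>2" for n \<omega>
  proof (cases "n = 0")
    case False
    have "(\<Sum>t=1..n. (d (past X (int t) \<omega>))\<^sup>2) \<le> (\<Sum>t=1..n. B\<^sup>2)"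
      by (intro sum_mono) (use bnd in \<open>auto intro: square_le_of_abs_le\<close>)
    then have "(\<Sum>t=1..n. (d (past X (int t) \<omega>))\<^sup>2) / real n \<le> B\<^sup>2"
      using False by (simp add: pos_divide_le_eq mult.commute)
    then show ?thesis unfolding Q by (rule mult_left_mono) simp
  qed (simp add: Q_def)
  have Q0: "Q n \<omega> \<ge> 0" for n \<omega> by (simp add: Q_def sum_nonneg)
  have TQ: "T n \<omega> * of_real (exp (- Q n \<omega> / 2)) = (\<Prod>t=1..n. (1 + \<i> * of_real (x n t \<omega>)) * of_real (exp (- (x n t \<omega>)\<^sup>2 / 2)))" for n \<omega>
    by (simp only: T_def Q_def prod.distrib of_real_prod[symmetric] exp_sum[symmetric] finite_atLeastAtMost
        sum_negf[symmetric] sum_divide_distrib)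
  have TQ1: "cmod (T n \<omega> * of_real (exp (- Q n \<omega> / 2))) \<le> 1" for n \<omega>
    unfolding TQ prod_norm[symmetric] by (intro prod_le_1 conjI norm_ge_zero iexp_factor_le_1)
  \<comment> \<open>The factor exp (- Q / 2) brings \<open>T\<close> into the unit disc, and
    \<open>Q\<close> is bounded because d is. Undoing the factor shows that \<open>T\<close> is
    bounded uniformly in n, as dominated convergence requires below.\<close>
  have Tb: "cmod (T n \<omega>) \<le> exp (s\<^sup>2 * B\<^sup>2)" for n \<omega>
  proof -
    have "cmod (T n \<omega>) = cmod (T n \<omega> * of_real (exp (- Q n \<omega> / 2))) * exp (Q n \<omega> / 2)"
      by (simp add: norm_mult mult.assoc exp_add[symmetric])
    also have "\<dots> \<le> 1 * exp (s\<^sup>2 * B\<^sup>2)"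
      using Qb[of n \<omega>] Q0[of n \<omega>] by (intro mult_mono TQ1) auto
    finally show ?thesis by simp
  qed
  have iexp_eq: "iexp (s * ((\<Sum>t=1..n. d (past X (int t) \<omega>)) / sqrt (real n))) = (\<Prod>t=1..n. iexp (x n t \<omega>))" for n \<omega>
    unfolding x_def
    by (simp add: exp_sum[symmetric] sum_distrib_left[symmetric] sum_divide_distrib[symmetric] del: of_real_sum)
       (simp add: sum_distrib_left sum_divide_distrib mult.assoc)
  have ET: "(\<integral>\<omega>. T n \<omega> \<partial>M) = 1" for n
    using martingale_product_expectation[OF d bnd, where n = n and s = "s / sqrt (real n)"]
    by (simp add: T_def x_def)
  have iT: "integrable M (T n)" for n
    by (rule integrable_const_bound[where B = "exp (s\<^sup>2 * B\<^sup>2)"]) (auto intro: AE_I2 Tb)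
  \<comment> \<open>Two products with all factors in the unit disc differ by at most the sum of the
    differences of their factors: n of them, each of order n powr (- 3/2).\<close>
  have diff: "cmod (iexp (s * ((\<Sum>t=1..n. d (past X (int t) \<omega>)) / sqrt (real n))) - T n \<omega> * of_real (exp (- Q n \<omega> / 2)))
      \<le> 2 * (\<bar>s\<bar> * B) ^ 3 / sqrt (real n)" for n \<omega>
  proof (cases "n = 0")
    case False
    have "cmod ((\<Prod>t=1..n. iexp (x n t \<omega>)) - T n \<omega> * of_real (exp (- Q n \<omega> / 2)))
      \<le> (\<Sum>t=1..n. cmod (iexp (x n t \<omega>) - (1 + \<i> * of_real (x n t \<omega>)) * of_real (exp (- (x n t \<omega>)\<^sup>2 / 2))))"
      unfolding TQ by (intro norm_prod_diff iexp_factor_le_1) simp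
    also have "\<dots> \<le> (\<Sum>t=1..n. 2 * (\<bar>s\<bar> * B / sqrt (real n)) ^ 3)"
    proof (rule sum_mono)
      fix t
      have "\<bar>x n t \<omega>\<bar> \<le> \<bar>s\<bar> * B / sqrt (real n)"
        unfolding x_def abs_divide abs_mult by (intro frac_le mult_mono bnd) (use False B in auto)
      then have "2 * \<bar>x n t \<omega>\<bar> ^ 3 \<le> 2 * (\<bar>s\<bar> * B / sqrt (real n)) ^ 3"
        by (intro mult_left_mono power_mono) auto
      with iexp_product_approx show "cmod (iexp (x n t \<omega>) - (1 + \<i> * of_real (x n t \<omega>)) * of_real (exp (- (x n t \<omega>)\<^sup>2 / 2)))
          \<le> 2 * (\<bar>s\<bar> * B / sqrt (real n)) ^ 3"
        by (rule order_trans)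
    qed
    also have "\<dots> = 2 * (\<bar>s\<bar> * B) ^ 3 / sqrt (real n)"
      using False by (simp add: power_divide power3_eq_cube)
    finally show ?thesis unfolding iexp_eq .
  qed (simp add: T_def Q_def)
  have i1: "integrable M (\<lambda>\<omega>. iexp (s * ((\<Sum>t=1..n. d (past X (int t) \<omega>)) / sqrt (real n))))" for n
    by (rule integrable_const_bound[where B = 1]) auto
  have i2: "integrable M (\<lambda>\<omega>. T n \<omega> * of_real (exp (- Q n \<omega> / 2)))" for n
    by (rule integrable_const_bound[where B = 1]) (intro AE_I2 TQ1, measurable)
  have "(\<lambda>n. (\<integral>\<omega>. iexp (s * ((\<Sum>t=1..n. d (past X (int t) \<omega>)) / sqrt (real n))) \<partial>M)
      - (\<integral>\<omega>. T n \<omega> * of_real (exp (- Q n \<omega> / 2)) \<partial>M)) \<longlonglongrightarrow> 0"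
  proof (rule Lim_null_comparison)
    show "\<forall>\<^sub>F n in sequentially. norm ((\<integral>\<omega>. iexp (s * ((\<Sum>t=1..n. d (past X (int t) \<omega>)) / sqrt (real n))) \<partial>M)
      - (\<integral>\<omega>. T n \<omega> * of_real (exp (- Q n \<omega> / 2)) \<partial>M)) \<le> 2 * (\<bar>s\<bar> * B) ^ 3 / sqrt (real n)"
    proof (intro always_eventually allI)
      fix n
      show "norm ((\<integral>\<omega>. iexp (s * ((\<Sum>t=1..n. d (past X (int t) \<omega>)) / sqrt (real n))) \<partial>M)
      - (\<integral>\<omega>. T n \<omega> * of_real (exp (- Q n \<omega> / 2)) \<partial>M)) \<le> 2 * (\<bar>s\<bar> * B) ^ 3 / sqrt (real n)"
        unfolding Bochner_Integration.integral_diff[OF i1 i2, symmetric]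
        by (intro order_trans[OF integral_norm_bound integral_le_const] AE_I2 diff integrable_norm
            Bochner_Integration.integrable_diff i1 i2)
    qed
    show "(\<lambda>n. 2 * (\<bar>s\<bar> * B) ^ 3 / sqrt (real n)) \<longlonglongrightarrow> 0"
      by real_asymp
  qed
  moreover have "(\<lambda>n. \<integral>\<omega>. T n \<omega> * of_real (exp (- Q n \<omega> / 2)) \<partial>M) \<longlonglongrightarrow> of_real (exp (- (s\<^sup>2 * v) / 2))"
  proof -
    \<comment> \<open>\<open>T\<close> itself need not converge. Only exp (- Q / 2) minus its
      constant limit is integrated against the bounded \<open>T\<close>; the constant is multiplied
      by the expectation of \<open>T\<close>, which is 1.\<close>
    have "(\<lambda>n. \<integral>\<omega>. T n \<omega> * of_real (exp (- Q n \<omega> / 2) - exp (- (s\<^sup>2 * v) / 2)) \<partial>M) \<longlonglongrightarrow> (\<integral>\<omega>. 0 \<partial>M)"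
    proof (rule integral_dominated_convergence[where w = "\<lambda>_. exp (s\<^sup>2 * B\<^sup>2) * 2"])
      have "AE \<omega> in M. (\<lambda>n. (\<Sum>t=1..n. (d (past X (int t) \<omega>))\<^sup>2) / real n) \<longlonglongrightarrow> v"
        unfolding v_def by (rule ergodic_average[OF d2])
      then show "AE \<omega> in M. (\<lambda>n. T n \<omega> * of_real (exp (- Q n \<omega> / 2) - exp (- (s\<^sup>2 * v) / 2))) \<longlonglongrightarrow> 0"
      proof eventually_elim
        case (elim \<omega>)
        then have "(\<lambda>n. Q n \<omega>) \<longlonglongrightarrow> s\<^sup>2 * v" unfolding Q by (intro tendsto_intros)
        then have "(\<lambda>n. exp (- Q n \<omega> / 2) - exp (- (s\<^sup>2 * v) / 2)) \<longlonglongrightarrow> exp (- (s\<^sup>2 * v) / 2) - exp (- (s\<^sup>2 * v) / 2)"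
          by (intro tendsto_intros) simp_all
        then have "(\<lambda>n. exp (s\<^sup>2 * B\<^sup>2) * \<bar>exp (- Q n \<omega> / 2) - exp (- (s\<^sup>2 * v) / 2)\<bar>) \<longlonglongrightarrow> 0"
          by (auto intro!: tendsto_mult_right_zero tendsto_rabs_zero)
        then show ?case
          by (rule Lim_null_comparison[rotated])
            (auto simp: norm_mult intro!: always_eventually mult_right_mono Tb simp del: of_real_exp of_real_diff)
      qed
      show "AE \<omega> in M. norm (T n \<omega> * of_real (exp (- Q n \<omega> / 2) - exp (- (s\<^sup>2 * v) / 2))) \<le> exp (s\<^sup>2 * B\<^sup>2) * 2" for n
      proof (rule AE_I2)
        fix \<omega>
        have "v \<ge> 0" by (simp add: v_def)
        then have "exp (- Q n \<omega> / 2) \<le> 1" "exp (- (s\<^sup>2 * v) / 2) \<le> 1" "0 < exp (- Q n \<omega> / 2)" "0 < exp (- (s\<^sup>2 * v) / 2)"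
          using Q0[of n \<omega>] by simp_all
        then have "\<bar>exp (- Q n \<omega> / 2) - exp (- (s\<^sup>2 * v) / 2)\<bar> \<le> 2" by linarith
        then show "norm (T n \<omega> * of_real (exp (- Q n \<omega> / 2) - exp (- (s\<^sup>2 * v) / 2))) \<le> exp (s\<^sup>2 * B\<^sup>2) * 2"
          unfolding norm_mult norm_of_real by (intro mult_mono Tb) auto
      qed
    qed simp_all
    moreover have "(\<integral>\<omega>. T n \<omega> * of_real (exp (- Q n \<omega> / 2) - exp (- (s\<^sup>2 * v) / 2)) \<partial>M) =
        (\<integral>\<omega>. T n \<omega> * of_real (exp (- Q n \<omega> / 2)) \<partial>M) - of_real (exp (- (s\<^sup>2 * v) / 2))" for n
      unfolding of_real_diff right_diff_distrib
      by (subst Bochner_Integration.integral_diff[OF i2 integrable_mult_left[OF iT]])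
         (simp add: integral_mult_left_zero ET)
    ultimately show ?thesis by (simp add: LIM_zero_iff)
  qed
  ultimately have "(\<lambda>n. ((\<integral>\<omega>. iexp (s * ((\<Sum>t=1..n. d (past X (int t) \<omega>)) / sqrt (real n))) \<partial>M)
      - (\<integral>\<omega>. T n \<omega> * of_real (exp (- Q n \<omega> / 2)) \<partial>M)) + (\<integral>\<omega>. T n \<omega> * of_real (exp (- Q n \<omega> / 2)) \<partial>M))
      \<longlonglongrightarrow> 0 + of_real (exp (- (s\<^sup>2 * v) / 2))"
    by (rule tendsto_add)
  then show ?thesis by (simp add: v_def)
qed

text \<open>Bounded differences close to d in L2 suffice: the characteristic functions of the
  normalised sums differ by at most |s| times the L2 distance, for all n at once, so the limits in n
  and k can be interchanged.\<close>

theorem martingale_clt: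
  assumes d: "martingale_difference d"
    and dk: "\<And>k::nat. martingale_difference (d' k)" "\<And>k p. \<bar>d' k p\<bar> \<le> B k"
    and conv: "(\<lambda>k. \<integral>p. (d p - d' k p)\<^sup>2 \<partial>path_law) \<longlonglongrightarrow> 0"
      "(\<lambda>k. \<integral>p. (d' k p)\<^sup>2 \<partial>path_law) \<longlonglongrightarrow> (\<integral>p. (d p)\<^sup>2 \<partial>path_law)"
  shows "(\<lambda>n. \<integral>\<omega>. iexp (s * ((\<Sum>t=1..n. d (past X (int t) \<omega>)) / sqrt (real n))) \<partial>M)
    \<longlonglongrightarrow> of_real (exp (- (s\<^sup>2 * (\<integral>p. (d p)\<^sup>2 \<partial>path_law)) / 2))"
proof (rule LIMSEQ_I)
  fix r :: real assume r: "r > 0"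
  let ?\<phi> = "\<lambda>d n. \<integral>\<omega>. iexp (s * ((\<Sum>t=1..n. d (past X (int t) \<omega>)) / sqrt (real n))) \<partial>M"
  let ?L = "\<lambda>d. complex_of_real (exp (- (s\<^sup>2 * (\<integral>p. (d p)\<^sup>2 \<partial>path_law)) / 2))"
  have "(\<lambda>k. \<bar>s\<bar> * sqrt (\<integral>p. (d p - d' k p)\<^sup>2 \<partial>path_law)) \<longlonglongrightarrow> \<bar>s\<bar> * sqrt 0"
    by (intro tendsto_intros conv)
  then have "\<forall>\<^sub>F k in sequentially. \<bar>s\<bar> * sqrt (\<integral>p. (d p - d' k p)\<^sup>2 \<partial>path_law) < r / 3"
    by (rule order_tendstoD) (use r in simp)
  moreover have "(\<lambda>k. ?L (d' k)) \<longlonglongrightarrow> ?L d"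
    by (intro tendsto_intros conv) simp
  then have "\<forall>\<^sub>F k in sequentially. dist (?L (d' k)) (?L d) < r / 3"
    by (rule tendstoD) (use r in simp)
  ultimately have "\<forall>\<^sub>F k in sequentially. \<bar>s\<bar> * sqrt (\<integral>p. (d p - d' k p)\<^sup>2 \<partial>path_law) < r / 3 \<and> dist (?L (d' k)) (?L d) < r / 3"
    by (rule eventually_conj)
  then obtain k where k: "\<bar>s\<bar> * sqrt (\<integral>p. (d p - d' k p)\<^sup>2 \<partial>path_law) < r / 3" "dist (?L (d' k)) (?L d) < r / 3"
    by (auto simp: eventually_sequentially)
  have e: "martingale_difference (\<lambda>p. d p - d' k p)" by (rule martingale_difference_diff[OF d dk(1)])
  note [measurable] = measurable_compose[OF past_measurable martingale_differenceD(1)[OF d]]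
    measurable_compose[OF past_measurable martingale_differenceD(1)[OF dk(1)]]
  have appr: "cmod (?\<phi> d n - ?\<phi> (d' k) n) < r / 3" for n
  proof -
    let ?Y = "\<lambda>\<omega>. \<Sum>t=1..n. d (past X (int t) \<omega>) - d' k (past X (int t) \<omega>)"
    let ?Z = "\<lambda>d \<omega>. s * ((\<Sum>t=1..n. d (past X (int t) \<omega>)) / sqrt (real n))"
    have i: "integrable M (\<lambda>\<omega>. iexp (?Z d \<omega>))" "integrable M (\<lambda>\<omega>. iexp (?Z (d' k) \<omega>))"
      by (rule integrable_const_bound[where B = 1]; auto)+
    note Y = expectation_abs_le_sqrt[OF _ martingale_sum_square(1)[OF e], of n]
    have iY: "integrable M ?Y" by (rule Y) measurable
    have "?\<phi> d n - ?\<phi> (d' k) n = (\<integral>\<omega>. iexp (?Z d \<omega>) - iexp (?Z (d' k) \<omega>) \<partial>M)"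
      using i by (rule Bochner_Integration.integral_diff[symmetric])
    also have "cmod \<dots> \<le> (\<integral>\<omega>. \<bar>s\<bar> / sqrt (real n) * \<bar>?Y \<omega>\<bar> \<partial>M)"
    proof (rule order_trans[OF integral_norm_bound integral_mono])
      show "integrable M (\<lambda>\<omega>. cmod (iexp (?Z d \<omega>) - iexp (?Z (d' k) \<omega>)))" using i by (intro integrable_norm) (rule Bochner_Integration.integrable_diff)
      show "integrable M (\<lambda>\<omega>. \<bar>s\<bar> / sqrt (real n) * \<bar>?Y \<omega>\<bar>)" using iY by simp
      fix \<omega>
      have "?Z d \<omega> - ?Z (d' k) \<omega> = s / sqrt (real n) * ?Y \<omega>"
        by (simp add: sum_subtractf right_diff_distrib diff_divide_distrib)
      then have "\<bar>?Z d \<omega> - ?Z (d' k) \<omega>\<bar> = \<bar>s\<bar> / sqrt (real n) * \<bar>?Y \<omega>\<bar>" by (simp add: abs_mult)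
      then show "cmod (iexp (?Z d \<omega>) - iexp (?Z (d' k) \<omega>)) \<le> \<bar>s\<bar> / sqrt (real n) * \<bar>?Y \<omega>\<bar>"
        using iexp_Lipschitz[of "?Z d \<omega>" "?Z (d' k) \<omega>"] by simp
    qed
    also have "\<dots> = \<bar>s\<bar> / sqrt (real n) * (\<integral>\<omega>. \<bar>?Y \<omega>\<bar> \<partial>M)" by (rule integral_mult_right_zero)
    also have "\<dots> \<le> \<bar>s\<bar> / sqrt (real n) * sqrt (\<integral>\<omega>. (?Y \<omega>)\<^sup>2 \<partial>M)"
      by (intro mult_left_mono Y) auto
    \<comment> \<open>Orthogonality of the increments supplies the factor sqrt n that cancels the
      normalisation.\<close>
    also have "\<dots> = \<bar>s\<bar> / sqrt (real n) * (sqrt (real n) * sqrt (\<integral>p. (d p - d' k p)\<^sup>2 \<partial>path_law))"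
      by (simp only: martingale_sum_square(2)[OF e] real_sqrt_mult)
    also have "\<dots> \<le> \<bar>s\<bar> * sqrt (\<integral>p. (d p - d' k p)\<^sup>2 \<partial>path_law)" by (cases "n = 0") auto
    finally show ?thesis using k(1) by (rule le_less_trans)
  qed
  have "\<forall>\<^sub>F n in sequentially. dist (?\<phi> (d' k) n) (?L (d' k)) < r / 3"
    by (rule tendstoD[OF bounded_martingale_clt[OF dk]]) (use r in simp)
  then obtain n0 where n0: "\<And>n. n \<ge> n0 \<Longrightarrow> dist (?\<phi> (d' k) n) (?L (d' k)) < r / 3"
    by (auto simp: eventually_sequentially)
  have "norm (?\<phi> d n - ?L d) < r" if "n \<ge> n0" for n
  proof -
    have "norm (?\<phi> d n - ?L d) \<le> cmod (?\<phi> d n - ?\<phi> (d' k) n) + (dist (?\<phi> (d' k) n) (?L (d' k)) + dist (?L (d' k)) (?L d))"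
      unfolding dist_norm by (rule norm_diff_triangle_le[OF order_refl norm_diff_triangle_le[OF order_refl order_refl]])
    also have "\<dots> < r / 3 + (r / 3 + r / 3)" by (intro add_strict_mono appr n0 that k)
    finally show ?thesis by simp
  qed
  then show "\<exists>no. \<forall>n\<ge>no. norm (?\<phi> d n - ?L d) < r" by blast
qed

declare shift_measurable [measurable del] Suc_shift_measurable [measurable del]

end

section \<open>The innovations are independent of the past\<close>

lemma Lip_finite_lipschitz:
  assumes "Lip g < \<infinity>"
  shows "dist (g x) (g y) \<le> enn2real (Lip g) * dist x y"
proof (cases "x = y")
  case False
  have "ennreal (dist (g x) (g y) / dist x y) \<le> Lip g"
    unfolding Lip_def by (intro SUP_upper2[of x] SUP_upper2[of y]) auto
  also have "Lip g = ennreal (enn2real (Lip g))" using assms by simp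
  finally have "dist (g x) (g y) / dist x y \<le> enn2real (Lip g)" by (simp add: ennreal_le_iff)
  then show ?thesis using False by (simp add: pos_divide_le_eq)
qed simp

lemma ennreal_series_real:
  fixes f :: "nat \<Rightarrow> ennreal"
  assumes "(\<Sum>j. f j) < \<infinity>"
  shows "f j < \<infinity>" "summable (\<lambda>j. enn2real (f j))" "(\<Sum>j. f j) = ennreal (\<Sum>j. enn2real (f j))"
proof -
  have fin: "f j < \<infinity>" for j
  proof -
    have "f j \<le> (\<Sum>j. f j)" using sum_le_suminf[of f "{j}"] by simp
    then show ?thesis using assms by (rule le_less_trans)
  qed
  then show "f j < \<infinity>" .
  have eq: "f = (\<lambda>j. ennreal (enn2real (f j)))" using fin by (simp add: fun_eq_iff)
  have "(\<Sum>j. ennreal (enn2real (f j))) \<noteq> \<top>" using assms eq by simp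
  then show s: "summable (\<lambda>j. enn2real (f j))" by (intro summable_suminf_not_top) simp_all
  show "(\<Sum>j. f j) = ennreal (\<Sum>j. enn2real (f j))"
    by (subst eq, rule suminf_ennreal2[OF _ s]) simp
qed

locale ar_model = square_integrable_process M X
  for M :: "'a measure" and X :: "int \<Rightarrow> 'a \<Rightarrow> real^'m::finite" +
  fixes \<xi> :: "int \<Rightarrow> 'a \<Rightarrow> real^'m" and A0 :: "'p \<Rightarrow> real^'m"
    and A :: "nat \<Rightarrow> 'p \<Rightarrow> real^'m \<Rightarrow> real^'m" and \<theta>0 :: 'p
  assumes noise: "iid_noise M \<xi>"
    and stable: "\<theta>0 \<in> stability_region A"
    and summable_A_0: "summable (\<lambda>j. A (Suc j) \<theta>0 0)"
    and equation: "\<And>t. AE \<omega> in M. X t \<omega> = \<xi> t \<omega> + ar_fun A0 A \<theta>0 (past X t \<omega>)"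
begin

section \<open>The solution as a limit of Picard iterates driven by the noise\<close>

definition lag_lip :: "nat \<Rightarrow> real" where "lag_lip j = enn2real (Lip (A (Suc j) \<theta>0))"

lemma lag_lip_nonneg: "lag_lip j \<ge> 0" by (simp add: lag_lip_def)

lemma lag_lip_series: "Lip (A (Suc j) \<theta>0) < \<infinity>" "summable lag_lip" "suminf lag_lip < 1"
proof -
  have 1: "(\<Sum>j. Lip (A (Suc j) \<theta>0)) < 1" using stable by (simp add: stability_region_def)
  then have "(\<Sum>j. Lip (A (Suc j) \<theta>0)) < \<infinity>" by (rule less_trans) simp
  note r = ennreal_series_real[OF this]
  show "Lip (A (Suc j) \<theta>0) < \<infinity>" by (rule r)
  show "summable lag_lip" using r(2) by (simp add: lag_lip_def [abs_def])
  show "suminf lag_lip < 1" using 1 r(3) by (simp add: lag_lip_def [abs_def] ennreal_less_one_iff)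
qed

lemma A_lipschitz: "norm (A (Suc j) \<theta>0 x - A (Suc j) \<theta>0 y) \<le> lag_lip j * norm (x - y)"
  using Lip_finite_lipschitz[OF lag_lip_series(1)] unfolding lag_lip_def dist_norm .

lemma A_measurable [measurable]: "A (Suc j) \<theta>0 \<in> borel_measurable borel"
proof (intro borel_measurable_continuous_onI lipschitz_on_continuous_on)
  show "(lag_lip j)-lipschitz_on UNIV (A (Suc j) \<theta>0)"
    by (rule lipschitz_onI) (use A_lipschitz lag_lip_nonneg in \<open>auto simp: dist_norm\<close>)
qed

lemma summable_A:
  assumes "summable (\<lambda>j. lag_lip j * norm (p (Suc j)))"
  shows "summable (\<lambda>j. A (Suc j) \<theta>0 (p (Suc j)))"
proof -
  have "summable (\<lambda>j. A (Suc j) \<theta>0 (p (Suc j)) - A (Suc j) \<theta>0 0)"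
    by (rule summable_comparison_test'[OF assms, of 0]) (use A_lipschitz[of _ _ 0] in simp)
  from summable_add[OF this summable_A_0] show ?thesis by simp
qed

lemma ar_fun_\<theta>0_measurable [measurable]: "ar_fun A0 A \<theta>0 \<in> borel_measurable seq_space"
proof -
  have "(\<lambda>p. A (Suc j) \<theta>0 (p (Suc j))) \<in> borel_measurable seq_space" for j
    by (rule measurable_compose[OF _ A_measurable]) measurable
  then show ?thesis
    unfolding ar_fun_def by (intro borel_measurable_add borel_measurable_const borel_measurable_suminf)
qed

text \<open>Fixed point iteration of the model equation, started at 0, with an arbitrary noise
  sequence z as input. The iterate at time t reads z up to time t only, and this survives the limit.
  Coordinate 0 of the inserted path is a dummy, as \<open>ar_fun\<close> looks at the positive
  lags.\<close>

primrec picard :: "nat \<Rightarrow> int \<Rightarrow> (int \<Rightarrow> real^'m) \<Rightarrow> real^'m" where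
  "picard 0 = (\<lambda>t z. 0)"
| "picard (Suc n) = (\<lambda>t z. z t + ar_fun A0 A \<theta>0 (\<lambda>j. if j = 0 then 0 else picard n (t - int j) z))"

lemma picard_measurable:
  "{..t} \<subseteq> I \<Longrightarrow> picard n t \<in> borel_measurable (PiM I (\<lambda>_. borel))"
proof (induction n arbitrary: t)
  case (Suc n)
  have m: "(\<lambda>z. z t) \<in> borel_measurable (PiM I (\<lambda>_. borel))"
    using Suc.prems by (intro measurable_component_singleton) auto
  have "(\<lambda>z j. if j = 0 then 0 else picard n (t - int j) z) \<in> measurable (PiM I (\<lambda>_. borel)) seq_space"
  proof (rule measurable_PiM_single')
    fix j :: nat
    have "picard n (t - int j) \<in> borel_measurable (PiM I (\<lambda>_. borel))"
      by (rule Suc.IH) (use Suc.prems in auto)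
    then show "(\<lambda>z. if j = 0 then 0 else picard n (t - int j) z) \<in> borel_measurable (PiM I (\<lambda>_. borel))"
      by (cases "j = 0") (simp_all only: if_True if_False simp_thms measurable_const space_borel UNIV_I)
  qed (simp add: space_PiM)
  from borel_measurable_add[OF m measurable_compose[OF this ar_fun_\<theta>0_measurable]] show ?case
    unfolding picard.simps .
qed (simp only: picard.simps borel_measurable_const)

lemma picard_restrict: "{..t} \<subseteq> I \<Longrightarrow> picard n t (restrict z I) = picard n t z"
proof (induction n arbitrary: t)
  case (Suc n)
  have "t \<in> I" using Suc.prems by auto
  moreover have "picard n (t - int j) (restrict z I) = picard n (t - int j) z" for j
    by (rule Suc.IH) (use Suc.prems in auto)
  ultimately show ?case by (simp only: picard.simps restrict_apply')
qed simp

lemma noise_measurable [measurable]: "\<xi> t \<in> borel_measurable M"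
proof -
  have "indep_vars (\<lambda>_. borel) \<xi> UNIV" using noise unfolding iid_noise_def by (rule conjunct1)
  then show ?thesis unfolding indep_vars_def by blast
qed

lemma noise_path_measurable: "(\<lambda>\<omega> t. \<xi> t \<omega>) \<in> measurable M (PiM UNIV (\<lambda>_. borel))"
  by (rule measurable_PiM_single'[OF noise_measurable]) simp

lemma picard_distance_measurable: "(\<lambda>\<omega>. norm (X t \<omega> - picard n t (\<lambda>s. \<xi> s \<omega>))) \<in> borel_measurable M"
proof -
  have [measurable]: "(\<lambda>\<omega>. picard n t (\<lambda>s. \<xi> s \<omega>)) \<in> borel_measurable M"
    by (rule measurable_compose[OF noise_path_measurable picard_measurable]) simp
  show ?thesis
    by (rule measurable_compose[OF borel_measurable_diff borel_measurable_norm]) (rule X_measurable, fact)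
qed

lemma nn_integral_norm_X: "(\<integral>\<^sup>+\<omega>. ennreal (norm (X t \<omega>)) \<partial>M) = ennreal (expectation (\<lambda>\<omega>. norm (X 0 \<omega>)))"
proof -
  have i: "integrable M (\<lambda>\<omega>. norm (X 0 \<omega>))"
    by (rule square_integrable_imp_integrable[OF _ X_square_integrable]) simp
  have m: "(\<lambda>p. norm (p 0)) \<in> borel_measurable seq_space" by measurable
  have i': "integrable M (\<lambda>\<omega>. norm (X s \<omega>))" for s
    using i integrable_past_iff[OF m, of 0] integrable_past_iff[OF m, of s] by (simp add: past_def)
  have "expectation (\<lambda>\<omega>. norm (X t \<omega>)) = expectation (\<lambda>\<omega>. norm (X 0 \<omega>))"
    using integral_past[OF m, of 0] integral_past[OF m, of t] by (simp add: past_def)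
  then show ?thesis using nn_integral_eq_integral[OF i'[of t]] by simp
qed

text \<open>One iteration multiplies the expected distance to X, taken over all times alike, by the
  total Lipschitz constant, which is below 1 by stability. The initial distance is the first
  absolute moment of X.\<close>

lemma picard_distance:
  "(\<integral>\<^sup>+\<omega>. ennreal (norm (X t \<omega> - picard n t (\<lambda>s. \<xi> s \<omega>))) \<partial>M)
    \<le> ennreal (suminf lag_lip ^ n * expectation (\<lambda>\<omega>. norm (X 0 \<omega>)))"
proof (induction n arbitrary: t)
  case 0
  then show ?case by (simp add: nn_integral_norm_X)
next
  case (Suc n)
  let ?c = "expectation (\<lambda>\<omega>. norm (X 0 \<omega>))" and ?a = "suminf lag_lip"
  let ?Y = "\<lambda>n t \<omega>. picard n t (\<lambda>s. \<xi> s \<omega>)"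
  have c0: "?c \<ge> 0" by simp
  have a0: "?a \<ge> 0" by (intro suminf_nonneg lag_lip_series lag_lip_nonneg)
  have m: "(\<lambda>\<omega>. norm (X s \<omega> - ?Y n s \<omega>)) \<in> borel_measurable M" for s
    by (rule picard_distance_measurable)
  have D: "AE \<omega> in M. summable (\<lambda>j. lag_lip j * norm (X (t - int (Suc j)) \<omega> - ?Y n (t - int (Suc j)) \<omega>))"
    "(\<integral>\<^sup>+\<omega>. ennreal (\<Sum>j. lag_lip j * norm (X (t - int (Suc j)) \<omega> - ?Y n (t - int (Suc j)) \<omega>)) \<partial>M)
      \<le> ennreal (\<Sum>j. lag_lip j * (?a ^ n * ?c))"
  proof -
    have i: "(\<integral>\<^sup>+\<omega>. ennreal (lag_lip j * norm (X s \<omega> - ?Y n s \<omega>)) \<partial>M) \<le> ennreal (lag_lip j * (?a ^ n * ?c))" for j s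
    proof -
      have "(\<integral>\<^sup>+\<omega>. ennreal (lag_lip j * norm (X s \<omega> - ?Y n s \<omega>)) \<partial>M) = ennreal (lag_lip j) * (\<integral>\<^sup>+\<omega>. ennreal (norm (X s \<omega> - ?Y n s \<omega>)) \<partial>M)"
        unfolding ennreal_mult[OF lag_lip_nonneg norm_ge_zero]
        by (intro nn_integral_cmult measurable_compose[OF m measurable_ennreal])
      also have "\<dots> \<le> ennreal (lag_lip j) * ennreal (?a ^ n * ?c)" by (intro mult_left_mono Suc) simp
      also have "\<dots> = ennreal (lag_lip j * (?a ^ n * ?c))" using lag_lip_nonneg a0 c0 by (intro ennreal_mult[symmetric]) auto
      finally show ?thesis .
    qed
    have m': "(\<lambda>\<omega>. lag_lip j * norm (X s \<omega> - ?Y n s \<omega>)) \<in> borel_measurable M" for j s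
      by (intro borel_measurable_times borel_measurable_const m)
    have nn: "0 \<le> lag_lip j * norm (X s \<omega> - ?Y n s \<omega>)" "0 \<le> lag_lip j * (?a ^ n * ?c)" for j s \<omega>
      by (intro mult_nonneg_nonneg lag_lip_nonneg norm_ge_zero zero_le_power a0 c0)+
    have sm: "summable (\<lambda>j. lag_lip j * (?a ^ n * ?c))" by (rule summable_mult2[OF lag_lip_series(2)])
    show "AE \<omega> in M. summable (\<lambda>j. lag_lip j * norm (X (t - int (Suc j)) \<omega> - ?Y n (t - int (Suc j)) \<omega>))"
      by (rule AE_summable_of_integrals(1)[OF m' nn(1) i nn(2) sm])
    show "(\<integral>\<^sup>+\<omega>. ennreal (\<Sum>j. lag_lip j * norm (X (t - int (Suc j)) \<omega> - ?Y n (t - int (Suc j)) \<omega>)) \<partial>M)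
      \<le> ennreal (\<Sum>j. lag_lip j * (?a ^ n * ?c))"
      by (rule AE_summable_of_integrals(2)[OF m' nn(1) i nn(2) sm])
  qed
  \<comment> \<open>Summability along X and summability of the distances give summability along the
    iterate. Only then may the two series be subtracted term by term.\<close>
  have E: "AE \<omega> in M. summable (\<lambda>j. lag_lip j * norm (X (t - int (Suc j)) \<omega>))"
  proof (rule AE_summable_of_integrals(1)[where c = "\<lambda>j. lag_lip j * ?c"])
    fix j
    show "(\<integral>\<^sup>+\<omega>. ennreal (lag_lip j * norm (X (t - int (Suc j)) \<omega>)) \<partial>M) \<le> ennreal (lag_lip j * ?c)"
      using lag_lip_nonneg c0 by (simp add: ennreal_mult nn_integral_cmult nn_integral_norm_X del: of_nat_Suc)
  qed (use lag_lip_nonneg c0 lag_lip_series(2) in \<open>auto intro!: summable_mult2\<close>)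
  have "AE \<omega> in M. norm (X t \<omega> - ?Y (Suc n) t \<omega>) \<le> (\<Sum>j. lag_lip j * norm (X (t - int (Suc j)) \<omega> - ?Y n (t - int (Suc j)) \<omega>))"
    using equation[of t] D(1) E
  proof eventually_elim
    case (elim \<omega>)
    let ?x = "\<lambda>j. X (t - int (Suc j)) \<omega>" and ?y = "\<lambda>j. ?Y n (t - int (Suc j)) \<omega>"
    have "summable (\<lambda>j. lag_lip j * norm (?x j - ?y j) + lag_lip j * norm (?x j))"
      using elim by (intro summable_add)
    then have sy0: "summable (\<lambda>j. lag_lip j * norm (?y j))"
    proof (rule summable_comparison_test'[where N = 0])
      fix j
      have "norm (?y j) \<le> norm (?x j - ?y j) + norm (?x j)"
        using norm_triangle_ineq4[of "?x j" "?x j - ?y j"] by simp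
      from mult_left_mono[OF this lag_lip_nonneg[of j]]
      show "norm (lag_lip j * norm (?y j)) \<le> lag_lip j * norm (?x j - ?y j) + lag_lip j * norm (?x j)"
        using lag_lip_nonneg[of j] by (simp add: distrib_left)
    qed
    have sx: "summable (\<lambda>j. A (Suc j) \<theta>0 (?x j))"
      using summable_A[of "past X t \<omega>"] elim(3) by (simp add: past_def)
    have sy: "summable (\<lambda>j. A (Suc j) \<theta>0 (?y j))"
      using summable_A[of "\<lambda>j. if j = 0 then 0 else ?Y n (t - int j) \<omega>"] sy0 by simp
    have "X t \<omega> - ?Y (Suc n) t \<omega> = (\<Sum>j. A (Suc j) \<theta>0 (?x j) - A (Suc j) \<theta>0 (?y j))"
      using elim(1) suminf_diff[OF sx sy] by (simp add: ar_fun_def past_def)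
    also have "norm \<dots> \<le> (\<Sum>j. lag_lip j * norm (?x j - ?y j))"
      by (rule norm_suminf_le[OF A_lipschitz elim(2)])
    finally show ?case .
  qed
  then have "(\<integral>\<^sup>+\<omega>. ennreal (norm (X t \<omega> - ?Y (Suc n) t \<omega>)) \<partial>M)
    \<le> (\<integral>\<^sup>+\<omega>. ennreal (\<Sum>j. lag_lip j * norm (X (t - int (Suc j)) \<omega> - ?Y n (t - int (Suc j)) \<omega>)) \<partial>M)"
    by (intro nn_integral_mono_AE) (auto elim!: eventually_mono intro!: ennreal_leI)
  also note D(2)
  also have "(\<Sum>j. lag_lip j * (?a ^ n * ?c)) = ?a ^ Suc n * ?c"
    by (simp add: suminf_mult2[OF lag_lip_series(2), symmetric] mult.assoc)
  finally show ?case .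
qed

definition noise_limit :: "int \<Rightarrow> (int \<Rightarrow> real^'m) \<Rightarrow> real^'m" where
  "noise_limit t z = lim (\<lambda>n. picard n t z)"

text \<open>The expected distances decay geometrically, so the distances are almost surely summable
  and tend to 0.\<close>

lemma X_eq_noise_limit: "AE \<omega> in M. X t \<omega> = noise_limit t (\<lambda>s. \<xi> s \<omega>)"
proof -
  let ?c = "expectation (\<lambda>\<omega>. norm (X 0 \<omega>))"
  have a0: "suminf lag_lip \<ge> 0" by (intro suminf_nonneg lag_lip_series lag_lip_nonneg)
  have "AE \<omega> in M. summable (\<lambda>n. norm (X t \<omega> - picard n t (\<lambda>s. \<xi> s \<omega>)))"
  proof (rule AE_summable_of_integrals(1)[OF picard_distance_measurable norm_ge_zero picard_distance])
    show "0 \<le> suminf lag_lip ^ n * ?c" for n using a0 by simp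
    show "summable (\<lambda>n. suminf lag_lip ^ n * ?c)"
      by (intro summable_mult2 summable_geometric) (use a0 lag_lip_series(3) in simp)
  qed
  then show ?thesis
  proof eventually_elim
    case (elim \<omega>)
    then have "(\<lambda>n. norm (X t \<omega> - picard n t (\<lambda>s. \<xi> s \<omega>))) \<longlonglongrightarrow> 0" by (rule summable_LIMSEQ_zero)
    then have "(\<lambda>n. norm (picard n t (\<lambda>s. \<xi> s \<omega>) - X t \<omega>)) \<longlonglongrightarrow> 0" by (simp only: norm_minus_commute)
    then have "(\<lambda>n. picard n t (\<lambda>s. \<xi> s \<omega>)) \<longlonglongrightarrow> X t \<omega>" by (simp only: tendsto_norm_zero_iff LIM_zero_iff)
    then show ?case unfolding noise_limit_def by (rule limI[symmetric])
  qed
qed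

lemma noise_limit_measurable:
  "{..t} \<subseteq> I \<Longrightarrow> noise_limit t \<in> borel_measurable (PiM I (\<lambda>_. borel))"
  unfolding noise_limit_def by (intro borel_measurable_lim_metric picard_measurable)

lemma noise_limit_restrict: "{..t} \<subseteq> I \<Longrightarrow> noise_limit t (restrict z I) = noise_limit t z"
  unfolding noise_limit_def by (simp only: picard_restrict)

text \<open>By the contraction the solution is a function of the noise up to the present, so the noise is
  independent of the whole past, not merely of the single coordinates as in \<^const>\<open>causal\<close>.\<close>

lemma noise_past_product:
  fixes \<eta> :: "real^'m \<Rightarrow> real" and w :: "(nat \<Rightarrow> real^'m) \<Rightarrow> real"
  assumes "\<eta> \<in> borel_measurable borel" "w \<in> borel_measurable seq_space"
    and i\<eta>: "integrable M (\<lambda>\<omega>. \<eta> (\<xi> t \<omega>))" and iw: "integrable M (\<lambda>\<omega>. w (past X (t - 1) \<omega>))"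
  shows "integrable M (\<lambda>\<omega>. \<eta> (\<xi> t \<omega>) * w (past X (t - 1) \<omega>))"
    "(\<integral>\<omega>. \<eta> (\<xi> t \<omega>) * w (past X (t - 1) \<omega>) \<partial>M) = (\<integral>\<omega>. \<eta> (\<xi> t \<omega>) \<partial>M) * (\<integral>\<omega>. w (past X (t - 1) \<omega>) \<partial>M)"
proof -
  let ?\<Psi> = "\<lambda>z (j::nat). noise_limit (t - 1 - int j) z"
  let ?R = "\<lambda>\<omega>. restrict (\<lambda>i. \<xi> i \<omega>) {..<t}"
  have "indep_vars (\<lambda>_. borel) \<xi> UNIV" using noise unfolding iid_noise_def by (rule conjunct1)
  then have indR: "indep_var (PiM {t} (\<lambda>_. borel)) (\<lambda>\<omega>. restrict (\<lambda>i. \<xi> i \<omega>) {t}) (PiM {..<t} (\<lambda>_. borel)) ?R"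
    by (rule indep_var_restrict) simp_all
  have "?\<Psi> \<in> measurable (PiM {..<t} (\<lambda>_. borel)) seq_space"
    by (rule measurable_PiM_single'[OF noise_limit_measurable]) (auto simp: space_PiM)
  then have m3: "(\<lambda>z. w (?\<Psi> z)) \<in> borel_measurable (PiM {..<t} (\<lambda>_. borel))"
    by (rule measurable_compose[OF _ assms(2)])
  have m4: "(\<lambda>z. \<eta> (z t)) \<in> borel_measurable (PiM {t} (\<lambda>_. borel))"
    by (rule measurable_compose[OF measurable_component_singleton[of t "{t}"] assms(1)]) simp
  from indep_var_compose[OF indR m4 m3]
  have ind: "indep_var borel (\<lambda>\<omega>. \<eta> (\<xi> t \<omega>)) borel (\<lambda>\<omega>. w (?\<Psi> (?R \<omega>)))"
    by (simp only: comp_def restrict_apply' singletonI)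
  \<comment> \<open>Every time t - 1 - j lies before t, hence the limits see only noise variables
    that survive the restriction.\<close>
  have R: "?\<Psi> (?R \<omega>) = ?\<Psi> (\<lambda>s. \<xi> s \<omega>)" for \<omega>
    by (intro ext noise_limit_restrict) (simp add: subset_iff)
  have "AE \<omega> in M. \<forall>t. X t \<omega> = noise_limit t (\<lambda>s. \<xi> s \<omega>)"
    unfolding AE_all_countable by (intro allI X_eq_noise_limit)
  then have eq: "AE \<omega> in M. w (?\<Psi> (?R \<omega>)) = w (past X (t - 1) \<omega>)"
    by eventually_elim (simp add: R past_def)
  have m1: "(\<lambda>\<omega>. w (?\<Psi> (?R \<omega>))) \<in> borel_measurable M"
    by (rule indep_var_rv2[OF ind])
  have m2: "(\<lambda>\<omega>. w (past X (t - 1) \<omega>)) \<in> borel_measurable M" by (rule measurable_compose[OF past_measurable assms(2)])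
  have m0: "(\<lambda>\<omega>. \<eta> (\<xi> t \<omega>)) \<in> borel_measurable M" by (rule measurable_compose[OF noise_measurable assms(1)])
  have i': "integrable M (\<lambda>\<omega>. w (?\<Psi> (?R \<omega>)))"
    using iw integrable_cong_AE[OF m1 m2 eq] by simp
  have eq2: "AE \<omega> in M. \<eta> (\<xi> t \<omega>) * w (?\<Psi> (?R \<omega>)) = \<eta> (\<xi> t \<omega>) * w (past X (t - 1) \<omega>)"
    using eq by eventually_elim simp
  show "integrable M (\<lambda>\<omega>. \<eta> (\<xi> t \<omega>) * w (past X (t - 1) \<omega>))"
    using indep_var_integrable[OF ind i\<eta> i'] integrable_cong_AE[OF borel_measurable_times[OF m0 m1] borel_measurable_times[OF m0 m2] eq2] by simp
  have "(\<integral>\<omega>. \<eta> (\<xi> t \<omega>) * w (past X (t - 1) \<omega>) \<partial>M) = (\<integral>\<omega>. \<eta> (\<xi> t \<omega>) * w (?\<Psi> (?R \<omega>)) \<partial>M)"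
    by (rule integral_cong_AE[OF borel_measurable_times[OF m0 m1] borel_measurable_times[OF m0 m2] eq2, symmetric])
  also have "\<dots> = (\<integral>\<omega>. \<eta> (\<xi> t \<omega>) \<partial>M) * (\<integral>\<omega>. w (?\<Psi> (?R \<omega>)) \<partial>M)"
    by (rule indep_var_lebesgue_integral[OF ind i\<eta> i'])
  also have "(\<integral>\<omega>. w (?\<Psi> (?R \<omega>)) \<partial>M) = (\<integral>\<omega>. w (past X (t - 1) \<omega>) \<partial>M)"
    by (rule integral_cong_AE[OF m1 m2 eq])
  finally show "(\<integral>\<omega>. \<eta> (\<xi> t \<omega>) * w (past X (t - 1) \<omega>) \<partial>M) = (\<integral>\<omega>. \<eta> (\<xi> t \<omega>) \<partial>M) * (\<integral>\<omega>. w (past X (t - 1) \<omega>) \<partial>M)" .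
qed

text \<open>The noise recovered from the path. It transfers statements about the noise to
  \<open>path_law\<close>, where the residuals and gradients live.\<close>

definition innovation :: "(nat \<Rightarrow> real^'m) \<Rightarrow> real^'m" where
  "innovation p = p 0 - ar_fun A0 A \<theta>0 p"

lemma innovation_measurable [measurable]: "innovation \<in> borel_measurable seq_space"
  unfolding innovation_def
  by (intro borel_measurable_diff ar_fun_\<theta>0_measurable measurable_component_singleton UNIV_I)

lemma noise_eq_innovation: "AE \<omega> in M. \<xi> t \<omega> = innovation (past X t \<omega>)"
  using equation[of t]
proof eventually_elim
  case (elim \<omega>)
  have "past X t \<omega> 0 = X t \<omega>" by (simp add: past_def)
  then show ?case unfolding innovation_def using elim by (simp only: add_diff_cancel_right')
qed

lemma component_measurable: "(\<lambda>x::real^'m. x $ k) \<in> borel_measurable borel"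
  by (intro borel_measurable_continuous_onI continuous_intros)

lemma noise_moments:
  "integrable M (\<lambda>\<omega>. (\<xi> 0 \<omega> $ k)\<^sup>2)" "integrable M (\<lambda>\<omega>. \<xi> 0 \<omega> $ k)" "(\<integral>\<omega>. \<xi> 0 \<omega> $ k \<partial>M) = 0"
  "(\<integral>\<omega>. \<xi> 0 \<omega> $ k * \<xi> 0 \<omega> $ l \<partial>M) = (if k = l then 1 else 0)"
proof -
  have v: "(\<integral>\<omega>. (\<xi> 0 \<omega> $ k)\<^sup>2 \<partial>M) = 1" "variance (\<lambda>\<omega>. \<xi> 0 \<omega> $ k) = 1"
    using noise unfolding iid_noise_def by blast+
  have orth: "k \<noteq> l \<Longrightarrow> (\<integral>\<omega>. \<xi> 0 \<omega> $ k * \<xi> 0 \<omega> $ l \<partial>M) = 0"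
    using noise unfolding iid_noise_def by blast
  \<comment> \<open>A function that is not integrable has Bochner integral 0, so the assumed value 1
    already forces integrability.\<close>
  show i2: "integrable M (\<lambda>\<omega>. (\<xi> 0 \<omega> $ k)\<^sup>2)"
    using v(1) not_integrable_integral_eq by fastforce
  show i1: "integrable M (\<lambda>\<omega>. \<xi> 0 \<omega> $ k)"
    by (rule square_integrable_imp_integrable[OF measurable_compose[OF noise_measurable component_measurable] i2])
  \<comment> \<open>Second moment and variance are both 1, so the square of the mean is 0.\<close>
  show "(\<integral>\<omega>. \<xi> 0 \<omega> $ k \<partial>M) = 0"
    using variance_eq[OF i1 i2] v by simp
  show "(\<integral>\<omega>. \<xi> 0 \<omega> $ k * \<xi> 0 \<omega> $ l \<partial>M) = (if k = l then 1 else 0)"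
    using orth v(1) by (cases "k = l") (simp_all add: power2_eq_square)
qed

lemma innovation_noise:
  fixes \<eta> :: "real^'m \<Rightarrow> real"
  assumes "\<eta> \<in> borel_measurable borel"
  shows "integrable path_law (\<lambda>p. \<eta> (innovation p)) \<longleftrightarrow> integrable M (\<lambda>\<omega>. \<eta> (\<xi> 0 \<omega>))"
    "(\<integral>p. \<eta> (innovation p) \<partial>path_law) = (\<integral>\<omega>. \<eta> (\<xi> 0 \<omega>) \<partial>M)"
proof -
  have m: "(\<lambda>p. \<eta> (innovation p)) \<in> borel_measurable seq_space"
    by (rule measurable_compose[OF innovation_measurable assms])
  note mm = measurable_compose[OF past_measurable m] measurable_compose[OF noise_measurable assms]
  have e: "AE \<omega> in M. \<eta> (innovation (past X 0 \<omega>)) = \<eta> (\<xi> 0 \<omega>)"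
    using noise_eq_innovation[of 0] by eventually_elim simp
  show "integrable path_law (\<lambda>p. \<eta> (innovation p)) \<longleftrightarrow> integrable M (\<lambda>\<omega>. \<eta> (\<xi> 0 \<omega>))"
    unfolding integrable_past_iff[OF m, of 0, symmetric] by (rule integrable_cong_AE[OF mm e])
  show "(\<integral>p. \<eta> (innovation p) \<partial>path_law) = (\<integral>\<omega>. \<eta> (\<xi> 0 \<omega>) \<partial>M)"
    unfolding integral_past[OF m, of 0, symmetric] by (rule integral_cong_AE[OF mm e])
qed

lemma innovation_moments:
  "integrable path_law (\<lambda>p. (innovation p $ k)\<^sup>2)" "integrable path_law (\<lambda>p. innovation p $ k)"
  "(\<integral>p. innovation p $ k \<partial>path_law) = 0"
  "integrable path_law (\<lambda>p. innovation p $ k * innovation p $ l)"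
  "(\<integral>p. innovation p $ k * innovation p $ l \<partial>path_law) = (if k = l then 1 else 0)"
proof -
  note c = component_measurable
  show 2: "integrable path_law (\<lambda>p. (innovation p $ k)\<^sup>2)" for k
  proof -
    have "(\<lambda>x::real^'m. (x $ k)\<^sup>2) \<in> borel_measurable borel" by (rule borel_measurable_power[OF c])
    from innovation_noise(1)[OF this] show ?thesis using noise_moments(1)[of k] by (rule iffD2)
  qed
  show "integrable path_law (\<lambda>p. innovation p $ k)"
    by (rule iffD2[OF innovation_noise(1)[OF c] noise_moments(2)])
  show "(\<integral>p. innovation p $ k \<partial>path_law) = 0"
    by (rule trans[OF innovation_noise(2)[OF c] noise_moments(3)])
  have "(\<lambda>p. innovation p $ l) \<in> borel_measurable path_law" for l
    unfolding measurable_path_law by (rule measurable_compose[OF innovation_measurable c])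
  then show "integrable path_law (\<lambda>p. innovation p $ k * innovation p $ l)"
    by (intro integrable_mult_of_squares 2)
  show "(\<integral>p. innovation p $ k * innovation p $ l \<partial>path_law) = (if k = l then 1 else 0)"
    by (rule trans[OF innovation_noise(2)[OF borel_measurable_times[OF c c]] noise_moments(4)])
qed

text \<open>Invariance of w under resetting coordinate 0 expresses that w depends on the strict past
  alone; this is the form in which independence is applied to lag series.\<close>

lemma innovation_past_product:
  fixes \<eta> :: "real^'m \<Rightarrow> real" and w :: "(nat \<Rightarrow> real^'m) \<Rightarrow> real"
  assumes \<eta>: "\<eta> \<in> borel_measurable borel" and wm: "w \<in> borel_measurable seq_space"
    and w: "\<And>p. w (p(0 := 0)) = w p"
    and i\<eta>: "integrable path_law (\<lambda>p. \<eta> (innovation p))" and iw: "integrable path_law w"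
  shows "integrable path_law (\<lambda>p. \<eta> (innovation p) * w p)"
    "(\<integral>p. \<eta> (innovation p) * w p \<partial>path_law) = (\<integral>p. \<eta> (innovation p) \<partial>path_law) * (\<integral>p. w p \<partial>path_law)"
proof -
  \<comment> \<open>Reindexes w as a function of the path seen one step earlier, with 0 inserted for
    the present value that w ignores.\<close>
  define w' where "w' q = w (\<lambda>j. case j of 0 \<Rightarrow> 0 | Suc i \<Rightarrow> q i)" for q
  have "(\<lambda>q j. case j of 0 \<Rightarrow> 0 | Suc i \<Rightarrow> q i) \<in> measurable seq_space seq_space"
  proof (rule measurable_PiM_single')
    fix j :: nat
    show "(\<lambda>q. case j of 0 \<Rightarrow> 0 | Suc i \<Rightarrow> q i) \<in> borel_measurable seq_space"
    proof (cases j)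
      case (Suc i)
      show ?thesis unfolding Suc nat.case by (rule measurable_component_singleton) (rule UNIV_I)
    qed (simp only: nat.case borel_measurable_const)
  qed (simp add: space_PiM)
  from measurable_compose[OF this wm] have w'm: "w' \<in> borel_measurable seq_space"
    unfolding w'_def [abs_def] .
  have w'w: "w' (past X (0 - 1) \<omega>) = w (past X 0 \<omega>)" for \<omega>
  proof -
    have "(\<lambda>j. case j of 0 \<Rightarrow> 0 | Suc i \<Rightarrow> past X (0 - 1) \<omega> i) = (past X 0 \<omega>)(0 := 0)"
      by (auto simp: fun_eq_iff past_def split: nat.split)
    then show ?thesis by (simp only: w'_def w)
  qed
  have i1: "integrable M (\<lambda>\<omega>. \<eta> (\<xi> 0 \<omega>))" using i\<eta> innovation_noise(1)[OF \<eta>] by blast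
  have i2: "integrable M (\<lambda>\<omega>. w' (past X (0 - 1) \<omega>))"
    unfolding w'w using iw by (rule integrable_past)
  note r = noise_past_product[OF \<eta> w'm i1 i2, unfolded w'w]
  have m: "(\<lambda>p. \<eta> (innovation p) * w p) \<in> borel_measurable seq_space"
    by (intro borel_measurable_times measurable_compose[OF innovation_measurable \<eta>] wm)
  have m': "(\<lambda>\<omega>. \<eta> (\<xi> 0 \<omega>) * w (past X 0 \<omega>)) \<in> borel_measurable M"
    by (intro borel_measurable_times measurable_compose[OF noise_measurable \<eta>] measurable_compose[OF past_measurable wm])
  have e: "AE \<omega> in M. \<eta> (innovation (past X 0 \<omega>)) * w (past X 0 \<omega>) = \<eta> (\<xi> 0 \<omega>) * w (past X 0 \<omega>)"
    using noise_eq_innovation[of 0] by eventually_elim simp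
  show "integrable path_law (\<lambda>p. \<eta> (innovation p) * w p)"
    using r(1) integrable_cong_AE[OF measurable_compose[OF past_measurable m] m' e] integrable_past_iff[OF m, of 0] by blast
  have "(\<integral>p. \<eta> (innovation p) * w p \<partial>path_law) = (\<integral>\<omega>. \<eta> (\<xi> 0 \<omega>) * w (past X 0 \<omega>) \<partial>M)"
    unfolding integral_past[OF m, of 0, symmetric]
    by (rule integral_cong_AE[OF measurable_compose[OF past_measurable m] m' e])
  also have "\<dots> = (\<integral>\<omega>. \<eta> (\<xi> 0 \<omega>) \<partial>M) * (\<integral>\<omega>. w (past X 0 \<omega>) \<partial>M)" using r(2) by simp
  finally show "(\<integral>p. \<eta> (innovation p) * w p \<partial>path_law) = (\<integral>p. \<eta> (innovation p) \<partial>path_law) * (\<integral>p. w p \<partial>path_law)"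
    unfolding integral_past[OF wm, of 0] innovation_noise(2)[OF \<eta>] .
qed

end

section \<open>Convergence of characteristic functions in several dimensions\<close>

text \<open>Finite sums of waves \<open>a cos (c \<bullet> x + b)\<close>, an algebra by the product-to-sum formula.\<close>

inductive trig_sum :: "(real^'d::finite \<Rightarrow> real) \<Rightarrow> bool" where
  wave: "trig_sum (\<lambda>x. a * cos (c \<bullet> x + b))"
| add: "trig_sum f \<Longrightarrow> trig_sum g \<Longrightarrow> trig_sum (\<lambda>x. f x + g x)"

lemma trig_sum_mult:
  assumes "trig_sum f" "trig_sum g" shows "trig_sum (\<lambda>x. f x * g x)"
  using assms(1)
proof induction
  case (wave a c b)
  from assms(2) show ?case
  proof induction
    case (wave a' c' b')
    have "a * cos (c \<bullet> x + b) * (a' * cos (c' \<bullet> x + b')) =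
      (a * a' / 2) * cos ((c - c') \<bullet> x + (b - b')) + (a * a' / 2) * cos ((c + c') \<bullet> x + (b + b'))" for x
    proof -
      have "cos (c \<bullet> x + b) * cos (c' \<bullet> x + b') =
          (cos ((c \<bullet> x + b) - (c' \<bullet> x + b')) + cos ((c \<bullet> x + b) + (c' \<bullet> x + b'))) / 2"
        by (rule cos_times_cos)
      then have "cos (c \<bullet> x + b) * cos (c' \<bullet> x + b') =
          (cos ((c - c') \<bullet> x + (b - b')) + cos ((c + c') \<bullet> x + (b + b'))) / 2"
        by (simp add: inner_diff_left inner_add_left algebra_simps)
      then show ?thesis by (simp add: mult.assoc mult.left_commute[of _ a'] distrib_left)
         (simp add: field_simps)
    qed
    then show ?case by (simp only:) (intro trig_sum.intros)
  next
    case (add f g)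
    then show ?case unfolding distrib_left by (intro trig_sum.add)
  qed
next
  case (add f h)
  then show ?case unfolding distrib_right by (intro trig_sum.add)
qed

lemma trig_sum_const: "trig_sum (\<lambda>_. c)"
  using trig_sum.wave[of c 0 0] by simp

lemma trig_sum_continuous: "trig_sum f \<Longrightarrow> continuous_on S f"
  by (induction rule: trig_sum.induct) (auto intro!: continuous_intros)

lemma trig_sum_bounded: "trig_sum f \<Longrightarrow> \<exists>B. \<forall>x. \<bar>f x\<bar> \<le> B"
proof (induction rule: trig_sum.induct)
  case (wave a c b)
  have "\<bar>a * cos (c \<bullet> x + b)\<bar> \<le> \<bar>a\<bar>" for x
    unfolding abs_mult by (rule mult_left_le) auto
  then show ?case by blast
next
  case (add f g)
  then obtain B C where "\<And>x. \<bar>f x\<bar> \<le> B" "\<And>x. \<bar>g x\<bar> \<le> C" by blast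
  then have "\<bar>f x + g x\<bar> \<le> B + C" for x by (rule order_trans[OF abs_triangle_ineq add_mono])
  then show ?case by blast
qed

text \<open>Allows a polynomial approximation of the clamp to be composed with a trigonometric sum
  without leaving the algebra.\<close>

lemma trig_sum_polynomial:
  assumes "trig_sum f" "real_polynomial_function q"
  shows "trig_sum (\<lambda>x. q (f x))"
  using assms(2)
proof induction
  case (linear h)
  then obtain k where "h = (\<lambda>x. x * k)" using real_bounded_linear by auto
  then show ?case using trig_sum_mult[OF assms(1) trig_sum_const] by simp
qed (auto intro: trig_sum_const trig_sum.add trig_sum_mult)

lemma trig_sum_separates:
  fixes x y :: "real^'d::finite"
  assumes "x \<noteq> y" shows "\<exists>f. trig_sum f \<and> f x \<noteq> f y"
proof -
  from assms obtain i where i: "x $ i \<noteq> y $ i" by (auto simp: vec_eq_iff)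
  \<comment> \<open>The scaling moves both i-th coordinates into the open interval from -pi/2 to
    pi/2, on which the sine is injective; the phase -pi/2 turns the cosine into a sine.\<close>
  define r where "r = pi / (2 * (1 + \<bar>x $ i\<bar> + \<bar>y $ i\<bar>))"
  have r: "r > 0" by (simp add: r_def)
  have b: "\<bar>r * z\<bar> < pi / 2" if "\<bar>z\<bar> \<le> \<bar>x $ i\<bar> + \<bar>y $ i\<bar>" for z
  proof -
    have "r * \<bar>z\<bar> < r * (1 + \<bar>x $ i\<bar> + \<bar>y $ i\<bar>)" using that r by (intro mult_strict_left_mono) auto
    also have "\<dots> = pi / 2" unfolding r_def by (simp add: field_simps add_pos_nonneg)
    finally show ?thesis using r by (simp add: abs_mult)
  qed
  let ?f = "\<lambda>z::real^'d. 1 * cos ((r *\<^sub>R axis i 1) \<bullet> z + - (pi / 2))"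
  have f: "?f z = sin (r * z $ i)" for z
    by (simp add: inner_axis' cos_diff)
  have bx: "\<bar>r * x $ i\<bar> < pi / 2" and by': "\<bar>r * y $ i\<bar> < pi / 2" by (rule b; simp)+
  have "sin (r * x $ i) \<noteq> sin (r * y $ i)"
  proof
    assume eq: "sin (r * x $ i) = sin (r * y $ i)"
    have "r * x $ i = r * y $ i"
    proof (rule sin_inj_pi)
      show "- (pi / 2) \<le> r * x $ i" "r * x $ i \<le> pi / 2" "- (pi / 2) \<le> r * y $ i" "r * y $ i \<le> pi / 2"
        using abs_le_D1[OF less_imp_le[OF bx]] abs_le_D2[OF less_imp_le[OF bx]]
          abs_le_D1[OF less_imp_le[OF by']] abs_le_D2[OF less_imp_le[OF by']] by simp_all
    qed (rule eq)
    then show False using r i by simp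
  qed
  then have "trig_sum ?f \<and> ?f x \<noteq> ?f y" using trig_sum.wave[of 1 "r *\<^sub>R axis i 1" "- (pi / 2)"] unfolding f by simp
  then show ?thesis by blast
qed

lemma trig_sum_approx:
  fixes g :: "real^'d::finite \<Rightarrow> real"
  assumes "compact K" "continuous_on K g" "e > 0"
  obtains f where "trig_sum f" "\<And>x. x \<in> K \<Longrightarrow> \<bar>g x - f x\<bar> < e"
proof -
  interpret function_ring_on "Collect trig_sum" K
    by unfold_locales (use assms in \<open>auto intro: trig_sum_continuous trig_sum.add trig_sum_mult trig_sum_const dest: trig_sum_separates\<close>)
  from Stone_Weierstrass_basic[OF assms(2,3)] that show ?thesis by blast
qed

lemma clamp_nonexpansive:
  fixes y z B :: real
  assumes "\<bar>y\<bar> \<le> B" shows "\<bar>y - max (- B) (min B z)\<bar> \<le> \<bar>y - z\<bar>"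
proof -
  have "- B \<le> y" "y \<le> B" using assms by (simp_all add: abs_le_iff)
  then have "y = max (- B) (min B y)" by simp
  then have "\<bar>y - max (- B) (min B z)\<bar> = \<bar>max (- B) (min B y) - max (- B) (min B z)\<bar>" by simp
  also have "\<dots> \<le> \<bar>min B y - min B z\<bar>" by (auto simp: max_def)
  also have "\<dots> \<le> \<bar>y - z\<bar>" by (auto simp: min_def)
  finally show ?thesis .
qed

lemma (in prob_space) expectation_diff_le:
  fixes f h :: "'a \<Rightarrow> real"
  assumes fh: "integrable M f" "integrable M h" and A: "A \<in> sets M"
    and near: "\<And>\<omega>. \<omega> \<in> space M \<Longrightarrow> \<omega> \<notin> A \<Longrightarrow> \<bar>f \<omega> - h \<omega>\<bar> \<le> e" and far: "\<And>\<omega>. \<bar>f \<omega> - h \<omega>\<bar> \<le> C"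
    and e: "e \<ge> 0"
  shows "\<bar>expectation f - expectation h\<bar> \<le> e + C * prob A"
proof -
  have C: "C \<ge> 0" using far[of undefined] by linarith
  have "expectation f - expectation h = expectation (\<lambda>\<omega>. f \<omega> - h \<omega>)" using fh by simp
  also have "\<bar>\<dots>\<bar> \<le> expectation (\<lambda>\<omega>. e + C * indicator A \<omega>)"
    unfolding real_norm_def[symmetric]
  proof (rule order_trans[OF integral_norm_bound integral_mono])
    fix \<omega> assume "\<omega> \<in> space M"
    then show "norm (f \<omega> - h \<omega>) \<le> e + C * indicator A \<omega>"
      using near[of \<omega>] far[of \<omega>] e C by (auto simp: indicator_def)
  qed (use fh A in \<open>auto simp: emeasure_eq_measure\<close>)
  also have "\<dots> = e + C * prob A" using A
    by (subst Bochner_Integration.integral_add) (auto simp: emeasure_eq_measure prob_space)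
  finally show ?thesis .
qed

text \<open>The clamped trigonometric approximation stays bounded outside the compact set, and clamping is
  itself approximated by polynomials of trigonometric sums.\<close>

lemma weak_convergence_from_waves:
  fixes Y :: "nat \<Rightarrow> 'a \<Rightarrow> real^'d::finite" and \<nu> :: "(real^'d) measure" and g :: "real^'d \<Rightarrow> real"
  assumes "prob_space M" "prob_space \<nu>" and [measurable_cong]: "sets \<nu> = sets borel"
    and [measurable]: "\<And>n. Y n \<in> borel_measurable M"
    and waves: "\<And>c b. (\<lambda>n. \<integral>\<omega>. cos (c \<bullet> Y n \<omega> + b) \<partial>M) \<longlonglongrightarrow> (\<integral>x. cos (c \<bullet> x + b) \<partial>\<nu>)"
    and tight: "\<And>e. e > 0 \<Longrightarrow> \<exists>R. (\<forall>n. measure M {\<omega> \<in> space M. norm (Y n \<omega>) > R} \<le> e) \<and> measure \<nu> {x \<in> space \<nu>. norm x > R} \<le> e"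
    and g: "continuous_on UNIV g" and gb: "\<And>x. \<bar>g x\<bar> \<le> B"
  shows "(\<lambda>n. \<integral>\<omega>. g (Y n \<omega>) \<partial>M) \<longlonglongrightarrow> (\<integral>x. g x \<partial>\<nu>)"
proof -
  interpret M: prob_space M by fact
  interpret N: prob_space \<nu> by fact
  have [measurable]: "g \<in> borel_measurable borel" using g by (rule borel_measurable_continuous_onI)
  have B: "B \<ge> 0" using gb[of 0] by linarith
  have tm: "f \<in> borel_measurable borel" if "trig_sum f" for f
    using trig_sum_continuous[OF that] by (rule borel_measurable_continuous_onI)
  have int: "integrable M (\<lambda>\<omega>. f (Y n \<omega>))" "integrable \<nu> f"
    if "f \<in> borel_measurable borel" "\<And>x. \<bar>f x\<bar> \<le> C" for f :: "real^'d \<Rightarrow> real" and C n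
    using that by (auto intro!: M.integrable_const_bound[where B = C] N.integrable_const_bound[where B = C] AE_I2)
  have int_trig: "integrable M (\<lambda>\<omega>. f (Y n \<omega>))" "integrable \<nu> f" if "trig_sum f" for f n
    using trig_sum_bounded[OF that] int[OF tm[OF that]] by blast+
  have trig: "(\<lambda>n. \<integral>\<omega>. f (Y n \<omega>) \<partial>M) \<longlonglongrightarrow> (\<integral>x. f x \<partial>\<nu>)" if "trig_sum f" for f
    using that
  proof induction
    case (wave a c b)
    show ?case using tendsto_mult_left[OF waves, of a c b] by simp
  next
    case (add f h)
    then show ?case using tendsto_add[OF add.IH] int_trig[OF add(1)] int_trig[OF add(2)] by simp
  qed
  show ?thesis
  proof (rule LIMSEQ_I)
    fix r :: real assume r: "r > 0"
    \<comment> \<open>With mass at most e outside the ball, where the error is at most 2 B + e, and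
      error e inside, each of the two replacements of g costs at most 2 e (1 + 2 B) = r / 3. The
      convergence of the trigonometric sum takes the last third.\<close>
    define e where "e = r / (6 * (1 + 2 * B))"
    have e: "e > 0" using r B by (simp add: e_def)
    obtain R where R: "\<And>n. measure M {\<omega> \<in> space M. norm (Y n \<omega>) > R} \<le> e" "measure \<nu> {x \<in> space \<nu>. norm x > R} \<le> e"
      using tight[OF e] by blast
    have eB: "0 < e / 2" using e by simp
    obtain f where f: "trig_sum f" "\<And>x. x \<in> cball 0 R \<Longrightarrow> \<bar>g x - f x\<bar> < e / 2"
      using trig_sum_approx[OF compact_cball continuous_on_subset[OF g subset_UNIV] eB] by blast
    obtain D where D: "\<And>x. \<bar>f x\<bar> \<le> D" using trig_sum_bounded[OF f(1)] by blast
    define cl where "cl y = max (- B) (min B y)" for y :: real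
    have "continuous_on {-D..D} cl" unfolding cl_def by (intro continuous_intros)
    from Stone_Weierstrass_real_polynomial_function[OF _ this eB]
    obtain q where q: "real_polynomial_function q" "\<And>y. y \<in> {-D..D} \<Longrightarrow> \<bar>cl y - q y\<bar> < e / 2"
      by auto
    define h where "h x = q (f x)" for x
    have h: "trig_sum h" unfolding h_def by (rule trig_sum_polynomial[OF f(1) q(1)])
    have qf: "\<bar>cl (f x) - h x\<bar> < e / 2" for x
      unfolding h_def using q(2)[of "f x"] D[of x] by (auto simp: abs_le_iff)
    have in_ball: "\<bar>g x - h x\<bar> \<le> e" if "\<not> norm x > R" for x
    proof -
      have "\<bar>g x - cl (f x)\<bar> \<le> \<bar>g x - f x\<bar>" unfolding cl_def by (rule clamp_nonexpansive[OF gb])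
      moreover have "\<bar>g x - f x\<bar> < e / 2" using f(2)[of x] that by simp
      ultimately show ?thesis using qf[of x] by linarith
    qed
    have out: "\<bar>g x - h x\<bar> \<le> 2 * B + e" for x
    proof -
      have "\<bar>cl (f x)\<bar> \<le> B" using B unfolding cl_def by linarith
      then show ?thesis using qf[of x] gb[of x] e by linarith
    qed
    have [measurable]: "h \<in> borel_measurable borel" by (rule tm[OF h])
    have aM: "\<bar>(\<integral>\<omega>. g (Y n \<omega>) \<partial>M) - (\<integral>\<omega>. h (Y n \<omega>) \<partial>M)\<bar> \<le> e + (2 * B + e) * measure M {\<omega> \<in> space M. norm (Y n \<omega>) > R}" for n
    proof (rule M.expectation_diff_le)
      show "integrable M (\<lambda>\<omega>. g (Y n \<omega>))" by (rule int[OF _ gb]) measurable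
      show "integrable M (\<lambda>\<omega>. h (Y n \<omega>))" by (rule int_trig[OF h])
      fix \<omega> assume "\<omega> \<in> space M" "\<omega> \<notin> {\<omega> \<in> space M. norm (Y n \<omega>) > R}"
      then show "\<bar>g (Y n \<omega>) - h (Y n \<omega>)\<bar> \<le> e" by (intro in_ball) simp
    qed (use e out in \<open>simp_all add: less_imp_le\<close>)
    have aN: "\<bar>(\<integral>x. g x \<partial>\<nu>) - (\<integral>x. h x \<partial>\<nu>)\<bar> \<le> e + (2 * B + e) * measure \<nu> {x \<in> space \<nu>. norm x > R}"
    proof (rule N.expectation_diff_le)
      show "integrable \<nu> g" by (rule int[OF _ gb]) measurable
      show "integrable \<nu> h" by (rule int_trig[OF h])
      fix x assume "x \<in> space \<nu>" "x \<notin> {x \<in> space \<nu>. norm x > R}"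
      then show "\<bar>g x - h x\<bar> \<le> e" by (intro in_ball) simp
    qed (use e out in \<open>simp_all add: less_imp_le\<close>)
    have small: "e + (2 * B + e) * m \<le> r / 3" if "m \<le> e" "0 \<le> m" "m \<le> 1" for m
    proof -
      have "(2 * B + e) * m = 2 * B * m + e * m" by (simp add: distrib_right)
      also have "\<dots> \<le> 2 * B * e + e * 1" using that B e by (intro add_mono mult_left_mono) auto
      finally have "e + (2 * B + e) * m \<le> 2 * (e * (1 + 2 * B))" using mult_nonneg_nonneg[OF B less_imp_le[OF e]] by (simp add: algebra_simps)
      also have "\<dots> = r / 3"
      proof -
        have "2 * (r / (6 * c) * c) = r / 3" if "c > 0" for c using that by simp
        from this[of "1 + 2 * B"] show ?thesis using B by (simp only: e_def)
      qed
      finally show ?thesis .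
    qed
    have "\<forall>\<^sub>F n in sequentially. dist (\<integral>\<omega>. h (Y n \<omega>) \<partial>M) (\<integral>x. h x \<partial>\<nu>) < r / 3"
      by (rule tendstoD[OF trig[OF h]]) (use r in simp)
    then have "\<forall>\<^sub>F n in sequentially. norm ((\<integral>\<omega>. g (Y n \<omega>) \<partial>M) - (\<integral>x. g x \<partial>\<nu>)) < r"
    proof eventually_elim
      case (elim n)
      then show ?case
        using order_trans[OF aM small[OF R(1)[of n] measure_nonneg M.prob_le_1]]
          order_trans[OF aN small[OF R(2) measure_nonneg N.prob_le_1]]
        unfolding dist_real_def real_norm_def by linarith
    qed
    then show "\<exists>no. \<forall>n\<ge>no. norm ((\<integral>\<omega>. g (Y n \<omega>) \<partial>M) - (\<integral>x. g x \<partial>\<nu>)) < r"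
      by (simp add: eventually_sequentially)
  qed
qed

section \<open>Partial derivatives and series over the lags\<close>

lemma pderivative_eq:
  assumes "(g has_derivative D) (at \<theta>)"
  shows "pderivative k g \<theta> = D (axis k 1)"
proof -
  have 1: "((\<lambda>h. \<theta> + h *\<^sub>R axis k 1) has_derivative (\<lambda>h. h *\<^sub>R axis k 1)) (at 0)"
    by (auto intro!: derivative_eq_intros)
  have "((\<lambda>h. g (\<theta> + h *\<^sub>R axis k 1)) has_derivative (\<lambda>h. D (h *\<^sub>R axis k 1))) (at 0)"
    by (rule has_derivative_compose[OF 1]) (use assms in simp)
  moreover have "D (h *\<^sub>R axis k 1) = h *\<^sub>R D (axis k 1)" for h
    using assms by (intro linear_cmul has_derivative_linear)
  ultimately have "((\<lambda>h. g (\<theta> + h *\<^sub>R axis k 1)) has_vector_derivative D (axis k 1)) (at 0)"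
    by (simp add: has_vector_derivative_def)
  then show ?thesis unfolding pderivative_def by (rule vector_derivative_at)
qed

lemma pderivative_sum_eq:
  assumes "(g has_derivative (\<lambda>v. \<Sum>i\<in>UNIV. v $ i *\<^sub>R D i)) (at \<theta>)"
  shows "pderivative k g \<theta> = D k"
proof -
  have "(\<Sum>i\<in>UNIV. axis k 1 $ i *\<^sub>R D i) = (\<Sum>i\<in>UNIV. if k = i then D i else 0)"
    by (intro sum.cong refl) (simp add: axis_def)
  then show ?thesis by (simp add: pderivative_eq[OF assms])
qed

lemma has_derivative_pderivative:
  fixes g :: "real^'d::finite \<Rightarrow> 'b::real_normed_vector"
  assumes "g differentiable (at \<theta>)"
  shows "(g has_derivative (\<lambda>v. \<Sum>k\<in>UNIV. v $ k *\<^sub>R pderivative k g \<theta>)) (at \<theta>)"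
proof -
  from assms obtain D where D: "(g has_derivative D) (at \<theta>)" by (auto simp: differentiable_def)
  interpret D: linear D by (rule has_derivative_linear[OF D])
  have "D v = (\<Sum>k\<in>UNIV. v $ k *\<^sub>R pderivative k g \<theta>)" for v
  proof -
    have "D v = D (\<Sum>k\<in>UNIV. v $ k *\<^sub>R axis k 1)"
      using basis_expansion[of v] by (simp add: scalar_mult_eq_scaleR)
    also have "\<dots> = (\<Sum>k\<in>UNIV. v $ k *\<^sub>R pderivative k g \<theta>)"
      by (simp add: D.sum D.scale pderivative_eq[OF D])
    finally show ?thesis .
  qed
  then have "D = (\<lambda>v. \<Sum>k\<in>UNIV. v $ k *\<^sub>R pderivative k g \<theta>)" by (rule ext)
  then show ?thesis using D by simp
qed

lemma C2_onD:
  fixes g :: "real^'d::finite \<Rightarrow> 'b::real_normed_vector"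
  assumes "C2_on S g" "\<theta> \<in> S"
  shows "(g has_derivative (\<lambda>v. \<Sum>k\<in>UNIV. v $ k *\<^sub>R pderivative k g \<theta>)) (at \<theta>)"
    "(pderivative j g has_derivative (\<lambda>v. \<Sum>k\<in>UNIV. v $ k *\<^sub>R pderivative k (pderivative j g) \<theta>)) (at \<theta>)"
    "continuous_on S (pderivative k (pderivative j g))"
proof -
  from assms(1) obtain U where U: "open U" "S \<subseteq> U" "g differentiable_on U" "pderivative j g differentiable_on U"
    "continuous_on U (pderivative k (pderivative j g))" for j k
    unfolding C2_on_def by blast
  have \<theta>: "\<theta> \<in> U" using U assms(2) by blast
  have d: "h differentiable (at \<theta>)" if "h differentiable_on U" for h :: "real^'d \<Rightarrow> 'b"
    using that \<theta> U(1) by (simp add: differentiable_on_eq_differentiable_at)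
  show "(g has_derivative (\<lambda>v. \<Sum>k\<in>UNIV. v $ k *\<^sub>R pderivative k g \<theta>)) (at \<theta>)"
    "(pderivative j g has_derivative (\<lambda>v. \<Sum>k\<in>UNIV. v $ k *\<^sub>R pderivative k (pderivative j g) \<theta>)) (at \<theta>)"
    by (intro has_derivative_pderivative d U)+
  show "continuous_on S (pderivative k (pderivative j g))" by (rule continuous_on_subset[OF U(5,2)])
qed

text \<open>\<open>ar_fun\<close> regrouped: the value at the zero sequence is split off and every
  lag term is centred at 0, so Lipschitz bounds alone give absolute convergence. Differentiation in
  the parameter turns a lag series into a lag series, hence one set of lemmas covers f and its
  derivatives.\<close>

definition lag_series ::
  "('p \<Rightarrow> 'b::real_normed_vector) \<Rightarrow> (nat \<Rightarrow> 'p \<Rightarrow> 'c::zero \<Rightarrow> 'b) \<Rightarrow> 'p \<Rightarrow> (nat \<Rightarrow> 'c) \<Rightarrow> 'b" where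
  "lag_series a0 a \<theta> p = a0 \<theta> + (\<Sum>j. a (Suc j) \<theta> (p (Suc j)) - a (Suc j) \<theta> 0)"

lemma lag_series_continuous_on:
  fixes a0 :: "real^'d::finite \<Rightarrow> real^'m::finite" and a :: "nat \<Rightarrow> real^'d \<Rightarrow> real^'m \<Rightarrow> real^'m"
  assumes "continuous_on V a0" "\<And>j x. continuous_on V (\<lambda>\<theta>. a (Suc j) \<theta> x - a (Suc j) \<theta> 0)"
    and b: "\<And>j x \<theta>. \<theta> \<in> V \<Longrightarrow> norm (a (Suc j) \<theta> x - a (Suc j) \<theta> 0) \<le> b (Suc j) * norm x"
    and s: "summable (\<lambda>j. b (Suc j) * norm (p (Suc j)))"
  shows "continuous_on V (\<lambda>\<theta>. lag_series a0 a \<theta> p)"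
proof -
  have ul: "uniform_limit V (\<lambda>n \<theta>. \<Sum>j<n. a (Suc j) \<theta> (p (Suc j)) - a (Suc j) \<theta> 0)
    (\<lambda>\<theta>. \<Sum>j. a (Suc j) \<theta> (p (Suc j)) - a (Suc j) \<theta> 0) sequentially"
    by (rule Weierstrass_m_test[OF b s])
  have ev: "\<forall>\<^sub>F n in sequentially. continuous_on V (\<lambda>\<theta>. \<Sum>j<n. a (Suc j) \<theta> (p (Suc j)) - a (Suc j) \<theta> 0)"
    by (intro always_eventually allI continuous_on_sum assms(2))
  have "continuous_on V (\<lambda>\<theta>. \<Sum>j. a (Suc j) \<theta> (p (Suc j)) - a (Suc j) \<theta> 0)"
    by (rule uniform_limit_theorem[OF ev ul]) simp
  then show ?thesis unfolding lag_series_def by (intro continuous_on_add assms(1))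
qed

text \<open>Termwise differentiation. The derivatives of the partial sums converge uniformly on V
  because the tails of the dominating series do not depend on the parameter.\<close>

lemma lag_series_has_derivative:
  fixes a0 :: "real^'d::finite \<Rightarrow> real^'m::finite" and a :: "nat \<Rightarrow> real^'d \<Rightarrow> real^'m \<Rightarrow> real^'m"
  assumes V: "open V" "convex V"
    and a0: "\<And>\<theta>. \<theta> \<in> V \<Longrightarrow> (a0 has_derivative (\<lambda>v. \<Sum>k\<in>UNIV. v $ k *\<^sub>R a0' k \<theta>)) (at \<theta>)"
    and a: "\<And>j x \<theta>. \<theta> \<in> V \<Longrightarrow> ((\<lambda>\<theta>. a (Suc j) \<theta> x) has_derivative (\<lambda>v. \<Sum>k\<in>UNIV. v $ k *\<^sub>R a' k (Suc j) \<theta> x)) (at \<theta>)"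
    and b: "\<And>j x \<theta>. \<theta> \<in> V \<Longrightarrow> norm (a (Suc j) \<theta> x - a (Suc j) \<theta> 0) \<le> b (Suc j) * norm x"
    and b': "\<And>k j x \<theta>. \<theta> \<in> V \<Longrightarrow> norm (a' k (Suc j) \<theta> x - a' k (Suc j) \<theta> 0) \<le> b (Suc j) * norm x"
    and s: "summable (\<lambda>j. b (Suc j) * norm (p (Suc j)))" and \<theta>: "\<theta> \<in> V"
  shows "((\<lambda>\<theta>. lag_series a0 a \<theta> p) has_derivative (\<lambda>v. \<Sum>k\<in>UNIV. v $ k *\<^sub>R lag_series (a0' k) (a' k) \<theta> p)) (at \<theta>)"
proof -
  let ?f = "\<lambda>j \<theta>. a (Suc j) \<theta> (p (Suc j)) - a (Suc j) \<theta> 0"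
  let ?c = "\<lambda>k j \<theta>. a' k (Suc j) \<theta> (p (Suc j)) - a' k (Suc j) \<theta> 0"
  let ?B = "\<lambda>j. b (Suc j) * norm (p (Suc j))"
  have f': "(?f j has_derivative (\<lambda>v. \<Sum>k\<in>UNIV. v $ k *\<^sub>R ?c k j \<theta>)) (at \<theta>)" if "\<theta> \<in> V" for j \<theta>
    using has_derivative_diff[OF a[OF that, of j "p (Suc j)"] a[OF that, of j 0]]
    by (simp add: scaleR_diff_right sum_subtractf)
  have sc: "summable (\<lambda>j. ?c k j \<theta>)" if "\<theta> \<in> V" for k \<theta>
    by (rule summable_comparison_test'[OF s, of 0]) (rule b'[OF that])
  have sf: "summable (\<lambda>j. ?f j \<theta>)" if "\<theta> \<in> V" for \<theta>
    by (rule summable_comparison_test'[OF s, of 0]) (rule b[OF that])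
  have tail: "norm ((\<Sum>i<n. ?c k i \<theta>) - (\<Sum>i. ?c k i \<theta>)) \<le> (\<Sum>i. ?B (i + n))" if "\<theta> \<in> V" for k n \<theta>
  proof -
    have "(\<Sum>i<n. ?c k i \<theta>) - (\<Sum>i. ?c k i \<theta>) = - (\<Sum>i. ?c k (i + n) \<theta>)"
      by (subst suminf_split_initial_segment[OF sc[OF that], of _ n]) simp
    moreover have "norm (\<Sum>i. ?c k (i + n) \<theta>) \<le> (\<Sum>i. ?B (i + n))"
      by (rule norm_suminf_le[OF _ summable_ignore_initial_segment[OF s]])
        (rule b'[OF that])
    ultimately show ?thesis by (simp only: norm_minus_cancel)
  qed
  have "\<exists>g. \<forall>x\<in>V. (\<lambda>n. ?f n x) sums g x \<and> (g has_derivative (\<lambda>v. \<Sum>k\<in>UNIV. v $ k *\<^sub>R (\<Sum>j. ?c k j x))) (at x within V)"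
  proof (rule has_derivative_series[OF V(2) _ _ \<theta>])
    show "(?f n has_derivative (\<lambda>v. \<Sum>k\<in>UNIV. v $ k *\<^sub>R ?c k n x)) (at x within V)" if "x \<in> V" for n x
      using f'[OF that] by (rule has_derivative_at_withinI)
    show "(\<lambda>n. ?f n \<theta>) sums suminf (\<lambda>n. ?f n \<theta>)" by (rule summable_sums[OF sf[OF \<theta>]])
    fix e :: real assume e: "e > 0"
    \<comment> \<open>The derivative is a sum over the coordinates of the parameter; each coordinate
      receives an equal share of e.\<close>
    define r where "r = e / real CARD('d)"
    have r: "r > 0" using e by (simp add: r_def)
    obtain N where N: "\<And>n. n \<ge> N \<Longrightarrow> norm (\<Sum>i. ?B (i + n)) < r"
      using suminf_exist_split[OF r s] by blast
    have "norm ((\<Sum>i<n. \<Sum>k\<in>UNIV. h $ k *\<^sub>R ?c k i x) - (\<Sum>k\<in>UNIV. h $ k *\<^sub>R (\<Sum>j. ?c k j x))) \<le> e * norm h"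
      if "n \<ge> N" "x \<in> V" for n x and h :: "real^'d"
    proof -
      have "(\<Sum>i<n. \<Sum>k\<in>UNIV. h $ k *\<^sub>R ?c k i x) = (\<Sum>k\<in>UNIV. h $ k *\<^sub>R (\<Sum>i<n. ?c k i x))"
        by (subst sum.swap) (simp only: scaleR_sum_right)
      then have "(\<Sum>i<n. \<Sum>k\<in>UNIV. h $ k *\<^sub>R ?c k i x) - (\<Sum>k\<in>UNIV. h $ k *\<^sub>R (\<Sum>j. ?c k j x))
        = (\<Sum>k\<in>UNIV. h $ k *\<^sub>R ((\<Sum>i<n. ?c k i x) - (\<Sum>j. ?c k j x)))"
        by (simp only: scaleR_diff_right sum_subtractf)
      also have "norm \<dots> \<le> (\<Sum>k\<in>(UNIV::'d set). norm h * r)"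
      proof (rule sum_norm_le)
        fix k
        have "norm ((\<Sum>i<n. ?c k i x) - (\<Sum>j. ?c k j x)) \<le> r"
          by (rule order_trans[OF tail[OF that(2)] order_trans[OF abs_ge_self
              less_imp_le[OF N[OF that(1), unfolded real_norm_def]]]])
        then show "norm (h $ k *\<^sub>R ((\<Sum>i<n. ?c k i x) - (\<Sum>j. ?c k j x))) \<le> norm h * r"
          unfolding norm_scaleR by (intro mult_mono component_le_norm_cart norm_ge_zero)
      qed
      also have "\<dots> = e * norm h" by (simp add: r_def)
      finally show ?thesis .
    qed
    then show "\<forall>\<^sub>F n in sequentially. \<forall>x\<in>V. \<forall>h. norm ((\<Sum>i<n. \<Sum>k\<in>UNIV. h $ k *\<^sub>R ?c k i x) -
        (\<Sum>k\<in>UNIV. h $ k *\<^sub>R (\<Sum>j. ?c k j x))) \<le> e * norm h"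
      unfolding eventually_sequentially by blast
  qed
  then obtain g where g: "\<And>x. x \<in> V \<Longrightarrow> (\<lambda>n. ?f n x) sums g x"
    "\<And>x. x \<in> V \<Longrightarrow> (g has_derivative (\<lambda>v. \<Sum>k\<in>UNIV. v $ k *\<^sub>R (\<Sum>j. ?c k j x))) (at x within V)"
    by blast
  have "(g has_derivative (\<lambda>v. \<Sum>k\<in>UNIV. v $ k *\<^sub>R (\<Sum>j. ?c k j \<theta>))) (at \<theta>)"
    using g(2)[OF \<theta>] by (simp only: at_within_open[OF \<theta> V(1)])
  then have "((\<lambda>\<theta>. \<Sum>j. ?f j \<theta>) has_derivative (\<lambda>v. \<Sum>k\<in>UNIV. v $ k *\<^sub>R (\<Sum>j. ?c k j \<theta>))) (at \<theta>)"
    by (rule has_derivative_transform_within_open[OF _ V(1) \<theta>]) (rule sums_unique[OF g(1)])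
  from has_derivative_add[OF a0[OF \<theta>] this] show ?thesis
    unfolding lag_series_def by (simp only: scaleR_add_right sum.distrib)
qed

section \<open>Congruence of a positive definite matrix to the identity\<close>

text \<open>Gram-Schmidt for the bilinear form of H; the columns of P are the orthonormal vectors.
  Then \<open>P ** transpose P\<close> is the inverse of H, so P is a square root of the limiting
  covariance as demanded by \<open>normal_law\<close>.\<close>

lemma positive_definite_congruent_identity:
  fixes H :: "real^'d::finite^'d"
  assumes sym: "transpose H = H" and pos: "\<And>x. x \<noteq> 0 \<Longrightarrow> x \<bullet> (H *v x) > 0"
  shows "\<exists>P :: real^'d^'d. transpose P ** H ** P = mat 1"
proof -
  define f where "f x y = x \<bullet> (H *v y)" for x y
  have fsym: "f x y = f y x" for x y
    unfolding f_def by (metis dot_lmul_matrix inner_commute sym vector_transpose_matrix)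
  have fadd: "f (x - y) z = f x z - f y z" for x y z unfolding f_def by (simp add: inner_diff_left)
  have fscale: "f (r *\<^sub>R x) z = r * f x z" for r x z unfolding f_def by simp
  have fsum: "f (\<Sum>i\<in>S. g i) z = (\<Sum>i\<in>S. f (g i) z)" for g :: "'d \<Rightarrow> real^'d" and S z
    unfolding f_def by (simp add: inner_sum_left)
  have "\<exists>b :: 'd \<Rightarrow> real^'d. (\<forall>i\<in>S. \<forall>k. k \<notin> S \<longrightarrow> b i $ k = 0) \<and>
      (\<forall>i\<in>S. \<forall>j\<in>S. f (b i) (b j) = (if i = j then 1 else 0))" for S :: "'d set"
    using finite[of S]
  proof (induction S rule: finite_induct)
    case (insert k S)
    then obtain b where supp: "\<And>i l. i \<in> S \<Longrightarrow> l \<notin> S \<Longrightarrow> b i $ l = 0"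
      and orth: "\<And>i j. i \<in> S \<Longrightarrow> j \<in> S \<Longrightarrow> f (b i) (b j) = (if i = j then 1 else 0)"
      by blast
    \<comment> \<open>The earlier vectors are supported in S, so the k-th coordinate of
      \<open>w\<close> is still 1 and \<open>w\<close> is nonzero. Carrying the support through the
      induction serves this purpose.\<close>
    define w where "w = axis k 1 - (\<Sum>i\<in>S. f (axis k 1) (b i) *\<^sub>R b i)"
    have wl: "w $ l = (if l = k then 1 else 0)" if "l \<notin> S" for l
      using that supp by (simp add: w_def axis_def)
    then have "w \<noteq> 0" using insert(2) by (metis zero_index zero_neq_one)
    then have n: "f w w > 0" using pos by (simp add: f_def)
    have wb: "f w (b j) = 0" if "j \<in> S" for j
    proof -
      have "f w (b j) = f (axis k 1) (b j) - (\<Sum>i\<in>S. f (axis k 1) (b i) * f (b i) (b j))"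
        by (simp add: w_def fadd fsum fscale)
      also have "(\<Sum>i\<in>S. f (axis k 1) (b i) * f (b i) (b j)) = (\<Sum>i\<in>S. if i = j then f (axis k 1) (b i) else 0)"
        by (intro sum.cong refl) (simp add: orth that)
      also have "\<dots> = f (axis k 1) (b j)" using that insert(1) by simp
      finally show ?thesis by simp
    qed
    let ?c = "1 / sqrt (f w w)"
    have ww: "f (?c *\<^sub>R w) (?c *\<^sub>R w) = 1"
      using n by (simp add: fscale fsym[of w "?c *\<^sub>R w"] real_sqrt_mult[symmetric] del: real_sqrt_mult)
    let ?b = "b(k := ?c *\<^sub>R w)"
    have "\<forall>i\<in>insert k S. \<forall>l. l \<notin> insert k S \<longrightarrow> ?b i $ l = 0"
      using wl supp by auto
    moreover have "\<forall>i\<in>insert k S. \<forall>j\<in>insert k S. f (?b i) (?b j) = (if i = j then 1 else 0)"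
      using insert(2) orth wb ww fsym[of "b _" "?c *\<^sub>R w"] by (auto simp: fscale)
    ultimately show ?case by blast
  qed simp
  from this[of UNIV] obtain b :: "'d \<Rightarrow> real^'d" where "\<forall>i\<in>UNIV. \<forall>j\<in>UNIV. f (b i) (b j) = (if i = j then 1 else 0)" by blast
  then have b: "f (b i) (b j) = (if i = j then 1 else 0)" for i j by simp
  define P :: "real^'d^'d" where "P = (\<chi> r c. b c $ r)"
  have "(transpose P ** H ** P) $ i $ j = f (b i) (b j)" for i j
    by (simp add: f_def P_def matrix_matrix_mult_def transpose_def matrix_vector_mult_def inner_vec_def
        sum_distrib_left sum_distrib_right mult.assoc) (subst sum.swap, simp)
  then have "transpose P ** H ** P = mat 1" by (simp add: vec_eq_iff b mat_def)
  then show ?thesis by blast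
qed

lemma inverse_of_congruent_identity:
  fixes H P :: "real^'d::finite^'d"
  assumes "transpose P ** H ** P = mat 1"
  shows "H ** (P ** transpose P) = mat 1" "P ** transpose P ** H = mat 1"
proof -
  have "P ** (transpose P ** H) = mat 1" using assms matrix_left_right_inverse by metis
  then show "P ** transpose P ** H = mat 1" by (simp add: matrix_mul_assoc)
  then show "H ** (P ** transpose P) = mat 1" using matrix_left_right_inverse by metis
qed

section \<open>Normal laws\<close>

text \<open>Lebesgue measure on vectors is an image of the product measure indexed by
  \<open>Basis\<close>; the work consists in reindexing \<open>Basis\<close> by the coordinates
  through \<open>axis\<close>.\<close>

lemma lborel_vec_integral_prod:
  fixes g :: "'d::finite \<Rightarrow> real \<Rightarrow> 'b::{real_normed_field, banach, second_countable_topology}"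
  assumes g: "\<And>i. integrable lborel (g i)"
  shows "integrable lborel (\<lambda>x::real^'d. \<Prod>i\<in>UNIV. g i (x $ i))"
    "(\<integral>x. (\<Prod>i\<in>UNIV. g i (x $ i)) \<partial>lborel) = (\<Prod>i\<in>UNIV. \<integral>z. g i z \<partial>lborel)"
proof -
  let ?B = "Basis :: (real^'d) set"
  let ?ax = "\<lambda>i::'d. axis i (1::real)"
  let ?s = "\<lambda>f. \<Sum>b\<in>?B. f b *\<^sub>R b"
  let ?P = "Pi\<^sub>M ?B (\<lambda>_. lborel) :: (real^'d \<Rightarrow> real) measure"
  interpret product_sigma_finite "\<lambda>_::real^'d. lborel :: real measure" by unfold_locales
  have B: "?B = range ?ax" by (auto simp: Basis_vec_def)
  have inj: "inj ?ax" by (auto simp: inj_on_def axis_eq_axis)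
  have [measurable]: "g i \<in> borel_measurable borel" for i using borel_measurable_integrable[OF g[of i]] by simp
  have comp: "?s f $ i = f (?ax i)" for f i
  proof -
    have "?s f $ i = (\<Sum>j\<in>UNIV. f (?ax j) * (?ax j $ i))"
      by (simp only: sum_component vector_scaleR_component real_scaleR_def B sum.reindex[OF inj] comp_def)
    also have "\<dots> = (\<Sum>j\<in>UNIV. if i = j then f (?ax j) else 0)"
      by (intro sum.cong refl) (simp add: axis_def)
    finally show ?thesis by simp
  qed
  define h where "h b = g (inv ?ax b)" for b
  have hax: "h (?ax i) = g i" for i unfolding h_def by (simp add: inv_f_f[OF inj])
  have prod_eq: "(\<Prod>i\<in>UNIV. g i (?s f $ i)) = (\<Prod>b\<in>?B. h b (f b))" for f
    unfolding comp by (simp add: B prod.reindex[OF inj] hax)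
  have sm: "?s \<in> measurable ?P borel" by measurable
  have hint: "integrable lborel (h b)" if "b \<in> ?B" for b using that g by (auto simp: B hax)
  have L: "(lborel :: (real^'d) measure) = distr ?P borel ?s" by (rule lborel_eq)
  have m: "(\<lambda>x::real^'d. \<Prod>i\<in>UNIV. g i (x $ i)) \<in> borel_measurable borel" by measurable
  show "integrable lborel (\<lambda>x::real^'d. \<Prod>i\<in>UNIV. g i (x $ i))"
    unfolding L integrable_distr_eq[OF sm m] prod_eq by (intro product_integrable_prod hint) simp
  have "(\<integral>x. (\<Prod>i\<in>UNIV. g i (x $ i)) \<partial>lborel) = (\<Prod>b\<in>?B. \<integral>z. h b z \<partial>lborel)"
    unfolding L integral_distr[OF sm m] prod_eq by (intro product_integral_prod hint) simp
  also have "\<dots> = (\<Prod>i\<in>UNIV. \<integral>z. g i z \<partial>lborel)" by (simp add: B prod.reindex[OF inj] hax)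
  finally show "(\<integral>x. (\<Prod>i\<in>UNIV. g i (x $ i)) \<partial>lborel) = (\<Prod>i\<in>UNIV. \<integral>z. g i z \<partial>lborel)" .
qed

lemma prob_space_std_normal_vec: "prob_space (std_normal_vec :: (real^'d::finite) measure)"
proof
  let ?f = "\<lambda>x::real^'d. \<Prod>i\<in>UNIV. std_normal_density (x $ i)"
  have i: "integrable lborel ?f" "integral\<^sup>L lborel ?f = 1"
    using lborel_vec_integral_prod[of "\<lambda>_. std_normal_density"] by auto
  have "emeasure std_normal_vec (space (std_normal_vec :: (real^'d) measure)) = (\<integral>\<^sup>+x. ennreal (?f x) \<partial>lborel)"
    unfolding std_normal_vec_def by (subst emeasure_density) auto
  also have "\<dots> = 1" using i by (subst nn_integral_eq_integral) (auto intro!: prod_nonneg AE_I2)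
  finally show "emeasure std_normal_vec (space (std_normal_vec :: (real^'d) measure)) = 1" .
qed

lemma char_std_normal_vec:
  fixes c :: "real^'d::finite"
  shows "(\<integral>x. iexp (c \<bullet> x) \<partial>std_normal_vec) = of_real (exp (- (c \<bullet> c) / 2))"
proof -
  let ?g = "\<lambda>i z. std_normal_density z *\<^sub>R iexp (c $ i * z)"
  have gi: "(\<integral>z. ?g i z \<partial>lborel) = of_real (exp (- (c $ i)\<^sup>2 / 2))" for i
    using char_std_normal_distribution[THEN fun_cong, of "c $ i"] unfolding char_def
    by (subst (asm) integral_density) (auto simp: exp_of_real[symmetric])
  have int: "integrable lborel (?g i)" for i
    by (rule Bochner_Integration.integrable_bound[of _ std_normal_density]) auto
  have "(\<integral>x. iexp (c \<bullet> x) \<partial>std_normal_vec) = (\<integral>x. (\<Prod>i\<in>UNIV. std_normal_density (x $ i)) *\<^sub>R iexp (c \<bullet> x) \<partial>lborel)"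
    unfolding std_normal_vec_def by (subst integral_density) (auto intro!: prod_nonneg AE_I2)
  also have "\<dots> = (\<integral>x. (\<Prod>i\<in>UNIV. ?g i (x $ i)) \<partial>lborel)"
    by (intro Bochner_Integration.integral_cong refl)
      (simp add: prod.distrib scaleR_conv_of_real inner_vec_def exp_sum[symmetric] sum_distrib_left)
  also have "\<dots> = (\<Prod>i\<in>UNIV. of_real (exp (- (c $ i)\<^sup>2 / 2)))"
    by (simp only: lborel_vec_integral_prod(2)[OF int] gi)
  also have "\<dots> = of_real (exp (\<Sum>i\<in>UNIV. - (c $ i)\<^sup>2 / 2))"
    by (simp only: of_real_prod[symmetric] exp_sum[OF finite])
  also have "(\<Sum>i\<in>UNIV. - (c $ i)\<^sup>2 / 2) = - (c \<bullet> c) / 2"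
    by (simp only: inner_vec_def inner_real_def power2_eq_square[symmetric] sum_divide_distrib sum_negf[symmetric])
  finally show ?thesis .
qed

text \<open>The law is written with the summand 0 to match \<open>normal_law\<close> with mean 0
  literally. The squared norm of \<open>transpose P *v c\<close> is the quadratic form of
  \<open>P ** transpose P\<close> at c.\<close>

lemma wave_normal_law:
  fixes c :: "real^'d::finite" and P :: "real^'d^'d"
  defines "\<nu> \<equiv> distr std_normal_vec borel (\<lambda>z. 0 + P *v z)"
  shows "prob_space \<nu>"
    and "(\<integral>x. cos (c \<bullet> x + b) \<partial>\<nu>) = Re (iexp b * of_real (exp (- ((transpose P *v c) \<bullet> (transpose P *v c)) / 2)))"
proof -
  interpret N: prob_space "std_normal_vec :: (real^'d) measure" by (rule prob_space_std_normal_vec)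
  have s [measurable_cong]: "sets (std_normal_vec :: (real^'d) measure) = sets borel" by (simp add: std_normal_vec_def)
  have "(\<lambda>z. 0 + P *v z) \<in> borel_measurable borel"
    by (intro borel_measurable_continuous_onI) (simp add: matrix_vector_mult_linear_continuous_on)
  then have Pm' [measurable]: "(\<lambda>z. 0 + P *v z) \<in> measurable std_normal_vec borel" using measurable_cong_sets[OF s refl] by blast
  show "prob_space \<nu>" unfolding \<nu>_def by (rule N.prob_space_distr[OF Pm'])
  let ?d = "transpose P *v c"
  have *: "c \<bullet> (0 + P *v z) = ?d \<bullet> z" for z
    using dot_lmul_matrix[of c P z] vector_transpose_matrix[of c "transpose P"] by simp
  have "(\<integral>x. cos (c \<bullet> x + b) \<partial>\<nu>) = (\<integral>z. cos (?d \<bullet> z + b) \<partial>std_normal_vec)"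
    unfolding \<nu>_def by (subst integral_distr[OF Pm']) (simp_all only: *, measurable)
  also have "\<dots> = (\<integral>z. Re (iexp b * iexp (?d \<bullet> z)) \<partial>std_normal_vec)"
    by (intro Bochner_Integration.integral_cong refl) (simp add: Re_exp exp_add[symmetric] ac_simps)
  also have "\<dots> = Re (\<integral>z. iexp b * iexp (?d \<bullet> z) \<partial>std_normal_vec)"
    by (intro integral_Re N.integrable_const_bound[where B = 1]) (auto simp: norm_mult)
  also have "(\<integral>z. iexp b * iexp (?d \<bullet> z) \<partial>std_normal_vec) = iexp b * of_real (exp (- (?d \<bullet> ?d) / 2))"
    by (simp only: integral_mult_right_zero char_std_normal_vec)
  finally show "(\<integral>x. cos (c \<bullet> x + b) \<partial>\<nu>) = Re (iexp b * of_real (exp (- (?d \<bullet> ?d) / 2)))" .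
qed

lemma (in prob_space) tight_single:
  fixes e :: real and Y :: "'a \<Rightarrow> 'b::real_normed_vector"
  assumes [measurable]: "(\<lambda>x. norm (Y x)) \<in> borel_measurable M" and e: "e > 0"
  obtains R where "prob {x \<in> space M. norm (Y x) > R} \<le> e"
proof -
  let ?A = "\<lambda>n::nat. {x \<in> space M. norm (Y x) > real n}"
  have "(\<lambda>n. prob (?A n)) \<longlonglongrightarrow> prob (\<Inter>n. ?A n)"
    by (rule finite_Lim_measure_decseq) (auto simp: decseq_def)
  moreover have "(\<Inter>n. ?A n) = {}"
  proof -
    have "\<exists>n. \<not> norm (Y x) > real n" for x
      using reals_Archimedean2[of "norm (Y x)"] less_asym by blast
    then show ?thesis by blast
  qed
  ultimately have "(\<lambda>n. prob (?A n)) \<longlonglongrightarrow> 0" by simp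
  then have "\<forall>\<^sub>F n in sequentially. prob (?A n) < e" by (rule order_tendstoD) (rule e)
  then show ?thesis using that by (auto simp: eventually_sequentially intro: less_imp_le)
qed

section \<open>Families of functions of the past\<close>

lemma integrable_power2_add:
  fixes f g :: "'a \<Rightarrow> real"
  assumes "f \<in> borel_measurable M" "g \<in> borel_measurable M"
    "integrable M (\<lambda>x. (f x)\<^sup>2)" "integrable M (\<lambda>x. (g x)\<^sup>2)"
  shows "integrable M (\<lambda>x. (f x + g x)\<^sup>2)"
proof -
  have "integrable M (\<lambda>x. (f x)\<^sup>2 + (g x)\<^sup>2 + 2 * (f x * g x))"
    by (intro Bochner_Integration.integrable_add integrable_mult_right integrable_mult_of_squares assms)
  then show ?thesis by (simp only: power2_sum mult.assoc)
qed

text \<open>By Cauchy-Schwarz the sum over t >= N is at most sqrt n times the square root of the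
  remaining sum of squares, which is small for large N; the first N terms are constant in n.\<close>

lemma sum_over_sqrt_tendsto_0:
  fixes l :: "nat \<Rightarrow> real"
  assumes l: "\<And>t. l t \<ge> 0" and s: "summable (\<lambda>t. (l t)\<^sup>2)"
  shows "(\<lambda>n. (\<Sum>t=1..n. l t) / sqrt (real n)) \<longlonglongrightarrow> 0"
proof (rule LIMSEQ_I)
  fix r :: real assume r: "r > 0"
  then have "(r / 2)\<^sup>2 > 0" by simp
  from suminf_exist_split[OF this s] obtain N where N: "norm (\<Sum>i. (l (i + N))\<^sup>2) < (r / 2)\<^sup>2" by blast
  define C where "C = (\<Sum>t<N. l t)"
  have tail: "(\<Sum>t=N..n. (l t)\<^sup>2) \<le> (r / 2)\<^sup>2" for n
  proof -
    have "(\<Sum>t=N..n. (l t)\<^sup>2) \<le> (\<Sum>t=0+N..<n+1+N. (l t)\<^sup>2)" by (rule sum_mono2) auto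
    also have "\<dots> = (\<Sum>i<n+1. (l (i + N))\<^sup>2)"
      by (simp only: sum.shift_bounds_nat_ivl lessThan_atLeast0)
    also have "\<dots> \<le> (\<Sum>i. (l (i + N))\<^sup>2)"
      by (rule sum_le_suminf[OF summable_ignore_initial_segment[OF s]]) simp_all
    finally show ?thesis using N by simp
  qed
  have bound: "(\<Sum>t=1..n. l t) / sqrt (real n) \<le> C / sqrt (real n) + r / 2" if n: "n > 0" "n \<ge> N" for n
  proof -
    have "(\<Sum>t=max 1 N..n. l t)\<^sup>2 = (\<Sum>t=max 1 N..n. 1 * l t)\<^sup>2" by simp
    also have "\<dots> \<le> (\<Sum>t=max 1 N..n. 1\<^sup>2) * (\<Sum>t=max 1 N..n. (l t)\<^sup>2)" by (rule Cauchy_Schwarz_ineq_sum)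
    also have "\<dots> \<le> real n * (r / 2)\<^sup>2"
    proof (rule mult_mono)
      have "card {max 1 N..n} \<le> card {1..n}" by (rule card_mono) auto
      then show "(\<Sum>t=max 1 N..n. 1\<^sup>2) \<le> real n" by simp
      have "(\<Sum>t=max 1 N..n. (l t)\<^sup>2) \<le> (\<Sum>t=N..n. (l t)\<^sup>2)" by (rule sum_mono2) auto
      then show "(\<Sum>t=max 1 N..n. (l t)\<^sup>2) \<le> (r / 2)\<^sup>2" using tail[of n] by linarith
    qed (simp_all add: sum_nonneg)
    also have "\<dots> = (sqrt (real n) * (r / 2))\<^sup>2"
      by (simp only: power_mult_distrib real_sqrt_pow2 of_nat_0_le_iff)
    finally have 1: "(\<Sum>t=max 1 N..n. l t) \<le> sqrt (real n) * (r / 2)"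
      by (rule power2_le_imp_le) (use r in simp)
    have "(\<Sum>t=1..n. l t) \<le> (\<Sum>t\<in>{..<N} \<union> {max 1 N..n}. l t)" by (rule sum_mono2) (auto simp: l)
    also have "\<dots> = C + (\<Sum>t=max 1 N..n. l t)" unfolding C_def by (rule sum.union_disjoint) auto
    finally have "(\<Sum>t=1..n. l t) \<le> C + sqrt (real n) * (r / 2)" using 1 by linarith
    then have "(\<Sum>t=1..n. l t) / sqrt (real n) \<le> (C + sqrt (real n) * (r / 2)) / sqrt (real n)"
      by (rule divide_right_mono) simp
    also have "\<dots> = C / sqrt (real n) + r / 2" using n by (simp add: add_divide_distrib)
    finally show ?thesis .
  qed
  have "(\<lambda>n. C / sqrt (real n)) \<longlonglongrightarrow> 0" by real_asymp
  then have "\<forall>\<^sub>F n in sequentially. C / sqrt (real n) < r / 2" by (rule order_tendstoD) (use r in simp)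
  with eventually_gt_at_top[of 0] eventually_ge_at_top[of N]
  have "\<forall>\<^sub>F n in sequentially. norm ((\<Sum>t=1..n. l t) / sqrt (real n) - 0) < r"
  proof eventually_elim
    case (elim n)
    have "(\<Sum>t=1..n. l t) / sqrt (real n) \<ge> 0" by (intro divide_nonneg_nonneg sum_nonneg l) simp
    then show ?case using bound[OF elim(1,2)] elim(3) unfolding diff_zero real_norm_def by linarith
  qed
  then show "\<exists>no. \<forall>n\<ge>no. norm ((\<Sum>t=1..n. l t) / sqrt (real n) - 0) < r"
    by (simp add: eventually_sequentially)
qed

text \<open>The inequality of arithmetic and geometric means, balanced with the parameter l: a
  second moment of order l^2 for g yields a bound linear in l. Positivity of l is needed for the
  balancing.\<close>

lemma integral_mult_le_scaled:
  fixes f g :: "'a \<Rightarrow> real"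
  assumes "f \<in> borel_measurable M" "g \<in> borel_measurable M"
    and f2: "integrable M (\<lambda>x. (f x)\<^sup>2)" and g2: "integrable M (\<lambda>x. (g x)\<^sup>2)"
    and B: "(\<integral>x. (g x)\<^sup>2 \<partial>M) \<le> l\<^sup>2 * B" and l: "l > 0"
  shows "(\<integral>x. f x * g x \<partial>M) \<le> l * (((\<integral>x. (f x)\<^sup>2 \<partial>M) + B) / 2)"
proof -
  have le: "f x * g x \<le> l / 2 * (f x)\<^sup>2 + 1 / (2 * l) * (g x)\<^sup>2" for x
  proof -
    have "0 \<le> (l * f x - g x)\<^sup>2" by simp
    then have "2 * l * (f x * g x) \<le> l\<^sup>2 * (f x)\<^sup>2 + (g x)\<^sup>2" by (simp add: power2_diff power_mult_distrib algebra_simps)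
    then have "2 * l * (f x * g x) / (2 * l) \<le> (l\<^sup>2 * (f x)\<^sup>2 + (g x)\<^sup>2) / (2 * l)"
      by (rule divide_right_mono) (use l in simp)
    then show ?thesis using l by (simp add: add_divide_distrib power2_eq_square)
  qed
  have "(\<integral>x. f x * g x \<partial>M) \<le> (\<integral>x. l / 2 * (f x)\<^sup>2 + 1 / (2 * l) * (g x)\<^sup>2 \<partial>M)"
    using f2 g2 by (intro integral_mono integrable_mult_of_squares assms le) simp
  also have "\<dots> = l / 2 * (\<integral>x. (f x)\<^sup>2 \<partial>M) + 1 / (2 * l) * (\<integral>x. (g x)\<^sup>2 \<partial>M)"
    using f2 g2 by simp
  also have "\<dots> \<le> l / 2 * (\<integral>x. (f x)\<^sup>2 \<partial>M) + 1 / (2 * l) * (l\<^sup>2 * B)"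
    using l B by (intro add_left_mono mult_left_mono) simp_all
  also have "\<dots> = l * (((\<integral>x. (f x)\<^sup>2 \<partial>M) + B) / 2)"
    using l by (simp add: power2_eq_square field_simps)
  finally show ?thesis .
qed

context square_integrable_process
begin

text \<open>The weight \<open>b 0\<close> is the Lipschitz constant in the present value \<open>p 0\<close>.\<close>

definition lipschitz_family ::
  "'p::metric_space set \<Rightarrow> (nat \<Rightarrow> real) \<Rightarrow> real \<Rightarrow> ('p \<Rightarrow> (nat \<Rightarrow> real^'m) \<Rightarrow> real^'m) \<Rightarrow> bool" where
  "lipschitz_family K b C \<phi> \<longleftrightarrow>
     (\<forall>\<theta>\<in>K. \<phi> \<theta> \<in> borel_measurable seq_space) \<and>
     (\<forall>p\<in>path_dom b. continuous_on K (\<lambda>\<theta>. \<phi> \<theta> p)) \<and>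
     (\<forall>\<theta>\<in>K. \<forall>p\<in>path_dom b. \<forall>q\<in>path_dom b. norm (\<phi> \<theta> p - \<phi> \<theta> q) \<le>
        b 0 * norm (p 0 - q 0) + (\<Sum>j. b (Suc j) * norm (p (Suc j) - q (Suc j)))) \<and>
     (\<forall>\<theta>\<in>K. norm (\<phi> \<theta> (\<lambda>_. 0)) \<le> C)"

text \<open>Captures what the estimates use of \<open>truncated_past\<close>: agreement before lag t
  and a uniform bound on the starting values from there on.\<close>

definition truncation :: "nat \<Rightarrow> real \<Rightarrow> (nat \<Rightarrow> real^'m) \<Rightarrow> (nat \<Rightarrow> real^'m) \<Rightarrow> bool" where
  "truncation t U p q \<longleftrightarrow> (\<forall>j<t. q j = p j) \<and> (\<forall>j\<ge>t. norm (q j) \<le> U)"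

text \<open>A square integrable bound for all members of a family, at a path and at its truncations
  alike. The tail weight is doubled because truncation may change a value by up to that
  amount.\<close>

definition envelope :: "(nat \<Rightarrow> real) \<Rightarrow> real \<Rightarrow> real \<Rightarrow> (nat \<Rightarrow> real^'m) \<Rightarrow> real" where
  "envelope b C U p = (b 0 * norm (p 0) + C) + 2 * tail_weight b U 0 p"

lemma path_coordinate_measurable: "(\<lambda>p::nat \<Rightarrow> real^'m. p i) \<in> borel_measurable seq_space"
  by (rule measurable_component_singleton) (rule UNIV_I)

lemma envelope_measurable: "envelope b C U \<in> borel_measurable seq_space"
  unfolding envelope_def
  by (intro borel_measurable_add borel_measurable_times borel_measurable_const tail_weight_measurable
      measurable_compose[OF path_coordinate_measurable borel_measurable_norm])

context
  fixes b :: "nat \<Rightarrow> real" and U C :: real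
  assumes b_nonneg: "\<And>j. b j \<ge> 0" and b_summable: "summable (\<lambda>j. b (Suc j))" and U: "U \<ge> 0" and C: "C \<ge> 0"
begin

lemma envelope_L2: "integrable path_law (\<lambda>p. (envelope b C U p)\<^sup>2)"
proof -
  have m: "(\<lambda>p::nat \<Rightarrow> real^'m. norm (p 0)) \<in> borel_measurable path_law"
    unfolding measurable_path_law by (rule measurable_compose[OF path_coordinate_measurable borel_measurable_norm])
  have tm: "tail_weight b U 0 \<in> borel_measurable path_law" unfolding measurable_path_law by (rule tail_weight_measurable)
  have i1: "integrable path_law (\<lambda>p. (b 0 * norm (p 0))\<^sup>2)"
    unfolding power_mult_distrib by (intro integrable_mult_right integrable_path_component)
  have i2: "integrable path_law (\<lambda>p. (b 0 * norm (p 0) + C)\<^sup>2)"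
    by (intro integrable_power2_add i1 borel_measurable_times borel_measurable_const m) simp
  have i3: "integrable path_law (\<lambda>p. (2 * tail_weight b U 0 p)\<^sup>2)"
    unfolding power_mult_distrib by (intro integrable_mult_right tail_weight_L2 b_nonneg b_summable U)
  show ?thesis unfolding envelope_def
    by (intro integrable_power2_add i2 i3 borel_measurable_add borel_measurable_times borel_measurable_const m tm)
qed

lemma
  assumes p: "p \<in> path_dom b" and q: "truncation t U p q" and t: "t \<ge> 1"
  shows truncation_dom: "q \<in> path_dom b"
    and truncation_distance: "summable (\<lambda>j. b (Suc j) * norm (q (Suc j) - p (Suc j)))"
      "(\<Sum>j. b (Suc j) * norm (q (Suc j) - p (Suc j))) \<le> tail_weight b U t p"
proof -
  have le: "b (Suc j) * norm (q (Suc j) - p (Suc j)) \<le> (if t \<le> Suc j then b (Suc j) else 0) * (norm (p (Suc j)) + U)" for j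
  proof (cases "t \<le> Suc j")
    case True
    have "norm (q (Suc j) - p (Suc j)) \<le> norm (q (Suc j)) + norm (p (Suc j))" by (rule norm_triangle_ineq4)
    also have "norm (q (Suc j)) \<le> U" using q True unfolding truncation_def by blast
    finally have "norm (q (Suc j) - p (Suc j)) \<le> norm (p (Suc j)) + U" by (simp add: add.commute)
    then show ?thesis using True b_nonneg by (simp add: mult_left_mono)
  next
    case False
    then have "q (Suc j) = p (Suc j)" using q unfolding truncation_def by simp
    then show ?thesis using False by simp
  qed
  note tw = summable_tail_weight[OF b_nonneg b_summable U p]
  show s: "summable (\<lambda>j. b (Suc j) * norm (q (Suc j) - p (Suc j)))"
    by (rule summable_comparison_test'[OF tw[of t], of 0]) (use le b_nonneg in simp)
  show "(\<Sum>j. b (Suc j) * norm (q (Suc j) - p (Suc j))) \<le> tail_weight b U t p"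
    unfolding tail_weight_def by (rule suminf_le[OF le s tw])
  have "summable (\<lambda>j. b (Suc j) * norm (q (Suc j) - p (Suc j)) + b (Suc j) * norm (p (Suc j)))"
    using s p unfolding path_dom_def by (intro summable_add) simp_all
  then show "q \<in> path_dom b"
    unfolding path_dom_def mem_Collect_eq
  proof (rule summable_comparison_test'[where N = 0])
    fix j :: nat
    have "norm (q (Suc j)) \<le> norm (q (Suc j) - p (Suc j)) + norm (p (Suc j))"
      using norm_triangle_ineq[of "q (Suc j) - p (Suc j)" "p (Suc j)"] by simp
    from mult_left_mono[OF this b_nonneg[of "Suc j"]]
    show "norm (b (Suc j) * norm (q (Suc j))) \<le> b (Suc j) * norm (q (Suc j) - p (Suc j)) + b (Suc j) * norm (p (Suc j))"
      using b_nonneg[of "Suc j"] by (simp add: distrib_left)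
  qed
qed

lemma zero_path_dom: "(\<lambda>_. 0) \<in> path_dom b"
  by (simp add: path_dom_def)

lemma
  assumes \<phi>: "lipschitz_family K b C \<phi>" and \<theta>: "\<theta> \<in> K" and p: "p \<in> path_dom b"
  shows lipschitz_family_bound: "norm (\<phi> \<theta> p) \<le> envelope b C U p"
    and lipschitz_family_truncation:
      "truncation t U p q \<Longrightarrow> t \<ge> 1 \<Longrightarrow> norm (\<phi> \<theta> q - \<phi> \<theta> p) \<le> tail_weight b U t p"
    and lipschitz_family_truncation_bound:
      "truncation t U p q \<Longrightarrow> t \<ge> 1 \<Longrightarrow> norm (\<phi> \<theta> q) \<le> envelope b C U p"
proof -
  have lip: "norm (\<phi> \<theta> p - \<phi> \<theta> q) \<le> b 0 * norm (p 0 - q 0) + (\<Sum>j. b (Suc j) * norm (p (Suc j) - q (Suc j)))"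
    if "p \<in> path_dom b" "q \<in> path_dom b" for p q using \<phi> \<theta> that unfolding lipschitz_family_def by blast
  have z: "norm (\<phi> \<theta> (\<lambda>_. 0)) \<le> C" using \<phi> \<theta> unfolding lipschitz_family_def by blast
  have s: "summable (\<lambda>j. b (Suc j) * norm (p (Suc j)))" using p by (simp add: path_dom_def)
  have "(\<Sum>j. b (Suc j) * norm (p (Suc j))) \<le> tail_weight b U 0 p"
    unfolding tail_weight_def
    by (rule suminf_le[OF _ s summable_tail_weight[OF b_nonneg b_summable U p]]) (use b_nonneg U in \<open>simp add: mult_left_mono\<close>)
  moreover have "norm (\<phi> \<theta> p) \<le> norm (\<phi> \<theta> p - \<phi> \<theta> (\<lambda>_. 0)) + norm (\<phi> \<theta> (\<lambda>_. 0))"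
    using norm_triangle_ineq[of "\<phi> \<theta> p - \<phi> \<theta> (\<lambda>_. 0)" "\<phi> \<theta> (\<lambda>_. 0)"] by simp
  ultimately have 1: "norm (\<phi> \<theta> p) \<le> (b 0 * norm (p 0) + C) + tail_weight b U 0 p"
    using lip[OF p zero_path_dom] z by simp
  have tw0: "tail_weight b U 0 p \<ge> 0" by (rule tail_weight_nonneg[OF b_nonneg b_summable U p])
  show "norm (\<phi> \<theta> p) \<le> envelope b C U p" using 1 tw0 unfolding envelope_def by linarith
  assume q: "truncation t U p q" and t: "t \<ge> 1"
  have q0: "q 0 = p 0" using q t unfolding truncation_def by simp
  show 2: "norm (\<phi> \<theta> q - \<phi> \<theta> p) \<le> tail_weight b U t p"
    using lip[OF truncation_dom[OF p q t] p] truncation_distance(2)[OF p q t] by (simp add: q0)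
  have "norm (\<phi> \<theta> q) \<le> norm (\<phi> \<theta> q - \<phi> \<theta> p) + norm (\<phi> \<theta> p)"
    using norm_triangle_ineq[of "\<phi> \<theta> q - \<phi> \<theta> p" "\<phi> \<theta> p"] by simp
  moreover have "tail_weight b U t p \<le> tail_weight b U 0 p"
    by (rule tail_weight_antimono[OF b_nonneg b_summable U p]) simp
  ultimately show "norm (\<phi> \<theta> q) \<le> envelope b C U p"
    using 1 2 unfolding envelope_def by linarith
qed

lemma envelope_nonneg: "p \<in> path_dom b \<Longrightarrow> 0 \<le> envelope b C U p"
  using tail_weight_nonneg[OF b_nonneg b_summable U, of p 0] b_nonneg[of 0] C unfolding envelope_def by simp

lemma product_truncation:
  assumes \<phi>: "lipschitz_family K b C \<phi>" and \<psi>: "lipschitz_family K b C \<psi>" and \<theta>: "\<theta> \<in> K"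
    and p: "p \<in> path_dom b" and q: "truncation t U p q" and t: "t \<ge> 1"
  shows "\<bar>\<phi> \<theta> q \<bullet> \<psi> \<theta> q - \<phi> \<theta> p \<bullet> \<psi> \<theta> p\<bar> \<le> 2 * (\<bar>envelope b C U p\<bar> * tail_weight b U t p)"
proof -
  let ?e = "envelope b C U p" and ?d = "tail_weight b U t p"
  have e: "\<bar>?e\<bar> = ?e" using envelope_nonneg[OF p] by simp
  have "\<phi> \<theta> q \<bullet> \<psi> \<theta> q - \<phi> \<theta> p \<bullet> \<psi> \<theta> p = (\<phi> \<theta> q - \<phi> \<theta> p) \<bullet> \<psi> \<theta> q + \<phi> \<theta> p \<bullet> (\<psi> \<theta> q - \<psi> \<theta> p)"
    by (simp add: inner_diff_left inner_diff_right)
  also have "\<bar>\<dots>\<bar> \<le> norm (\<phi> \<theta> q - \<phi> \<theta> p) * norm (\<psi> \<theta> q) + norm (\<phi> \<theta> p) * norm (\<psi> \<theta> q - \<psi> \<theta> p)"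
    by (rule order_trans[OF abs_triangle_ineq add_mono]) (rule Cauchy_Schwarz_ineq2)+
  also have "\<dots> \<le> ?d * ?e + ?e * ?d"
    using envelope_nonneg[OF p] tail_weight_nonneg[OF b_nonneg b_summable U p, of t]
    by (intro add_mono mult_mono lipschitz_family_truncation[OF _ \<theta> p q t] lipschitz_family_bound[OF _ \<theta> p]
        lipschitz_family_truncation_bound[OF _ \<theta> p q t] \<phi> \<psi>) simp_all
  finally show ?thesis unfolding e by (simp add: mult.commute)
qed

lemma lipschitz_family_inner_measurable:
  assumes "lipschitz_family K b C \<phi>" "lipschitz_family K b C \<psi>" "\<theta> \<in> K"
  shows "(\<lambda>p. \<phi> \<theta> p \<bullet> \<psi> \<theta> p) \<in> borel_measurable seq_space"
  using assms unfolding lipschitz_family_def by (intro borel_measurable_inner) blast+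

text \<open>The exceptional null set is chosen before \<theta> and q, so the estimate may be used at
  random parameters such as the estimator or a mean value point, with the truncated pasts for q.
  Ergodic average and truncation error each take half of \<epsilon>.\<close>

lemma product_average:
  fixes \<phi> \<psi> :: "'p::{metric_space, second_countable_topology} \<Rightarrow> (nat \<Rightarrow> real^'m) \<Rightarrow> real^'m"
  assumes \<phi>: "lipschitz_family K b C \<phi>" and \<psi>: "lipschitz_family K b C \<psi>"
    and \<theta>1: "\<theta>1 \<in> K" and \<epsilon>: "\<epsilon> > 0"
  obtains \<rho> where "\<rho> > 0" "AE \<omega> in M. \<forall>\<^sub>F n in sequentially. \<forall>\<theta>\<in>K \<inter> ball \<theta>1 \<rho>. \<forall>q.
    (\<forall>t\<in>{1..n}. truncation t U (past X (int t) \<omega>) (q t)) \<longrightarrow>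
    \<bar>(\<Sum>t=1..n. \<phi> \<theta> (q t) \<bullet> \<psi> \<theta> (q t)) / real n - (\<integral>p. \<phi> \<theta>1 p \<bullet> \<psi> \<theta>1 p \<partial>path_law)\<bar> \<le> \<epsilon>"
proof -
  let ?e = "envelope b C U" and ?f = "\<lambda>\<theta> p. \<phi> \<theta> p \<bullet> \<psi> \<theta> p"
  let ?I = "\<integral>p. ?f \<theta>1 p \<partial>path_law"
  have e2: "\<epsilon> / 2 > 0" using \<epsilon> by simp
  have good: "AE p in path_law. continuous_on K (\<lambda>\<theta>. ?f \<theta> p) \<and> (\<forall>\<theta>\<in>K. \<bar>?f \<theta> p\<bar> \<le> (?e p)\<^sup>2)"
    using AE_path_dom[OF b_nonneg b_summable U]
  proof eventually_elim
    case (elim p)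
    have "continuous_on K (\<lambda>\<theta>. ?f \<theta> p)"
      using \<phi> \<psi> elim unfolding lipschitz_family_def by (intro continuous_on_inner) blast+
    moreover have "\<bar>?f \<theta> p\<bar> \<le> (?e p)\<^sup>2" if "\<theta> \<in> K" for \<theta>
    proof -
      have "\<bar>?f \<theta> p\<bar> \<le> norm (\<phi> \<theta> p) * norm (\<psi> \<theta> p)" by (rule Cauchy_Schwarz_ineq2)
      also have "\<dots> \<le> ?e p * ?e p"
        by (intro mult_mono lipschitz_family_bound[OF _ that elim] \<phi> \<psi> envelope_nonneg[OF elim]) simp
      finally show ?thesis by (simp only: power2_eq_square)
    qed
    ultimately show ?case by blast
  qed
  obtain \<rho> where \<rho>: "\<rho> > 0" and AE1: "AE \<omega> in M. \<forall>\<^sub>F n in sequentially. \<forall>\<theta>\<in>K \<inter> ball \<theta>1 \<rho>.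
    \<bar>(\<Sum>t=1..n. ?f \<theta> (past X (int t) \<omega>)) / real n - ?I\<bar> \<le> \<epsilon> / 2"
    by (rule uniform_ergodic_average[OF lipschitz_family_inner_measurable[OF \<phi> \<psi>] envelope_L2 good \<theta>1 e2])
  have em: "(\<lambda>p. \<bar>?e p\<bar>) \<in> borel_measurable seq_space"
    by (rule borel_measurable_abs[OF envelope_measurable])
  have "AE \<omega> in M. (\<lambda>n. (\<Sum>t=1..n. \<bar>?e (past X (int t) \<omega>)\<bar> * tail_weight b U t (past X (int t) \<omega>)) / real n) \<longlonglongrightarrow> 0"
    by (rule average_tail_weight_tendsto_0[OF b_nonneg b_summable U em]) (simp_all add: envelope_L2)
  with AE1 AE_all_past[OF AE_path_dom[OF b_nonneg b_summable U]]
  have "AE \<omega> in M. \<forall>\<^sub>F n in sequentially. \<forall>\<theta>\<in>K \<inter> ball \<theta>1 \<rho>. \<forall>q.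
    (\<forall>t\<in>{1..n}. truncation t U (past X (int t) \<omega>) (q t)) \<longrightarrow> \<bar>(\<Sum>t=1..n. ?f \<theta> (q t)) / real n - ?I\<bar> \<le> \<epsilon>"
  proof eventually_elim
    case (elim \<omega>)
    let ?p = "\<lambda>t. past X (int t) \<omega>"
    let ?R = "\<lambda>t. \<bar>?e (?p t)\<bar> * tail_weight b U t (?p t)"
    have "\<forall>\<^sub>F n in sequentially. (\<Sum>t=1..n. ?R t) / real n < \<epsilon> / 4"
      by (rule order_tendstoD(2)[OF elim(3)]) (use \<epsilon> in simp)
    with elim(1) show ?case
    proof eventually_elim
      case (elim n)
      show ?case
      proof (intro ballI allI impI)
        fix \<theta> q
        assume \<theta>: "\<theta> \<in> K \<inter> ball \<theta>1 \<rho>" and q: "\<forall>t\<in>{1..n}. truncation t U (?p t) (q t)"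
        have "\<bar>(\<Sum>t=1..n. ?f \<theta> (q t)) / real n - (\<Sum>t=1..n. ?f \<theta> (?p t)) / real n\<bar>
          = \<bar>\<Sum>t=1..n. ?f \<theta> (q t) - ?f \<theta> (?p t)\<bar> / real n"
          by (simp add: sum_subtractf diff_divide_distrib[symmetric])
        also have "\<dots> \<le> (\<Sum>t=1..n. 2 * ?R t) / real n"
        proof (intro divide_right_mono order_trans[OF sum_abs sum_mono])
          fix t assume t: "t \<in> {1..n}"
          show "\<bar>?f \<theta> (q t) - ?f \<theta> (?p t)\<bar> \<le> 2 * ?R t"
            by (rule product_truncation[OF \<phi> \<psi>]) (use \<theta> t q \<open>\<forall>t. past X t \<omega> \<in> path_dom b\<close> in auto)
        qed simp
        also have "\<dots> = 2 * ((\<Sum>t=1..n. ?R t) / real n)" by (simp only: sum_distrib_left[symmetric] times_divide_eq_right)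
        finally have "\<bar>(\<Sum>t=1..n. ?f \<theta> (q t)) / real n - (\<Sum>t=1..n. ?f \<theta> (?p t)) / real n\<bar> \<le> \<epsilon> / 2"
          using elim(2) by linarith
        moreover have "\<bar>(\<Sum>t=1..n. ?f \<theta> (?p t)) / real n - ?I\<bar> \<le> \<epsilon> / 2" using elim(1) \<theta> by blast
        ultimately show "\<bar>(\<Sum>t=1..n. ?f \<theta> (q t)) / real n - ?I\<bar> \<le> \<epsilon>" by linarith
      qed
    qed
  qed
  with \<rho> show ?thesis by (rule that)
qed

text \<open>In mean the t-th truncation error is at most a constant times the tail of b beyond lag
  t. Square summable tails therefore add up to o(sqrt n), the precision required for the
  score.\<close>

lemma product_truncation_expectation:
  assumes \<phi>: "lipschitz_family K b C \<phi>" and \<psi>: "lipschitz_family K b C \<psi>" and \<theta>: "\<theta> \<in> K"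
    and tails: "summable (\<lambda>t. (\<Sum>j. if t \<le> Suc j then b (Suc j) else 0)\<^sup>2)"
    and q: "\<And>t \<omega>. t \<ge> 1 \<Longrightarrow> truncation t U (past X (int t) \<omega>) (q t \<omega>)"
    and qm: "\<And>t. t \<ge> 1 \<Longrightarrow> (\<lambda>\<omega>. \<phi> \<theta> (q t \<omega>) \<bullet> \<psi> \<theta> (q t \<omega>)) \<in> borel_measurable M"
  defines "r \<equiv> \<lambda>t \<omega>. \<phi> \<theta> (q t \<omega>) \<bullet> \<psi> \<theta> (q t \<omega>) - \<phi> \<theta> (past X (int t) \<omega>) \<bullet> \<psi> \<theta> (past X (int t) \<omega>)"
  shows "t \<ge> 1 \<Longrightarrow> integrable M (r t)"
    and "(\<lambda>n. (\<integral>\<omega>. \<bar>\<Sum>t=1..n. r t \<omega>\<bar> \<partial>M) / sqrt (real n)) \<longlonglongrightarrow> 0"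
proof -
  let ?e = "\<lambda>p. \<bar>envelope b C U p\<bar>"
  let ?R = "\<lambda>t p. ?e p * tail_weight b U t p"
  have em: "?e \<in> borel_measurable path_law" unfolding measurable_path_law
    by (rule borel_measurable_abs[OF envelope_measurable])
  have tm: "tail_weight b U t \<in> borel_measurable path_law" for t unfolding measurable_path_law
    by (rule tail_weight_measurable)
  have e2: "integrable path_law (\<lambda>p. (?e p)\<^sup>2)" using envelope_L2 by simp
  note t2 = tail_weight_L2[OF b_nonneg b_summable U]
  have iR: "integrable path_law (?R t)" for t
    by (rule integrable_mult_of_squares[OF em tm e2 t2(1)])
  have rm: "r t \<in> borel_measurable M" if "t \<ge> 1" for t
    unfolding r_def
    by (intro borel_measurable_diff qm[OF that]
        measurable_compose[OF past_measurable lipschitz_family_inner_measurable[OF \<phi> \<psi> \<theta>]])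
  have rb: "AE \<omega> in M. \<bar>r t \<omega>\<bar> \<le> 2 * ?R t (past X (int t) \<omega>)" if "t \<ge> 1" for t
    using AE_past[OF AE_path_dom[OF b_nonneg b_summable U], of "int t"]
    by eventually_elim (simp only: r_def, rule product_truncation[OF \<phi> \<psi> \<theta> _ q[OF that] that])
  have iR2: "integrable M (\<lambda>\<omega>. 2 * ?R t (past X (int t) \<omega>))" for t
    by (intro integrable_mult_right integrable_past[OF iR])
  show ir: "integrable M (r t)" if "t \<ge> 1" for t
  proof (rule Bochner_Integration.integrable_bound[OF iR2[of t] rm[OF that]])
    show "AE \<omega> in M. norm (r t \<omega>) \<le> norm (2 * ?R t (past X (int t) \<omega>))"
      using rb[OF that] by eventually_elim simp
  qed
  define \<tau> where "\<tau> t = (\<Sum>j. if t \<le> Suc j then b (Suc j) else 0)" for t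
  \<comment> \<open>The added 1 / (t + 1) makes the bound strictly positive, as
    \<open>integral_mult_le_scaled\<close> demands, and leaves it square summable.\<close>
  define l where "l t = \<tau> t + 1 / real (Suc t)" for t
  have \<tau>0: "\<tau> t \<ge> 0" for t unfolding \<tau>_def
    by (intro suminf_nonneg summable_tail[OF b_nonneg b_summable U]) (simp add: b_nonneg)
  have l0: "l t > 0" for t using \<tau>0[of t] unfolding l_def by (intro add_nonneg_pos) simp_all
  have mb: "moment_bound U \<ge> 0" unfolding moment_bound_def by simp
  define K' where "K' = ((\<integral>p. (?e p)\<^sup>2 \<partial>path_law) + moment_bound U) / 2"
  have ER: "(\<integral>p. ?R t p \<partial>path_law) \<le> l t * K'" for t
    unfolding K'_def
  proof (rule integral_mult_le_scaled[OF em tm e2 t2(1) _ l0])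
    have "\<tau> t \<le> l t" unfolding l_def by simp
    then have "(\<tau> t)\<^sup>2 * moment_bound U \<le> (l t)\<^sup>2 * moment_bound U"
      using \<tau>0 mb by (intro mult_right_mono power_mono)
    with t2(2)[of t] show "(\<integral>p. (tail_weight b U t p)\<^sup>2 \<partial>path_law) \<le> (l t)\<^sup>2 * moment_bound U"
      unfolding \<tau>_def by linarith
  qed
  have l2: "summable (\<lambda>t. (l t)\<^sup>2)"
  proof (rule summable_comparison_test'[where N = 0])
    have "summable (\<lambda>t. (1 / real (Suc t))\<^sup>2)"
      using inverse_squares_sums unfolding sums_iff by (simp add: add.commute power_divide)
    then show "summable (\<lambda>t. 2 * (\<tau> t)\<^sup>2 + 2 * (1 / real (Suc t))\<^sup>2)"
      using tails unfolding \<tau>_def by (intro summable_add summable_mult)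
    fix t
    have "(x + y)\<^sup>2 \<le> 2 * x\<^sup>2 + 2 * y\<^sup>2" for x y :: real
      using sum_squares_bound[of x y] by (simp add: power2_sum)
    then show "norm ((l t)\<^sup>2) \<le> 2 * (\<tau> t)\<^sup>2 + 2 * (1 / real (Suc t))\<^sup>2"
      unfolding l_def real_norm_def abs_power2 .
  qed
  show "(\<lambda>n. (\<integral>\<omega>. \<bar>\<Sum>t=1..n. r t \<omega>\<bar> \<partial>M) / sqrt (real n)) \<longlonglongrightarrow> 0"
  proof (rule Lim_null_comparison)
    show "(\<lambda>n. 2 * K' * ((\<Sum>t=1..n. l t) / sqrt (real n))) \<longlonglongrightarrow> 0"
      by (intro tendsto_mult_right_zero sum_over_sqrt_tendsto_0 l2 less_imp_le[OF l0])
    show "\<forall>\<^sub>F n in sequentially. norm ((\<integral>\<omega>. \<bar>\<Sum>t=1..n. r t \<omega>\<bar> \<partial>M) / sqrt (real n)) \<le> 2 * K' * ((\<Sum>t=1..n. l t) / sqrt (real n))"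
    proof (intro always_eventually allI)
      fix n
      have i: "integrable M (\<lambda>\<omega>. \<Sum>t=1..n. r t \<omega>)" by (intro Bochner_Integration.integrable_sum ir) simp
      have ia: "integrable M (\<lambda>\<omega>. \<bar>r t \<omega>\<bar>)" if "t \<in> {1..n}" for t using ir[of t] that by simp
      have "(\<integral>\<omega>. \<bar>\<Sum>t=1..n. r t \<omega>\<bar> \<partial>M) \<le> (\<integral>\<omega>. (\<Sum>t=1..n. \<bar>r t \<omega>\<bar>) \<partial>M)"
        by (intro integral_mono integrable_abs i Bochner_Integration.integrable_sum ia sum_abs)
      also have "\<dots> = (\<Sum>t=1..n. \<integral>\<omega>. \<bar>r t \<omega>\<bar> \<partial>M)"
        by (rule Bochner_Integration.integral_sum) (rule ia)
      also have "\<dots> \<le> (\<Sum>t=1..n. 2 * K' * l t)"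
      proof (rule sum_mono)
        fix t assume t: "t \<in> {1..n}"
        then have t1: "t \<ge> 1" by simp
        have "(\<integral>\<omega>. \<bar>r t \<omega>\<bar> \<partial>M) \<le> (\<integral>\<omega>. 2 * ?R t (past X (int t) \<omega>) \<partial>M)"
          by (rule integral_mono_AE[OF ia[OF t] iR2 rb[OF t1]])
        also have "\<dots> = 2 * (\<integral>p. ?R t p \<partial>path_law)"
          using integral_past[of "?R t" "int t"] borel_measurable_integrable[OF iR[of t]] by simp
        also have "\<dots> \<le> 2 * K' * l t" using ER[of t] by (simp add: mult.commute)
        finally show "(\<integral>\<omega>. \<bar>r t \<omega>\<bar> \<partial>M) \<le> 2 * K' * l t" .
      qed
      also have "\<dots> = 2 * K' * (\<Sum>t=1..n. l t)" by (simp only: sum_distrib_left)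
      finally have "(\<integral>\<omega>. \<bar>\<Sum>t=1..n. r t \<omega>\<bar> \<partial>M) / sqrt (real n) \<le> 2 * K' * (\<Sum>t=1..n. l t) / sqrt (real n)"
        by (rule divide_right_mono) simp
      then show "norm ((\<integral>\<omega>. \<bar>\<Sum>t=1..n. r t \<omega>\<bar> \<partial>M) / sqrt (real n)) \<le> 2 * K' * ((\<Sum>t=1..n. l t) / sqrt (real n))"
        by simp
    qed
  qed
qed

end

end

section \<open>Decay of the lag coefficients\<close>

lemma power_decay_summable:
  assumes "power_decay v l" "l > s + 1"
  shows "summable (\<lambda>j. enn2real (v (Suc j)) * real (Suc j) powr s)"
proof -
  have "(\<lambda>j. enn2real (v j) * real j powr s) \<in> O(\<lambda>j. real j powr (- l) * real j powr s)"
    using assms(1) unfolding power_decay_def by (intro landau_o.big.mult) simp_all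
  then have O: "(\<lambda>j. enn2real (v j) * real j powr s) \<in> O(\<lambda>j. real j powr (s - l))"
    by (simp add: powr_add[symmetric] algebra_simps)
  have "summable (\<lambda>j. norm (real j powr (s - l)))"
    using assms(2) summable_real_powr_iff[of "s - l"] by simp
  from summable_comparison_test_bigo[OF this O] show ?thesis
    by (rule summable_Suc_iff[THEN iffD2])
qed

text \<open>A moment of order s of the weights bounds the tail beyond t by a multiple of t powr (-
  s). It is finite when s < l - 1, and the squares are summable when s > 1/2; an exponent above 3/2
  leaves room for both.\<close>

lemma power_decay_tails_square_summable:
  assumes v: "power_decay v l" and l: "l > 3/2"
  shows "summable (\<lambda>t. (\<Sum>j. if t \<le> Suc j then enn2real (v (Suc j)) else 0)\<^sup>2)"
proof -
  \<comment> \<open>The midpoint between 1/2 and l - 1.\<close>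
  define s where "s = l / 2 - 1/4"
  have s: "s > 1/2" "l > s + 1" using l by (simp_all add: s_def)
  let ?a = "\<lambda>j. enn2real (v (Suc j)) * real (Suc j) powr s"
  have sa: "summable ?a" by (rule power_decay_summable[OF v s(2)])
  have sv: "summable (\<lambda>j. enn2real (v (Suc j)))"
    using power_decay_summable[OF v, of 0] l by simp
  define D where "D = suminf ?a"
  let ?\<tau> = "\<lambda>t. \<Sum>j. if t \<le> Suc j then enn2real (v (Suc j)) else 0"
  have st: "summable (\<lambda>j. if t \<le> Suc j then enn2real (v (Suc j)) else 0)" for t
    by (rule summable_comparison_test'[OF sv, of 0]) simp
  have \<tau>0: "?\<tau> t \<ge> 0" for t by (intro suminf_nonneg st) simp
  have \<tau>: "?\<tau> t \<le> D * real t powr (- s)" if "t \<ge> 1" for t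
  proof -
    have "?\<tau> t \<le> (\<Sum>j. ?a j * real t powr (- s))"
    proof (rule suminf_le[OF _ st summable_mult2[OF sa]])
      fix j
      show "(if t \<le> Suc j then enn2real (v (Suc j)) else 0) \<le> ?a j * real t powr (- s)"
      proof (cases "t \<le> Suc j")
        case True
        have "1 = real t powr s * real t powr (- s)" using that by (simp add: powr_minus)
        also have "\<dots> \<le> real (Suc j) powr s * real t powr (- s)"
          using True s(1) by (intro mult_right_mono powr_mono2) simp_all
        finally have "enn2real (v (Suc j)) * 1 \<le> enn2real (v (Suc j)) * (real (Suc j) powr s * real t powr (- s))"
          by (rule mult_left_mono) simp
        then show ?thesis using True by (simp only: if_True mult_1_right mult.assoc)
      qed simp
    qed
    then show ?thesis by (simp only: suminf_mult2[OF sa, symmetric] D_def)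
  qed
  have "summable (\<lambda>t. real t powr (- (2 * s)))" using s summable_real_powr_iff[of "- (2 * s)"] by simp
  then have "summable (\<lambda>t. D\<^sup>2 * real t powr (- (2 * s)))" by (rule summable_mult)
  then show ?thesis
  proof (rule summable_comparison_test'[where N = 1])
    fix t :: nat assume t: "t \<ge> 1"
    have "(?\<tau> t)\<^sup>2 \<le> (D * real t powr (- s))\<^sup>2" by (rule power_mono[OF \<tau>[OF t] \<tau>0])
    also have "\<dots> = D\<^sup>2 * real t powr (- (2 * s))"
      using t by (simp add: power_mult_distrib powr_powr powr_realpow[symmetric] powr_add[symmetric] power2_eq_square)
    finally show "norm ((?\<tau> t)\<^sup>2) \<le> D\<^sup>2 * real t powr (- (2 * s))" by simp
  qed
qed

context square_integrable_process
begin

lemma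
  fixes a0 :: "real^'d::finite \<Rightarrow> real^'m" and a :: "nat \<Rightarrow> real^'d \<Rightarrow> real^'m \<Rightarrow> real^'m"
  assumes a0: "continuous_on K a0" and C: "\<And>\<theta>. \<theta> \<in> K \<Longrightarrow> norm (a0 \<theta>) \<le> C"
    and cont: "\<And>j x. continuous_on K (\<lambda>\<theta>. a (Suc j) \<theta> x - a (Suc j) \<theta> 0)"
    and lip: "\<And>j x y \<theta>. \<theta> \<in> K \<Longrightarrow> norm (a (Suc j) \<theta> x - a (Suc j) \<theta> y) \<le> b (Suc j) * norm (x - y)"
    and b: "\<And>j. b j \<ge> 0"
  shows lipschitz_family_lag_series: "lipschitz_family K b C (lag_series a0 a)"
    and lipschitz_family_residual: "b 0 \<ge> 1 \<Longrightarrow> lipschitz_family K b C (\<lambda>\<theta> p. p 0 - lag_series a0 a \<theta> p)"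
proof -
  have am: "(\<lambda>p. a (Suc j) \<theta> (p (Suc j)) - a (Suc j) \<theta> 0) \<in> borel_measurable seq_space" if "\<theta> \<in> K" for j \<theta>
  proof -
    have "(b (Suc j))-lipschitz_on UNIV (a (Suc j) \<theta>)"
      by (rule lipschitz_onI) (use lip[OF that] b in \<open>simp_all add: dist_norm\<close>)
    then have "a (Suc j) \<theta> \<in> borel_measurable borel"
      by (intro borel_measurable_continuous_onI lipschitz_on_continuous_on)
    then show ?thesis
      by (intro borel_measurable_diff borel_measurable_const measurable_compose[OF path_coordinate_measurable])
  qed
  have meas: "lag_series a0 a \<theta> \<in> borel_measurable seq_space" if "\<theta> \<in> K" for \<theta>
    unfolding lag_series_def
    by (intro borel_measurable_add borel_measurable_const borel_measurable_suminf am[OF that])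
  have lip0: "norm (a (Suc j) \<theta> x - a (Suc j) \<theta> 0) \<le> b (Suc j) * norm x" if "\<theta> \<in> K" for j \<theta> x
    using lip[OF that, of j x 0] by simp
  have co: "continuous_on K (\<lambda>\<theta>. lag_series a0 a \<theta> p)" if "p \<in> path_dom b" for p
    by (rule lag_series_continuous_on[of K a0 a b p, OF a0 cont lip0]) (use that in \<open>simp_all add: path_dom_def\<close>)
  have L: "norm (lag_series a0 a \<theta> p - lag_series a0 a \<theta> q) \<le> (\<Sum>j. b (Suc j) * norm (p (Suc j) - q (Suc j)))"
    if \<theta>: "\<theta> \<in> K" and p: "p \<in> path_dom b" and q: "q \<in> path_dom b" for \<theta> p q
  proof -
    have s: "summable (\<lambda>j. a (Suc j) \<theta> (p (Suc j)) - a (Suc j) \<theta> 0)" if "p \<in> path_dom b" for p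
      by (rule summable_comparison_test'[where N = 0 and g = "\<lambda>j. b (Suc j) * norm (p (Suc j))"])
        (use that lip0[OF \<theta>] in \<open>simp_all add: path_dom_def\<close>)
    have "summable (\<lambda>j. b (Suc j) * norm (p (Suc j)) + b (Suc j) * norm (q (Suc j)))"
      using p q by (intro summable_add) (simp_all add: path_dom_def)
    then have sd: "summable (\<lambda>j. b (Suc j) * norm (p (Suc j) - q (Suc j)))"
    proof (rule summable_comparison_test'[where N = 0])
      fix j
      from mult_left_mono[OF norm_triangle_ineq4[of "p (Suc j)" "q (Suc j)"] b[of "Suc j"]]
      show "norm (b (Suc j) * norm (p (Suc j) - q (Suc j))) \<le> b (Suc j) * norm (p (Suc j)) + b (Suc j) * norm (q (Suc j))"
        using b[of "Suc j"] by (simp add: distrib_left)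
    qed
    have "lag_series a0 a \<theta> p - lag_series a0 a \<theta> q =
        (\<Sum>j. (a (Suc j) \<theta> (p (Suc j)) - a (Suc j) \<theta> 0) - (a (Suc j) \<theta> (q (Suc j)) - a (Suc j) \<theta> 0))"
      unfolding lag_series_def by (subst suminf_diff[OF s[OF p] s[OF q], symmetric]) simp
    also have "norm \<dots> \<le> (\<Sum>j. b (Suc j) * norm (p (Suc j) - q (Suc j)))"
      by (rule norm_suminf_le[OF _ sd]) (use lip[OF \<theta>] in simp)
    finally show ?thesis .
  qed
  have z: "lag_series a0 a \<theta> (\<lambda>_. 0) = a0 \<theta>" for \<theta> by (simp add: lag_series_def)
  have "norm (lag_series a0 a \<theta> p - lag_series a0 a \<theta> q) \<le> b 0 * norm (p 0 - q 0) + (\<Sum>j. b (Suc j) * norm (p (Suc j) - q (Suc j)))"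
    if "\<theta> \<in> K" "p \<in> path_dom b" "q \<in> path_dom b" for \<theta> p q
    using L[OF that] mult_nonneg_nonneg[OF b norm_ge_zero, of 0 "p 0 - q 0"] by linarith
  then show "lipschitz_family K b C (lag_series a0 a)"
    unfolding lipschitz_family_def using meas co C by (auto simp: z)
  assume b0: "b 0 \<ge> 1"
  have "norm ((p 0 - lag_series a0 a \<theta> p) - (q 0 - lag_series a0 a \<theta> q)) \<le>
      b 0 * norm (p 0 - q 0) + (\<Sum>j. b (Suc j) * norm (p (Suc j) - q (Suc j)))"
    if "\<theta> \<in> K" "p \<in> path_dom b" "q \<in> path_dom b" for \<theta> p q
  proof -
    have "(p 0 - lag_series a0 a \<theta> p) - (q 0 - lag_series a0 a \<theta> q) = (p 0 - q 0) - (lag_series a0 a \<theta> p - lag_series a0 a \<theta> q)"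
      by simp
    then have "norm ((p 0 - lag_series a0 a \<theta> p) - (q 0 - lag_series a0 a \<theta> q)) \<le> norm (p 0 - q 0) + norm (lag_series a0 a \<theta> p - lag_series a0 a \<theta> q)"
      by (simp only: norm_triangle_ineq4)
    moreover have "norm (p 0 - q 0) \<le> b 0 * norm (p 0 - q 0)"
      using mult_right_mono[OF b0 norm_ge_zero[of "p 0 - q 0"]] by simp
    ultimately show ?thesis using L[OF that] by linarith
  qed
  moreover have "(\<lambda>p. p 0 - lag_series a0 a \<theta> p) \<in> borel_measurable seq_space" if "\<theta> \<in> K" for \<theta>
    by (intro borel_measurable_diff path_coordinate_measurable meas[OF that])
  moreover have "continuous_on K (\<lambda>\<theta>. p 0 - lag_series a0 a \<theta> p)" if "p \<in> path_dom b" for p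
    by (intro continuous_on_diff continuous_on_const co[OF that])
  ultimately show "lipschitz_family K b C (\<lambda>\<theta> p. p 0 - lag_series a0 a \<theta> p)"
    unfolding lipschitz_family_def using C by (auto simp: z)
qed

end

lemma SUP_Lip_bound:
  assumes "(SUP \<theta>\<in>S. Lip (g \<theta>)) < \<infinity>" "\<theta> \<in> S"
  shows "norm (g \<theta> x - g \<theta> y) \<le> enn2real (SUP \<theta>\<in>S. Lip (g \<theta>)) * norm (x - y)"
proof -
  have le: "Lip (g \<theta>) \<le> (SUP \<theta>\<in>S. Lip (g \<theta>))" by (rule SUP_upper[OF assms(2)])
  have "norm (g \<theta> x - g \<theta> y) \<le> enn2real (Lip (g \<theta>)) * norm (x - y)"
    using Lip_finite_lipschitz[OF le_less_trans[OF le assms(1)]] by (simp add: dist_norm)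
  also have "\<dots> \<le> enn2real (SUP \<theta>\<in>S. Lip (g \<theta>)) * norm (x - y)"
    by (intro mult_right_mono enn2real_mono le) (use assms(1) in simp_all)
  finally show ?thesis .
qed

section \<open>Strong consistency\<close>

locale ar_estimation = ar_model M X \<xi> A0 A \<theta>0
  for M :: "'a measure" and X \<xi> :: "int \<Rightarrow> 'a \<Rightarrow> real^'m::finite"
    and A0 :: "real^'d::finite \<Rightarrow> real^'m" and A :: "nat \<Rightarrow> real^'d \<Rightarrow> real^'m \<Rightarrow> real^'m" and \<theta>0 :: "real^'d" +
  fixes \<Theta> :: "(real^'d) set" and u :: "nat \<Rightarrow> real^'m" and \<theta>hat :: "nat \<Rightarrow> 'a \<Rightarrow> real^'d"
  assumes standing: "ar_standing \<Theta> A0 A" and compact: "compact \<Theta>" and \<theta>0: "\<theta>0 \<in> \<Theta>"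
    and identifiable: "\<And>\<theta>. \<theta> \<in> \<Theta> \<Longrightarrow> (\<And>t. AE \<omega> in M. ar_fun A0 A \<theta> (past X t \<omega>) = ar_fun A0 A \<theta>0 (past X t \<omega>)) \<Longrightarrow> \<theta> = \<theta>0"
    and decay: "\<exists>l>3/2. power_decay (\<lambda>j. SUP \<theta>\<in>\<Theta>. Lip (A j \<theta>)) l"
    and u: "finitely_supported u" and qmle: "is_qmle M \<Theta> A0 A X u \<theta>hat"
begin

section \<open>Lipschitz weights and continuity of the regression function\<close>

definition \<alpha> :: "nat \<Rightarrow> real" where "\<alpha> j = enn2real (SUP \<theta>\<in>\<Theta>. Lip (A j \<theta>))"

definition f0 :: "real^'d \<Rightarrow> real^'m" where "f0 \<theta> = ar_fun A0 A \<theta> (\<lambda>_. 0)"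

lemma \<alpha>_nonneg: "\<alpha> j \<ge> 0" by (simp add: \<alpha>_def)

lemma \<alpha>_lipschitz: "\<theta> \<in> \<Theta> \<Longrightarrow> norm (A (Suc j) \<theta> x - A (Suc j) \<theta> y) \<le> \<alpha> (Suc j) * norm (x - y)"
  unfolding \<alpha>_def by (rule SUP_Lip_bound) (use decay in \<open>auto simp: power_decay_def\<close>)

lemma \<alpha>_summable: "summable (\<lambda>j. \<alpha> (Suc j))"
proof -
  obtain l where l: "l > 3/2" "power_decay (\<lambda>j. SUP \<theta>\<in>\<Theta>. Lip (A j \<theta>)) l" using decay by blast
  from power_decay_summable[OF l(2), of 0] l(1) show ?thesis by (simp add: \<alpha>_def)
qed

lemma finitely_supported_single: "finitely_supported (\<lambda>i. if i = k then x else 0)"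
  unfolding finitely_supported_def by (rule finite_subset[of _ "{k}"]) (auto split: if_splits)

lemma standing_finitely_supported:
  assumes "finitely_supported x"
  shows "\<theta> \<in> \<Theta> \<Longrightarrow> summable (\<lambda>j. A (Suc j) \<theta> (x (Suc j)))" "continuous_on \<Theta> (\<lambda>\<theta>. ar_fun A0 A \<theta> x)"
  using standing assms unfolding ar_standing_def by blast+

lemma finitely_supported_0: "finitely_supported (\<lambda>_. 0)" by (simp add: finitely_supported_def)

lemma f0_continuous: "continuous_on \<Theta> f0"
  unfolding f0_def by (rule standing_finitely_supported(2)[OF finitely_supported_0])

text \<open>Continuity is assumed for \<open>ar_fun\<close> at finitely supported sequences. A
  sequence supported on one lag, compared with the zero sequence, isolates the term of that
  lag.\<close>

lemma A_continuous: "continuous_on \<Theta> (\<lambda>\<theta>. A (Suc j) \<theta> x - A (Suc j) \<theta> 0)"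
proof -
  let ?x = "\<lambda>i. if i = Suc j then x else 0"
  have "A (Suc j) \<theta> x - A (Suc j) \<theta> 0 = ar_fun A0 A \<theta> ?x - f0 \<theta>" if "\<theta> \<in> \<Theta>" for \<theta>
  proof -
    have s: "summable (\<lambda>i. A (Suc i) \<theta> (?x (Suc i)))" "summable (\<lambda>i. A (Suc i) \<theta> 0)"
      using standing_finitely_supported(1)[OF finitely_supported_single that]
        standing_finitely_supported(1)[OF finitely_supported_0 that] by blast+
    have "ar_fun A0 A \<theta> ?x - f0 \<theta> = (\<Sum>i. A (Suc i) \<theta> (?x (Suc i)) - A (Suc i) \<theta> 0)"
      unfolding f0_def ar_fun_def using suminf_diff[OF s] by simp
    also have "\<dots> = (\<Sum>i\<in>{j}. A (Suc i) \<theta> (?x (Suc i)) - A (Suc i) \<theta> 0)"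
      by (rule suminf_finite) auto
    finally show ?thesis by simp
  qed
  moreover have "continuous_on \<Theta> (\<lambda>\<theta>. ar_fun A0 A \<theta> ?x - f0 \<theta>)"
    by (intro continuous_on_diff f0_continuous standing_finitely_supported(2)[OF finitely_supported_single])
  ultimately show ?thesis by (simp cong: continuous_on_cong)
qed

definition f :: "real^'d \<Rightarrow> (nat \<Rightarrow> real^'m) \<Rightarrow> real^'m" where "f = lag_series f0 A"

definition resid :: "real^'d \<Rightarrow> (nat \<Rightarrow> real^'m) \<Rightarrow> real^'m" where "resid \<theta> p = p 0 - f \<theta> p"

definition f0_bound :: real where "f0_bound = (SOME C. C \<ge> 0 \<and> (\<forall>\<theta>\<in>\<Theta>. norm (f0 \<theta>) \<le> C))"

lemma f0_bound: "f0_bound \<ge> 0" "\<theta> \<in> \<Theta> \<Longrightarrow> norm (f0 \<theta>) \<le> f0_bound"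
proof -
  have "bounded (f0 ` \<Theta>)" by (intro compact_imp_bounded compact_continuous_image f0_continuous compact)
  then obtain C where "\<forall>y\<in>f0 ` \<Theta>. norm y \<le> C" unfolding bounded_iff by blast
  then have "max 0 C \<ge> 0 \<and> (\<forall>\<theta>\<in>\<Theta>. norm (f0 \<theta>) \<le> max 0 C)" by (auto simp: le_max_iff_disj)
  then have "f0_bound \<ge> 0 \<and> (\<forall>\<theta>\<in>\<Theta>. norm (f0 \<theta>) \<le> f0_bound)" unfolding f0_bound_def by (rule someI)
  then show "f0_bound \<ge> 0" "\<theta> \<in> \<Theta> \<Longrightarrow> norm (f0 \<theta>) \<le> f0_bound" by blast+
qed

lemma ar_fun_eq_f:
  assumes \<theta>: "\<theta> \<in> \<Theta>" and p: "summable (\<lambda>j. \<alpha> (Suc j) * norm (p (Suc j)))"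
  shows "ar_fun A0 A \<theta> p = f \<theta> p"
proof -
  have s0: "summable (\<lambda>j. A (Suc j) \<theta> 0)" by (rule standing_finitely_supported(1)[OF finitely_supported_0 \<theta>])
  have "summable (\<lambda>j. A (Suc j) \<theta> (p (Suc j)) - A (Suc j) \<theta> 0)"
    by (rule summable_comparison_test'[OF p, of 0]) (use \<alpha>_lipschitz[OF \<theta>, of _ _ 0] in simp)
  from suminf_add[OF this s0] show ?thesis unfolding f_def lag_series_def f0_def ar_fun_def by (simp add: add.commute)
qed

definition U :: real where "U = (SOME C. C \<ge> 0 \<and> (\<forall>i\<ge>1. norm (u i) \<le> C))"

lemma U: "U \<ge> 0" "i \<ge> 1 \<Longrightarrow> norm (u i) \<le> U"
proof -
  let ?S = "{j. j \<ge> 1 \<and> u j \<noteq> 0}"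
  have fin: "finite ?S" using u by (simp add: finitely_supported_def)
  have "norm (u i) \<le> (\<Sum>j\<in>?S. norm (u j))" if "i \<ge> 1" for i
  proof (cases "u i = 0")
    case False
    then have "i \<in> ?S" using that by simp
    then show ?thesis by (intro member_le_sum fin norm_ge_zero)
  qed (simp add: sum_nonneg)
  then have "\<exists>C. C \<ge> 0 \<and> (\<forall>i\<ge>1. norm (u i) \<le> C)"
    by (intro exI[of _ "\<Sum>j\<in>?S. norm (u j)"] conjI allI impI sum_nonneg norm_ge_zero)
  then have "U \<ge> 0 \<and> (\<forall>i\<ge>1. norm (u i) \<le> U)" unfolding U_def by (rule someI_ex)
  then show "U \<ge> 0" "i \<ge> 1 \<Longrightarrow> norm (u i) \<le> U" by blast+
qed

lemma truncated_past: "t \<ge> 1 \<Longrightarrow> truncation t U (past X (int t) \<omega>) (truncated_past X u t \<omega>)"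
  unfolding truncation_def truncated_past_def past_def using U by auto

lemma truncated_past_0: "t \<ge> 1 \<Longrightarrow> truncated_past X u t \<omega> 0 = X (int t) \<omega>"
  by (simp add: truncated_past_def)

definition b :: "nat \<Rightarrow> real" where "b j = (if j = 0 then 1 else \<alpha> j)"

lemma b_nonneg: "b j \<ge> 0" by (simp add: b_def \<alpha>_nonneg)

lemma b_Suc: "b (Suc j) = \<alpha> (Suc j)" by (simp add: b_def)

lemma b_summable: "summable (\<lambda>j. b (Suc j))" unfolding b_Suc by (rule \<alpha>_summable)

lemma family_resid: "lipschitz_family \<Theta> b f0_bound resid"
  unfolding resid_def [abs_def] f_def
  by (rule lipschitz_family_residual[of \<Theta> f0 f0_bound A b, OF f0_continuous f0_bound(2) A_continuous _ b_nonneg])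
    (simp_all add: b_Suc \<alpha>_lipschitz b_def[of 0])

lemma path_dom_ar_fun: "\<theta> \<in> \<Theta> \<Longrightarrow> p \<in> path_dom b \<Longrightarrow> ar_fun A0 A \<theta> p = f \<theta> p"
  by (rule ar_fun_eq_f) (simp_all add: path_dom_def b_Suc)

lemma innovation_eq_resid: "p \<in> path_dom b \<Longrightarrow> innovation p = resid \<theta>0 p"
  by (simp add: innovation_def resid_def path_dom_ar_fun[OF \<theta>0])

definition Q :: "real^'d \<Rightarrow> real" where "Q \<theta> = (\<integral>p. resid \<theta> p \<bullet> resid \<theta> p \<partial>path_law)"

lemma f_ignores_present: "f \<theta> (p(0 := 0)) = f \<theta> p"
  by (simp add: f_def lag_series_def)

lemma f_measurable: "\<theta> \<in> \<Theta> \<Longrightarrow> f \<theta> \<in> borel_measurable seq_space"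
proof -
  assume \<theta>: "\<theta> \<in> \<Theta>"
  have "resid \<theta> \<in> borel_measurable seq_space" using family_resid \<theta> unfolding lipschitz_family_def by blast
  then have "(\<lambda>p. p 0 - resid \<theta> p) \<in> borel_measurable seq_space"
    by (intro borel_measurable_diff path_coordinate_measurable)
  then show ?thesis by (simp add: resid_def)
qed

text \<open>The residual at \<theta> is the innovation plus \<open>?D\<close>, a square integrable
  function of the strict past, so the mixed term has mean 0 and the excess of Q is the second moment
  of \<open>?D\<close>.\<close>

lemma Q_minimal:
  assumes \<theta>: "\<theta> \<in> \<Theta>" and ne: "\<theta> \<noteq> \<theta>0"
  shows "Q \<theta>0 < Q \<theta>"
proof -
  let ?D = "\<lambda>p. f \<theta>0 p - f \<theta> p" and ?e = "envelope b f0_bound U"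
  note dom = AE_path_dom[OF b_nonneg b_summable U(1)]
  note e2 = envelope_L2[OF b_nonneg b_summable U(1) f0_bound(1)]
  have Dm: "?D \<in> borel_measurable seq_space" by (intro borel_measurable_diff f_measurable \<theta> \<theta>0)
  have Dkm: "(\<lambda>p. ?D p $ k) \<in> borel_measurable seq_space" for k
    by (rule measurable_compose[OF Dm component_measurable])
  have Db: "norm (?D p) \<le> 2 * ?e p" if "p \<in> path_dom b" for p
  proof -
    have "norm (?D p) = norm (resid \<theta> p - resid \<theta>0 p)" by (simp add: resid_def)
    also have "\<dots> \<le> norm (resid \<theta> p) + norm (resid \<theta>0 p)" by (rule norm_triangle_ineq4)
    also have "\<dots> \<le> ?e p + ?e p"
      by (intro add_mono lipschitz_family_bound[OF b_nonneg b_summable U(1) f0_bound(1) family_resid] \<theta> \<theta>0 that)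
    finally show ?thesis by simp
  qed
  have D2: "integrable path_law (\<lambda>p. ?D p \<bullet> ?D p)"
  proof (rule Bochner_Integration.integrable_bound)
    show "integrable path_law (\<lambda>p. 4 * (?e p)\<^sup>2)" using e2 by simp
    show "(\<lambda>p. ?D p \<bullet> ?D p) \<in> borel_measurable path_law"
      unfolding measurable_path_law by (intro borel_measurable_inner Dm)
    show "AE p in path_law. norm (?D p \<bullet> ?D p) \<le> norm (4 * (?e p)\<^sup>2)"
      using dom
    proof eventually_elim
      case (elim p)
      have "norm (?D p \<bullet> ?D p) = (norm (?D p))\<^sup>2" by (simp add: power2_norm_eq_inner)
      also have "\<dots> \<le> (2 * ?e p)\<^sup>2" by (intro power_mono Db elim norm_ge_zero)
      finally show ?case by (simp add: power_mult_distrib)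
    qed
  qed
  have Dk2: "integrable path_law (\<lambda>p. (?D p $ k)\<^sup>2)" for k
  proof (rule Bochner_Integration.integrable_bound[OF D2])
    show "(\<lambda>p. (?D p $ k)\<^sup>2) \<in> borel_measurable path_law"
      unfolding measurable_path_law by (rule borel_measurable_power[OF Dkm])
    have "(x $ k)\<^sup>2 \<le> x \<bullet> x" for x :: "real^'m"
      using power_mono[OF component_le_norm_cart[of x k], of 2] by (simp add: power2_norm_eq_inner)
    then show "AE p in path_law. norm ((?D p $ k)\<^sup>2) \<le> norm (?D p \<bullet> ?D p)" 
      by (intro AE_I2) (simp only: real_norm_def abs_power2 abs_of_nonneg[OF inner_ge_zero])
  qed
  have Dk: "integrable path_law (\<lambda>p. ?D p $ k)" for k
    by (rule path_law.square_integrable_imp_integrable[OF _ Dk2]) (simp only: measurable_path_law Dkm)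
  \<comment> \<open>Independence is available for real functions, so the mixed term is treated
    coordinate by coordinate.\<close>
  have o: "integrable path_law (\<lambda>p. innovation p $ k * ?D p $ k)" "(\<integral>p. innovation p $ k * ?D p $ k \<partial>path_law) = 0" for k
    using innovation_past_product[OF component_measurable Dkm _ innovation_moments(2) Dk, of k k]
    by (simp_all add: f_ignores_present innovation_moments(3))
  have io: "integrable path_law (\<lambda>p. innovation p \<bullet> ?D p)" "(\<integral>p. innovation p \<bullet> ?D p \<partial>path_law) = 0"
    unfolding inner_vec_def inner_real_def using o by (simp_all only: Bochner_Integration.integrable_sum Bochner_Integration.integral_sum sum.neutral_const)
  have iI: "integrable path_law (\<lambda>p. innovation p \<bullet> innovation p)"
    unfolding inner_vec_def inner_real_def by (intro Bochner_Integration.integrable_sum innovation_moments(4))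
  have Im: "(\<lambda>p. innovation p \<bullet> innovation p) \<in> borel_measurable path_law"
    using borel_measurable_integrable[OF iI] .
  have rm: "(\<lambda>p. resid \<theta>' p \<bullet> resid \<theta>' p) \<in> borel_measurable path_law" if "\<theta>' \<in> \<Theta>" for \<theta>'
    unfolding measurable_path_law by (rule lipschitz_family_inner_measurable[OF b_nonneg b_summable U(1) f0_bound(1) family_resid family_resid that])
  have Q0: "Q \<theta>0 = (\<integral>p. innovation p \<bullet> innovation p \<partial>path_law)"
    unfolding Q_def
  proof (rule integral_cong_AE[OF rm[OF \<theta>0] Im])
    show "AE p in path_law. resid \<theta>0 p \<bullet> resid \<theta>0 p = innovation p \<bullet> innovation p"
      using dom by eventually_elim (simp only: innovation_eq_resid)
  qed
  have i3: "integrable path_law (\<lambda>p. innovation p \<bullet> innovation p + (?D p \<bullet> ?D p + 2 * (innovation p \<bullet> ?D p)))"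
    by (intro Bochner_Integration.integrable_add integrable_mult_right iI D2 io)
  have "Q \<theta> = (\<integral>p. innovation p \<bullet> innovation p + (?D p \<bullet> ?D p + 2 * (innovation p \<bullet> ?D p)) \<partial>path_law)"
    unfolding Q_def
  proof (rule integral_cong_AE[OF rm[OF \<theta>] borel_measurable_integrable[OF i3]])
    show "AE p in path_law. resid \<theta> p \<bullet> resid \<theta> p = innovation p \<bullet> innovation p + (?D p \<bullet> ?D p + 2 * (innovation p \<bullet> ?D p))"
      using dom
    proof eventually_elim
      case (elim p)
      have "resid \<theta> p = innovation p + ?D p" using innovation_eq_resid[OF elim] by (simp add: resid_def)
      then have "resid \<theta> p \<bullet> resid \<theta> p = (innovation p + ?D p) \<bullet> (innovation p + ?D p)" by (simp only:)
      then show ?case by (simp only: inner_add_left inner_add_right inner_commute[of "?D p" "innovation p"])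
    qed
  qed
  also have "\<dots> = Q \<theta>0 + (\<integral>p. ?D p \<bullet> ?D p \<partial>path_law)"
    using iI D2 io by (simp only: Q0 Bochner_Integration.integral_add Bochner_Integration.integrable_add integrable_mult_right
        integral_mult_right_zero mult_zero_right add_0_right)
  finally have Q: "Q \<theta> = Q \<theta>0 + (\<integral>p. ?D p \<bullet> ?D p \<partial>path_law)" .
  have "(\<integral>p. ?D p \<bullet> ?D p \<partial>path_law) \<noteq> 0"
  proof
    \<comment> \<open>Equality on path space transfers to the past at every time t, which is the
      form of the identifiability assumption.\<close>
    assume "(\<integral>p. ?D p \<bullet> ?D p \<partial>path_law) = 0"
    then have "AE p in path_law. ?D p \<bullet> ?D p = 0"
      using integral_nonneg_eq_0_iff_AE[OF D2] by simp
    then have "AE p in path_law. f \<theta> p = f \<theta>0 p" by eventually_elim simp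
    with dom have "AE p in path_law. ar_fun A0 A \<theta> p = ar_fun A0 A \<theta>0 p"
      by eventually_elim (simp only: path_dom_ar_fun \<theta> \<theta>0)
    then have "AE \<omega> in M. ar_fun A0 A \<theta> (past X t \<omega>) = ar_fun A0 A \<theta>0 (past X t \<omega>)" for t
      by (rule AE_past)
    then have "\<theta> = \<theta>0" by (rule identifiable[OF \<theta>])
    then show False using ne by simp
  qed
  moreover have "(\<integral>p. ?D p \<bullet> ?D p \<partial>path_law) \<ge> 0" by simp
  ultimately show ?thesis using Q by linarith
qed

section \<open>The observed loss and its minimisers\<close>

definition loss :: "nat \<Rightarrow> 'a \<Rightarrow> real^'d \<Rightarrow> real" where
  "loss n \<omega> \<theta> = (\<Sum>t=1..n. resid \<theta> (truncated_past X u t \<omega>) \<bullet> resid \<theta> (truncated_past X u t \<omega>))"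

lemma truncated_past_dom: "past X (int t) \<omega> \<in> path_dom b \<Longrightarrow> t \<ge> 1 \<Longrightarrow> truncated_past X u t \<omega> \<in> path_dom b"
  by (rule truncation_dom[OF b_nonneg b_summable U(1) f0_bound(1) _ truncated_past])

lemma quasi_loglik_eq:
  assumes "\<And>t. past X t \<omega> \<in> path_dom b" "\<theta> \<in> \<Theta>"
  shows "quasi_loglik A0 A X u n \<omega> \<theta> = - (1/2) * loss n \<omega> \<theta>"
  unfolding quasi_loglik_def loss_def
proof (intro arg_cong[where f = "\<lambda>z. - (1/2) * z"] sum.cong refl)
  fix t assume "t \<in> {1..n}"
  then have t: "t \<ge> 1" by simp
  have "X (int t) \<omega> - ar_fun A0 A \<theta> (truncated_past X u t \<omega>) = resid \<theta> (truncated_past X u t \<omega>)"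
    using path_dom_ar_fun[OF assms(2) truncated_past_dom[OF assms(1) t]] by (simp add: resid_def truncated_past_0[OF t])
  then show "(norm (X (int t) \<omega> - ar_fun A0 A \<theta> (truncated_past X u t \<omega>)))\<^sup>2 =
      resid \<theta> (truncated_past X u t \<omega>) \<bullet> resid \<theta> (truncated_past X u t \<omega>)"
    by (simp only: power2_norm_eq_inner)
qed

lemma \<theta>hat_minimises:
  assumes dom: "\<And>t. past X t \<omega> \<in> path_dom b" and \<omega>: "\<omega> \<in> space M" and n: "n \<ge> 1"
  shows "\<theta>hat n \<omega> \<in> \<Theta>" "\<theta> \<in> \<Theta> \<Longrightarrow> loss n \<omega> (\<theta>hat n \<omega>) \<le> loss n \<omega> \<theta>"
proof -
  have am: "is_arg_max (quasi_loglik A0 A X u n \<omega>) (\<lambda>\<theta>. \<theta> \<in> \<Theta>) (\<theta>hat n \<omega>)"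
    using qmle \<omega> n unfolding is_qmle_def by blast
  then show 1: "\<theta>hat n \<omega> \<in> \<Theta>" by (simp add: is_arg_max_def)
  assume "\<theta> \<in> \<Theta>"
  then have "quasi_loglik A0 A X u n \<omega> \<theta> \<le> quasi_loglik A0 A X u n \<omega> (\<theta>hat n \<omega>)"
    using am unfolding is_arg_max_def by (meson not_less)
  then show "loss n \<omega> (\<theta>hat n \<omega>) \<le> loss n \<omega> \<theta>"
    using quasi_loglik_eq[OF dom 1, of n] quasi_loglik_eq[OF dom \<open>\<theta> \<in> \<Theta>\<close>, of n] by linarith
qed

text \<open>With a tolerance of one quarter of the gap between Q at \<theta>1 and at \<theta>0, the
  averaged loss near \<theta>1 eventually exceeds the one at \<theta>0, so no minimiser can lie
  there.\<close>

lemma \<theta>hat_avoids: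
  assumes \<theta>1: "\<theta>1 \<in> \<Theta>" "\<theta>1 \<noteq> \<theta>0"
  shows "\<exists>\<rho>>0. AE \<omega> in M. \<forall>\<^sub>F n in sequentially. \<theta>hat n \<omega> \<notin> ball \<theta>1 \<rho>"
proof -
  define e where "e = (Q \<theta>1 - Q \<theta>0) / 4"
  have e: "e > 0" using Q_minimal[OF \<theta>1] by (simp add: e_def)
  note pa = product_average[OF b_nonneg b_summable U(1) f0_bound(1) family_resid family_resid]
  obtain \<rho> where \<rho>: "\<rho> > 0" "AE \<omega> in M. \<forall>\<^sub>F n in sequentially. \<forall>\<theta>\<in>\<Theta> \<inter> ball \<theta>1 \<rho>. \<forall>q.
    (\<forall>t\<in>{1..n}. truncation t U (past X (int t) \<omega>) (q t)) \<longrightarrow>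
    \<bar>(\<Sum>t=1..n. resid \<theta> (q t) \<bullet> resid \<theta> (q t)) / real n - (\<integral>p. resid \<theta>1 p \<bullet> resid \<theta>1 p \<partial>path_law)\<bar> \<le> e"
    by (rule pa[OF \<theta>1(1) e])
  obtain \<rho>0 where \<rho>0: "\<rho>0 > 0" "AE \<omega> in M. \<forall>\<^sub>F n in sequentially. \<forall>\<theta>\<in>\<Theta> \<inter> ball \<theta>0 \<rho>0. \<forall>q.
    (\<forall>t\<in>{1..n}. truncation t U (past X (int t) \<omega>) (q t)) \<longrightarrow>
    \<bar>(\<Sum>t=1..n. resid \<theta> (q t) \<bullet> resid \<theta> (q t)) / real n - (\<integral>p. resid \<theta>0 p \<bullet> resid \<theta>0 p \<partial>path_law)\<bar> \<le> e"
    by (rule pa[OF \<theta>0 e])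
  have b0: "\<theta>0 \<in> ball \<theta>0 \<rho>0" using \<rho>0(1) by simp
  have "AE \<omega> in M. \<forall>\<^sub>F n in sequentially. \<theta>hat n \<omega> \<notin> ball \<theta>1 \<rho>"
    using \<rho>(2) \<rho>0(2) AE_all_past[OF AE_path_dom[OF b_nonneg b_summable U(1)]] AE_space
  proof eventually_elim
    case (elim \<omega>)
    have dom: "past X t \<omega> \<in> path_dom b" for t using elim(3) by blast
    have q: "\<forall>t\<in>{1..n}. truncation t U (past X (int t) \<omega>) (truncated_past X u t \<omega>)" for n
      using truncated_past by simp
    from elim(1,2) eventually_ge_at_top[of 1] show ?case
    proof eventually_elim
      case (elim n)
      show ?case
      proof
        assume b: "\<theta>hat n \<omega> \<in> ball \<theta>1 \<rho>"
        have h: "\<theta>hat n \<omega> \<in> \<Theta>" by (rule \<theta>hat_minimises(1)[OF dom \<open>\<omega> \<in> space M\<close> elim(3)])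
        have "\<bar>loss n \<omega> (\<theta>hat n \<omega>) / real n - Q \<theta>1\<bar> \<le> e"
          unfolding loss_def Q_def
          by (rule bspec[OF elim(1), OF IntI[OF h b], THEN spec, of "\<lambda>t. truncated_past X u t \<omega>", THEN mp, OF q])
        moreover have "\<bar>loss n \<omega> \<theta>0 / real n - Q \<theta>0\<bar> \<le> e"
          unfolding loss_def Q_def
          by (rule bspec[OF elim(2), OF IntI[OF \<theta>0 b0], THEN spec, of "\<lambda>t. truncated_past X u t \<omega>", THEN mp, OF q])
        moreover have "loss n \<omega> (\<theta>hat n \<omega>) / real n \<le> loss n \<omega> \<theta>0 / real n"
          by (intro divide_right_mono \<theta>hat_minimises(2)[OF dom \<open>\<omega> \<in> space M\<close> elim(3) \<theta>0]) simp
        moreover have False if "\<bar>x - Q \<theta>1\<bar> \<le> e" "\<bar>y - Q \<theta>0\<bar> \<le> e" "x \<le> y" for x y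
          using that e unfolding e_def abs_le_iff by (simp add: field_simps)
        ultimately show False by blast
      qed
    qed
  qed
  then show ?thesis using \<rho>(1) by blast
qed

text \<open>Outside a ball around \<theta>0 the parameter set is compact, hence covered by finitely
  many of the balls that the estimator eventually avoids. Wald's argument.\<close>

theorem strongly_consistent: "AE \<omega> in M. (\<lambda>n. \<theta>hat n \<omega>) \<longlonglongrightarrow> \<theta>0"
proof -
  have near: "AE \<omega> in M. \<forall>\<^sub>F n in sequentially. dist (\<theta>hat n \<omega>) \<theta>0 < e" if e: "e > 0" for e
  proof -
    let ?K = "\<Theta> - ball \<theta>0 e"
    have "\<forall>\<theta>1\<in>?K. \<exists>\<rho>>0. AE \<omega> in M. \<forall>\<^sub>F n in sequentially. \<theta>hat n \<omega> \<notin> ball \<theta>1 \<rho>"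
    proof
      fix \<theta>1 assume "\<theta>1 \<in> ?K"
      then have "\<theta>1 \<in> \<Theta>" "\<theta>1 \<noteq> \<theta>0" using e by auto
      then show "\<exists>\<rho>>0. AE \<omega> in M. \<forall>\<^sub>F n in sequentially. \<theta>hat n \<omega> \<notin> ball \<theta>1 \<rho>" by (rule \<theta>hat_avoids)
    qed
    then obtain \<rho> where \<rho>: "\<And>\<theta>1. \<theta>1 \<in> ?K \<Longrightarrow> \<rho> \<theta>1 > 0"
      "\<And>\<theta>1. \<theta>1 \<in> ?K \<Longrightarrow> AE \<omega> in M. \<forall>\<^sub>F n in sequentially. \<theta>hat n \<omega> \<notin> ball \<theta>1 (\<rho> \<theta>1)"
      by metis
    have "compact ?K" by (intro compact_diff compact open_ball)
    moreover have "?K \<subseteq> (\<Union>\<theta>1\<in>?K. ball \<theta>1 (\<rho> \<theta>1))" using \<rho>(1) by force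
    ultimately obtain F where F: "F \<subseteq> ?K" "finite F" "?K \<subseteq> (\<Union>\<theta>1\<in>F. ball \<theta>1 (\<rho> \<theta>1))"
      using compactE_image[of ?K ?K "\<lambda>\<theta>1. ball \<theta>1 (\<rho> \<theta>1)"] by (metis open_ball)
    have "AE \<omega> in M. \<forall>\<theta>1\<in>F. \<forall>\<^sub>F n in sequentially. \<theta>hat n \<omega> \<notin> ball \<theta>1 (\<rho> \<theta>1)"
      by (rule AE_finite_allI[OF F(2)]) (use F(1) \<rho>(2) in blast)
    with AE_all_past[OF AE_path_dom[OF b_nonneg b_summable U(1)]] AE_space show ?thesis
    proof eventually_elim
      case (elim \<omega>)
      have dom: "past X t \<omega> \<in> path_dom b" for t using elim(1) by blast
      have "\<forall>\<^sub>F n in sequentially. \<forall>\<theta>1\<in>F. \<theta>hat n \<omega> \<notin> ball \<theta>1 (\<rho> \<theta>1)"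
        using elim(3) F(2) by (simp add: eventually_ball_finite)
      with eventually_ge_at_top[of 1] show ?case
      proof eventually_elim
        case (elim n)
        have "\<theta>hat n \<omega> \<in> \<Theta>" by (rule \<theta>hat_minimises(1)[OF dom \<open>\<omega> \<in> space M\<close> elim(1)])
        moreover have "\<theta>hat n \<omega> \<notin> ?K" using elim(2) F(3) by blast
        ultimately show ?case by (simp add: dist_commute)
      qed
    qed
  qed
  \<comment> \<open>The null set depends on the radius; radii 1 / (k + 1) make the union
    countable.\<close>
  have "AE \<omega> in M. \<forall>k::nat. \<forall>\<^sub>F n in sequentially. dist (\<theta>hat n \<omega>) \<theta>0 < 1 / real (Suc k)"
    unfolding AE_all_countable by (intro allI near) simp
  then show ?thesis
  proof eventually_elim
    case (elim \<omega>)
    show ?case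
    proof (rule tendstoI)
      fix e :: real assume "e > 0"
      then obtain k where "1 / real (Suc k) < e" using reals_Archimedean[of e] by (auto simp: inverse_eq_divide)
      then show "\<forall>\<^sub>F n in sequentially. dist (\<theta>hat n \<omega>) \<theta>0 < e"
        using elim[rule_format, of k] by (auto elim: eventually_mono)
    qed
  qed
qed

end

section \<open>A central limit theorem for the innovations\<close>

lemma inner_square_le: "(x \<bullet> y)\<^sup>2 \<le> (x \<bullet> x) * (y \<bullet> y)" for x y :: "'a::real_inner"
  using Cauchy_Schwarz_ineq[of x y] .

context ar_model
begin

lemma square_integrable_shift:
  fixes w :: "(nat \<Rightarrow> real^'m) \<Rightarrow> real"
  assumes "w \<in> borel_measurable seq_space" "integrable path_law (\<lambda>p. (w p)\<^sup>2)"
  shows "integrable path_law (\<lambda>p. (w (\<lambda>j. p (Suc j)))\<^sup>2)"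
proof -
  have wm: "(\<lambda>p. (w (\<lambda>j. p (Suc j)))\<^sup>2) \<in> borel_measurable seq_space"
    by (rule borel_measurable_power[OF measurable_compose[OF Suc_shift_measurable assms(1)]])
  have "past X 1 \<omega> (Suc j) = past X 0 \<omega> j" for \<omega> j by (simp add: past_def)
  then show ?thesis
    using integrable_past[OF assms(2), of 0] integrable_past_iff[OF wm, of 1] by simp
qed

text \<open>Stated for a centred transform \<eta> of the innovation, so that it covers both the
  identity and the truncated innovations of the central limit theorem. Square integrability of the
  product comes from independence.\<close>

lemma innovation_martingale_difference:
  fixes \<eta> :: "real^'m \<Rightarrow> real^'m" and v :: "(nat \<Rightarrow> real^'m) \<Rightarrow> real^'m"
  assumes \<eta>: "\<eta> \<in> borel_measurable borel"
    and \<eta>2: "integrable path_law (\<lambda>p. \<eta> (innovation p) \<bullet> \<eta> (innovation p))"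
    and \<eta>0: "\<And>k. (\<integral>p. \<eta> (innovation p) $ k \<partial>path_law) = 0"
    and v: "v \<in> borel_measurable seq_space" "\<And>p. v (p(0 := 0)) = v p"
    and v2: "integrable path_law (\<lambda>p. v p \<bullet> v p)"
  shows "martingale_difference (\<lambda>p. \<eta> (innovation p) \<bullet> v p)"
  unfolding martingale_difference_def
proof (intro conjI ballI impI)
  have \<eta>i: "(\<lambda>p. \<eta> (innovation p)) \<in> borel_measurable seq_space"
    by (rule measurable_compose[OF innovation_measurable \<eta>])
  show m: "(\<lambda>p. \<eta> (innovation p) \<bullet> v p) \<in> borel_measurable seq_space"
    by (intro borel_measurable_inner \<eta>i v)
  have vv: "(\<lambda>p. v p \<bullet> v p) \<in> borel_measurable seq_space" by (intro borel_measurable_inner v)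
  have \<eta>\<eta>: "(\<lambda>x. \<eta> x \<bullet> \<eta> x) \<in> borel_measurable borel" by (intro borel_measurable_inner \<eta>)
  have prod: "integrable path_law (\<lambda>p. (\<eta> (innovation p) \<bullet> \<eta> (innovation p)) * (v p \<bullet> v p))"
    by (rule innovation_past_product(1)[OF \<eta>\<eta> vv _ \<eta>2 v2]) (simp add: v(2))
  show "integrable path_law (\<lambda>p. (\<eta> (innovation p) \<bullet> v p)\<^sup>2)"
  proof (rule Bochner_Integration.integrable_bound[OF prod])
    show "(\<lambda>p. (\<eta> (innovation p) \<bullet> v p)\<^sup>2) \<in> borel_measurable path_law"
      unfolding measurable_path_law by (rule borel_measurable_power[OF m])
    show "AE p in path_law. norm ((\<eta> (innovation p) \<bullet> v p)\<^sup>2) \<le> norm ((\<eta> (innovation p) \<bullet> \<eta> (innovation p)) * (v p \<bullet> v p))"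
      using inner_square_le by (intro AE_I2) (simp add: abs_mult)
  qed
  fix w :: "(nat \<Rightarrow> real^'m) \<Rightarrow> real"
  assume w: "w \<in> borel_measurable seq_space" and w2: "integrable path_law (\<lambda>p. (w p)\<^sup>2)"
  let ?w = "\<lambda>p. w (\<lambda>j. p (Suc j))"
  have wm: "?w \<in> borel_measurable seq_space" by (rule measurable_compose[OF Suc_shift_measurable w])
  have vk: "(\<lambda>p. v p $ k) \<in> borel_measurable seq_space" for k
    by (rule measurable_compose[OF v(1) component_measurable])
  have sq_le: "(x $ k)\<^sup>2 \<le> x \<bullet> x" for x :: "real^'m" and k
    using power_mono[OF component_le_norm_cart[of x k], of 2] by (simp add: power2_norm_eq_inner)
  have vk2: "integrable path_law (\<lambda>p. (v p $ k)\<^sup>2)" for k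
    by (rule Bochner_Integration.integrable_bound[OF v2])
      (simp_all only: measurable_path_law borel_measurable_power[OF vk] real_norm_def abs_power2 abs_of_nonneg[OF inner_ge_zero] sq_le AE_I2)
  have \<eta>k: "(\<lambda>x. \<eta> x $ k) \<in> borel_measurable borel" for k
    by (rule measurable_compose[OF \<eta> component_measurable])
  have \<eta>ki: "(\<lambda>p. \<eta> (innovation p) $ k) \<in> borel_measurable seq_space" for k
    by (rule measurable_compose[OF \<eta>i component_measurable])
  have \<eta>k2: "integrable path_law (\<lambda>p. (\<eta> (innovation p) $ k)\<^sup>2)" for k
    by (rule Bochner_Integration.integrable_bound[OF \<eta>2])
      (simp_all only: measurable_path_law borel_measurable_power[OF \<eta>ki] real_norm_def abs_power2 abs_of_nonneg[OF inner_ge_zero] sq_le AE_I2)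
  have \<eta>k1: "integrable path_law (\<lambda>p. \<eta> (innovation p) $ k)" for k
    by (rule path_law.square_integrable_imp_integrable[OF _ \<eta>k2]) (simp only: measurable_path_law \<eta>ki)
  have vw: "integrable path_law (\<lambda>p. v p $ k * ?w p)" for k
    by (intro integrable_mult_of_squares vk2 square_integrable_shift w w2) (simp_all only: measurable_path_law vk wm)
  have vwm: "(\<lambda>p. v p $ k * ?w p) \<in> borel_measurable seq_space" for k by (intro borel_measurable_times vk wm)
  have o: "integrable path_law (\<lambda>p. \<eta> (innovation p) $ k * (v p $ k * ?w p))"
    "(\<integral>p. \<eta> (innovation p) $ k * (v p $ k * ?w p) \<partial>path_law) = 0" for k
    using innovation_past_product[OF \<eta>k vwm _ \<eta>k1 vw, of k k] by (simp_all add: v(2) \<eta>0)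
  have "(\<eta> (innovation p) \<bullet> v p) * ?w p = (\<Sum>k\<in>UNIV. \<eta> (innovation p) $ k * (v p $ k * ?w p))" for p
    by (simp add: inner_vec_def sum_distrib_right mult.assoc)
  then show "(\<integral>p. (\<eta> (innovation p) \<bullet> v p) * ?w p \<partial>path_law) = 0"
    using o by (simp only: Bochner_Integration.integral_sum sum.neutral_const)
qed

lemma innovation_square_integrable: "integrable path_law (\<lambda>p. innovation p \<bullet> innovation p)"
  unfolding inner_vec_def inner_real_def by (intro Bochner_Integration.integrable_sum innovation_moments(4))

text \<open>Independence factors every term of the double sum over coordinates, and the identity
  covariance of the noise keeps only the diagonal. Applied to gradients, this makes the covariance
  of the score equal to their Gram matrix.\<close>

lemma
  fixes v w :: "(nat \<Rightarrow> real^'m) \<Rightarrow> real^'m"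
  assumes v: "v \<in> borel_measurable seq_space" "\<And>p. v (p(0 := 0)) = v p" "integrable path_law (\<lambda>p. v p \<bullet> v p)"
    and w: "w \<in> borel_measurable seq_space" "\<And>p. w (p(0 := 0)) = w p" "integrable path_law (\<lambda>p. w p \<bullet> w p)"
  shows innovation_covariance_integrable: "integrable path_law (\<lambda>p. (innovation p \<bullet> v p) * (innovation p \<bullet> w p))"
    and innovation_covariance: "(\<integral>p. (innovation p \<bullet> v p) * (innovation p \<bullet> w p) \<partial>path_law) = (\<integral>p. v p \<bullet> w p \<partial>path_law)"
    and innovation_inner_expectation: "integrable path_law (\<lambda>p. innovation p \<bullet> v p)" "(\<integral>p. innovation p \<bullet> v p \<partial>path_law) = 0"
proof -
  have sq_le: "(x $ k)\<^sup>2 \<le> x \<bullet> x" for x :: "real^'m" and k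
    using power_mono[OF component_le_norm_cart[of x k], of 2] by (simp add: power2_norm_eq_inner)
  have k2: "integrable path_law (\<lambda>p. (v p $ k)\<^sup>2)" "(\<lambda>p. v p $ k) \<in> borel_measurable seq_space"
    if "v \<in> borel_measurable seq_space" "integrable path_law (\<lambda>p. v p \<bullet> v p)" for k and v :: "(nat \<Rightarrow> real^'m) \<Rightarrow> real^'m"
  proof -
    show 1: "(\<lambda>p. v p $ k) \<in> borel_measurable seq_space" by (rule measurable_compose[OF that(1) component_measurable])
    show "integrable path_law (\<lambda>p. (v p $ k)\<^sup>2)"
      by (rule Bochner_Integration.integrable_bound[OF that(2)])
        (simp_all only: measurable_path_law borel_measurable_power[OF 1] real_norm_def abs_power2 abs_of_nonneg[OF inner_ge_zero] sq_le AE_I2)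
  qed
  note vk = k2[OF v(1,3)] and wk = k2[OF w(1,3)]
  have vw: "integrable path_law (\<lambda>p. v p $ k * w p $ l)" for k l
    by (intro integrable_mult_of_squares vk wk) (simp_all only: measurable_path_law vk wk)
  have vwm: "(\<lambda>p. v p $ k * w p $ l) \<in> borel_measurable seq_space" for k l
    by (intro borel_measurable_times vk wk)
  have xm: "(\<lambda>x::real^'m. x $ k * x $ l) \<in> borel_measurable borel" for k l
    by (intro borel_measurable_times component_measurable)
  have t: "integrable path_law (\<lambda>p. (innovation p $ k * innovation p $ l) * (v p $ k * w p $ l))"
    "(\<integral>p. (innovation p $ k * innovation p $ l) * (v p $ k * w p $ l) \<partial>path_law) =
      (if k = l then 1 else 0) * (\<integral>p. v p $ k * w p $ l \<partial>path_law)" for k l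
    using innovation_past_product[OF xm vwm _ innovation_moments(4) vw, of k l k l]
    by (simp_all only: v(2) w(2) innovation_moments(5))
  have eq: "(innovation p \<bullet> v p) * (innovation p \<bullet> w p) =
      (\<Sum>k\<in>UNIV. \<Sum>l\<in>UNIV. (innovation p $ k * innovation p $ l) * (v p $ k * w p $ l))" for p
    unfolding inner_vec_def inner_real_def sum_product by (simp only: ac_simps)
  show "integrable path_law (\<lambda>p. (innovation p \<bullet> v p) * (innovation p \<bullet> w p))"
    unfolding eq by (intro Bochner_Integration.integrable_sum t)
  have "(\<integral>p. (innovation p \<bullet> v p) * (innovation p \<bullet> w p) \<partial>path_law) =
    (\<Sum>k\<in>UNIV. \<Sum>l\<in>UNIV. (if k = l then 1 else 0) * (\<integral>p. v p $ k * w p $ l \<partial>path_law))"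
    unfolding eq using t by (simp only: Bochner_Integration.integral_sum Bochner_Integration.integrable_sum)
  also have "\<dots> = (\<Sum>k\<in>UNIV. \<integral>p. v p $ k * w p $ k \<partial>path_law)"
    by (simp add: if_distrib[of "\<lambda>z. z * _"] cong: if_cong)
  also have "\<dots> = (\<integral>p. v p \<bullet> w p \<partial>path_law)"
    unfolding inner_vec_def inner_real_def using vw by (simp only: Bochner_Integration.integral_sum)
  finally show "(\<integral>p. (innovation p \<bullet> v p) * (innovation p \<bullet> w p) \<partial>path_law) = (\<integral>p. v p \<bullet> w p \<partial>path_law)" .
  have v1: "integrable path_law (\<lambda>p. v p $ k)" for k
    by (rule path_law.square_integrable_imp_integrable[OF _ vk(1)]) (simp only: measurable_path_law vk)
  have o: "integrable path_law (\<lambda>p. innovation p $ k * v p $ k)" "(\<integral>p. innovation p $ k * v p $ k \<partial>path_law) = 0" for k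
    using innovation_past_product[OF component_measurable vk(2) _ innovation_moments(2) v1, of k k]
    by (simp_all add: v(2) innovation_moments(3))
  show "integrable path_law (\<lambda>p. innovation p \<bullet> v p)" "(\<integral>p. innovation p \<bullet> v p \<partial>path_law) = 0"
    unfolding inner_vec_def inner_real_def using o
    by (simp_all only: Bochner_Integration.integrable_sum Bochner_Integration.integral_sum sum.neutral_const)
qed

text \<open>Bounded martingale differences are obtained by cutting the innovation and the direction
  v separately; cutting their product would destroy the martingale property.\<close>

theorem innovation_clt:
  fixes v :: "(nat \<Rightarrow> real^'m) \<Rightarrow> real^'m"
  assumes v: "v \<in> borel_measurable seq_space" "\<And>p. v (p(0 := 0)) = v p" and v2: "integrable path_law (\<lambda>p. v p \<bullet> v p)"
  shows "(\<lambda>n. \<integral>\<omega>. iexp (s * ((\<Sum>t=1..n. innovation (past X (int t) \<omega>) \<bullet> v (past X (int t) \<omega>)) / sqrt (real n))) \<partial>M)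
    \<longlonglongrightarrow> of_real (exp (- (s\<^sup>2 * (\<integral>p. v p \<bullet> v p \<partial>path_law)) / 2))"
proof -
  define cut where "cut K z = (if \<bar>z\<bar> \<le> K then z else 0)" for K z :: real
  define m where "m k i = (\<integral>p. cut (real k) (innovation p $ i) \<partial>path_law)" for k i
  \<comment> \<open>A cut coordinate need not have mean 0; subtracting its mean \<open>m k i\<close>
    restores the centring. The corrections vanish in the limit because the noise is centred.\<close>
  define \<eta> :: "nat \<Rightarrow> real^'m \<Rightarrow> real^'m" where "\<eta> k x = (\<chi> i. cut (real k) (x $ i) - m k i)" for k x
  define vK where "vK k p = (if norm (v p) \<le> real k then v p else 0)" for k :: nat and p
  let ?d = "\<lambda>p. innovation p \<bullet> v p" and ?dk = "\<lambda>k p. \<eta> k (innovation p) \<bullet> vK k p"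
  define a where "a i = (\<integral>p. \<bar>innovation p $ i\<bar> \<partial>path_law)" for i
  \<comment> \<open>Dominates the innovation and all its recentred cuts at once: \<open>a i\<close>
    bounds the corrections for every k.\<close>
  define S where "S x = norm x + (\<Sum>i\<in>UNIV. \<bar>x $ i\<bar> + a i)" for x :: "real^'m"
  have cut_le: "\<bar>cut K z\<bar> \<le> \<bar>z\<bar>" "K \<ge> 0 \<Longrightarrow> \<bar>cut K z\<bar> \<le> K" for K z by (simp_all add: cut_def)
  have cutm: "(\<lambda>z. cut K z) \<in> borel_measurable borel" for K unfolding cut_def by measurable
  have innk: "(\<lambda>p. innovation p $ i) \<in> borel_measurable path_law" for i
    unfolding measurable_path_law by (rule measurable_compose[OF innovation_measurable component_measurable])
  have cuti: "integrable path_law (\<lambda>p. cut (real k) (innovation p $ i))" for k i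
    by (rule Bochner_Integration.integrable_bound[OF innovation_moments(2)[of i]])
      (simp_all only: measurable_compose[OF innk cutm] real_norm_def cut_le AE_I2)
  have ml: "\<bar>m k i\<bar> \<le> a i" for k i
    unfolding m_def a_def real_norm_def[symmetric]
    by (rule order_trans[OF integral_norm_bound integral_mono])
      (use cuti innovation_moments(2) cut_le in simp_all)
  have m0: "(\<lambda>k. m k i) \<longlonglongrightarrow> 0" for i
  proof -
    have "(\<lambda>k. m k i) \<longlonglongrightarrow> (\<integral>p. innovation p $ i \<partial>path_law)"
      unfolding m_def
    proof (rule integral_dominated_convergence[where w = "\<lambda>p. \<bar>innovation p $ i\<bar>"])
      show "AE p in path_law. (\<lambda>k. cut (real k) (innovation p $ i)) \<longlonglongrightarrow> innovation p $ i"
      proof (rule AE_I2)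
        fix p
        obtain k0 :: nat where "\<bar>innovation p $ i\<bar> \<le> real k0" using real_arch_simple by blast
        then have "\<forall>\<^sub>F k in sequentially. cut (real k) (innovation p $ i) = innovation p $ i"
          unfolding eventually_sequentially cut_def by (intro exI[of _ k0]) auto
        then show "(\<lambda>k. cut (real k) (innovation p $ i)) \<longlonglongrightarrow> innovation p $ i" by (rule tendsto_eventually)
      qed
    qed (use innk measurable_compose[OF innk cutm] innovation_moments(2) cut_le in simp_all)
    then show ?thesis by (simp only: innovation_moments(3))
  qed
  have \<eta>m: "\<eta> k \<in> borel_measurable borel" for k
  proof -
    have "\<eta> k = (\<lambda>x. \<Sum>i\<in>UNIV. (cut (real k) (x $ i) - m k i) *\<^sub>R axis i 1)"
      by (simp add: \<eta>_def fun_eq_iff vec_eq_iff axis_def if_distrib[of "\<lambda>z. _ * z"] cong: if_cong)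
    also have "\<dots> \<in> borel_measurable borel"
      by (intro borel_measurable_sum borel_measurable_scaleR borel_measurable_diff borel_measurable_const
          measurable_compose[OF component_measurable cutm])
    finally show ?thesis .
  qed
  have vKm: "vK k \<in> borel_measurable seq_space" for k
    unfolding vK_def
    by (intro measurable_If v borel_measurable_const borel_measurable_le measurable_compose[OF v(1) borel_measurable_norm])
  have vKv: "vK k p \<bullet> vK k p \<le> v p \<bullet> v p" for k p by (simp add: vK_def)
  have vKn: "norm (vK k p) \<le> norm (v p)" "norm (vK k p) \<le> real k" for k p by (simp_all add: vK_def)
  have vK2: "integrable path_law (\<lambda>p. vK k p \<bullet> vK k p)" for k
    by (rule Bochner_Integration.integrable_bound[OF v2])
      (simp_all only: measurable_path_law borel_measurable_inner[OF vKm vKm] real_norm_def abs_of_nonneg[OF inner_ge_zero] vKv AE_I2)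
  have \<eta>S: "norm (\<eta> k x) \<le> (\<Sum>i\<in>UNIV. \<bar>x $ i\<bar> + a i)" for k x
  proof -
    have "norm (\<eta> k x) \<le> (\<Sum>i\<in>UNIV. \<bar>\<eta> k x $ i\<bar>)" by (rule norm_le_l1_cart)
    also have "\<dots> \<le> (\<Sum>i\<in>UNIV. \<bar>x $ i\<bar> + a i)"
    proof (rule sum_mono)
      fix i
      show "\<bar>\<eta> k x $ i\<bar> \<le> \<bar>x $ i\<bar> + a i"
        unfolding \<eta>_def vec_lambda_beta by (rule order_trans[OF abs_triangle_ineq4 add_mono[OF cut_le(1) ml]])
    qed
    finally show ?thesis .
  qed
  have \<eta>b: "norm (\<eta> k x) \<le> (\<Sum>i\<in>UNIV. real k + a i)" for k x
  proof -
    have "norm (\<eta> k x) \<le> (\<Sum>i\<in>UNIV. \<bar>\<eta> k x $ i\<bar>)" by (rule norm_le_l1_cart)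
    also have "\<dots> \<le> (\<Sum>i\<in>UNIV. real k + a i)"
    proof (rule sum_mono)
      fix i
      show "\<bar>\<eta> k x $ i\<bar> \<le> real k + a i"
        unfolding \<eta>_def vec_lambda_beta by (rule order_trans[OF abs_triangle_ineq4 add_mono[OF cut_le(2) ml]]) simp
    qed
    finally show ?thesis .
  qed
  have \<eta>i: "(\<lambda>p. \<eta> k (innovation p)) \<in> borel_measurable seq_space" for k
    by (rule measurable_compose[OF innovation_measurable \<eta>m])
  have \<eta>2: "integrable path_law (\<lambda>p. \<eta> k (innovation p) \<bullet> \<eta> k (innovation p))" for k
  proof (rule path_law.integrable_const_bound[where B = "(\<Sum>i\<in>(UNIV::'m set). real k + a i)\<^sup>2"])
    show "AE p in path_law. norm (\<eta> k (innovation p) \<bullet> \<eta> k (innovation p)) \<le> (\<Sum>i\<in>(UNIV::'m set). real k + a i)\<^sup>2"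
      using power_mono[OF \<eta>b norm_ge_zero, of k _ 2] by (intro AE_I2) (simp add: power2_norm_eq_inner)
  qed (simp only: measurable_path_law borel_measurable_inner[OF \<eta>i \<eta>i])
  have \<eta>0: "(\<integral>p. \<eta> k (innovation p) $ i \<partial>path_law) = 0" for k i
    unfolding \<eta>_def vec_lambda_beta using cuti[of k i] by (simp add: m_def path_law.prob_space)
  have mdk: "martingale_difference (?dk k)" for k
    by (rule innovation_martingale_difference[OF \<eta>m \<eta>2 \<eta>0 vKm _ vK2]) (simp add: vK_def v(2))
  have md: "martingale_difference ?d"
    by (rule innovation_martingale_difference[of "\<lambda>x. x", OF _ innovation_square_integrable innovation_moments(3) v v2]) simp
  have Sm: "S \<in> borel_measurable borel"
    unfolding S_def
    by (intro borel_measurable_add borel_measurable_sum borel_measurable_abs borel_measurable_const component_measurable borel_measurable_norm)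
  have S0: "S x \<ge> norm x" "S x \<ge> (\<Sum>i\<in>UNIV. \<bar>x $ i\<bar> + a i)" for x
    unfolding S_def by (simp_all add: a_def sum_nonneg)
  have S2: "integrable path_law (\<lambda>p. (S (innovation p))\<^sup>2)"
  proof -
    have n: "integrable path_law (\<lambda>p. (norm (innovation p))\<^sup>2)"
      unfolding power2_norm_eq_inner by (rule innovation_square_integrable)
    have nm: "(\<lambda>p. norm (innovation p)) \<in> borel_measurable path_law"
      unfolding measurable_path_law by (rule measurable_compose[OF innovation_measurable borel_measurable_norm])
    have "S x \<le> (1 + real CARD('m)) * norm x + (\<Sum>i\<in>UNIV. a i)" for x
    proof -
      have "(\<Sum>i\<in>UNIV. \<bar>x $ i\<bar> + a i) \<le> (\<Sum>i\<in>UNIV. norm x + a i)"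
        by (intro sum_mono add_right_mono component_le_norm_cart)
      then show ?thesis by (simp add: S_def sum.distrib distrib_right)
    qed
    then have le: "(S x)\<^sup>2 \<le> ((1 + real CARD('m)) * norm x + (\<Sum>i\<in>UNIV. a i))\<^sup>2" for x
      by (intro power_mono order_trans[OF norm_ge_zero S0(1)])
    have i: "integrable path_law (\<lambda>p. ((1 + real CARD('m)) * norm (innovation p) + (\<Sum>i\<in>UNIV. a i))\<^sup>2)"
    proof (rule integrable_power2_add)
      show "integrable path_law (\<lambda>p. ((1 + real CARD('m)) * norm (innovation p))\<^sup>2)"
        unfolding power_mult_distrib using n by (rule integrable_mult_right)
    qed (intro borel_measurable_times borel_measurable_const nm, simp_all)
    show ?thesis
      by (rule Bochner_Integration.integrable_bound[OF i])
        (simp_all only: measurable_path_law borel_measurable_power[OF measurable_compose[OF innovation_measurable Sm]] real_norm_def abs_power2 le AE_I2)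
  qed
  \<comment> \<open>The squares of \<open>S\<close> at the innovation and of the norm of v are
    independent, so second moments of the factors suffice for the product.\<close>
  have dom: "integrable path_law (\<lambda>p. (2 * S (innovation p))\<^sup>2 * (v p \<bullet> v p))"
  proof -
    have vv: "(\<lambda>p. v p \<bullet> v p) \<in> borel_measurable seq_space" by (intro borel_measurable_inner v)
    have "integrable path_law (\<lambda>p. (S (innovation p))\<^sup>2 * (v p \<bullet> v p))"
      by (rule innovation_past_product(1)[OF borel_measurable_power[OF Sm] vv _ S2 v2]) (simp add: v(2))
    then have "integrable path_law (\<lambda>p. 4 * ((S (innovation p))\<^sup>2 * (v p \<bullet> v p)))" by (rule integrable_mult_right)
    then show ?thesis by (simp add: power_mult_distrib mult.assoc)
  qed
  have lim: "(\<lambda>k. ?dk k p) \<longlonglongrightarrow> ?d p" for p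
  proof -
    let ?x = "innovation p"
    have "(\<lambda>k. \<eta> k ?x $ i) \<longlonglongrightarrow> ?x $ i - 0" for i
      unfolding \<eta>_def vec_lambda_beta
    proof (intro tendsto_diff m0)
      obtain k0 :: nat where "\<bar>?x $ i\<bar> \<le> real k0" using real_arch_simple by blast
      then have "\<forall>\<^sub>F k in sequentially. cut (real k) (?x $ i) = ?x $ i"
        unfolding eventually_sequentially cut_def by (intro exI[of _ k0]) auto
      then show "(\<lambda>k. cut (real k) (?x $ i)) \<longlonglongrightarrow> ?x $ i" by (rule tendsto_eventually)
    qed
    then have 1: "(\<lambda>k. \<eta> k ?x) \<longlonglongrightarrow> ?x" by (intro vec_tendstoI) simp
    obtain k0 :: nat where "norm (v p) \<le> real k0" using real_arch_simple by blast
    then have "\<forall>\<^sub>F k in sequentially. vK k p = v p"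
      unfolding eventually_sequentially vK_def by (intro exI[of _ k0]) auto
    then have 2: "(\<lambda>k. vK k p) \<longlonglongrightarrow> v p" by (rule tendsto_eventually)
    show ?thesis by (rule tendsto_inner[OF 1 2])
  qed
  have dk_le: "\<bar>?dk k p\<bar> \<le> S (innovation p) * norm (v p)" for k p
    by (rule order_trans[OF Cauchy_Schwarz_ineq2 mult_mono])
      (use order_trans[OF \<eta>S S0(2)] vKn order_trans[OF norm_ge_zero S0(1)] in simp_all)
  have d_le: "\<bar>?d p\<bar> \<le> S (innovation p) * norm (v p)" for p
    by (rule order_trans[OF Cauchy_Schwarz_ineq2 mult_right_mono]) (simp_all add: S0)
  have sq: "z\<^sup>2 \<le> (2 * S (innovation p))\<^sup>2 * (v p \<bullet> v p)" if "\<bar>z\<bar> \<le> 2 * (S (innovation p) * norm (v p))" for z p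
    using square_le_of_abs_le[OF that] by (simp add: power_mult_distrib power2_norm_eq_inner mult.assoc)
  have Sv0: "0 \<le> S (innovation p) * norm (v p)" for p using order_trans[OF norm_ge_zero S0(1)] by simp
  note dm = martingale_differenceD(1)[OF md] martingale_differenceD(1)[OF mdk]
  have c1: "(\<lambda>k. \<integral>p. (?d p - ?dk k p)\<^sup>2 \<partial>path_law) \<longlonglongrightarrow> (\<integral>p. 0 \<partial>path_law)"
  proof (rule integral_dominated_convergence[OF _ _ dom])
    show "AE p in path_law. (\<lambda>k. (?d p - ?dk k p)\<^sup>2) \<longlonglongrightarrow> 0"
    proof (rule AE_I2)
      fix p
      have "(\<lambda>k. (?d p - ?dk k p)\<^sup>2) \<longlonglongrightarrow> (?d p - ?d p)\<^sup>2" by (intro tendsto_intros lim)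
      then show "(\<lambda>k. (?d p - ?dk k p)\<^sup>2) \<longlonglongrightarrow> 0" by simp
    qed
    show "AE p in path_law. norm ((?d p - ?dk k p)\<^sup>2) \<le> (2 * S (innovation p))\<^sup>2 * (v p \<bullet> v p)" for k
    proof (rule AE_I2)
      fix p
      have "\<bar>?d p - ?dk k p\<bar> \<le> 2 * (S (innovation p) * norm (v p))"
        using order_trans[OF abs_triangle_ineq4 add_mono[OF d_le dk_le]] by (simp only: mult_2)
      then show "norm ((?d p - ?dk k p)\<^sup>2) \<le> (2 * S (innovation p))\<^sup>2 * (v p \<bullet> v p)"
        unfolding real_norm_def abs_power2 by (rule sq)
    qed
  qed (simp_all only: measurable_path_law borel_measurable_const borel_measurable_power[OF borel_measurable_diff[OF dm]])
  have c2: "(\<lambda>k. \<integral>p. (?dk k p)\<^sup>2 \<partial>path_law) \<longlonglongrightarrow> (\<integral>p. (?d p)\<^sup>2 \<partial>path_law)"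
  proof (rule integral_dominated_convergence[OF _ _ dom])
    show "AE p in path_law. (\<lambda>k. (?dk k p)\<^sup>2) \<longlonglongrightarrow> (?d p)\<^sup>2"
      by (intro AE_I2 tendsto_power lim)
    show "AE p in path_law. norm ((?dk k p)\<^sup>2) \<le> (2 * S (innovation p))\<^sup>2 * (v p \<bullet> v p)" for k
    proof (rule AE_I2)
      fix p
      have "\<bar>?dk k p\<bar> \<le> 2 * (S (innovation p) * norm (v p))" using dk_le[of k p] Sv0[of p] by linarith
      then show "norm ((?dk k p)\<^sup>2) \<le> (2 * S (innovation p))\<^sup>2 * (v p \<bullet> v p)"
        unfolding real_norm_def abs_power2 by (rule sq)
    qed
  qed (simp_all only: measurable_path_law borel_measurable_power[OF dm(1)] borel_measurable_power[OF dm(2)])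
  have bk: "\<bar>?dk k p\<bar> \<le> (\<Sum>i\<in>(UNIV::'m set). real k + a i) * real k" for k p
    by (rule order_trans[OF Cauchy_Schwarz_ineq2 mult_mono[OF \<eta>b vKn(2)]]) (simp_all add: a_def sum_nonneg)
  have d2: "(\<integral>p. (?d p)\<^sup>2 \<partial>path_law) = (\<integral>p. v p \<bullet> v p \<partial>path_law)"
    unfolding power2_eq_square by (rule innovation_covariance[OF v v2 v v2])
  show ?thesis
    using martingale_clt[OF md mdk bk _ c2, of s] c1 by (simp add: d2)
qed

end

section \<open>Convergence in probability\<close>

text \<open>The almost sure bound holds eventually for each k, with a threshold depending on the
  point. Its failure has vanishing probability, and on the rest Markov's inequality handles R
  through its vanishing mean and k V through the choice of k.\<close>

lemma (in prob_space) probability_tendsto_0: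
  fixes D R V :: "nat \<Rightarrow> 'a \<Rightarrow> real"
  assumes meas [measurable]: "\<And>n. n \<ge> 1 \<Longrightarrow> D n \<in> borel_measurable M"
    and R: "\<And>n. integrable M (R n)" "\<And>n \<omega>. R n \<omega> \<ge> 0" "(\<lambda>n. expectation (R n)) \<longlonglongrightarrow> 0"
    and V: "\<And>n. integrable M (V n)" "\<And>n \<omega>. V n \<omega> \<ge> 0" "\<And>n. expectation (V n) \<le> C"
    and bound: "\<And>k. k > 0 \<Longrightarrow> AE \<omega> in M. \<forall>\<^sub>F n in sequentially. D n \<omega> \<le> R n \<omega> + k * V n \<omega>"
    and d: "d > 0"
  shows "(\<lambda>n. prob {\<omega> \<in> space M. D n \<omega> > d}) \<longlonglongrightarrow> 0"
proof (rule LIMSEQ_I)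
  fix e :: real assume e: "e > 0"
  note [measurable] = borel_measurable_integrable[OF R(1)] borel_measurable_integrable[OF V(1)]
  have C: "C \<ge> 0" using V(3)[of 0] Bochner_Integration.integral_nonneg[of M "V 0"] V(2) by (meson order_trans)
  \<comment> \<open>Markov's inequality for V at level d / (2 k) gives 2 C k / d, which this choice
    keeps below e / 3. The added 1 covers C = 0.\<close>
  define k where "k = e * d / (6 * (C + 1))"
  have k: "k > 0" using e d C by (simp add: k_def)
  define Bad where "Bad n = {\<omega> \<in> space M. D n \<omega> > R n \<omega> + k * V n \<omega>}" for n
  have Bad: "Bad n \<in> events" if "n \<ge> 1" for n
    using that unfolding Bad_def by measurable
  \<comment> \<open>\<open>D 0\<close> is not assumed to be measurable, so the event is replaced by
    the empty set at n = 0.\<close>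
  define Bad' where "Bad' n = (if n \<ge> 1 then Bad n else {})" for n
  have Bad' [measurable]: "Bad' n \<in> events" for n using Bad by (simp add: Bad'_def)
  have "(\<lambda>n. \<integral>\<omega>. indicator (Bad' n) \<omega> \<partial>M) \<longlonglongrightarrow> (\<integral>\<omega>. (0::real) \<partial>M)"
  proof (rule integral_dominated_convergence[where w = "\<lambda>_. 1"])
    show "AE \<omega> in M. (\<lambda>n. indicator (Bad' n) \<omega> :: real) \<longlonglongrightarrow> 0"
      using bound[OF k]
    proof eventually_elim
      case (elim \<omega>)
      then have "\<forall>\<^sub>F n in sequentially. (indicator (Bad' n) \<omega> :: real) = 0"
        by eventually_elim (simp add: Bad'_def Bad_def)
      then show ?case by (rule tendsto_eventually)
    qed
  qed (simp_all add: indicator_def)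
  then have "(\<lambda>n. prob (Bad' n)) \<longlonglongrightarrow> 0" by simp
  then have "\<forall>\<^sub>F n in sequentially. prob (Bad' n) < e / 3" by (rule order_tendstoD) (use e in simp)
  moreover have "(\<lambda>n. expectation (R n) / (d / 2)) \<longlonglongrightarrow> 0 / (d / 2)" by (intro tendsto_divide R tendsto_const) (use d in simp)
  then have "\<forall>\<^sub>F n in sequentially. expectation (R n) / (d / 2) < e / 3" by (rule order_tendstoD) (use e in simp)
  ultimately have "\<forall>\<^sub>F n in sequentially. norm (prob {\<omega> \<in> space M. D n \<omega> > d} - 0) < e"
    using eventually_ge_at_top[of 1]
  proof eventually_elim
    case (elim n)
    let ?R = "{\<omega> \<in> space M. R n \<omega> \<ge> d / 2}" and ?V = "{\<omega> \<in> space M. V n \<omega> \<ge> d / (2 * k)}"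
    have "{\<omega> \<in> space M. D n \<omega> > d} \<subseteq> Bad' n \<union> ?R \<union> ?V"
    proof
      fix \<omega> assume \<omega>: "\<omega> \<in> {\<omega> \<in> space M. D n \<omega> > d}"
      show "\<omega> \<in> Bad' n \<union> ?R \<union> ?V"
      proof (rule ccontr)
        assume "\<omega> \<notin> Bad' n \<union> ?R \<union> ?V"
        then have 1: "D n \<omega> \<le> R n \<omega> + k * V n \<omega>" "R n \<omega> < d / 2" "V n \<omega> < d / (2 * k)"
          using \<omega> elim(3) by (auto simp: Bad'_def Bad_def not_le)
        have "k * V n \<omega> < k * (d / (2 * k))" by (rule mult_strict_left_mono[OF 1(3) k])
        also have "\<dots> = d / 2" using k by simp
        finally show False using 1 \<omega> by auto
      qed
    qed
    then have "prob {\<omega> \<in> space M. D n \<omega> > d} \<le> prob (Bad' n \<union> ?R \<union> ?V)"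
      by (intro finite_measure_mono) auto
    also have "\<dots> \<le> (prob (Bad' n) + prob ?R) + prob ?V"
      by (intro order_trans[OF measure_Un_le] add_right_mono) auto
    also have "prob ?R \<le> expectation (R n) / (d / 2)"
      by (intro integral_Markov_inequality_measure[where A = "{}"] AE_I2 R) (use d in auto)
    also have "prob ?V \<le> expectation (V n) / (d / (2 * k))"
      by (intro integral_Markov_inequality_measure[where A = "{}"] AE_I2 V) (use d k in auto)
    also have "\<dots> \<le> C / (d / (2 * k))" by (intro divide_right_mono V) (use d k in simp)
    also have "\<dots> = 2 * C * (k / d)" by simp
    also have "k / d = e / (6 * (C + 1))" using d by (simp add: k_def)
    also have "2 * C * (e / (6 * (C + 1))) = (2 * C / (6 * (C + 1))) * e" by simp
    also have "\<dots> \<le> 1/3 * e" by (intro mult_right_mono) (use C e in \<open>simp_all add: pos_divide_le_eq\<close>)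
    finally have "prob {\<omega> \<in> space M. D n \<omega> > d} < e" using elim(1,2) by simp
    then show ?case by simp
  qed
  then show "\<exists>no. \<forall>n\<ge>no. norm (prob {\<omega> \<in> space M. D n \<omega> > d} - 0) < e"
    by (simp add: eventually_sequentially)
qed

text \<open>The test function is uniformly continuous only on compact sets, so tightness of W
  confines both sequences to a ball up to small probability.\<close>

lemma (in prob_space) slutsky:
  fixes Y W :: "nat \<Rightarrow> 'a \<Rightarrow> real^'d::finite" and g :: "real^'d \<Rightarrow> real"
  assumes Y [measurable]: "\<And>n. n \<ge> 1 \<Longrightarrow> Y n \<in> borel_measurable M"
    and W [measurable]: "\<And>n. W n \<in> borel_measurable M"
    and tight: "\<And>e. e > 0 \<Longrightarrow> \<exists>R. \<forall>n. prob {\<omega> \<in> space M. norm (W n \<omega>) > R} \<le> e"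
    and close: "\<And>d. d > 0 \<Longrightarrow> (\<lambda>n. prob {\<omega> \<in> space M. norm (Y n \<omega> - W n \<omega>) > d}) \<longlonglongrightarrow> 0"
    and g: "continuous_on UNIV g" "\<And>x. \<bar>g x\<bar> \<le> B"
    and lim: "(\<lambda>n. expectation (\<lambda>\<omega>. g (W n \<omega>))) \<longlonglongrightarrow> l"
  shows "(\<lambda>n. expectation (\<lambda>\<omega>. g (Y n \<omega>))) \<longlonglongrightarrow> l"
proof -
  have gm [measurable]: "g \<in> borel_measurable borel" using g(1) by (rule borel_measurable_continuous_onI)
  have B: "B \<ge> 0" using order_trans[OF abs_ge_zero g(2)[of 0]] .
  have "(\<lambda>n. expectation (\<lambda>\<omega>. g (Y n \<omega>)) - expectation (\<lambda>\<omega>. g (W n \<omega>))) \<longlonglongrightarrow> 0"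
  proof (rule LIMSEQ_I)
    fix r :: real assume r: "r > 0"
    define e where "e = r / (4 * (2 * B + 1))"
    have e: "e > 0" using r B by (simp add: e_def)
    have eB: "2 * B * e \<le> r / 4"
    proof -
      have "2 * B * e = (2 * B / (2 * B + 1)) * (r / 4)" by (simp add: e_def)
      also have "\<dots> \<le> 1 * (r / 4)" by (intro mult_right_mono) (use B r in simp_all)
      finally show ?thesis by simp
    qed
    obtain R where R: "\<And>n. prob {\<omega> \<in> space M. norm (W n \<omega>) > R} \<le> e" using tight[OF e] by blast
    have "uniformly_continuous_on (cball 0 (R + 1)) g"
      by (intro compact_uniformly_continuous continuous_on_subset[OF g(1)]) auto
    moreover have "r / 4 > 0" using r by simp
    ultimately obtain d0 where d0: "d0 > 0" "\<And>x y. x \<in> cball 0 (R + 1) \<Longrightarrow> y \<in> cball 0 (R + 1) \<Longrightarrow> dist y x < d0 \<Longrightarrow> dist (g y) (g x) < r / 4"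
      unfolding uniformly_continuous_on_def by meson
    \<comment> \<open>The cap at 1 keeps Y inside the ball of radius R + 1, on which uniform
      continuity was taken.\<close>
    define d where "d = min (d0 / 2) 1"
    have d: "d > 0" "d < d0" "d \<le> 1" using d0(1) unfolding d_def by linarith+
    have "\<forall>\<^sub>F n in sequentially. prob {\<omega> \<in> space M. norm (Y n \<omega> - W n \<omega>) > d} < e"
      by (rule order_tendstoD(2)[OF close[OF d(1)] e])
    with eventually_ge_at_top[of 1]
    have "\<forall>\<^sub>F n in sequentially. norm (expectation (\<lambda>\<omega>. g (Y n \<omega>)) - expectation (\<lambda>\<omega>. g (W n \<omega>)) - 0) < r"
    proof eventually_elim
      case (elim n)
      note Yn [measurable] = Y[OF elim(1)]
      let ?A = "{\<omega> \<in> space M. norm (W n \<omega>) > R}" and ?D = "{\<omega> \<in> space M. norm (Y n \<omega> - W n \<omega>) > d}"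
      have AD [measurable]: "?A \<in> events" "?D \<in> events" by measurable
      have "\<bar>expectation (\<lambda>\<omega>. g (Y n \<omega>)) - expectation (\<lambda>\<omega>. g (W n \<omega>))\<bar> \<le> r / 4 + (2 * B) * prob (?A \<union> ?D)"
      proof (rule expectation_diff_le)
        show "integrable M (\<lambda>\<omega>. g (Y n \<omega>))" "integrable M (\<lambda>\<omega>. g (W n \<omega>))"
          by (rule integrable_const_bound[where B = B]; use g(2) in simp)+
        show "\<bar>g (Y n \<omega>) - g (W n \<omega>)\<bar> \<le> 2 * B" for \<omega>
          using order_trans[OF abs_triangle_ineq4 add_mono[OF g(2) g(2)]] by simp
        fix \<omega> assume \<omega>: "\<omega> \<in> space M" "\<omega> \<notin> ?A \<union> ?D"
        then have 1: "norm (W n \<omega>) \<le> R" "norm (Y n \<omega> - W n \<omega>) \<le> d" by auto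
        have "norm (Y n \<omega>) \<le> norm (Y n \<omega> - W n \<omega>) + norm (W n \<omega>)"
          using norm_triangle_ineq[of "Y n \<omega> - W n \<omega>" "W n \<omega>"] by simp
        then have "Y n \<omega> \<in> cball 0 (R + 1)" "W n \<omega> \<in> cball 0 (R + 1)" using 1 d by auto
        then have "dist (g (Y n \<omega>)) (g (W n \<omega>)) < r / 4" using 1 d by (intro d0(2)) (auto simp: dist_norm)
        then show "\<bar>g (Y n \<omega>) - g (W n \<omega>)\<bar> \<le> r / 4" by (simp add: dist_real_def)
      qed (use r in auto)
      also have "prob (?A \<union> ?D) \<le> e + e"
        using measure_Un_le[OF AD] R[of n] elim(2) by linarith
      then have "r / 4 + (2 * B) * prob (?A \<union> ?D) \<le> r / 4 + (2 * B) * (e + e)"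
        by (intro add_left_mono mult_left_mono) (use B in simp_all)
      also have "\<dots> < r" using eB r by (simp add: distrib_left)
      finally show ?case by simp
    qed
    then show "\<exists>no. \<forall>n\<ge>no. norm (expectation (\<lambda>\<omega>. g (Y n \<omega>)) - expectation (\<lambda>\<omega>. g (W n \<omega>)) - 0) < r"
      by (simp add: eventually_sequentially)
  qed
  from tendsto_add[OF this lim] show ?thesis by simp
qed

text \<open>The derivatives of \<open>q_fun\<close> are known only almost surely. In the completed
  space a function equal to a measurable one off a null set is measurable, whatever its values
  there.\<close>

lemma integral_completion_AE_eq:
  fixes f g :: "'a \<Rightarrow> real"
  assumes g: "integrable M g" and eq: "AE x in M. f x = g x"
  shows "integrable (completion M) f" "(\<integral>x. f x \<partial>completion M) = (\<integral>x. g x \<partial>M)"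
proof -
  have gm: "g \<in> borel_measurable M" using g by (rule borel_measurable_integrable)
  then have gc: "g \<in> borel_measurable (completion M)" by (rule measurable_completion)
  have eqc: "AE x in completion M. f x = g x" using eq by (rule AE_completion)
  have fc: "f \<in> borel_measurable (completion M)"
  proof (rule measurableI)
    fix S :: "real set" assume S: "S \<in> sets borel"
    show "f -` S \<inter> space (completion M) \<in> sets (completion M)"
    proof (rule completion.in_sets_AE[OF _ measurable_sets[OF gc S]])
      show "AE x in completion M. (x \<in> g -` S \<inter> space (completion M)) = (x \<in> f -` S \<inter> space (completion M))"
        using eqc by eventually_elim simp
    qed simp
  qed simp
  have "integrable (completion M) g" using integrable_completion[OF gm] g by simp
  then show "integrable (completion M) f" using integrable_cong_AE[OF fc gc eqc] by simp
  show "(\<integral>x. f x \<partial>completion M) = (\<integral>x. g x \<partial>M)"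
    using integral_cong_AE[OF fc gc eqc] integral_completion[OF gm] by simp
qed

section \<open>Asymptotic normality\<close>

lemma summable_square_add:
  fixes x y :: "nat \<Rightarrow> real"
  assumes "summable (\<lambda>t. (x t)\<^sup>2)" "summable (\<lambda>t. (y t)\<^sup>2)"
  shows "summable (\<lambda>t. (x t + y t)\<^sup>2)"
proof (rule summable_comparison_test'[where N = 0])
  show "summable (\<lambda>t. 2 * (x t)\<^sup>2 + 2 * (y t)\<^sup>2)" using assms by (intro summable_add summable_mult)
  have "(a + b)\<^sup>2 \<le> 2 * a\<^sup>2 + 2 * b\<^sup>2" for a b :: real
    using sum_squares_bound[of a b] by (simp add: power2_sum)
  then show "norm ((x t + y t)\<^sup>2) \<le> 2 * (x t)\<^sup>2 + 2 * (y t)\<^sup>2" for t by simp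
qed

lemma summable_square_sum:
  fixes x :: "'i \<Rightarrow> nat \<Rightarrow> real"
  assumes "finite I" "\<And>i. i \<in> I \<Longrightarrow> summable (\<lambda>t. (x i t)\<^sup>2)"
  shows "summable (\<lambda>t. (\<Sum>i\<in>I. x i t)\<^sup>2)"
  using assms
proof (induction I rule: finite_induct)
  case (insert i I)
  have "summable (\<lambda>t. (x i t + (\<Sum>i\<in>I. x i t))\<^sup>2)"
    by (rule summable_square_add) (use insert in auto)
  then show ?case using insert(1,2) by simp
qed simp

lemma borel_measurable_vecI:
  fixes f :: "'a \<Rightarrow> real^'d::finite"
  assumes "\<And>k. (\<lambda>\<omega>. f \<omega> $ k) \<in> borel_measurable M"
  shows "f \<in> borel_measurable M"
  unfolding borel_measurable_euclidean_space[of f]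
  using assms by (auto simp: Basis_vec_def inner_axis)

locale ar_normality = ar_estimation M X \<xi> A0 A \<theta>0 \<Theta> u \<theta>hat
  for M :: "'a measure" and X \<xi> :: "int \<Rightarrow> 'a \<Rightarrow> real^'m::finite"
    and A0 :: "real^'d::finite \<Rightarrow> real^'m" and A :: "nat \<Rightarrow> real^'d \<Rightarrow> real^'m \<Rightarrow> real^'m" and \<theta>0 :: "real^'d"
    and \<Theta> :: "(real^'d) set" and u :: "nat \<Rightarrow> real^'m" and \<theta>hat :: "nat \<Rightarrow> 'a \<Rightarrow> real^'d" +
  assumes interior: "\<theta>0 \<in> interior \<Theta>"
    and \<theta>hat_measurable: "\<And>n. n \<ge> 1 \<Longrightarrow> \<theta>hat n \<in> borel_measurable M"
    and A_C2: "\<And>j x. C2_on \<Theta> (\<lambda>\<theta>. A (Suc j) \<theta> x)"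
    and f0_C2: "C2_on (interior \<Theta>) (\<lambda>\<theta>. ar_fun A0 A \<theta> (\<lambda>_. 0))"
    and independent: "\<And>c :: real^'d. (\<And>t. AE \<omega> in M. (\<Sum>i\<in>UNIV. c $ i *\<^sub>R
           pderivative i (\<lambda>\<theta>. ar_fun A0 A \<theta> (past X t \<omega>)) \<theta>0) = 0) \<Longrightarrow> c = 0"
    and decay1: "\<And>k. \<exists>l'>3/2. power_decay
        (\<lambda>j. SUP \<theta>\<in>\<Theta>. Lip (\<lambda>x. pderivative k (\<lambda>\<theta>. A j \<theta> x) \<theta>)) l'"
    and decay2: "\<And>k k'. (\<Sum>j. SUP \<theta>\<in>\<Theta>.
        Lip (\<lambda>x. pderivative k (pderivative k' (\<lambda>\<theta>. A (Suc j) \<theta> x)) \<theta>)) < \<infinity>"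
begin

section \<open>Lipschitz weights of the first and second derivatives in the parameter\<close>

definition A1 :: "'d \<Rightarrow> nat \<Rightarrow> real^'d \<Rightarrow> real^'m \<Rightarrow> real^'m" where
  "A1 k j \<theta> x = pderivative k (\<lambda>\<theta>. A j \<theta> x) \<theta>"

definition A2 :: "'d \<Rightarrow> 'd \<Rightarrow> nat \<Rightarrow> real^'d \<Rightarrow> real^'m \<Rightarrow> real^'m" where
  "A2 k l j \<theta> x = pderivative k (pderivative l (\<lambda>\<theta>. A j \<theta> x)) \<theta>"

definition \<alpha>1 :: "'d \<Rightarrow> nat \<Rightarrow> real" where "\<alpha>1 k j = enn2real (SUP \<theta>\<in>\<Theta>. Lip (A1 k j \<theta>))"

definition \<alpha>2 :: "'d \<Rightarrow> 'd \<Rightarrow> nat \<Rightarrow> real" where "\<alpha>2 k l j = enn2real (SUP \<theta>\<in>\<Theta>. Lip (A2 k l j \<theta>))"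

lemma \<alpha>12_nonneg: "\<alpha>1 k j \<ge> 0" "\<alpha>2 k l j \<ge> 0" by (simp_all add: \<alpha>1_def \<alpha>2_def)

lemma decay1': "\<exists>l>3/2. power_decay (\<lambda>j. SUP \<theta>\<in>\<Theta>. Lip (A1 k j \<theta>)) l"
  using decay1[of k] unfolding A1_def [abs_def] .

lemma decay2': "(\<Sum>j. SUP \<theta>\<in>\<Theta>. Lip (A2 k l (Suc j) \<theta>)) < \<infinity>"
  using decay2[of k l] unfolding A2_def [abs_def] .

lemma \<alpha>1_lipschitz: "\<theta> \<in> \<Theta> \<Longrightarrow> norm (A1 k (Suc j) \<theta> x - A1 k (Suc j) \<theta> y) \<le> \<alpha>1 k (Suc j) * norm (x - y)"
  unfolding \<alpha>1_def by (rule SUP_Lip_bound) (use decay1'[of k] in \<open>auto simp: power_decay_def\<close>)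

lemma \<alpha>2_lipschitz: "\<theta> \<in> \<Theta> \<Longrightarrow> norm (A2 k l (Suc j) \<theta> x - A2 k l (Suc j) \<theta> y) \<le> \<alpha>2 k l (Suc j) * norm (x - y)"
  unfolding \<alpha>2_def by (rule SUP_Lip_bound[OF ennreal_series_real(1)[OF decay2']])

lemma \<alpha>1_summable: "summable (\<lambda>j. \<alpha>1 k (Suc j))"
proof -
  obtain l where l: "l > 3/2" "power_decay (\<lambda>j. SUP \<theta>\<in>\<Theta>. Lip (A1 k j \<theta>)) l" using decay1' by blast
  from power_decay_summable[OF l(2), of 0] l(1) show ?thesis by (simp add: \<alpha>1_def)
qed

lemma \<alpha>2_summable: "summable (\<lambda>j. \<alpha>2 k l (Suc j))"
  unfolding \<alpha>2_def by (rule ennreal_series_real(2)[OF decay2'])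

text \<open>Two weight sequences are kept apart. \<open>b1\<close> dominates residual and gradients
  and has square summable tails, as the score at \<theta>0 requires. \<open>b2\<close> also
  dominates the second derivatives, whose weights are merely summable; this suffices for averages of
  the Hessian.\<close>

definition b1 :: "nat \<Rightarrow> real" where "b1 j = (if j = 0 then 1 else \<alpha> j + (\<Sum>k\<in>UNIV. \<alpha>1 k j))"

definition b2 :: "nat \<Rightarrow> real" where
  "b2 j = (if j = 0 then 1 else \<alpha> j + (\<Sum>k\<in>UNIV. \<alpha>1 k j) + (\<Sum>k\<in>UNIV. \<Sum>l\<in>UNIV. \<alpha>2 k l j))"

lemma b12_nonneg: "b1 j \<ge> 0" "b2 j \<ge> 0"
  unfolding b1_def b2_def by (simp_all add: \<alpha>_nonneg \<alpha>12_nonneg sum_nonneg add_nonneg_nonneg)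

lemma b12_0: "b1 0 = 1" "b2 0 = 1" by (simp_all add: b1_def b2_def)

lemma b1_summable: "summable (\<lambda>j. b1 (Suc j))"
  unfolding b1_def by (simp add: summable_add \<alpha>_summable summable_sum \<alpha>1_summable)

lemma b2_summable: "summable (\<lambda>j. b2 (Suc j))"
  unfolding b2_def by (simp add: summable_add \<alpha>_summable summable_sum \<alpha>1_summable \<alpha>2_summable)

lemma weights:
  "\<alpha> (Suc j) \<le> b1 (Suc j)" "\<alpha>1 k (Suc j) \<le> b1 (Suc j)" "b1 (Suc j) \<le> b2 (Suc j)" "\<alpha>2 k l (Suc j) \<le> b2 (Suc j)"
proof -
  have 1: "\<alpha>1 k (Suc j) \<le> (\<Sum>k\<in>UNIV. \<alpha>1 k (Suc j))" by (rule member_le_sum) (simp_all add: \<alpha>12_nonneg)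
  have "\<alpha>2 k l (Suc j) \<le> (\<Sum>l\<in>UNIV. \<alpha>2 k l (Suc j))" by (rule member_le_sum) (simp_all add: \<alpha>12_nonneg)
  also have "\<dots> \<le> (\<Sum>k\<in>UNIV. \<Sum>l\<in>UNIV. \<alpha>2 k l (Suc j))"
    by (rule member_le_sum) (simp_all add: \<alpha>12_nonneg sum_nonneg)
  finally have 2: "\<alpha>2 k l (Suc j) \<le> (\<Sum>k\<in>UNIV. \<Sum>l\<in>UNIV. \<alpha>2 k l (Suc j))" .
  have n: "0 \<le> \<alpha> (Suc j)" "0 \<le> (\<Sum>k\<in>UNIV. \<alpha>1 k (Suc j))" "0 \<le> (\<Sum>k\<in>UNIV. \<Sum>l\<in>UNIV. \<alpha>2 k l (Suc j))"
    by (simp_all add: \<alpha>_nonneg \<alpha>12_nonneg sum_nonneg)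
  show "\<alpha> (Suc j) \<le> b1 (Suc j)" "\<alpha>1 k (Suc j) \<le> b1 (Suc j)" "b1 (Suc j) \<le> b2 (Suc j)" "\<alpha>2 k l (Suc j) \<le> b2 (Suc j)"
    using 1 2 n unfolding b1_def b2_def by simp_all
qed

text \<open>The tail of a finite sum of weight sequences is the sum of their tails, and square
  summability is stable under finite sums.\<close>

lemma b1_tails: "summable (\<lambda>t. (\<Sum>j. if t \<le> Suc j then b1 (Suc j) else 0)\<^sup>2)"
proof -
  let ?T = "\<lambda>a t. \<Sum>j. if t \<le> Suc j then a (Suc j) else (0::real)"
  have s: "summable (\<lambda>j. if t \<le> Suc j then a (Suc j) else 0)" if "summable (\<lambda>j. a (Suc j))" "\<And>j. a j \<ge> 0" for a :: "nat \<Rightarrow> real" and t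
    by (rule summable_comparison_test'[OF that(1), of 0]) (use that(2) in simp)
  have sa: "summable (\<lambda>j. if t \<le> Suc j then \<alpha> (Suc j) else 0)" for t by (rule s[OF \<alpha>_summable \<alpha>_nonneg])
  have s1: "summable (\<lambda>j. if t \<le> Suc j then \<alpha>1 k (Suc j) else 0)" for t k by (rule s[OF \<alpha>1_summable \<alpha>12_nonneg(1)])
  have eq: "?T b1 t = ?T \<alpha> t + (\<Sum>k\<in>UNIV. ?T (\<alpha>1 k) t)" for t
  proof -
    have "(\<Sum>k\<in>UNIV. ?T (\<alpha>1 k) t) = (\<Sum>j. \<Sum>k\<in>UNIV. if t \<le> Suc j then \<alpha>1 k (Suc j) else 0)"
      by (rule suminf_sum[symmetric]) (rule s1)
    then have "?T \<alpha> t + (\<Sum>k\<in>UNIV. ?T (\<alpha>1 k) t) = (\<Sum>j. (if t \<le> Suc j then \<alpha> (Suc j) else 0) + (\<Sum>k\<in>UNIV. if t \<le> Suc j then \<alpha>1 k (Suc j) else 0))"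
      using suminf_add[OF sa summable_sum[OF s1]] by simp
    also have "\<dots> = ?T b1 t" by (intro suminf_cong) (simp add: b1_def)
    finally show ?thesis by simp
  qed
  have a: "summable (\<lambda>t. (?T \<alpha> t)\<^sup>2)"
    using decay power_decay_tails_square_summable unfolding \<alpha>_def by blast
  have a1: "summable (\<lambda>t. (?T (\<alpha>1 k) t)\<^sup>2)" for k
    using decay1'[of k] power_decay_tails_square_summable unfolding \<alpha>1_def by blast
  show ?thesis unfolding eq by (intro summable_square_add a summable_square_sum a1) simp
qed

definition r :: real where "r = (SOME r. r > 0 \<and> cball \<theta>0 r \<subseteq> interior \<Theta>)"

lemma r: "r > 0" "cball \<theta>0 r \<subseteq> interior \<Theta>"
proof -
  have "\<exists>r. r > 0 \<and> cball \<theta>0 r \<subseteq> interior \<Theta>"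
    using interior open_contains_cball[of "interior \<Theta>"] by auto
  then have "r > 0 \<and> cball \<theta>0 r \<subseteq> interior \<Theta>" unfolding r_def by (rule someI_ex)
  then show "r > 0" "cball \<theta>0 r \<subseteq> interior \<Theta>" by blast+
qed

text \<open>The closed ball provides uniform bounds by compactness, the open ball inside it is where
  derivatives are taken. Both lie in the interior of \<Theta>.\<close>

abbreviation "K \<equiv> cball \<theta>0 r"
abbreviation "V \<equiv> ball \<theta>0 r"

lemma K_sub: "\<theta> \<in> K \<Longrightarrow> \<theta> \<in> interior \<Theta>" "\<theta> \<in> K \<Longrightarrow> \<theta> \<in> \<Theta>"
  using r interior_subset by blast+

lemma V_sub: "\<theta> \<in> V \<Longrightarrow> \<theta> \<in> K" by simp

lemma \<theta>0_in: "\<theta>0 \<in> V" "\<theta>0 \<in> K" using r by simp_all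

lemma f0_derivative:
  assumes "\<theta> \<in> K"
  shows "(f0 has_derivative (\<lambda>v. \<Sum>k\<in>UNIV. v $ k *\<^sub>R pderivative k f0 \<theta>)) (at \<theta>)"
    "(pderivative j f0 has_derivative (\<lambda>v. \<Sum>k\<in>UNIV. v $ k *\<^sub>R pderivative k (pderivative j f0) \<theta>)) (at \<theta>)"
  using C2_onD(1,2)[OF f0_C2 K_sub(1)[OF assms]] unfolding f0_def [abs_def, symmetric] by blast+

lemma f0_second_continuous: "continuous_on K (pderivative k (pderivative l f0))"
  using continuous_on_subset[OF C2_onD(3)[OF f0_C2 K_sub(1)[OF \<theta>0_in(2)]] r(2)] unfolding f0_def [abs_def, symmetric] .

lemma continuous_on_of_derivatives:
  fixes g :: "real^'d \<Rightarrow> 'b::real_normed_vector"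
  shows "(\<And>\<theta>. \<theta> \<in> S \<Longrightarrow> (g has_derivative D \<theta>) (at \<theta>)) \<Longrightarrow> continuous_on S g"
  by (intro continuous_at_imp_continuous_on ballI has_derivative_continuous) blast

lemma f0_continuous_K: "continuous_on K f0" "continuous_on K (pderivative k f0)"
  by (rule continuous_on_of_derivatives, rule f0_derivative, assumption)+

definition C :: real where
  "C = (SOME C. \<forall>\<theta>\<in>K. norm (f0 \<theta>) \<le> C \<and> (\<forall>k. norm (pderivative k f0 \<theta>) \<le> C) \<and>
     (\<forall>k l. norm (pderivative k (pderivative l f0) \<theta>) \<le> C))"

lemma C_bounds:
  assumes "\<theta> \<in> K"
  shows "norm (f0 \<theta>) \<le> C" "norm (pderivative k f0 \<theta>) \<le> C" "norm (pderivative k (pderivative l f0) \<theta>) \<le> C"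
proof -
  define h where "h \<theta> = norm (f0 \<theta>) + (\<Sum>k\<in>UNIV. norm (pderivative k f0 \<theta>)) +
    (\<Sum>k\<in>UNIV. \<Sum>l\<in>UNIV. norm (pderivative k (pderivative l f0) \<theta>))" for \<theta>
  have "continuous_on K h" unfolding h_def
    by (intro continuous_on_add continuous_on_sum continuous_on_norm f0_continuous_K f0_second_continuous)
  then have "bounded (h ` K)" by (intro compact_imp_bounded compact_continuous_image compact_cball)
  then obtain B where "\<forall>y\<in>h ` K. norm y \<le> B" unfolding bounded_iff by blast
  then have B: "h \<theta> \<le> B" if "\<theta> \<in> K" for \<theta>
  proof -
    have "norm (h \<theta>) \<le> B" using \<open>\<forall>y\<in>h ` K. norm y \<le> B\<close> that by blast
    then show ?thesis by (simp add: abs_le_iff)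
  qed
  have "norm (f0 \<theta>) \<le> B \<and> (\<forall>k. norm (pderivative k f0 \<theta>) \<le> B) \<and>
     (\<forall>k l. norm (pderivative k (pderivative l f0) \<theta>) \<le> B)" if \<theta>: "\<theta> \<in> K" for \<theta>
  proof -
    have n: "0 \<le> (\<Sum>k\<in>UNIV. norm (pderivative k f0 \<theta>))"
      "0 \<le> (\<Sum>k\<in>UNIV. \<Sum>l\<in>UNIV. norm (pderivative k (pderivative l f0) \<theta>))" by (simp_all add: sum_nonneg)
    have 1: "norm (pderivative k f0 \<theta>) \<le> (\<Sum>k\<in>UNIV. norm (pderivative k f0 \<theta>))" for k
      by (rule member_le_sum) simp_all
    have 2: "norm (pderivative k (pderivative l f0) \<theta>) \<le> (\<Sum>k\<in>UNIV. \<Sum>l\<in>UNIV. norm (pderivative k (pderivative l f0) \<theta>))" for k l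
    proof -
      have "norm (pderivative k (pderivative l f0) \<theta>) \<le> (\<Sum>l\<in>UNIV. norm (pderivative k (pderivative l f0) \<theta>))"
        by (rule member_le_sum) simp_all
      also have "\<dots> \<le> (\<Sum>k\<in>UNIV. \<Sum>l\<in>UNIV. norm (pderivative k (pderivative l f0) \<theta>))"
        by (rule member_le_sum) (simp_all add: sum_nonneg)
      finally show ?thesis .
    qed
    have B': "norm (f0 \<theta>) + (\<Sum>k\<in>UNIV. norm (pderivative k f0 \<theta>)) +
      (\<Sum>k\<in>UNIV. \<Sum>l\<in>UNIV. norm (pderivative k (pderivative l f0) \<theta>)) \<le> B" using B[OF \<theta>] by (simp add: h_def)
    have "norm (f0 \<theta>) \<le> B" using B' n by linarith
    moreover have "norm (pderivative k f0 \<theta>) \<le> B" for k using B' n 1[of k] norm_ge_zero[of "f0 \<theta>"] by linarith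
    moreover have "norm (pderivative k (pderivative l f0) \<theta>) \<le> B" for k l using B' n 2[of k l] norm_ge_zero[of "f0 \<theta>"] by linarith
    ultimately show ?thesis by blast
  qed
  then have "\<forall>\<theta>\<in>K. norm (f0 \<theta>) \<le> C \<and> (\<forall>k. norm (pderivative k f0 \<theta>) \<le> C) \<and>
     (\<forall>k l. norm (pderivative k (pderivative l f0) \<theta>) \<le> C)"
    unfolding C_def by (intro someI[of "\<lambda>C. \<forall>\<theta>\<in>K. norm (f0 \<theta>) \<le> C \<and> (\<forall>k. norm (pderivative k f0 \<theta>) \<le> C) \<and>
     (\<forall>k l. norm (pderivative k (pderivative l f0) \<theta>) \<le> C)"]) blast
  then show "norm (f0 \<theta>) \<le> C" "norm (pderivative k f0 \<theta>) \<le> C" "norm (pderivative k (pderivative l f0) \<theta>) \<le> C"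
    using assms by blast+
qed

lemma C_nonneg: "C \<ge> 0" by (rule order_trans[OF norm_ge_zero C_bounds(1)[OF \<theta>0_in(2)]])

text \<open>The partial derivatives of f, and with \<open>g2\<close> the second ones, written as lag
  series of the differentiated coefficients. Smoothness of the lag-free part comes from
  \<open>f0_C2\<close>.\<close>

definition g1 :: "'d \<Rightarrow> real^'d \<Rightarrow> (nat \<Rightarrow> real^'m) \<Rightarrow> real^'m" where
  "g1 k = lag_series (pderivative k f0) (A1 k)"

definition g2 :: "'d \<Rightarrow> 'd \<Rightarrow> real^'d \<Rightarrow> (nat \<Rightarrow> real^'m) \<Rightarrow> real^'m" where
  "g2 k l = lag_series (pderivative k (pderivative l f0)) (A2 k l)"

lemma A_derivative:
  assumes "\<theta> \<in> \<Theta>"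
  shows "((\<lambda>\<theta>. A (Suc j) \<theta> x) has_derivative (\<lambda>v. \<Sum>k\<in>UNIV. v $ k *\<^sub>R A1 k (Suc j) \<theta> x)) (at \<theta>)"
    "((\<lambda>\<theta>. A1 l (Suc j) \<theta> x) has_derivative (\<lambda>v. \<Sum>k\<in>UNIV. v $ k *\<^sub>R A2 k l (Suc j) \<theta> x)) (at \<theta>)"
  using C2_onD(1,2)[OF A_C2 assms] unfolding A1_def A2_def by blast+

lemma A1_continuous: "continuous_on K (\<lambda>\<theta>. A1 k (Suc j) \<theta> x)"
  by (rule continuous_on_of_derivatives, rule A_derivative(2), rule K_sub)

lemma A2_continuous: "continuous_on K (\<lambda>\<theta>. A2 k l (Suc j) \<theta> x)"
  unfolding A2_def
  by (rule continuous_on_subset[OF C2_onD(3)[OF A_C2 \<theta>0]]) (use K_sub in blast)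

lemma mult_weight: "a \<le> w \<Longrightarrow> z \<le> a * norm x \<Longrightarrow> z \<le> w * norm x" for a w z :: real and x :: "real^'m"
  by (meson mult_right_mono norm_ge_zero order_trans)

text \<open>Left open in the weights w so that residual and gradient can be used with
  \<open>b1\<close> for the score and with \<open>b2\<close> next to the second derivatives.\<close>

lemma families1:
  assumes w: "\<And>j. b1 (Suc j) \<le> w (Suc j)" "\<And>j. w j \<ge> 0" "w 0 = 1"
  shows "lipschitz_family K w C resid" "lipschitz_family K w C (g1 k)"
proof -
  have 1: "norm (A (Suc j) \<theta> x - A (Suc j) \<theta> y) \<le> w (Suc j) * norm (x - y)" if "\<theta> \<in> K" for j x y \<theta>
    by (rule mult_weight[OF order_trans[OF weights(1) w(1)] \<alpha>_lipschitz[OF K_sub(2)[OF that]]])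
  have 2: "norm (A1 k (Suc j) \<theta> x - A1 k (Suc j) \<theta> y) \<le> w (Suc j) * norm (x - y)" if "\<theta> \<in> K" for j x y \<theta>
    by (rule mult_weight[OF order_trans[OF weights(2) w(1)] \<alpha>1_lipschitz[OF K_sub(2)[OF that]]])
  have c: "continuous_on K (\<lambda>\<theta>. A (Suc j) \<theta> x - A (Suc j) \<theta> 0)" for j x
    by (rule continuous_on_subset[OF A_continuous]) (use K_sub in blast)
  have c1: "continuous_on K (\<lambda>\<theta>. A1 k (Suc j) \<theta> x - A1 k (Suc j) \<theta> 0)" for j x
    by (intro continuous_on_diff A1_continuous)
  show "lipschitz_family K w C resid"
    unfolding resid_def [abs_def] f_def
    by (rule lipschitz_family_residual[of K f0 C A w, OF f0_continuous_K(1) C_bounds(1) c 1 w(2)]) (simp_all add: w)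
  show "lipschitz_family K w C (g1 k)"
    unfolding g1_def
    by (rule lipschitz_family_lag_series[of K "pderivative k f0" C "A1 k" w, OF f0_continuous_K(2) C_bounds(2) c1 2 w(2)])
qed

lemma family_b1: "lipschitz_family K b1 C resid" "lipschitz_family K b1 C (g1 k)"
  by (rule families1; simp add: b12_nonneg b12_0)+

lemma family_b2: "lipschitz_family K b2 C resid" "lipschitz_family K b2 C (g1 k)" "lipschitz_family K b2 C (g2 k l)"
proof -
  show "lipschitz_family K b2 C resid" "lipschitz_family K b2 C (g1 k)"
    by (rule families1; simp add: b12_nonneg b12_0 weights)+
  have 2: "norm (A2 k l (Suc j) \<theta> x - A2 k l (Suc j) \<theta> y) \<le> b2 (Suc j) * norm (x - y)" if "\<theta> \<in> K" for j x y \<theta>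
    by (rule mult_weight[OF weights(4) \<alpha>2_lipschitz[OF K_sub(2)[OF that]]])
  have c2: "continuous_on K (\<lambda>\<theta>. A2 k l (Suc j) \<theta> x - A2 k l (Suc j) \<theta> 0)" for j x
    by (intro continuous_on_diff A2_continuous)
  show "lipschitz_family K b2 C (g2 k l)"
    unfolding g2_def
    by (rule lipschitz_family_lag_series[of K "pderivative k (pderivative l f0)" C "A2 k l" b2,
        OF f0_second_continuous C_bounds(3) c2 2 b12_nonneg(2)])
qed

section \<open>Derivatives of the residual, of its square and of the score\<close>

lemma f_derivatives:
  assumes \<theta>: "\<theta> \<in> V" and p: "p \<in> path_dom b2"
  shows "((\<lambda>\<theta>. f \<theta> p) has_derivative (\<lambda>v. \<Sum>k\<in>UNIV. v $ k *\<^sub>R g1 k \<theta> p)) (at \<theta>)"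
    "((\<lambda>\<theta>. g1 l \<theta> p) has_derivative (\<lambda>v. \<Sum>k\<in>UNIV. v $ k *\<^sub>R g2 k l \<theta> p)) (at \<theta>)"
proof -
  have p': "summable (\<lambda>j. b2 (Suc j) * norm (p (Suc j)))" using p by (simp add: path_dom_def)
  have V: "\<theta> \<in> \<Theta>" if "\<theta> \<in> V" for \<theta> using K_sub V_sub that by blast
  have a: "norm (A (Suc j) \<theta> x - A (Suc j) \<theta> 0) \<le> b2 (Suc j) * norm x" if "\<theta> \<in> V" for j x \<theta>
    using mult_weight[OF order_trans[OF weights(1) weights(3)] \<alpha>_lipschitz[OF V[OF that]], of j x 0] by simp
  have a1: "norm (A1 k (Suc j) \<theta> x - A1 k (Suc j) \<theta> 0) \<le> b2 (Suc j) * norm x" if "\<theta> \<in> V" for k j x \<theta>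
    using mult_weight[OF order_trans[OF weights(2) weights(3)] \<alpha>1_lipschitz[OF V[OF that]], of k j x 0] by simp
  have a2: "norm (A2 k l (Suc j) \<theta> x - A2 k l (Suc j) \<theta> 0) \<le> b2 (Suc j) * norm x" if "\<theta> \<in> V" for k l j x \<theta>
    using mult_weight[OF weights(4) \<alpha>2_lipschitz[OF V[OF that]], of k l j x 0] by simp
  show "((\<lambda>\<theta>. f \<theta> p) has_derivative (\<lambda>v. \<Sum>k\<in>UNIV. v $ k *\<^sub>R g1 k \<theta> p)) (at \<theta>)"
    unfolding f_def g1_def
    by (rule lag_series_has_derivative[where V = V and b = b2 and a' = A1 and a0' = "\<lambda>k. pderivative k f0"])
      (use f0_derivative(1)[OF V_sub] A_derivative(1)[OF V] a a1 p' \<theta> in \<open>simp_all add: convex_ball\<close>)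
  show "((\<lambda>\<theta>. g1 l \<theta> p) has_derivative (\<lambda>v. \<Sum>k\<in>UNIV. v $ k *\<^sub>R g2 k l \<theta> p)) (at \<theta>)"
    unfolding g1_def g2_def
    by (rule lag_series_has_derivative[where V = V and b = b2 and a' = "\<lambda>k. A2 k l" and a0' = "\<lambda>k. pderivative k (pderivative l f0)"])
      (use f0_derivative(2)[OF V_sub] A_derivative(2)[OF V] a1 a2 p' \<theta> in \<open>simp_all add: convex_ball\<close>)
qed

lemma path_dom_b2: "p \<in> path_dom b2 \<Longrightarrow> p \<in> path_dom b" "p \<in> path_dom b2 \<Longrightarrow> p \<in> path_dom b1"
proof -
  assume "p \<in> path_dom b2"
  then have s: "summable (\<lambda>j. b2 (Suc j) * norm (p (Suc j)))" by (simp add: path_dom_def)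
  show "p \<in> path_dom b" unfolding path_dom_def mem_Collect_eq
    by (rule summable_comparison_test'[OF s, of 0])
      (use order_trans[OF weights(1) weights(3)] in \<open>simp add: b_Suc \<alpha>_nonneg mult_right_mono\<close>)
  show "p \<in> path_dom b1" unfolding path_dom_def mem_Collect_eq
    by (rule summable_comparison_test'[OF s, of 0]) (use weights(3) b12_nonneg in \<open>simp add: mult_right_mono\<close>)
qed

lemma AE_path_dom_b2: "AE p in path_law. p \<in> path_dom b2"
  by (rule AE_path_dom[OF b12_nonneg(2) b2_summable U(1)])

lemma resid_derivative:
  assumes \<theta>: "\<theta> \<in> V" and p: "p \<in> path_dom b2"
  shows "((\<lambda>\<theta>. resid \<theta> p) has_derivative (\<lambda>v. - (\<Sum>k\<in>UNIV. v $ k *\<^sub>R g1 k \<theta> p))) (at \<theta>)"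
proof -
  have "((\<lambda>\<theta>. p 0 - f \<theta> p) has_derivative (\<lambda>v. 0 - (\<Sum>k\<in>UNIV. v $ k *\<^sub>R g1 k \<theta> p))) (at \<theta>)"
    by (intro has_derivative_diff has_derivative_const f_derivatives assms)
  then show ?thesis by (simp add: resid_def)
qed

lemma square_derivative:
  assumes \<theta>: "\<theta> \<in> V" and p: "p \<in> path_dom b2"
  shows "((\<lambda>\<theta>. resid \<theta> p \<bullet> resid \<theta> p) has_derivative (\<lambda>v. \<Sum>k\<in>UNIV. v $ k *\<^sub>R (- 2 * (resid \<theta> p \<bullet> g1 k \<theta> p)))) (at \<theta>)"
proof -
  note d = resid_derivative[OF assms]
  have "(\<lambda>v. resid \<theta> p \<bullet> - (\<Sum>k\<in>UNIV. v $ k *\<^sub>R g1 k \<theta> p) + - (\<Sum>k\<in>UNIV. v $ k *\<^sub>R g1 k \<theta> p) \<bullet> resid \<theta> p)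
    = (\<lambda>v. \<Sum>k\<in>UNIV. v $ k *\<^sub>R (- 2 * (resid \<theta> p \<bullet> g1 k \<theta> p)))"
  proof
    fix v :: "real^'d"
    have "resid \<theta> p \<bullet> - (\<Sum>k\<in>UNIV. v $ k *\<^sub>R g1 k \<theta> p) + - (\<Sum>k\<in>UNIV. v $ k *\<^sub>R g1 k \<theta> p) \<bullet> resid \<theta> p
      = - 2 * (\<Sum>k\<in>UNIV. v $ k * (resid \<theta> p \<bullet> g1 k \<theta> p))"
      by (simp add: inner_commute[of _ "resid \<theta> p"] inner_sum_right)
    also have "\<dots> = (\<Sum>k\<in>UNIV. v $ k *\<^sub>R (- 2 * (resid \<theta> p \<bullet> g1 k \<theta> p)))"
      unfolding sum_distrib_left by (intro sum.cong refl) simp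
    finally show "resid \<theta> p \<bullet> - (\<Sum>k\<in>UNIV. v $ k *\<^sub>R g1 k \<theta> p) + - (\<Sum>k\<in>UNIV. v $ k *\<^sub>R g1 k \<theta> p) \<bullet> resid \<theta> p
      = (\<Sum>k\<in>UNIV. v $ k *\<^sub>R (- 2 * (resid \<theta> p \<bullet> g1 k \<theta> p)))" .
  qed
  with has_derivative_inner[OF d d] show ?thesis by simp
qed

lemma score_derivative:
  assumes \<theta>: "\<theta> \<in> V" and p: "p \<in> path_dom b2"
  shows "((\<lambda>\<theta>. resid \<theta> p \<bullet> g1 k \<theta> p) has_derivative
    (\<lambda>v. \<Sum>l\<in>UNIV. v $ l *\<^sub>R (resid \<theta> p \<bullet> g2 l k \<theta> p - g1 l \<theta> p \<bullet> g1 k \<theta> p))) (at \<theta>)"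
proof -
  have "(\<lambda>v. resid \<theta> p \<bullet> (\<Sum>l\<in>UNIV. v $ l *\<^sub>R g2 l k \<theta> p) + - (\<Sum>l\<in>UNIV. v $ l *\<^sub>R g1 l \<theta> p) \<bullet> g1 k \<theta> p)
    = (\<lambda>v. \<Sum>l\<in>UNIV. v $ l *\<^sub>R (resid \<theta> p \<bullet> g2 l k \<theta> p - g1 l \<theta> p \<bullet> g1 k \<theta> p))"
    by (simp add: fun_eq_iff inner_sum_right inner_sum_left right_diff_distrib sum_subtractf)
  with has_derivative_inner[OF resid_derivative[OF assms] f_derivatives(2)[OF assms, of k]] show ?thesis by simp
qed

lemma pderivative_ar_fun:
  assumes p: "p \<in> path_dom b2"
  shows "pderivative k (\<lambda>\<theta>. ar_fun A0 A \<theta> p) \<theta>0 = g1 k \<theta>0 p"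
proof (rule pderivative_sum_eq)
  show "((\<lambda>\<theta>. ar_fun A0 A \<theta> p) has_derivative (\<lambda>v. \<Sum>k\<in>UNIV. v $ k *\<^sub>R g1 k \<theta>0 p)) (at \<theta>0)"
  proof (rule has_derivative_transform_within_open[OF f_derivatives(1)[OF \<theta>0_in(1) p] open_ball \<theta>0_in(1)])
    fix \<theta> assume "\<theta> \<in> V"
    then show "f \<theta> p = ar_fun A0 A \<theta> p"
      using path_dom_ar_fun[OF K_sub(2) path_dom_b2(1)[OF p]] by simp
  qed
qed

text \<open>The first derivative is computed on the whole ball and not only at \<theta>0, since the
  second one differentiates it as a function of the parameter.\<close>

lemma pderivative_q_fun:
  assumes p: "past X 0 \<omega> \<in> path_dom b2"
  defines "p \<equiv> past X 0 \<omega>"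
  shows "\<theta> \<in> V \<Longrightarrow> pderivative j (q_fun A0 A X 0 \<omega>) \<theta> = - 2 * (resid \<theta> p \<bullet> g1 j \<theta> p)"
    and "pderivative i (pderivative j (q_fun A0 A X 0 \<omega>)) \<theta>0 = - 2 * (resid \<theta>0 p \<bullet> g2 i j \<theta>0 p - g1 i \<theta>0 p \<bullet> g1 j \<theta>0 p)"
proof -
  have pd: "p \<in> path_dom b2" using p by (simp add: p_def)
  have q: "resid \<theta> p \<bullet> resid \<theta> p = q_fun A0 A X 0 \<omega> \<theta>" if "\<theta> \<in> V" for \<theta>
  proof -
    have "X 0 \<omega> = p 0" by (simp add: p_def past_def)
    then show ?thesis
      using path_dom_ar_fun[OF K_sub(2) path_dom_b2(1)[OF pd], of \<theta>] that
      by (simp add: q_fun_def resid_def p_def[symmetric] power2_norm_eq_inner)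
  qed
  have 1: "pderivative j (q_fun A0 A X 0 \<omega>) \<theta> = - 2 * (resid \<theta> p \<bullet> g1 j \<theta> p)" if "\<theta> \<in> V" for \<theta> j
    by (rule pderivative_sum_eq[OF has_derivative_transform_within_open[OF square_derivative[OF that pd] open_ball that q]])
  then show "\<theta> \<in> V \<Longrightarrow> pderivative j (q_fun A0 A X 0 \<omega>) \<theta> = - 2 * (resid \<theta> p \<bullet> g1 j \<theta> p)" .
  have "((\<lambda>\<theta>. - 2 * (resid \<theta> p \<bullet> g1 j \<theta> p)) has_derivative
    (\<lambda>v. - 2 * (\<Sum>l\<in>UNIV. v $ l *\<^sub>R (resid \<theta>0 p \<bullet> g2 l j \<theta>0 p - g1 l \<theta>0 p \<bullet> g1 j \<theta>0 p)))) (at \<theta>0)"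
    by (rule has_derivative_mult_right[OF score_derivative[OF \<theta>0_in(1) pd]])
  then have "((\<lambda>\<theta>. - 2 * (resid \<theta> p \<bullet> g1 j \<theta> p)) has_derivative
    (\<lambda>v. \<Sum>l\<in>UNIV. v $ l *\<^sub>R (- 2 * (resid \<theta>0 p \<bullet> g2 l j \<theta>0 p - g1 l \<theta>0 p \<bullet> g1 j \<theta>0 p)))) (at \<theta>0)"
    by (simp only: sum_distrib_left real_scaleR_def mult.left_commute)
  from pderivative_sum_eq[OF has_derivative_transform_within_open[OF this open_ball \<theta>0_in(1) 1[symmetric]]]
  show "pderivative i (pderivative j (q_fun A0 A X 0 \<omega>)) \<theta>0 = - 2 * (resid \<theta>0 p \<bullet> g2 i j \<theta>0 p - g1 i \<theta>0 p \<bullet> g1 j \<theta>0 p)" .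
qed

section \<open>The Gram matrix of the gradients and the matrices F and G\<close>

lemma family_L2:
  assumes "lipschitz_family K b2 C \<phi>" "\<theta> \<in> K"
  shows "integrable path_law (\<lambda>p. \<phi> \<theta> p \<bullet> \<phi> \<theta> p)"
proof (rule Bochner_Integration.integrable_bound)
  note s = b12_nonneg(2) b2_summable U(1) C_nonneg
  show "integrable path_law (\<lambda>p. (envelope b2 C U p)\<^sup>2)" by (rule envelope_L2[OF s])
  show "(\<lambda>p. \<phi> \<theta> p \<bullet> \<phi> \<theta> p) \<in> borel_measurable path_law"
    unfolding measurable_path_law by (rule lipschitz_family_inner_measurable[OF s assms(1,1,2)])
  show "AE p in path_law. norm (\<phi> \<theta> p \<bullet> \<phi> \<theta> p) \<le> norm ((envelope b2 C U p)\<^sup>2)"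
    using AE_path_dom_b2
  proof eventually_elim
    case (elim p)
    have "norm (\<phi> \<theta> p \<bullet> \<phi> \<theta> p) = (norm (\<phi> \<theta> p))\<^sup>2" by (simp add: power2_norm_eq_inner)
    also have "\<dots> \<le> (envelope b2 C U p)\<^sup>2"
      by (intro power_mono lipschitz_family_bound[OF s assms elim] norm_ge_zero)
    finally show ?case by simp
  qed
qed

lemma family_measurable: "lipschitz_family K b2 C \<phi> \<Longrightarrow> \<theta> \<in> K \<Longrightarrow> \<phi> \<theta> \<in> borel_measurable seq_space"
  unfolding lipschitz_family_def by blast

lemma inner_integrable:
  fixes v w :: "(nat \<Rightarrow> real^'m) \<Rightarrow> real^'m"
  assumes v: "v \<in> borel_measurable seq_space" "integrable path_law (\<lambda>p. v p \<bullet> v p)"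
    and w: "w \<in> borel_measurable seq_space" "integrable path_law (\<lambda>p. w p \<bullet> w p)"
  shows "integrable path_law (\<lambda>p. v p \<bullet> w p)"
proof (rule Bochner_Integration.integrable_bound)
  show "integrable path_law (\<lambda>p. v p \<bullet> v p + w p \<bullet> w p)" using v w by simp
  show "(\<lambda>p. v p \<bullet> w p) \<in> borel_measurable path_law"
    unfolding measurable_path_law by (intro borel_measurable_inner v w)
  have "norm (x \<bullet> y) \<le> norm (x \<bullet> x + y \<bullet> y)" for x y :: "real^'m"
  proof -
    have "\<bar>x \<bullet> y\<bar> \<le> norm x * norm y" by (rule Cauchy_Schwarz_ineq2)
    also have "\<dots> \<le> (norm x)\<^sup>2 + (norm y)\<^sup>2"
      using sum_squares_bound[of "norm x" "norm y"] mult_nonneg_nonneg[OF norm_ge_zero[of x] norm_ge_zero[of y]] by linarith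
    finally show ?thesis by (simp add: power2_norm_eq_inner)
  qed
  then show "AE p in path_law. norm (v p \<bullet> w p) \<le> norm (v p \<bullet> v p + w p \<bullet> w p)" by (rule AE_I2)
qed

lemma g1_props:
  "g1 k \<theta>0 \<in> borel_measurable seq_space" "integrable path_law (\<lambda>p. g1 k \<theta>0 p \<bullet> g1 k \<theta>0 p)"
  "g1 k \<theta>0 (p(0 := 0)) = g1 k \<theta>0 p"
  by (rule family_measurable[OF family_b2(2) \<theta>0_in(2)], rule family_L2[OF family_b2(2) \<theta>0_in(2)])
     (simp add: g1_def lag_series_def)

lemma g2_props:
  "g2 k l \<theta>0 \<in> borel_measurable seq_space" "integrable path_law (\<lambda>p. g2 k l \<theta>0 p \<bullet> g2 k l \<theta>0 p)"
  "g2 k l \<theta>0 (p(0 := 0)) = g2 k l \<theta>0 p"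
  by (rule family_measurable[OF family_b2(3) \<theta>0_in(2)], rule family_L2[OF family_b2(3) \<theta>0_in(2)])
     (simp add: g2_def lag_series_def)

lemma g1_inner_integrable: "integrable path_law (\<lambda>p. g1 k \<theta>0 p \<bullet> g1 l \<theta>0 p)"
  by (rule inner_integrable[OF g1_props(1,2) g1_props(1,2)])

definition H :: "real^'d^'d" where
  "H = (\<chi> i j. \<integral>p. g1 i \<theta>0 p \<bullet> g1 j \<theta>0 p \<partial>path_law)"

text \<open>The derivative of f at \<theta>0 along c. Pairing the score with c reduces its limit law
  to a scalar central limit theorem (Cramer-Wold), whose variance is the quadratic form of
  \<open>H\<close>.\<close>

definition direction :: "real^'d \<Rightarrow> (nat \<Rightarrow> real^'m) \<Rightarrow> real^'m" where
  "direction c p = (\<Sum>k\<in>UNIV. c $ k *\<^sub>R g1 k \<theta>0 p)"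

lemma direction_measurable: "direction c \<in> borel_measurable seq_space"
  unfolding direction_def [abs_def]
  by (intro borel_measurable_sum borel_measurable_scaleR borel_measurable_const g1_props)

lemma direction_ignores_present: "direction c (p(0 := 0)) = direction c p"
  unfolding direction_def by (simp only: g1_props)

lemma direction_inner: "direction c p \<bullet> direction c p =
    (\<Sum>i\<in>UNIV. \<Sum>j\<in>UNIV. c $ i * (c $ j * (g1 i \<theta>0 p \<bullet> g1 j \<theta>0 p)))"
proof -
  have a: "direction c p \<bullet> v = (\<Sum>i\<in>UNIV. c $ i * (g1 i \<theta>0 p \<bullet> v))" for v
    by (simp only: direction_def inner_sum_left inner_scaleR_left)
  have b: "v \<bullet> direction c p = (\<Sum>j\<in>UNIV. c $ j * (v \<bullet> g1 j \<theta>0 p))" for v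
    by (simp only: direction_def inner_sum_right inner_scaleR_right)
  show ?thesis
    unfolding a[of "direction c p"] unfolding b by (simp only: sum_distrib_left)
qed

lemma direction_L2:
  "integrable path_law (\<lambda>p. direction c p \<bullet> direction c p)"
  "(\<integral>p. direction c p \<bullet> direction c p \<partial>path_law) = c \<bullet> (H *v c)"
proof -
  show "integrable path_law (\<lambda>p. direction c p \<bullet> direction c p)"
    unfolding direction_inner
    by (intro Bochner_Integration.integrable_sum integrable_mult_right g1_inner_integrable)
  have "(\<integral>p. direction c p \<bullet> direction c p \<partial>path_law) = (\<Sum>i\<in>UNIV. \<Sum>j\<in>UNIV. c $ i * (c $ j * H $ i $ j))"
  proof -
    have "(\<integral>p. direction c p \<bullet> direction c p \<partial>path_law) = (\<Sum>i\<in>UNIV. \<integral>p. (\<Sum>j\<in>UNIV. c $ i * (c $ j * (g1 i \<theta>0 p \<bullet> g1 j \<theta>0 p))) \<partial>path_law)"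
      unfolding direction_inner
      by (intro Bochner_Integration.integral_sum Bochner_Integration.integrable_sum integrable_mult_right g1_inner_integrable)
    also have "\<dots> = (\<Sum>i\<in>UNIV. \<Sum>j\<in>UNIV. \<integral>p. c $ i * (c $ j * (g1 i \<theta>0 p \<bullet> g1 j \<theta>0 p)) \<partial>path_law)"
      by (intro sum.cong refl Bochner_Integration.integral_sum integrable_mult_right g1_inner_integrable)
    finally show ?thesis by (simp only: integral_mult_right_zero H_def vec_lambda_beta)
  qed
  also have "\<dots> = c \<bullet> (H *v c)"
  proof -
    have "(H *v c) $ i = (\<Sum>j\<in>UNIV. c $ j * H $ i $ j)" for i
      unfolding matrix_vector_mult_def vec_lambda_beta by (intro sum.cong refl mult.commute)
    then show ?thesis by (simp only: inner_vec_def inner_real_def sum_distrib_left)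
  qed
  finally show "(\<integral>p. direction c p \<bullet> direction c p \<partial>path_law) = c \<bullet> (H *v c)" .
qed

lemma H_symmetric: "transpose H = H"
proof -
  have "g1 j \<theta>0 p \<bullet> g1 i \<theta>0 p = g1 i \<theta>0 p \<bullet> g1 j \<theta>0 p" for i j p by (rule inner_commute)
  then show ?thesis unfolding H_def transpose_def vec_eq_iff vec_lambda_beta by presburger
qed

lemma H_positive:
  assumes "c \<noteq> 0" shows "c \<bullet> (H *v c) > 0"
proof -
  have "c \<bullet> (H *v c) \<ge> 0" unfolding direction_L2(2)[symmetric] by simp
  moreover have "c \<bullet> (H *v c) \<noteq> 0"
  proof
    assume "c \<bullet> (H *v c) = 0"
    then have "AE p in path_law. direction c p \<bullet> direction c p = 0"
      unfolding direction_L2(2)[symmetric] using integral_nonneg_eq_0_iff_AE[OF direction_L2(1)[of c]] inner_ge_zero by blast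
    with AE_path_dom_b2
    have "AE p in path_law. (\<Sum>i\<in>UNIV. c $ i *\<^sub>R pderivative i (\<lambda>\<theta>. ar_fun A0 A \<theta> p) \<theta>0) = 0"
    proof eventually_elim
      case (elim p)
      then have "direction c p = 0" by simp
      then show ?case by (simp only: direction_def pderivative_ar_fun[OF elim(1)])
    qed
    have "c = 0"
    proof (rule independent)
      fix t
      show "AE \<omega> in M. (\<Sum>i\<in>UNIV. c $ i *\<^sub>R pderivative i (\<lambda>\<theta>. ar_fun A0 A \<theta> (past X t \<omega>)) \<theta>0) = 0"
        by (rule AE_past) fact
    qed
    then show False using assms by simp
  qed
  ultimately show ?thesis by linarith
qed

text \<open>The second derivative of f enters multiplied by the innovation, which is centred and
  independent of it; only the Gram term survives, with factor 2.\<close>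

lemma F_matrix:
  "integrable (completion M) (\<lambda>\<omega>. pderivative i (pderivative j (q_fun A0 A X 0 \<omega>)) \<theta>0)"
  "F_matrix M A0 A X \<theta>0 = 2 *\<^sub>R H"
proof -
  let ?G = "\<lambda>i j p. - 2 * (innovation p \<bullet> g2 i j \<theta>0 p - g1 i \<theta>0 p \<bullet> g1 j \<theta>0 p)"
  have i: "integrable path_law (?G i j)" and v: "(\<integral>p. ?G i j p \<partial>path_law) = 2 * H $ i $ j" for i j
  proof -
    note o = innovation_inner_expectation[OF g2_props(1) g2_props(3) g2_props(2) g2_props(1) g2_props(3) g2_props(2), of i j]
    show "integrable path_law (?G i j)"
      by (intro integrable_mult_right Bochner_Integration.integrable_diff o g1_inner_integrable)
    show "(\<integral>p. ?G i j p \<partial>path_law) = 2 * H $ i $ j"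
      using o g1_inner_integrable[of i j] by (simp add: H_def)
  qed
  have eq: "AE \<omega> in M. pderivative i (pderivative j (q_fun A0 A X 0 \<omega>)) \<theta>0 = ?G i j (past X 0 \<omega>)" for i j
    using AE_past[OF AE_path_dom_b2, of 0]
  proof eventually_elim
    case (elim \<omega>)
    show ?case
      unfolding pderivative_q_fun(2)[OF elim] innovation_eq_resid[OF path_dom_b2(1)[OF elim]] by (rule refl)
  qed
  note c = integral_completion_AE_eq[OF integrable_past[OF i] eq]
  show "integrable (completion M) (\<lambda>\<omega>. pderivative i (pderivative j (q_fun A0 A X 0 \<omega>)) \<theta>0)" by (rule c)
  have m: "?G i j \<in> borel_measurable seq_space" for i j using borel_measurable_integrable[OF i[of i j]] by simp
  have "(\<integral>\<omega>. pderivative i (pderivative j (q_fun A0 A X 0 \<omega>)) \<theta>0 \<partial>completion M) = 2 * H $ i $ j" for i j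
    unfolding c(2) integral_past[OF m] by (rule v)
  then show "F_matrix M A0 A X \<theta>0 = 2 *\<^sub>R H" by (simp add: F_matrix_def vec_eq_iff)
qed

text \<open>Each first derivative of the squared residual is -2 times innovation paired with
  gradient, and the noise has identity covariance, hence the factor 4.\<close>

lemma G_matrix:
  "integrable (completion M) (\<lambda>\<omega>. pderivative i (q_fun A0 A X 0 \<omega>) \<theta>0 * pderivative j (q_fun A0 A X 0 \<omega>) \<theta>0)"
  "G_matrix M A0 A X \<theta>0 = 4 *\<^sub>R H"
proof -
  let ?G = "\<lambda>i j p. 4 * ((innovation p \<bullet> g1 i \<theta>0 p) * (innovation p \<bullet> g1 j \<theta>0 p))"
  have i: "integrable path_law (?G i j)" and v: "(\<integral>p. ?G i j p \<partial>path_law) = 4 * H $ i $ j" for i j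
  proof -
    note cv = innovation_covariance_integrable[OF g1_props(1) g1_props(3) g1_props(2) g1_props(1) g1_props(3) g1_props(2), of i j]
      innovation_covariance[OF g1_props(1) g1_props(3) g1_props(2) g1_props(1) g1_props(3) g1_props(2), of i j]
    show "integrable path_law (?G i j)" by (intro integrable_mult_right cv)
    show "(\<integral>p. ?G i j p \<partial>path_law) = 4 * H $ i $ j"
      by (simp only: integral_mult_right_zero cv(2) H_def vec_lambda_beta)
  qed
  have eq: "AE \<omega> in M. pderivative i (q_fun A0 A X 0 \<omega>) \<theta>0 * pderivative j (q_fun A0 A X 0 \<omega>) \<theta>0 = ?G i j (past X 0 \<omega>)" for i j
    using AE_past[OF AE_path_dom_b2, of 0]
  proof eventually_elim
    case (elim \<omega>)
    show ?case
      unfolding pderivative_q_fun(1)[OF elim \<theta>0_in(1)] innovation_eq_resid[OF path_dom_b2(1)[OF elim]] by simp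
  qed
  note c = integral_completion_AE_eq[OF integrable_past[OF i] eq]
  show "integrable (completion M) (\<lambda>\<omega>. pderivative i (q_fun A0 A X 0 \<omega>) \<theta>0 * pderivative j (q_fun A0 A X 0 \<omega>) \<theta>0)" by (rule c)
  have m: "?G i j \<in> borel_measurable seq_space" for i j using borel_measurable_integrable[OF i[of i j]] by simp
  have "(\<integral>\<omega>. pderivative i (q_fun A0 A X 0 \<omega>) \<theta>0 * pderivative j (q_fun A0 A X 0 \<omega>) \<theta>0 \<partial>completion M) = 4 * H $ i $ j" for i j
    unfolding c(2) integral_past[OF m] by (rule v)
  then show "G_matrix M A0 A X \<theta>0 = 4 *\<^sub>R H" by (simp add: G_matrix_def vec_eq_iff)
qed

text \<open>The score at \<theta>0 built from the complete stationary past and normalised by sqrt n.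
  It is the martingale approximation of the score that the estimator sees.\<close>

definition score_mean :: "nat \<Rightarrow> 'a \<Rightarrow> real^'d" where
  "score_mean n \<omega> = (\<chi> k. (\<Sum>t=1..n. innovation (past X (int t) \<omega>) \<bullet> g1 k \<theta>0 (past X (int t) \<omega>)) / sqrt (real n))"

lemma inner_score_mean:
  "c \<bullet> score_mean n \<omega> = (\<Sum>t=1..n. innovation (past X (int t) \<omega>) \<bullet> direction c (past X (int t) \<omega>)) / sqrt (real n)"
proof -
  have "c \<bullet> score_mean n \<omega> = (\<Sum>k\<in>UNIV. \<Sum>t=1..n. c $ k * (innovation (past X (int t) \<omega>) \<bullet> g1 k \<theta>0 (past X (int t) \<omega>))) / sqrt (real n)"
    by (simp add: inner_vec_def score_mean_def sum_divide_distrib sum_distrib_left)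
  also have "\<dots> = (\<Sum>t=1..n. \<Sum>k\<in>UNIV. c $ k * (innovation (past X (int t) \<omega>) \<bullet> g1 k \<theta>0 (past X (int t) \<omega>))) / sqrt (real n)"
    by (subst sum.swap) simp
  finally show ?thesis by (simp add: direction_def inner_sum_right)
qed

lemma g1_martingale_difference: "martingale_difference (\<lambda>p. innovation p \<bullet> g1 k \<theta>0 p)"
  by (rule innovation_martingale_difference[of "\<lambda>x. x", OF _ innovation_square_integrable innovation_moments(3)
      g1_props(1) g1_props(3) g1_props(2)]) simp

text \<open>The bound does not depend on n, which yields tightness and the bounded means required
  for the linearisation error.\<close>

lemma score_mean_component:
  "integrable M (\<lambda>\<omega>. score_mean n \<omega> $ k)" "(\<integral>\<omega>. \<bar>score_mean n \<omega> $ k\<bar> \<partial>M) \<le> sqrt (H $ k $ k)"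
proof -
  let ?S = "\<lambda>\<omega>. \<Sum>t=1..n. innovation (past X (int t) \<omega>) \<bullet> g1 k \<theta>0 (past X (int t) \<omega>)"
  note md = g1_martingale_difference[of k]
  have m: "?S \<in> borel_measurable M"
    by (intro borel_measurable_sum measurable_compose[OF past_measurable martingale_differenceD(1)[OF md]])
  have H: "(\<integral>p. (innovation p \<bullet> g1 k \<theta>0 p)\<^sup>2 \<partial>path_law) = H $ k $ k"
    unfolding power2_eq_square H_def vec_lambda_beta
    by (rule innovation_covariance[OF g1_props(1) g1_props(3) g1_props(2) g1_props(1) g1_props(3) g1_props(2)])
  note e = expectation_abs_le_sqrt[OF m martingale_sum_square(1)[OF md, of n]]
  have z: "score_mean n \<omega> $ k = ?S \<omega> / sqrt (real n)" for \<omega> by (simp add: score_mean_def)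
  show "integrable M (\<lambda>\<omega>. score_mean n \<omega> $ k)" unfolding z using e(1) by (rule integrable_divide)
  have "(\<integral>\<omega>. \<bar>score_mean n \<omega> $ k\<bar> \<partial>M) = (\<integral>\<omega>. \<bar>?S \<omega>\<bar> \<partial>M) / sqrt (real n)"
    unfolding z by simp
  also have "\<dots> \<le> sqrt (\<integral>\<omega>. (?S \<omega>)\<^sup>2 \<partial>M) / sqrt (real n)" by (rule divide_right_mono[OF e(2)]) simp
  also have "\<dots> = sqrt (real n) * sqrt (H $ k $ k) / sqrt (real n)"
    unfolding martingale_sum_square(2)[OF md] H by (simp only: real_sqrt_mult)
  also have "\<dots> \<le> sqrt (H $ k $ k)"
  proof (cases "n = 0")
    case True
    have "H $ k $ k \<ge> 0" unfolding H[symmetric] by simp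
    then show ?thesis using True by simp
  qed simp
  finally show "(\<integral>\<omega>. \<bar>score_mean n \<omega> $ k\<bar> \<partial>M) \<le> sqrt (H $ k $ k)" .
qed

lemma score_mean_char:
  "(\<lambda>n. \<integral>\<omega>. iexp (c \<bullet> score_mean n \<omega>) \<partial>M) \<longlonglongrightarrow> of_real (exp (- (c \<bullet> (H *v c)) / 2))"
proof -
  have "1 * ((\<Sum>t=1..n. innovation (past X (int t) \<omega>) \<bullet> direction c (past X (int t) \<omega>)) / sqrt (real n)) = c \<bullet> score_mean n \<omega>" for n \<omega>
    unfolding inner_score_mean by (rule mult_1)
  moreover have "1\<^sup>2 * (\<integral>p. direction c p \<bullet> direction c p \<partial>path_law) = c \<bullet> (H *v c)"
    unfolding direction_L2(2) power_one by (rule mult_1)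
  ultimately show ?thesis
    using innovation_clt[OF direction_measurable direction_ignores_present direction_L2(1), of 1 c] by (simp only:)
qed

section \<open>The score equation along truncated pasts\<close>

abbreviation lagged :: "nat \<Rightarrow> 'a \<Rightarrow> nat \<Rightarrow> real^'m" where "lagged t \<omega> \<equiv> truncated_past X u t \<omega>"

lemma lagged_measurable: "lagged t \<in> measurable M seq_space"
proof (rule measurable_PiM_single')
  fix j :: nat
  show "(\<lambda>\<omega>. lagged t \<omega> j) \<in> borel_measurable M"
    unfolding truncated_past_def by (cases "j < t") simp_all
qed (simp add: space_PiM)

text \<open>Minus one half of the partial derivative of \<open>loss\<close>; \<open>hessian\<close>
  is the derivative of \<open>score\<close>, which explains its limit -H after division by
  n.\<close>

definition score :: "'d \<Rightarrow> nat \<Rightarrow> 'a \<Rightarrow> real^'d \<Rightarrow> real" where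
  "score k n \<omega> \<theta> = (\<Sum>t=1..n. resid \<theta> (lagged t \<omega>) \<bullet> g1 k \<theta> (lagged t \<omega>))"

definition hessian :: "'d \<Rightarrow> 'd \<Rightarrow> nat \<Rightarrow> 'a \<Rightarrow> real^'d \<Rightarrow> real" where
  "hessian k l n \<omega> \<theta> = (\<Sum>t=1..n. resid \<theta> (lagged t \<omega>) \<bullet> g2 l k \<theta> (lagged t \<omega>)) -
     (\<Sum>t=1..n. g1 l \<theta> (lagged t \<omega>) \<bullet> g1 k \<theta> (lagged t \<omega>))"

context
  fixes \<omega> :: 'a
  assumes dom: "\<And>t. past X t \<omega> \<in> path_dom b2"
begin

lemma lagged_dom: "t \<ge> 1 \<Longrightarrow> lagged t \<omega> \<in> path_dom b2"
  by (rule truncation_dom[OF b12_nonneg(2) b2_summable U(1) C_nonneg dom truncated_past])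

lemma score_has_derivative:
  assumes "\<theta> \<in> V"
  shows "(score k n \<omega> has_derivative (\<lambda>v. \<Sum>l\<in>UNIV. v $ l * hessian k l n \<omega> \<theta>)) (at \<theta>)"
proof -
  have "(score k n \<omega> has_derivative (\<lambda>v. \<Sum>t=1..n. \<Sum>l\<in>UNIV. v $ l *\<^sub>R
    (resid \<theta> (lagged t \<omega>) \<bullet> g2 l k \<theta> (lagged t \<omega>) - g1 l \<theta> (lagged t \<omega>) \<bullet> g1 k \<theta> (lagged t \<omega>)))) (at \<theta>)"
    unfolding score_def [abs_def]
    by (intro has_derivative_sum score_derivative assms lagged_dom) simp
  moreover have "(\<Sum>t=1..n. \<Sum>l\<in>UNIV. v $ l *\<^sub>R
    (resid \<theta> (lagged t \<omega>) \<bullet> g2 l k \<theta> (lagged t \<omega>) - g1 l \<theta> (lagged t \<omega>) \<bullet> g1 k \<theta> (lagged t \<omega>)))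
    = (\<Sum>l\<in>UNIV. v $ l * hessian k l n \<omega> \<theta>)" for v :: "real^'d"
    unfolding hessian_def sum_subtractf[symmetric] sum_distrib_left
    by (subst sum.swap) (simp only: real_scaleR_def)
  ultimately show ?thesis by (simp only:)
qed

text \<open>Once the estimator lies in the open ball it is a local minimum of the differentiable
  loss, so all partial derivatives vanish there.\<close>

lemma score_zero:
  assumes h: "\<theta>hat n \<omega> \<in> V" and \<omega>: "\<omega> \<in> space M" and n: "n \<ge> 1"
  shows "score k n \<omega> (\<theta>hat n \<omega>) = 0"
proof -
  let ?h = "\<theta>hat n \<omega>"
  have d: "past X t \<omega> \<in> path_dom b" for t by (rule path_dom_b2(1)[OF dom])
  have "(loss n \<omega> has_derivative (\<lambda>v. \<Sum>t=1..n. \<Sum>k\<in>UNIV. v $ k *\<^sub>R (- 2 * (resid ?h (lagged t \<omega>) \<bullet> g1 k ?h (lagged t \<omega>))))) (at ?h)"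
    unfolding loss_def [abs_def]
    by (intro has_derivative_sum square_derivative h lagged_dom) simp
  moreover have "(\<Sum>t=1..n. \<Sum>k\<in>UNIV. v $ k *\<^sub>R (- 2 * (resid ?h (lagged t \<omega>) \<bullet> g1 k ?h (lagged t \<omega>))))
      = (\<Sum>k\<in>UNIV. v $ k *\<^sub>R (- 2 * score k n \<omega> ?h))" for v :: "real^'d"
    unfolding score_def real_scaleR_def sum_distrib_left by (rule sum.swap)
  ultimately have D: "(loss n \<omega> has_derivative (\<lambda>v. \<Sum>k\<in>UNIV. v $ k *\<^sub>R (- 2 * score k n \<omega> ?h))) (at ?h)"
    by (simp only:)
  have "\<forall>y\<in>V. loss n \<omega> ?h \<le> loss n \<omega> y"
    using \<theta>hat_minimises(2)[OF d \<omega> n] K_sub(2) V_sub by blast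
  then have "(\<lambda>v. \<Sum>k\<in>UNIV. v $ k *\<^sub>R (- 2 * score k n \<omega> ?h)) = (\<lambda>v. 0)"
    using differential_zero_maxmin[OF h open_ball D] by blast
  then have "pderivative k (loss n \<omega>) ?h = 0" unfolding pderivative_eq[OF D] by (rule fun_cong)
  then show ?thesis using pderivative_sum_eq[OF D, of k] by simp
qed

lemma score_mean_value:
  assumes h: "h \<in> V"
  obtains \<theta> where "\<theta> \<in> V" "dist \<theta> \<theta>0 \<le> dist h \<theta>0"
    "score k n \<omega> h - score k n \<omega> \<theta>0 = (\<Sum>l\<in>UNIV. (h - \<theta>0) $ l * hessian k l n \<omega> \<theta>)"
proof -
  let ?z = "\<lambda>s. \<theta>0 + s *\<^sub>R (h - \<theta>0)"
  have dz: "dist (?z s) \<theta>0 = \<bar>s\<bar> * dist h \<theta>0" for s by (simp add: dist_norm)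
  have zV: "?z s \<in> V" "dist (?z s) \<theta>0 \<le> dist h \<theta>0" if "0 \<le> s" "s \<le> 1" for s
  proof -
    show 1: "dist (?z s) \<theta>0 \<le> dist h \<theta>0" unfolding dz using that by (intro mult_left_le_one_le) simp_all
    show "?z s \<in> V" using 1 h by (simp add: dist_commute)
  qed
  have "((\<lambda>s. score k n \<omega> (?z s)) has_derivative (\<lambda>x. \<Sum>l\<in>UNIV. (x *\<^sub>R (h - \<theta>0)) $ l * hessian k l n \<omega> (?z s))) (at s within {0..1})"
    if "0 \<le> s" "s \<le> 1" for s
  proof (rule has_derivative_compose[where f = ?z and g = "score k n \<omega>", OF _ score_has_derivative[OF zV(1)[OF that]]])
    show "(?z has_derivative (\<lambda>x. x *\<^sub>R (h - \<theta>0))) (at s within {0..1})"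
      by (auto intro!: derivative_eq_intros)
  qed
  from mvt_simple[OF zero_less_one this]
  obtain s where s: "s \<in> {0<..<1}" "score k n \<omega> (?z 1) - score k n \<omega> (?z 0) =
      (\<Sum>l\<in>UNIV. ((1 - 0) *\<^sub>R (h - \<theta>0)) $ l * hessian k l n \<omega> (?z s))" by blast
  show ?thesis
    by (rule that[of "?z s"]) (use s zV[of s] in simp_all)
qed

end

definition H_inv :: "real^'d^'d" where "H_inv = matrix_inv H"

definition remainder :: "nat \<Rightarrow> 'a \<Rightarrow> real" where
  "remainder n \<omega> = (\<Sum>k\<in>UNIV. \<bar>\<Sum>t=1..n. resid \<theta>0 (lagged t \<omega>) \<bullet> g1 k \<theta>0 (lagged t \<omega>)
     - resid \<theta>0 (past X (int t) \<omega>) \<bullet> g1 k \<theta>0 (past X (int t) \<omega>)\<bar> / sqrt (real n))"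

lemma remainder_nonneg: "remainder n \<omega> \<ge> 0" by (simp add: remainder_def sum_nonneg)

text \<open>\<open>remainder\<close> compares the score at \<theta>0 along truncated and complete
  pasts. At the scale 1 / sqrt n this needs the square summable tails, hence the families with
  weights \<open>b1\<close>.\<close>

lemma remainder_tendsto_0: "integrable M (remainder n)" "(\<lambda>n. \<integral>\<omega>. remainder n \<omega> \<partial>M) \<longlonglongrightarrow> 0"
proof -
  let ?r = "\<lambda>k t \<omega>. resid \<theta>0 (lagged t \<omega>) \<bullet> g1 k \<theta>0 (lagged t \<omega>)
     - resid \<theta>0 (past X (int t) \<omega>) \<bullet> g1 k \<theta>0 (past X (int t) \<omega>)"
  note s = b12_nonneg(1) b1_summable U(1) C_nonneg
  have m: "(\<lambda>\<omega>. resid \<theta>0 (lagged t \<omega>) \<bullet> g1 k \<theta>0 (lagged t \<omega>)) \<in> borel_measurable M" for k t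
    by (intro measurable_compose[OF lagged_measurable
        lipschitz_family_inner_measurable[OF s family_b1(1) family_b1(2) \<theta>0_in(2)]])
  note pt = product_truncation_expectation[OF s family_b1(1) family_b1(2) \<theta>0_in(2) b1_tails truncated_past m]
  have i: "integrable M (\<lambda>\<omega>. \<bar>\<Sum>t=1..n. ?r k t \<omega>\<bar> / sqrt (real n))" for k n
    by (intro integrable_divide integrable_abs Bochner_Integration.integrable_sum pt(1)) auto
  show "integrable M (remainder n)"
    unfolding remainder_def [abs_def] by (intro Bochner_Integration.integrable_sum i)
  have "(\<integral>\<omega>. remainder n \<omega> \<partial>M) = (\<Sum>k\<in>UNIV. (\<integral>\<omega>. \<bar>\<Sum>t=1..n. ?r k t \<omega>\<bar> \<partial>M) / sqrt (real n))" for n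
    unfolding remainder_def using i[of _ n] by (simp only: Bochner_Integration.integral_sum integral_divide_zero)
  moreover have "(\<lambda>n. \<Sum>k\<in>UNIV. (\<integral>\<omega>. \<bar>\<Sum>t=1..n. ?r k t \<omega>\<bar> \<partial>M) / sqrt (real n)) \<longlonglongrightarrow> (\<Sum>k\<in>(UNIV::'d set). 0)"
    by (intro tendsto_sum pt(2))
  ultimately show "(\<lambda>n. \<integral>\<omega>. remainder n \<omega> \<partial>M) \<longlonglongrightarrow> 0" by simp
qed

text \<open>The first sum of the Hessian averages to the mean of the innovation paired with a second
  derivative, which is 0, the second one to H. A whole ball of parameters is covered, so random
  intermediate points are allowed.\<close>

lemma hessian_limit:
  assumes e: "e > 0"
  shows "\<exists>\<rho>>0. AE \<omega> in M. \<forall>\<^sub>F n in sequentially. \<forall>\<theta>\<in>K \<inter> ball \<theta>0 \<rho>. \<bar>hessian k l n \<omega> \<theta> / real n + H $ k $ l\<bar> \<le> e"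
proof -
  note s = b12_nonneg(2) b2_summable U(1) C_nonneg
  have e2: "e / 2 > 0" using e by simp
  obtain \<rho>1 where \<rho>1: "\<rho>1 > 0" "AE \<omega> in M. \<forall>\<^sub>F n in sequentially. \<forall>\<theta>\<in>K \<inter> ball \<theta>0 \<rho>1. \<forall>q.
    (\<forall>t\<in>{1..n}. truncation t U (past X (int t) \<omega>) (q t)) \<longrightarrow>
    \<bar>(\<Sum>t=1..n. resid \<theta> (q t) \<bullet> g2 l k \<theta> (q t)) / real n - (\<integral>p. resid \<theta>0 p \<bullet> g2 l k \<theta>0 p \<partial>path_law)\<bar> \<le> e / 2"
    by (rule product_average[OF s family_b2(1) family_b2(3) \<theta>0_in(2) e2])
  obtain \<rho>2 where \<rho>2: "\<rho>2 > 0" "AE \<omega> in M. \<forall>\<^sub>F n in sequentially. \<forall>\<theta>\<in>K \<inter> ball \<theta>0 \<rho>2. \<forall>q.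
    (\<forall>t\<in>{1..n}. truncation t U (past X (int t) \<omega>) (q t)) \<longrightarrow>
    \<bar>(\<Sum>t=1..n. g1 l \<theta> (q t) \<bullet> g1 k \<theta> (q t)) / real n - (\<integral>p. g1 l \<theta>0 p \<bullet> g1 k \<theta>0 p \<partial>path_law)\<bar> \<le> e / 2"
    by (rule product_average[OF s family_b2(2) family_b2(2) \<theta>0_in(2) e2])
  note g = g2_props(1) g2_props(3) g2_props(2)
  note o = innovation_inner_expectation[OF g g, of l k]
  have z: "(\<integral>p. resid \<theta>0 p \<bullet> g2 l k \<theta>0 p \<partial>path_law) = 0"
  proof -
    have "(\<integral>p. resid \<theta>0 p \<bullet> g2 l k \<theta>0 p \<partial>path_law) = (\<integral>p. innovation p \<bullet> g2 l k \<theta>0 p \<partial>path_law)"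
    proof (rule integral_cong_AE)
      show "(\<lambda>p. resid \<theta>0 p \<bullet> g2 l k \<theta>0 p) \<in> borel_measurable path_law"
        unfolding measurable_path_law by (rule lipschitz_family_inner_measurable[OF s family_b2(1) family_b2(3) \<theta>0_in(2)])
      show "(\<lambda>p. innovation p \<bullet> g2 l k \<theta>0 p) \<in> borel_measurable path_law" by (rule borel_measurable_integrable[OF o(1)])
      show "AE p in path_law. resid \<theta>0 p \<bullet> g2 l k \<theta>0 p = innovation p \<bullet> g2 l k \<theta>0 p"
        using AE_path_dom_b2 by eventually_elim (simp only: innovation_eq_resid path_dom_b2)
    qed
    then show ?thesis using o(2) by simp
  qed
  have Hkl: "(\<integral>p. g1 l \<theta>0 p \<bullet> g1 k \<theta>0 p \<partial>path_law) = H $ k $ l" by (simp add: H_def inner_commute)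
  have "AE \<omega> in M. \<forall>\<^sub>F n in sequentially. \<forall>\<theta>\<in>K \<inter> ball \<theta>0 (min \<rho>1 \<rho>2). \<bar>hessian k l n \<omega> \<theta> / real n + H $ k $ l\<bar> \<le> e"
    using \<rho>1(2) \<rho>2(2)
  proof eventually_elim
    case (elim \<omega>)
    have q: "\<forall>t\<in>{1..n}. truncation t U (past X (int t) \<omega>) (lagged t \<omega>)" for n using truncated_past by simp
    from elim show ?case
    proof eventually_elim
      case (elim n)
      show ?case
      proof
        fix \<theta> assume \<theta>: "\<theta> \<in> K \<inter> ball \<theta>0 (min \<rho>1 \<rho>2)"
        have 1: "\<theta> \<in> K \<inter> ball \<theta>0 \<rho>1" "\<theta> \<in> K \<inter> ball \<theta>0 \<rho>2" using \<theta> by simp_all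
        have a: "\<bar>(\<Sum>t=1..n. resid \<theta> (lagged t \<omega>) \<bullet> g2 l k \<theta> (lagged t \<omega>)) / real n - 0\<bar> \<le> e / 2"
          using bspec[OF elim(1) 1(1), THEN spec, of "\<lambda>t. lagged t \<omega>", THEN mp, OF q] unfolding z .
        have b: "\<bar>(\<Sum>t=1..n. g1 l \<theta> (lagged t \<omega>) \<bullet> g1 k \<theta> (lagged t \<omega>)) / real n - H $ k $ l\<bar> \<le> e / 2"
          using bspec[OF elim(2) 1(2), THEN spec, of "\<lambda>t. lagged t \<omega>", THEN mp, OF q] unfolding Hkl .
        have ab: "\<bar>(x - y) + w\<bar> \<le> e" if "\<bar>x - 0\<bar> \<le> e / 2" "\<bar>y - w\<bar> \<le> e / 2" for x y w :: real
          using that by linarith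
        show "\<bar>hessian k l n \<omega> \<theta> / real n + H $ k $ l\<bar> \<le> e"
          unfolding hessian_def diff_divide_distrib by (rule ab[OF a b])
      qed
    qed
  qed
  then show ?thesis using \<rho>1(1) \<rho>2(1) by (intro exI[of _ "min \<rho>1 \<rho>2"]) simp
qed

definition scaled_error :: "nat \<Rightarrow> 'a \<Rightarrow> real^'d" where
  "scaled_error n \<omega> = sqrt (real n) *\<^sub>R (\<theta>hat n \<omega> - \<theta>0)"

definition limit_variable :: "real^'d^'d \<Rightarrow> nat \<Rightarrow> 'a \<Rightarrow> real^'d" where
  "limit_variable R n \<omega> = R *v score_mean n \<omega>"

text \<open>Linearisation of the score equation: with \<open>S\<close> the scaled score at \<open>\<theta>0\<close> and \<open>J\<close> the Hessian at
  intermediate points, \<open>H Y = S + (H + J / n) Y\<close>, where \<open>Y\<close> is the scaled error.\<close>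

lemma linearisation:
  assumes R: "R ** H = mat 1" and B: "\<And>z. norm (R *v z) \<le> B * norm z" "B \<ge> 0"
    and e: "e > 0" "2 * e * (real CARD('d))\<^sup>2 * B \<le> 1"
  shows "AE \<omega> in M. \<forall>\<^sub>F n in sequentially. norm (scaled_error n \<omega> - limit_variable R n \<omega>)
    \<le> 2 * B * remainder n \<omega> + 2 * e * (real CARD('d))\<^sup>2 * B * norm (limit_variable R n \<omega>)"
proof -
  let ?d = "real CARD('d)"
  have "\<forall>kl. \<exists>\<rho>>0. AE \<omega> in M. \<forall>\<^sub>F n in sequentially. \<forall>\<theta>\<in>K \<inter> ball \<theta>0 \<rho>.
      \<bar>hessian (fst kl) (snd kl) n \<omega> \<theta> / real n + H $ fst kl $ snd kl\<bar> \<le> e"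
    by (intro allI hessian_limit e(1))
  then obtain \<rho>' where \<rho>': "\<And>kl. \<rho>' kl > 0 \<and> (AE \<omega> in M. \<forall>\<^sub>F n in sequentially. \<forall>\<theta>\<in>K \<inter> ball \<theta>0 (\<rho>' kl).
      \<bar>hessian (fst kl) (snd kl) n \<omega> \<theta> / real n + H $ fst kl $ snd kl\<bar> \<le> e)"
    by (rule choice[THEN exE]) blast
  define \<rho> where "\<rho> k l = \<rho>' (k, l)" for k l
  have \<rho>: "\<rho> k l > 0" "AE \<omega> in M. \<forall>\<^sub>F n in sequentially. \<forall>\<theta>\<in>K \<inter> ball \<theta>0 (\<rho> k l).
      \<bar>hessian k l n \<omega> \<theta> / real n + H $ k $ l\<bar> \<le> e" for k l
    using \<rho>'[of "(k, l)"] unfolding \<rho>_def fst_conv snd_conv by blast+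
  have "AE \<omega> in M. \<forall>k\<in>UNIV. \<forall>l\<in>UNIV. \<forall>\<^sub>F n in sequentially. \<forall>\<theta>\<in>K \<inter> ball \<theta>0 (\<rho> k l).
      \<bar>hessian k l n \<omega> \<theta> / real n + H $ k $ l\<bar> \<le> e"
    by (intro AE_finite_allI finite \<rho>(2))
  with strongly_consistent AE_all_past[OF AE_path_dom_b2] AE_space show ?thesis
  proof eventually_elim
    case (elim \<omega>)
    have dom: "past X t \<omega> \<in> path_dom b2" for t using elim(2) by blast
    have "\<forall>\<^sub>F n in sequentially. \<forall>k\<in>UNIV. \<forall>l\<in>UNIV. \<forall>\<theta>\<in>K \<inter> ball \<theta>0 (\<rho> k l). \<bar>hessian k l n \<omega> \<theta> / real n + H $ k $ l\<bar> \<le> e"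
      using elim(4) by (intro eventually_ball_finite[OF finite[of "UNIV :: 'd set"]] ballI) blast+
    moreover have "\<forall>\<^sub>F n in sequentially. \<forall>k\<in>UNIV. \<forall>l\<in>UNIV. dist (\<theta>hat n \<omega>) \<theta>0 < \<rho> k l"
      using elim(1) \<rho>(1) by (intro eventually_ball_finite[OF finite[of "UNIV :: 'd set"]] ballI) (auto intro: tendstoD)
    moreover have "\<forall>\<^sub>F n in sequentially. dist (\<theta>hat n \<omega>) \<theta>0 < r" by (rule tendstoD[OF elim(1) r(1)])
    ultimately show ?case using eventually_ge_at_top[of 1]
    proof eventually_elim
      case (elim n)
      let ?h = "\<theta>hat n \<omega>" and ?Y = "scaled_error n \<omega>" and ?W = "limit_variable R n \<omega>" and ?s = "sqrt (real n)"
      have s: "?s > 0" using elim(4) by simp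
      have hV: "?h \<in> V" using elim(3) by (simp add: dist_commute)
      \<comment> \<open>The defect of H Y as a solution of the limiting linear system. Applying R,
        the inverse of H, turns it into the difference of the scaled error and its linear
        approximation.\<close>
      define err where "err = (\<chi> k. (\<Sum>l\<in>UNIV. H $ k $ l * ?Y $ l) - score_mean n \<omega> $ k)"
      have errk: "\<bar>err $ k\<bar> \<le> \<bar>\<Sum>t=1..n. resid \<theta>0 (lagged t \<omega>) \<bullet> g1 k \<theta>0 (lagged t \<omega>)
          - resid \<theta>0 (past X (int t) \<omega>) \<bullet> g1 k \<theta>0 (past X (int t) \<omega>)\<bar> / ?s + e * ?d * norm ?Y" for k
      proof -
        obtain \<theta> where \<theta>: "\<theta> \<in> V" "dist \<theta> \<theta>0 \<le> dist ?h \<theta>0"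
          "score k n \<omega> ?h - score k n \<omega> \<theta>0 = (\<Sum>l\<in>UNIV. (?h - \<theta>0) $ l * hessian k l n \<omega> \<theta>)"
          by (rule score_mean_value[OF dom hV])
        have "score k n \<omega> ?h = 0" by (rule score_zero[OF dom hV \<open>\<omega> \<in> space M\<close> elim(4)])
        then have "- score k n \<omega> \<theta>0 / ?s = (\<Sum>l\<in>UNIV. (?h - \<theta>0) $ l * hessian k l n \<omega> \<theta>) / ?s"
          using \<theta>(3) by simp
        also have "\<dots> = (\<Sum>l\<in>UNIV. ?Y $ l * (hessian k l n \<omega> \<theta> / real n))"
          unfolding sum_divide_distrib
        proof (rule sum.cong[OF refl])
          fix l
          \<comment> \<open>One factor sqrt n goes to the parameter difference, producing the scaled
            error, and the Hessian is left with the full 1 / n of an average.\<close>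
          have g: "a * b / x = (x * a) * (b / (x * x))" if "x > 0" for a b x :: real using that by (simp add: field_simps)
          have s2: "?s * ?s = real n" by simp
          show "(?h - \<theta>0) $ l * hessian k l n \<omega> \<theta> / ?s = ?Y $ l * (hessian k l n \<omega> \<theta> / real n)"
            using g[OF s, of "(?h - \<theta>0) $ l" "hessian k l n \<omega> \<theta>"]
            unfolding s2 scaled_error_def vector_scaleR_component real_scaleR_def .
        qed
        finally have sc: "- score k n \<omega> \<theta>0 / ?s = (\<Sum>l\<in>UNIV. ?Y $ l * (hessian k l n \<omega> \<theta> / real n))" .
        have "(\<Sum>l\<in>UNIV. H $ k $ l * ?Y $ l) = (\<Sum>l\<in>UNIV. ?Y $ l * (hessian k l n \<omega> \<theta> / real n + H $ k $ l)) + score k n \<omega> \<theta>0 / ?s"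
          using sc by (simp add: distrib_left sum.distrib mult.commute)
        moreover have "score k n \<omega> \<theta>0 / ?s - score_mean n \<omega> $ k = (\<Sum>t=1..n. resid \<theta>0 (lagged t \<omega>) \<bullet> g1 k \<theta>0 (lagged t \<omega>)
          - resid \<theta>0 (past X (int t) \<omega>) \<bullet> g1 k \<theta>0 (past X (int t) \<omega>)) / ?s"
          unfolding score_def score_mean_def vec_lambda_beta diff_divide_distrib[symmetric] sum_subtractf
          by (simp only: innovation_eq_resid[OF path_dom_b2(1)[OF dom]])
        ultimately have err: "err $ k = (\<Sum>l\<in>UNIV. ?Y $ l * (hessian k l n \<omega> \<theta> / real n + H $ k $ l)) +
          (\<Sum>t=1..n. resid \<theta>0 (lagged t \<omega>) \<bullet> g1 k \<theta>0 (lagged t \<omega>)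
          - resid \<theta>0 (past X (int t) \<omega>) \<bullet> g1 k \<theta>0 (past X (int t) \<omega>)) / ?s"
          unfolding err_def vec_lambda_beta by linarith
        have "\<bar>\<Sum>l\<in>UNIV. ?Y $ l * (hessian k l n \<omega> \<theta> / real n + H $ k $ l)\<bar> \<le> (\<Sum>l\<in>(UNIV::'d set). norm ?Y * e)"
        proof (rule order_trans[OF sum_abs sum_mono])
          fix l
          have "dist \<theta> \<theta>0 < \<rho> k l" using \<theta>(2) elim(2) by (meson UNIV_I le_less_trans)
          then have "\<theta> \<in> K \<inter> ball \<theta>0 (\<rho> k l)" using \<theta>(1) by (simp add: dist_commute)
          then have "\<bar>hessian k l n \<omega> \<theta> / real n + H $ k $ l\<bar> \<le> e" using elim(1) by blast
          then show "\<bar>?Y $ l * (hessian k l n \<omega> \<theta> / real n + H $ k $ l)\<bar> \<le> norm ?Y * e"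
            unfolding abs_mult by (intro mult_mono component_le_norm_cart) simp_all
        qed
        also have "\<dots> = e * ?d * norm ?Y" by simp
        finally have 1: "\<bar>\<Sum>l\<in>UNIV. ?Y $ l * (hessian k l n \<omega> \<theta> / real n + H $ k $ l)\<bar> \<le> e * ?d * norm ?Y" .
        have abs_div: "\<bar>x / ?s\<bar> = \<bar>x\<bar> / ?s" for x using s by (simp only: abs_divide abs_of_pos)
        show ?thesis
          unfolding err using abs_triangle_ineq[of "\<Sum>l\<in>UNIV. ?Y $ l * (hessian k l n \<omega> \<theta> / real n + H $ k $ l)"] 1
          unfolding abs_div[symmetric] by (smt (verit))
      qed
      have "norm err \<le> (\<Sum>k\<in>UNIV. \<bar>err $ k\<bar>)" by (rule norm_le_l1_cart)
      also have "\<dots> \<le> (\<Sum>k\<in>UNIV. \<bar>\<Sum>t=1..n. resid \<theta>0 (lagged t \<omega>) \<bullet> g1 k \<theta>0 (lagged t \<omega>)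
          - resid \<theta>0 (past X (int t) \<omega>) \<bullet> g1 k \<theta>0 (past X (int t) \<omega>)\<bar> / ?s + e * ?d * norm ?Y)"
        by (rule sum_mono) (rule errk)
      also have "\<dots> = remainder n \<omega> + e * ?d\<^sup>2 * norm ?Y"
        by (simp add: remainder_def sum.distrib power2_eq_square)
      finally have ne: "norm err \<le> remainder n \<omega> + e * ?d\<^sup>2 * norm ?Y" .
      have "err = H *v ?Y - score_mean n \<omega>"
        by (simp add: err_def vec_eq_iff matrix_vector_mult_def)
      then have "R *v err = R *v (H *v ?Y) - ?W"
        by (simp only: matrix_vector_mult_diff_distrib limit_variable_def)
      also have "R *v (H *v ?Y) = ?Y" by (simp add: matrix_vector_mul_assoc R)
      finally have "norm (?Y - ?W) \<le> B * norm err" using B(1)[of err] by simp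
      also have "\<dots> \<le> B * (remainder n \<omega> + e * ?d\<^sup>2 * norm ?Y)" by (rule mult_left_mono[OF ne B(2)])
      finally have 1: "norm (?Y - ?W) \<le> B * remainder n \<omega> + (e * ?d\<^sup>2 * B) * norm ?Y"
        by (simp add: distrib_left mult_ac)
      \<comment> \<open>The error bound involves the norm of Y itself, which has no a priori bound.
        Estimating it by \<open>D\<close> plus the norm of W lets half of \<open>D\<close> be
        absorbed into the left-hand side, since the coefficient is at most 1/2.\<close>
      define D where "D = norm (?Y - ?W)"
      have "norm ?Y \<le> D + norm ?W" unfolding D_def using norm_triangle_ineq[of "?Y - ?W" ?W] by simp
      then have "(e * ?d\<^sup>2 * B) * norm ?Y \<le> (e * ?d\<^sup>2 * B) * (D + norm ?W)"
        by (rule mult_left_mono) (use e B in simp)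
      then have "D \<le> B * remainder n \<omega> + (e * ?d\<^sup>2 * B) * D + (e * ?d\<^sup>2 * B) * norm ?W"
        using 1 unfolding D_def by (simp add: distrib_left)
      moreover have "(e * ?d\<^sup>2 * B) * D \<le> 1/2 * D"
        by (rule mult_right_mono) (use e in \<open>simp_all add: D_def\<close>)
      ultimately have "D \<le> 2 * (B * remainder n \<omega>) + 2 * ((e * ?d\<^sup>2 * B) * norm ?W)" by linarith
      then show ?case by (simp add: D_def mult.assoc)
    qed
  qed
qed

theorem asymptotically_normal: "asymptotically_normal M A0 A X \<theta>0 \<theta>hat"
proof -
  obtain P :: "real^'d^'d" where P: "transpose P ** H ** P = mat 1"
    using positive_definite_congruent_identity[OF H_symmetric H_positive] by blast
  \<comment> \<open>\<open>R\<close> is the inverse of \<open>H\<close>. The factorisation through P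
    is also the square root from which the limit law \<nu> is built.\<close>
  define R where "R = P ** transpose P"
  have RH: "R ** H = mat 1" and HR: "H ** R = mat 1"
    using inverse_of_congruent_identity[OF P] by (simp_all add: R_def)
  have Rsym: "transpose R = R" by (simp add: R_def matrix_transpose_mul)
  define \<nu> where "\<nu> = distr std_normal_vec borel (\<lambda>z. 0 + P *v z)"
  interpret N: prob_space \<nu> unfolding \<nu>_def by (rule wave_normal_law(1))
  let ?Y = scaled_error and ?W = "limit_variable R"
  obtain B where B: "\<And>z. norm (R *v z) \<le> B * norm z" "B > 0"
    using bounded_linear.pos_bounded[OF matrix_vector_mul_bounded_linear[of R]] by (metis mult.commute)
  have Zm: "score_mean n \<in> borel_measurable M" for n
    by (rule borel_measurable_vecI) (rule borel_measurable_integrable[OF score_mean_component(1)])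
  have Wm: "?W n \<in> borel_measurable M" for n
    unfolding limit_variable_def
    by (rule measurable_compose[OF Zm borel_measurable_continuous_onI[OF matrix_vector_mult_linear_continuous_on]])
  have Ym: "?Y n \<in> borel_measurable M" if "n \<ge> 1" for n
    unfolding scaled_error_def using \<theta>hat_measurable[OF that]
    by (intro borel_measurable_scaleR borel_measurable_diff borel_measurable_const)
  \<comment> \<open>A bound for the mean norm of W that holds for all n. It gives tightness by
    Markov's inequality and serves as the constant \<open>C\<close> in
    \<open>probability_tendsto_0\<close>.\<close>
  define D where "D = B * (\<Sum>k\<in>UNIV. sqrt (H $ k $ k))"
  have Wle: "norm (?W n \<omega>) \<le> B * (\<Sum>k\<in>UNIV. \<bar>score_mean n \<omega> $ k\<bar>)" for n \<omega>
    unfolding limit_variable_def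
    by (rule order_trans[OF B(1) mult_left_mono[OF norm_le_l1_cart]]) (use B(2) in simp)
  have iZ: "integrable M (\<lambda>\<omega>. B * (\<Sum>k\<in>UNIV. \<bar>score_mean n \<omega> $ k\<bar>))" for n
    by (intro integrable_mult_right Bochner_Integration.integrable_sum integrable_abs score_mean_component)
  have iW: "integrable M (\<lambda>\<omega>. norm (?W n \<omega>))" for n
  proof (rule Bochner_Integration.integrable_bound[OF iZ[of n]])
    show "(\<lambda>\<omega>. norm (?W n \<omega>)) \<in> borel_measurable M" by (rule measurable_compose[OF Wm borel_measurable_norm])
    show "AE \<omega> in M. norm (norm (?W n \<omega>)) \<le> norm (B * (\<Sum>k\<in>UNIV. \<bar>score_mean n \<omega> $ k\<bar>))"
      using order_trans[OF Wle abs_ge_self] by (intro AE_I2) simp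
  qed
  have EW: "(\<integral>\<omega>. norm (?W n \<omega>) \<partial>M) \<le> D" for n
  proof -
    have "(\<integral>\<omega>. norm (?W n \<omega>) \<partial>M) \<le> (\<integral>\<omega>. B * (\<Sum>k\<in>UNIV. \<bar>score_mean n \<omega> $ k\<bar>) \<partial>M)"
      by (rule integral_mono[OF iW iZ Wle])
    also have "\<dots> = B * (\<Sum>k\<in>UNIV. \<integral>\<omega>. \<bar>score_mean n \<omega> $ k\<bar> \<partial>M)"
      using score_mean_component(1)
      by (simp only: integral_mult_right_zero Bochner_Integration.integral_sum integrable_abs)
    also have "\<dots> \<le> D" unfolding D_def
      by (intro mult_left_mono sum_mono score_mean_component) (use B(2) in simp)
    finally show ?thesis .
  qed
  have D0: "D \<ge> 0" by (rule order_trans[OF _ EW[of 0]]) simp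
  have tight: "\<exists>r. \<forall>n. measure M {\<omega> \<in> space M. norm (?W n \<omega>) > r} \<le> e" if e: "e > 0" for e
  proof (intro exI allI)
    fix n
    let ?r = "(D + 1) / e"
    have r: "?r > 0" using D0 e by simp
    have "measure M {\<omega> \<in> space M. norm (?W n \<omega>) > ?r} \<le> measure M {\<omega> \<in> space M. norm (?W n \<omega>) \<ge> ?r}"
    proof (rule finite_measure_mono)
      note [measurable] = measurable_compose[OF Wm borel_measurable_norm]
      show "{\<omega> \<in> space M. norm (?W n \<omega>) \<ge> ?r} \<in> events" by measurable
    qed auto
    also have "\<dots> \<le> (\<integral>\<omega>. norm (?W n \<omega>) \<partial>M) / ?r"
      by (rule integral_Markov_inequality_measure[OF iW sets.empty_sets _ r]) simp
    also have "\<dots> \<le> D / ?r" using EW r by (intro divide_right_mono) simp_all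
    also have "\<dots> \<le> e" using D0 e by (simp add: field_simps)
    finally show "measure M {\<omega> \<in> space M. norm (?W n \<omega>) > ?r} \<le> e" .
  qed
  have waves: "(\<lambda>n. \<integral>\<omega>. cos (c \<bullet> ?W n \<omega> + b) \<partial>M) \<longlonglongrightarrow> (\<integral>x. cos (c \<bullet> x + b) \<partial>\<nu>)" for c b
  proof -
    let ?c = "R *v c"
    have cW: "c \<bullet> ?W n \<omega> = ?c \<bullet> score_mean n \<omega>" for n \<omega>
      unfolding limit_variable_def using dot_lmul_matrix[of c R "score_mean n \<omega>"] vector_transpose_matrix[of c R]
      by (simp add: Rsym)
    \<comment> \<open>Since R inverts H, the quadratic form of H at R c is that of R at c, and R
      splits as P times its transpose. This identifies the limit of the waves with their integral
      under \<nu>.\<close>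
    have q: "?c \<bullet> (H *v ?c) = (transpose P *v c) \<bullet> (transpose P *v c)"
    proof -
      have "H *v ?c = c" by (simp add: matrix_vector_mul_assoc HR)
      then have 1: "?c \<bullet> (H *v ?c) = c \<bullet> ?c" by (simp add: inner_commute)
      have Rc: "?c = P *v (transpose P *v c)" unfolding R_def by (simp only: matrix_vector_mul_assoc)
      have "c \<bullet> (P *v (transpose P *v c)) = (transpose P *v c) \<bullet> (transpose P *v c)"
        using dot_lmul_matrix[of c P "transpose P *v c"] vector_transpose_matrix[of c "transpose P"] by simp
      then show ?thesis unfolding 1 by (simp only: Rc)
    qed
    have "(\<lambda>n. Re (iexp b * (\<integral>\<omega>. iexp (?c \<bullet> score_mean n \<omega>) \<partial>M))) \<longlonglongrightarrow> Re (iexp b * of_real (exp (- (?c \<bullet> (H *v ?c)) / 2)))"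
      by (intro tendsto_Re tendsto_mult_left score_mean_char)
    moreover have "(\<integral>\<omega>. cos (c \<bullet> ?W n \<omega> + b) \<partial>M) = Re (iexp b * (\<integral>\<omega>. iexp (?c \<bullet> score_mean n \<omega>) \<partial>M))" for n
    proof -
      have m: "(\<lambda>\<omega>. iexp (?c \<bullet> score_mean n \<omega>)) \<in> borel_measurable M"
        by (rule measurable_compose[OF Zm borel_measurable_continuous_onI]) (intro continuous_intros)
      have i: "integrable M (\<lambda>\<omega>. iexp b * iexp (?c \<bullet> score_mean n \<omega>))"
        by (rule integrable_const_bound[where B = 1]) (simp_all add: norm_mult borel_measurable_times[OF borel_measurable_const m])
      have "(\<integral>\<omega>. cos (c \<bullet> ?W n \<omega> + b) \<partial>M) = (\<integral>\<omega>. Re (iexp b * iexp (?c \<bullet> score_mean n \<omega>)) \<partial>M)"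
        unfolding cW by (intro Bochner_Integration.integral_cong refl) (simp add: Re_exp exp_add[symmetric] ac_simps)
      also have "\<dots> = Re (\<integral>\<omega>. iexp b * iexp (?c \<bullet> score_mean n \<omega>) \<partial>M)" by (rule integral_Re[OF i])
      finally show ?thesis by (simp only: integral_mult_right_zero)
    qed
    ultimately show ?thesis unfolding \<nu>_def wave_normal_law(2) q by simp
  qed
  have limW: "(\<lambda>n. \<integral>\<omega>. g (?W n \<omega>) \<partial>M) \<longlonglongrightarrow> (\<integral>x. g x \<partial>\<nu>)"
    if g: "continuous_on UNIV g" "\<And>x. \<bar>g x\<bar> \<le> C'" for g :: "real^'d \<Rightarrow> real" and C'
  proof (rule weak_convergence_from_waves[OF prob_space_axioms N.prob_space_axioms _ Wm waves _ g])
    show "sets \<nu> = sets borel" by (simp add: \<nu>_def)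
    fix e :: real assume e: "e > 0"
    obtain r1 where r1: "\<And>n. measure M {\<omega> \<in> space M. norm (?W n \<omega>) > r1} \<le> e" using tight[OF e] by blast
    have nm: "(\<lambda>x. norm x) \<in> borel_measurable \<nu>" by (simp add: \<nu>_def)
    obtain r2 where r2: "N.prob {x \<in> space \<nu>. norm x > r2} \<le> e" by (rule N.tight_single[of "\<lambda>x. x", OF nm e])
    have "measure M {\<omega> \<in> space M. norm (?W n \<omega>) > max r1 r2} \<le> e" for n
    proof (rule order_trans[OF finite_measure_mono r1[of n]])
      note [measurable] = measurable_compose[OF Wm borel_measurable_norm]
      show "{\<omega> \<in> space M. norm (?W n \<omega>) > r1} \<in> events" by measurable
    qed auto
    moreover have "N.prob {x \<in> space \<nu>. norm x > max r1 r2} \<le> e"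
    proof (rule order_trans[OF N.finite_measure_mono r2])
      note [measurable] = nm
      show "{x \<in> space \<nu>. norm x > r2} \<in> N.events" by measurable
    qed auto
    ultimately show "\<exists>r. (\<forall>n. measure M {\<omega> \<in> space M. norm (?W n \<omega>) > r} \<le> e) \<and> measure \<nu> {x \<in> space \<nu>. norm x > r} \<le> e"
      by blast
  qed
  have close: "(\<lambda>n. prob {\<omega> \<in> space M. norm (?Y n \<omega> - ?W n \<omega>) > d}) \<longlonglongrightarrow> 0" if d: "d > 0" for d
  proof (rule probability_tendsto_0[where R = "\<lambda>n \<omega>. 2 * B * remainder n \<omega>" and V = "\<lambda>n \<omega>. norm (?W n \<omega>)" and C = D])
    show "(\<lambda>\<omega>. norm (?Y n \<omega> - ?W n \<omega>)) \<in> borel_measurable M" if "n \<ge> 1" for n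
      by (rule measurable_compose[OF borel_measurable_diff[OF Ym[OF that] Wm] borel_measurable_norm])
    show "integrable M (\<lambda>\<omega>. 2 * B * remainder n \<omega>)" for n by (intro integrable_mult_right remainder_tendsto_0)
    show "0 \<le> 2 * B * remainder n \<omega>" for n \<omega> using B(2) remainder_nonneg by simp
    show "(\<lambda>n. expectation (\<lambda>\<omega>. 2 * B * remainder n \<omega>)) \<longlonglongrightarrow> 0"
      unfolding integral_mult_right_zero by (intro tendsto_mult_right_zero remainder_tendsto_0)
    fix k :: real assume k: "k > 0"
    define c where "c = 2 * (real CARD('d))\<^sup>2 * B"
    have c: "c > 0" using B(2) by (simp add: c_def)
    \<comment> \<open>Chosen so that the coefficient of the norm of W in
      \<open>linearisation\<close> is exactly min k 1: at most k for the conclusion, at most 1 for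
      the absorption argument.\<close>
    define e where "e = min k 1 / c"
    have e: "e > 0" using k c by (simp add: e_def)
    have ec: "2 * e * (real CARD('d))\<^sup>2 * B = min k 1"
    proof -
      have "2 * e * (real CARD('d))\<^sup>2 * B = e * c" by (simp add: c_def)
      then show ?thesis using c by (simp add: e_def)
    qed
    have "2 * e * (real CARD('d))\<^sup>2 * B \<le> 1" unfolding ec by simp
    from linearisation[OF RH B(1) less_imp_le[OF B(2)] e this]
    show "AE \<omega> in M. \<forall>\<^sub>F n in sequentially. norm (?Y n \<omega> - ?W n \<omega>) \<le> 2 * B * remainder n \<omega> + k * norm (?W n \<omega>)"
      unfolding ec
    proof eventually_elim
      case (elim \<omega>)
      then show ?case
      proof eventually_elim
        case (elim n)
        have "min k 1 * norm (?W n \<omega>) \<le> k * norm (?W n \<omega>)" by (rule mult_right_mono) simp_all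
        then show ?case using elim by linarith
      qed
    qed
  qed (use iW EW d in simp_all)
  have wc: "weak_conv_vec (\<lambda>n. distr M borel (\<lambda>\<omega>. sqrt (real n) *\<^sub>R (\<theta>hat n \<omega> - \<theta>0))) \<nu>"
    unfolding weak_conv_vec_def
  proof (intro allI impI)
    fix g :: "real^'d \<Rightarrow> real"
    assume g: "continuous_on UNIV g \<and> bounded (range g)"
    then obtain C' where C': "\<And>x. \<bar>g x\<bar> \<le> C'" unfolding bounded_iff by auto
    have gm: "g \<in> borel_measurable borel" using g by (intro borel_measurable_continuous_onI) blast
    have "(\<lambda>n. \<integral>\<omega>. g (?Y n \<omega>) \<partial>M) \<longlonglongrightarrow> (\<integral>x. g x \<partial>\<nu>)"
      by (rule slutsky[OF Ym Wm tight close _ C' limW[OF _ C']]) (use g in blast)+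
    \<comment> \<open>At n = 0 nothing is known about the measurability of the estimator, so
      expectations under the laws are identified only from n = 1 on.\<close>
    moreover have "\<forall>\<^sub>F n in sequentially. (\<integral>\<omega>. g (?Y n \<omega>) \<partial>M) = (\<integral>x. g x \<partial>distr M borel (\<lambda>\<omega>. sqrt (real n) *\<^sub>R (\<theta>hat n \<omega> - \<theta>0)))"
      using eventually_ge_at_top[of 1]
    proof eventually_elim
      case (elim n)
      show ?case using integral_distr[OF Ym[OF elim] gm] unfolding scaled_error_def by simp
    qed
    ultimately show "(\<lambda>n. \<integral>x. g x \<partial>distr M borel (\<lambda>\<omega>. sqrt (real n) *\<^sub>R (\<theta>hat n \<omega> - \<theta>0))) \<longlonglongrightarrow> (\<integral>x. g x \<partial>\<nu>)"
      by (rule Lim_transform_eventually)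
  qed
  let ?F = "F_matrix M A0 A X \<theta>0" and ?G = "G_matrix M A0 A X \<theta>0"
  have scale: "(a *\<^sub>R S) ** (b *\<^sub>R T) = (a * b) *\<^sub>R (S ** T)" for a b and S T :: "real^'d^'d"
    by (simp add: matrix_matrix_mult_def vec_eq_iff sum_distrib_left mult_ac)
  have FR: "?F ** ((1/2) *\<^sub>R R) = mat 1" "((1/2) *\<^sub>R R) ** ?F = mat 1"
    unfolding F_matrix(2) scale by (simp_all add: HR RH)
  have inv: "invertible ?F" using FR unfolding invertible_def by blast
  \<comment> \<open>\<open>matrix_inv\<close> is an arbitrary choice among inverses; invertibility
    gives its defining property, and uniqueness of inverses identifies it with R / 2.\<close>
  have "matrix_inv ?F ** ?F = mat 1"
    using someI_ex[OF inv[unfolded invertible_def]] unfolding matrix_inv_def by blast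
  then have "matrix_inv ?F = (1/2) *\<^sub>R R"
    using FR(1) by (metis matrix_mul_assoc matrix_mul_lid matrix_mul_rid)
  \<comment> \<open>With F = 2 H and G = 4 H the scalars cancel, (1/2) 4 (1/2) = 1, and R H R = R
    leaves the covariance R.\<close>
  then have cov: "matrix_inv ?F ** ?G ** matrix_inv ?F = P ** transpose P"
    by (simp only: G_matrix(2) scale RH matrix_mul_lid R_def[symmetric]) simp
  have "normal_law 0 (matrix_inv ?F ** ?G ** matrix_inv ?F) \<nu>"
    unfolding normal_law_def cov \<nu>_def by blast
  then show ?thesis
    unfolding asymptotically_normal_def Let_def
    using F_matrix(1) G_matrix(1) inv wc by blast
qed

end

theorem proposition9:
  fixes M :: "'a measure"
    and \<xi> X :: "int \<Rightarrow> 'a \<Rightarrow> real^'m::finite"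
    and A0 :: "real^'d::finite \<Rightarrow> real^'m"
    and A :: "nat \<Rightarrow> real^'d \<Rightarrow> real^'m \<Rightarrow> real^'m"
    and \<Theta> :: "(real^'d) set"
    and \<theta>0 :: "real^'d"
    and u :: "nat \<Rightarrow> real^'m"
    and \<theta>hat :: "nat \<Rightarrow> 'a \<Rightarrow> real^'d"
  assumes "prob_space M"
    and "iid_noise M \<xi>"
    and "integrable M (\<lambda>\<omega>. norm (\<xi> 0 \<omega>) ^ 2)"
    and "ar_standing \<Theta> A0 A"
    and "compact \<Theta>" and "\<Theta> \<subseteq> stability_region A" and "\<theta>0 \<in> \<Theta>"
    and "stationary_solution M 2 \<xi> A0 A \<theta>0 X"
    and "\<forall>\<theta>\<in>\<Theta>. (\<forall>t. AE \<omega> in M. ar_fun A0 A \<theta> (past X t \<omega>) = ar_fun A0 A \<theta>0 (past X t \<omega>))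
           \<longrightarrow> \<theta> = \<theta>0"
    and "\<exists>l>3/2. power_decay (\<lambda>j. SUP \<theta>\<in>\<Theta>. Lip (A j \<theta>)) l"
    and "finitely_supported u"
    and "is_qmle M \<Theta> A0 A X u \<theta>hat"
  shows "(AE \<omega> in M. (\<lambda>n. \<theta>hat n \<omega>) \<longlonglongrightarrow> \<theta>0) \<and>
    (\<theta>0 \<in> interior \<Theta> \<and> interior \<Theta> \<subseteq> stability_region A \<and>
     integrable M (\<lambda>\<omega>. norm (\<xi> 0 \<omega>) ^ 4) \<and>
     stationary_solution M 4 \<xi> A0 A \<theta>0 X \<and>
     (\<forall>n\<ge>1. \<theta>hat n \<in> borel_measurable M) \<and>
     C2_on \<Theta> A0 \<and>
     (\<forall>j\<ge>1. \<forall>x. C2_on \<Theta> (\<lambda>\<theta>. A j \<theta> x)) \<and>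
     C2_on (interior \<Theta>) (\<lambda>\<theta>. ar_fun A0 A \<theta> (\<lambda>_. 0)) \<and>
     (\<forall>c :: real^'d.
        (\<forall>t. AE \<omega> in M. (\<Sum>i\<in>UNIV. c $ i *\<^sub>R
           pderivative i (\<lambda>\<theta>. ar_fun A0 A \<theta> (past X t \<omega>)) \<theta>0) = 0) \<longrightarrow> c = 0) \<and>
     (\<forall>k. \<exists>l'>3/2. power_decay
        (\<lambda>j. SUP \<theta>\<in>\<Theta>. Lip (\<lambda>x. pderivative k (\<lambda>\<theta>. A j \<theta> x) \<theta>)) l') \<and>
     (\<forall>k k'. (\<Sum>j. SUP \<theta>\<in>\<Theta>.
        Lip (\<lambda>x. pderivative k (pderivative k' (\<lambda>\<theta>. A (Suc j) \<theta> x)) \<theta>)) < \<infinity>)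
     \<longrightarrow> asymptotically_normal M A0 A X \<theta>0 \<theta>hat)"
proof -
  have X: "X t \<in> borel_measurable M" "AE \<omega> in M. X t \<omega> = \<xi> t \<omega> + ar_fun A0 A \<theta>0 (past X t \<omega>)" for t
    using \<open>stationary_solution M 2 \<xi> A0 A \<theta>0 X\<close> unfolding stationary_solution_def by blast+
  have X': "strictly_stationary M X" "ergodic_process M X" "integrable M (\<lambda>\<omega>. (norm (X 0 \<omega>))\<^sup>2)"
    using \<open>stationary_solution M 2 \<xi> A0 A \<theta>0 X\<close> unfolding stationary_solution_def by blast+
  have "finitely_supported (\<lambda>_. 0 :: real^'m)" by (simp add: finitely_supported_def)
  with \<open>ar_standing \<Theta> A0 A\<close> \<open>\<theta>0 \<in> \<Theta>\<close> have summable: "summable (\<lambda>j. A (Suc j) \<theta>0 0)"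
    unfolding ar_standing_def by blast
  have stable: "\<theta>0 \<in> stability_region A" using \<open>\<Theta> \<subseteq> stability_region A\<close> \<open>\<theta>0 \<in> \<Theta>\<close> by blast
  interpret prob_space M by fact
  interpret stationary_process M X by (unfold_locales; (rule X X')?)
  interpret square_integrable_process M X by unfold_locales (rule X')
  interpret ar_model M X \<xi> A0 A \<theta>0 by (unfold_locales; (rule X \<open>iid_noise M \<xi>\<close> stable summable)?)
  have identifiable: "\<theta> = \<theta>0" if "\<theta> \<in> \<Theta>" "\<And>t. AE \<omega> in M. ar_fun A0 A \<theta> (past X t \<omega>) = ar_fun A0 A \<theta>0 (past X t \<omega>)" for \<theta>
    using assms(9) that by blast
  interpret ar_estimation M X \<xi> A0 A \<theta>0 \<Theta> u \<theta>hat
    by unfold_locales (use assms identifiable in blast)+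
  show ?thesis
  proof (intro conjI impI; (elim conjE)?)
    show "AE \<omega> in M. (\<lambda>n. \<theta>hat n \<omega>) \<longlonglongrightarrow> \<theta>0" by (rule strongly_consistent)
  next
    assume *: "\<theta>0 \<in> interior \<Theta>" "\<forall>n\<ge>1. \<theta>hat n \<in> borel_measurable M" "\<forall>j\<ge>1. \<forall>x. C2_on \<Theta> (\<lambda>\<theta>. A j \<theta> x)"
      "C2_on (interior \<Theta>) (\<lambda>\<theta>. ar_fun A0 A \<theta> (\<lambda>_. 0))"
      "\<forall>c :: real^'d. (\<forall>t. AE \<omega> in M. (\<Sum>i\<in>UNIV. c $ i *\<^sub>R
           pderivative i (\<lambda>\<theta>. ar_fun A0 A \<theta> (past X t \<omega>)) \<theta>0) = 0) \<longrightarrow> c = 0"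
      "\<forall>k. \<exists>l'>3/2. power_decay (\<lambda>j. SUP \<theta>\<in>\<Theta>. Lip (\<lambda>x. pderivative k (\<lambda>\<theta>. A j \<theta> x) \<theta>)) l'"
      "\<forall>k k'. (\<Sum>j. SUP \<theta>\<in>\<Theta>. Lip (\<lambda>x. pderivative k (pderivative k' (\<lambda>\<theta>. A (Suc j) \<theta> x)) \<theta>)) < \<infinity>"
    have "ar_normality M X \<xi> A0 A \<theta>0 \<Theta> u \<theta>hat"
    proof
      show "C2_on \<Theta> (\<lambda>\<theta>. A (Suc j) \<theta> x)" for j x using *(3) by simp
      show "c = 0" if "\<And>t. AE \<omega> in M. (\<Sum>i\<in>UNIV. c $ i *\<^sub>R
          pderivative i (\<lambda>\<theta>. ar_fun A0 A \<theta> (past X t \<omega>)) \<theta>0) = 0" for c :: "real^'d"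
        using *(5) that by blast
    qed (use * in blast)+
    then show "asymptotically_normal M A0 A X \<theta>0 \<theta>hat" by (rule ar_normality.asymptotically_normal)
  qed
qed

end
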